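(* A t.d.l.c. group $G$ is computably t.d.l.c. via a Baire presentation if and only if $G$ is computably t.d.l.c. via a meet groupoid. Moreover, from a presentation of $G$ of one type one can effectively obtain a presentation of $G$ of the other type.
   Context: All topological groups have a countable basis; all t.d.l.c. groups are infinite. Trees: a tree is a nonempty prefix-closed subset of $\mathbb N^*$; $[T]$ its set of infinite paths with Baire-space topology; $[\sigma]_T=\{f\in[T]:\sigma\prec f\}$. A computable leafless tree $T$ is computably locally compact (c.l.c.) if $[T]$ is locally compact, $\{\sigma\in T:[\sigma]_T\text{ compact}\}$ is decidable, and there is a computable $H$ with $\rho(i)\le H(\sigma,i)$ for $i<|\rho|$ whenever $[\sigma]_T$ is compact and $\rho\in T$ extends $\sigma$. $\Phi:[T]\to[S]$ is computable if there is a partial computable monotone $P$ from a subset of $T$ to $S$ with $\Phi(f)=\bigcup_n\{P(f\upharpoonright n):f\upharpoonright n\in\mathrm{dom}P\}$ for all $f$; binary functions analogously with $P$ on pairs of equal-length strings. $G$ is computably t.d.l.c. via a Baire presentation if $G$ is isomorphic as a topological group to some $([T],\mathrm{Op},\mathrm{Inv})$ with $T$ c.l.c. and $\mathrm{Op},\mathrm{Inv}$ computable. Meet groupoid $\mathcal W(G)$: elements are the compact open cosets of $G$ and $\emptyset$; operations: inverse, intersection, and partial product $A\cdot B=AB$ defined exactly when, for some compact open subgroup $V$, $A$ is a left coset and $B$ a right coset of $V$. A copy is Haar computable if its domain is a computable subset of $\mathbb N$, the operations (including definedness of the product) are computable, and $(U,V)\mapsto|U:U\cap V|$ for subgroups $U,V$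 (elements with $U\cdot U=U$) is computable. $G$ is computably t.d.l.c. via a meet groupoid if $\mathcal W(G)$ has a Haar computable copy. "Effectively obtain": an algorithm maps indices of the computable data of one presentation to indices of the data of the other.
   Formalization: In the "Moreover" part, for compact G the Baire presentation need not have correct compactness and bound data at the empty string (the literal claim fails there); the algorithm is chosen per type of group elements, where sequences of naturals cover all groups. *)

theory Defs
  imports
    "HOL-Analysis.Analysis"
    "HOL-Algebra.Coset"
    "HOL-Algebra.Left_Coset"
    "HOL-Library.Nat_Bijection"
    "HOL-Library.Sublist"
begin

section \<open>Partial computable functions and their indices\<close>

text \<open>
  The unary partial recursive functions on the natural numbers, with the Cantor pairing
  \<^const>\<open>prod_encode\<close> playing the role of tuples. Strings of natural numbers are coded by the
  bijection \<^const>\<open>list_encode\<close>.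
\<close>

datatype code =
    Code_Zero | Code_Succ | Code_Fst | Code_Snd
  | Code_Pair code code
  | Code_Comp code code
  | Code_Prec code code
  | Code_Min code

primrec eval :: "code \<Rightarrow> nat \<Rightarrow> nat option" where
  "eval Code_Zero = (\<lambda>x. Some 0)"
| "eval Code_Succ = (\<lambda>x. Some (Suc x))"
| "eval Code_Fst = (\<lambda>x. Some (fst (prod_decode x)))"
| "eval Code_Snd = (\<lambda>x. Some (snd (prod_decode x)))"
| "eval (Code_Pair c d) = (\<lambda>x.
     Option.bind (eval c x) (\<lambda>a. Option.bind (eval d x) (\<lambda>b. Some (prod_encode (a, b)))))"
| "eval (Code_Comp c d) = (\<lambda>x. Option.bind (eval d x) (eval c))"
| "eval (Code_Prec c d) = (\<lambda>x.
     rec_nat (eval c (fst (prod_decode x)))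
       (\<lambda>k r. Option.bind r (\<lambda>v. eval d (prod_encode (fst (prod_decode x), prod_encode (k, v)))))
       (snd (prod_decode x)))"
| "eval (Code_Min c) = (\<lambda>x.
     if \<exists>m. eval c (prod_encode (x, m)) = Some 0 \<and>
            (\<forall>k<m. \<exists>v. eval c (prod_encode (x, k)) = Some (Suc v))
     then Some (LEAST m. eval c (prod_encode (x, m)) = Some 0)
     else None)"

primrec code_index :: "code \<Rightarrow> nat" where
  "code_index Code_Zero = 0"
| "code_index Code_Succ = 1"
| "code_index Code_Fst = 2"
| "code_index Code_Snd = 3"
| "code_index (Code_Pair c d) = 4 * prod_encode (code_index c, code_index d) + 4"
| "code_index (Code_Comp c d) = 4 * prod_encode (code_index c, code_index d) + 5"
| "code_index (Code_Prec c d) = 4 * prod_encode (code_index c, code_index d) + 6"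
| "code_index (Code_Min c) = 4 * code_index c + 7"

lemma inj_code_index: "inj code_index"
proof (rule injI)
  fix c d :: code
  show "code_index c = code_index d \<Longrightarrow> c = d"
  proof (induction c arbitrary: d)
    case Code_Zero then show ?case by (cases d) simp_all
  next
    case Code_Succ then show ?case by (cases d) simp_all
  next
    case Code_Fst then show ?case by (cases d) simp_all
  next
    case Code_Snd then show ?case by (cases d) simp_all
  next
    case (Code_Pair c1 c2) then show ?case by (cases d) (simp_all, presburger+)
  next
    case (Code_Comp c1 c2) then show ?case by (cases d) (simp_all, presburger+)
  next
    case (Code_Prec c1 c2) then show ?case by (cases d) (simp_all, presburger+)
  next
    case (Code_Min c) then show ?case by (cases d) (simp_all, presburger+)
  qed
qed

lemma surj_code_index: "surj code_index"
proof -
  have "\<exists>c. code_index c = n" for n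
  proof (induction n rule: less_induct)
    case (less n)
    show ?case
    proof (cases "n < 4")
      case True
      then have "n = 0 \<or> n = 1 \<or> n = 2 \<or> n = 3" by auto
      then show ?thesis using code_index.simps(1-4) by metis
    next
      case False
      define m where "m = (n - 4) div 4"
      obtain a b where ab: "m = prod_encode (a, b)"
        by (metis prod_decode_inverse surj_pair)
      have "a \<le> m" "b \<le> m"
        unfolding ab by (rule le_prod_encode_1, rule le_prod_encode_2)
      moreover have "m < n"
        using False unfolding m_def by presburger
      ultimately obtain c d c' where c: "code_index c = a" and d: "code_index d = b"
          and c': "code_index c' = m"
        using less by (meson order.strict_trans1)
      have "n = 4 * m + 4 \<or> n = 4 * m + 5 \<or> n = 4 * m + 6 \<or> n = 4 * m + 7"
        using False unfolding m_def by presburger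
      then show ?thesis
        using ab c d c' code_index.simps(5-8) by metis
    qed
  qed
  then show ?thesis by (metis surjI)
qed

lemma bij_code_index: "bij code_index"
  by (simp add: bij_def inj_code_index surj_code_index)

text \<open>The partial computable function with index \<open>e\<close>.\<close>

definition phi :: "nat \<Rightarrow> nat \<Rightarrow> nat option" where
  "phi e = eval (inv_into UNIV code_index e)"

definition decides :: "nat \<Rightarrow> nat set \<Rightarrow> bool" where
  "decides e A \<longleftrightarrow> (\<forall>x. phi e x = Some (of_bool (x \<in> A)))"


section \<open>Topological groups\<close>

definition topological_group :: "('a, 'b) monoid_scheme \<Rightarrow> 'a topology \<Rightarrow> bool" where
  "topological_group G X \<longleftrightarrow>
     group G \<and> topspace X = carrier G \<and>
     continuous_map (prod_topology X X) X (\<lambda>(x, y). x \<otimes>\<^bsub>G\<^esub> y) \<and>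
     continuous_map X X (\<lambda>x. inv\<^bsub>G\<^esub> x)"

definition totally_disconnected_space :: "'a topology \<Rightarrow> bool" where
  "totally_disconnected_space X \<longleftrightarrow> (\<forall>x \<in> topspace X. connected_component_of_set X x = {x})"

text \<open>Standing conventions: countable basis, and infinite.\<close>

definition tdlc_group :: "('a, 'b) monoid_scheme \<Rightarrow> 'a topology \<Rightarrow> bool" where
  "tdlc_group G X \<longleftrightarrow>
     topological_group G X \<and> Hausdorff_space X \<and> totally_disconnected_space X \<and>
     locally_compact_space X \<and> second_countable X \<and> infinite (carrier G)"

definition topological_group_isomorphic ::
    "('a, 'b) monoid_scheme \<Rightarrow> 'a topology \<Rightarrow> ('c, 'd) monoid_scheme \<Rightarrow> 'c topology \<Rightarrow> bool" where
  "topological_group_isomorphic G X H Y \<longleftrightarrow> (\<exists>h. h \<in> iso G H \<and> homeomorphic_map X Y h)"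


section \<open>Trees and computable maps on path spaces\<close>

definition is_tree :: "nat list set \<Rightarrow> bool" where
  "is_tree T \<longleftrightarrow> T \<noteq> {} \<and> (\<forall>\<sigma>\<in>T. \<forall>\<tau>. prefix \<tau> \<sigma> \<longrightarrow> \<tau> \<in> T)"

definition leafless :: "nat list set \<Rightarrow> bool" where
  "leafless T \<longleftrightarrow> (\<forall>\<sigma>\<in>T. \<exists>n. \<sigma> @ [n] \<in> T)"

definition restrict_to :: "(nat \<Rightarrow> nat) \<Rightarrow> nat \<Rightarrow> nat list" where
  "restrict_to f n = map f [0..<n]"

definition paths :: "nat list set \<Rightarrow> (nat \<Rightarrow> nat) set" where
  "paths T = {f. \<forall>n. restrict_to f n \<in> T}"

definition path_space :: "nat list set \<Rightarrow> (nat \<Rightarrow> nat) topology" where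
  "path_space T = subtopology (product_topology (\<lambda>_. discrete_topology UNIV) UNIV) (paths T)"

definition paths_through :: "nat list set \<Rightarrow> nat list \<Rightarrow> (nat \<Rightarrow> nat) set" where
  "paths_through T \<sigma> = {f \<in> paths T. restrict_to f (length \<sigma>) = \<sigma>}"

definition compact_nodes :: "nat list set \<Rightarrow> nat list set" where
  "compact_nodes T = {\<sigma> \<in> T. compactin (path_space T) (paths_through T \<sigma>)}"

text \<open>
  \<open>clc_tree_index R eT eC eH T\<close>: \<open>T\<close> is a leafless tree with locally compact path space, \<open>eT\<close>
  decides \<open>T\<close>, and \<open>eC\<close> (compactness) and \<open>eH\<close> (bounds) are correct at all strings in \<open>R\<close>.
  For \<open>R = UNIV\<close> this says that \<open>T\<close> is computably locally compact via \<open>eT, eC, eH\<close>.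
\<close>

definition clc_tree_index :: "nat list set \<Rightarrow> nat \<Rightarrow> nat \<Rightarrow> nat \<Rightarrow> nat list set \<Rightarrow> bool" where
  "clc_tree_index R eT eC eH T \<longleftrightarrow>
     is_tree T \<and> leafless T \<and> locally_compact_space (path_space T) \<and>
     decides eT (list_encode ` T) \<and>
     (\<forall>\<sigma>\<in>R. phi eC (list_encode \<sigma>) = Some (of_bool (\<sigma> \<in> compact_nodes T))) \<and>
     (\<exists>H. (\<forall>\<sigma>\<in>R. \<forall>i. phi eH (prod_encode (list_encode \<sigma>, i)) = Some (H \<sigma> i)) \<and>
          (\<forall>\<sigma>\<in>R \<inter> compact_nodes T. \<forall>\<rho>\<in>T. prefix \<sigma> \<rho> \<longrightarrow> (\<forall>i<length \<rho>. \<rho> ! i \<le> H \<sigma> i)))"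

definition path_graph :: "(nat \<Rightarrow> nat) \<Rightarrow> (nat \<times> nat) set" where
  "path_graph f = {(i, f i) |i. True}"

definition string_graph :: "nat list \<Rightarrow> (nat \<times> nat) set" where
  "string_graph \<rho> = {(i, \<rho> ! i) |i. i < length \<rho>}"

text \<open>
  The equation \<open>\<Phi> f = \<Union>\<^sub>n P (f \<restriction> n)\<close> is an equation between graphs of functions.
\<close>

definition computable_map_index ::
    "nat \<Rightarrow> nat list set \<Rightarrow> nat list set \<Rightarrow> ((nat \<Rightarrow> nat) \<Rightarrow> nat \<Rightarrow> nat) \<Rightarrow> bool" where
  "computable_map_index e T S \<Phi> \<longleftrightarrow> (\<exists>P :: nat list \<Rightarrow> nat list option.
     (\<forall>\<sigma>. phi e (list_encode \<sigma>) = map_option list_encode (P \<sigma>)) \<and>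
     dom P \<subseteq> T \<and> ran P \<subseteq> S \<and>
     (\<forall>\<sigma>\<in>dom P. \<forall>\<tau>\<in>dom P. prefix \<sigma> \<tau> \<longrightarrow> prefix (the (P \<sigma>)) (the (P \<tau>))) \<and>
     (\<forall>f\<in>paths T. \<Phi> f \<in> paths S \<and>
        path_graph (\<Phi> f) =
          (\<Union>n \<in> {n. restrict_to f n \<in> dom P}. string_graph (the (P (restrict_to f n))))))"

definition computable_map2_index ::
    "nat \<Rightarrow> nat list set \<Rightarrow> nat list set \<Rightarrow>
     ((nat \<Rightarrow> nat) \<Rightarrow> (nat \<Rightarrow> nat) \<Rightarrow> nat \<Rightarrow> nat) \<Rightarrow> bool" where
  "computable_map2_index e T S \<Phi> \<longleftrightarrow> (\<exists>P :: nat list \<times> nat list \<Rightarrow> nat list option.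
     (\<forall>\<sigma> \<tau>. phi e (prod_encode (list_encode \<sigma>, list_encode \<tau>)) = map_option list_encode (P (\<sigma>, \<tau>))) \<and>
     dom P \<subseteq> {(\<sigma>, \<tau>). \<sigma> \<in> T \<and> \<tau> \<in> T \<and> length \<sigma> = length \<tau>} \<and> ran P \<subseteq> S \<and>
     (\<forall>(\<sigma>, \<tau>)\<in>dom P. \<forall>(\<sigma>', \<tau>')\<in>dom P.
        prefix \<sigma> \<sigma>' \<and> prefix \<tau> \<tau>' \<longrightarrow> prefix (the (P (\<sigma>, \<tau>))) (the (P (\<sigma>', \<tau>')))) \<and>
     (\<forall>f\<in>paths T. \<forall>g\<in>paths T. \<Phi> f g \<in> paths S \<and>
        path_graph (\<Phi> f g) =
          (\<Union>n \<in> {n. (restrict_to f n, restrict_to g n) \<in> dom P}.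
             string_graph (the (P (restrict_to f n, restrict_to g n))))))"


section \<open>Baire presentations\<close>

definition baire_presentation_index ::
    "nat list set \<Rightarrow> nat \<Rightarrow> ('a, 'b) monoid_scheme \<Rightarrow> 'a topology \<Rightarrow> bool" where
  "baire_presentation_index R p G X \<longleftrightarrow>
     (\<exists>eT eC eH eOp eInv T. \<exists>B :: (nat \<Rightarrow> nat) monoid.
        p = list_encode [eT, eC, eH, eOp, eInv] \<and>
        clc_tree_index R eT eC eH T \<and>
        carrier B = paths T \<and> topological_group B (path_space T) \<and>
        computable_map2_index eOp T T (\<lambda>f g. f \<otimes>\<^bsub>B\<^esub> g) \<and>
        computable_map_index eInv T T (\<lambda>f. inv\<^bsub>B\<^esub> f) \<and>
        topological_group_isomorphic G X B (path_space T))"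

definition computably_tdlc_via_baire :: "('a, 'b) monoid_scheme \<Rightarrow> 'a topology \<Rightarrow> bool" where
  "computably_tdlc_via_baire G X \<longleftrightarrow> (\<exists>p. baire_presentation_index UNIV p G X)"

text \<open>
  The notion of index used for the uniform part of the theorem. If \<open>G\<close> is not compact, all of
  the data of a Baire presentation is required to be correct. If \<open>G\<close> is compact, nothing is
  required of the compactness and bound data at the root (the empty string): this finite
  amount of information (whether the whole group is compact, together with what is needed to bound the
  first entries; later entries are bounded via the children) can be filled in non-uniformly, so that the notion of being computably
  locally compact is unaffected, but it is not uniformly computable from a Haar computable
  copy of the meet groupoid, which does not reveal the greatest coset, if there is one. For
  example, uniformly in \<open>e\<close> there is a Haar computable copy of the meet groupoid of \<open>G\<^sub>e\<close>, where
  \<open>G\<^sub>e = \<int> \<times> \<int>\<^sub>p\<close> if the \<open>e\<close>-th computation diverges and \<open>G\<^sub>e = (\<int>/n) \<times> \<int>\<^sub>p\<close>, for a large \<open>n\<close>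
  depending on the halting time, if it halts; deciding compactness at the root uniformly would
  solve the halting problem.
\<close>

definition baire_index :: "nat \<Rightarrow> ('a, 'b) monoid_scheme \<Rightarrow> 'a topology \<Rightarrow> bool" where
  "baire_index p G X \<longleftrightarrow>
     baire_presentation_index (if compact_space X then {\<sigma>. \<sigma> \<noteq> []} else UNIV) p G X"

lemma baire_presentation_index_mono:
  "R \<subseteq> S \<Longrightarrow> baire_presentation_index S p G X \<Longrightarrow> baire_presentation_index R p G X"
  unfolding baire_presentation_index_def clc_tree_index_def by (elim exE conjE, intro exI conjI) auto

lemma baire_index_if_full: "baire_presentation_index UNIV p G X \<Longrightarrow> baire_index p G X"
  unfolding baire_index_def by (rule baire_presentation_index_mono) auto

lemma baire_index_noncompact:
  "\<not> compact_space X \<Longrightarrow> baire_index p G X \<longleftrightarrow> baire_presentation_index UNIV p G X"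
  unfolding baire_index_def by simp


section \<open>The meet groupoid\<close>

record 'w meet_groupoid =
  mg_dom :: "'w set"
  mg_inv :: "'w \<Rightarrow> 'w"
  mg_meet :: "'w \<Rightarrow> 'w \<Rightarrow> 'w"
  mg_prod :: "'w \<Rightarrow> 'w \<Rightarrow> 'w option"

definition compact_open_subgroup :: "('a, 'b) monoid_scheme \<Rightarrow> 'a topology \<Rightarrow> 'a set \<Rightarrow> bool" where
  "compact_open_subgroup G X V \<longleftrightarrow> subgroup V G \<and> openin X V \<and> compactin X V"

definition compact_open_coset :: "('a, 'b) monoid_scheme \<Rightarrow> 'a topology \<Rightarrow> 'a set \<Rightarrow> bool" where
  "compact_open_coset G X A \<longleftrightarrow> openin X A \<and> compactin X A \<and>
     (\<exists>V. subgroup V G \<and> (A \<in> lcosets\<^bsub>G\<^esub> V \<or> A \<in> rcosets\<^bsub>G\<^esub> V))"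

text \<open>The product is \<open>None\<close> where it is undefined; in particular wherever \<open>\<emptyset>\<close> is a factor.\<close>

definition meet_groupoid_of :: "('a, 'b) monoid_scheme \<Rightarrow> 'a topology \<Rightarrow> 'a set meet_groupoid" where
  "meet_groupoid_of G X =
     \<lparr> mg_dom = insert {} {A. compact_open_coset G X A},
       mg_inv = (\<lambda>A. set_inv\<^bsub>G\<^esub> A),
       mg_meet = (\<inter>),
       mg_prod = (\<lambda>A B.
         if \<exists>V. compact_open_subgroup G X V \<and> A \<in> lcosets\<^bsub>G\<^esub> V \<and> B \<in> rcosets\<^bsub>G\<^esub> V
         then Some (A <#>\<^bsub>G\<^esub> B) else None) \<rparr>"

definition meet_groupoid_iso ::
    "('v \<Rightarrow> 'w) \<Rightarrow> 'v meet_groupoid \<Rightarrow> 'w meet_groupoid \<Rightarrow> bool" where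
  "meet_groupoid_iso \<beta> M N \<longleftrightarrow>
     bij_betw \<beta> (mg_dom M) (mg_dom N) \<and>
     (\<forall>x\<in>mg_dom M. mg_inv M x \<in> mg_dom M \<and> \<beta> (mg_inv M x) = mg_inv N (\<beta> x)) \<and>
     (\<forall>x\<in>mg_dom M. \<forall>y\<in>mg_dom M.
        mg_meet M x y \<in> mg_dom M \<and> \<beta> (mg_meet M x y) = mg_meet N (\<beta> x) (\<beta> y)) \<and>
     (\<forall>x\<in>mg_dom M. \<forall>y\<in>mg_dom M.
        set_option (mg_prod M x y) \<subseteq> mg_dom M \<and>
        map_option \<beta> (mg_prod M x y) = mg_prod N (\<beta> x) (\<beta> y))"

definition group_index :: "('a, 'b) monoid_scheme \<Rightarrow> 'a set \<Rightarrow> 'a set \<Rightarrow> nat" where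
  "group_index G U V = card (rcosets\<^bsub>G\<lparr>carrier := U\<rparr>\<^esub> V)"

text \<open>
  \<open>p\<close> is an index of a Haar computable copy \<open>M\<close> of the meet groupoid of \<open>G\<close>. The entries
  \<open>eDef\<close> and \<open>eProd\<close> are for the definedness of the product and for the product itself.
\<close>

definition haar_index :: "nat \<Rightarrow> ('a, 'b) monoid_scheme \<Rightarrow> 'a topology \<Rightarrow> bool" where
  "haar_index p G X \<longleftrightarrow>
     (\<exists>eD eInv eMeet eDef eProd eHaar. \<exists>M :: nat meet_groupoid. \<exists>\<beta>.
        p = list_encode [eD, eInv, eMeet, eDef, eProd, eHaar] \<and>
        meet_groupoid_iso \<beta> M (meet_groupoid_of G X) \<and>
        decides eD (mg_dom M) \<and>
        (\<forall>x\<in>mg_dom M. phi eInv x = Some (mg_inv M x)) \<and>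
        (\<forall>x\<in>mg_dom M. \<forall>y\<in>mg_dom M. phi eMeet (prod_encode (x, y)) = Some (mg_meet M x y)) \<and>
        (\<forall>x\<in>mg_dom M. \<forall>y\<in>mg_dom M.
           phi eDef (prod_encode (x, y)) = Some (of_bool (mg_prod M x y \<noteq> None))) \<and>
        (\<forall>x\<in>mg_dom M. \<forall>y\<in>mg_dom M. phi eProd (prod_encode (x, y)) = mg_prod M x y) \<and>
        (\<forall>u\<in>mg_dom M. \<forall>v\<in>mg_dom M. mg_prod M u u = Some u \<and> mg_prod M v v = Some v \<longrightarrow>
           phi eHaar (prod_encode (u, v)) = Some (group_index G (\<beta> u) (\<beta> u \<inter> \<beta> v))))"

definition computably_tdlc_via_meet_groupoid :: "('a, 'b) monoid_scheme \<Rightarrow> 'a topology \<Rightarrow> bool" where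
  "computably_tdlc_via_meet_groupoid G X \<longleftrightarrow> (\<exists>p. haar_index p G X)"

end

theory Submission
  imports Defs
begin

text \<open>
  Indices are transformed by combining programs, so that no universal function is needed. A
  computable map of paths is given by a partial function on strings; its programs are first
  transformed into total ones whose searches are bounded by an additional argument.

  Given a Baire presentation, a compact open set is coded by a list of nonempty strings. By
  compactness it is decidable whether \<open>K L \<subseteq> M\<close> and whether \<open>K\<^sup>-\<^sup>1 \<subseteq> M\<close> for compact open sets
  given by codes. A nonempty compact open set \<open>A\<close> is a coset iff there are compact open sets
  \<open>A\<^sup>-\<^sup>1\<close>, \<open>A A\<^sup>-\<^sup>1\<close> and \<open>A\<^sup>-\<^sup>1 A\<close> satisfying finitely many such inclusions, so together with these
  witnesses cosets have decidable codes, and all operations of the meet groupoid are found by searching.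

  Given a meet groupoid, let \<open>V\<^sub>0 \<supseteq> V\<^sub>1 \<supseteq> \<dots>\<close> be the finite intersections of the compact open
  subgroups in the order of their codes. By van Dantzig's theorem they form a basis at the identity,
  so \<open>g\<close> is determined by the sequence of the codes of \<open>g V\<^sub>0, g V\<^sub>1, \<dots>\<close>, and these sequences are
  the paths of a computable tree. Indices of subgroups bound the branching. If \<open>V\<^sub>k \<subseteq> h V\<^sub>j h\<^sup>-\<^sup>1\<close>,
  then \<open>g V\<^sub>k\<close> and \<open>h V\<^sub>j\<close> determine \<open>g h V\<^sub>j\<close>, so that multiplication is computable; likewise,
  if \<open>g V\<^sub>k g\<^sup>-\<^sup>1 \<subseteq> V\<^sub>j\<close>, then \<open>g V\<^sub>k\<close> determines \<open>g\<^sup>-\<^sup>1 V\<^sub>j\<close>.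
\<close>


section \<open>Uniformly computable families\<close>

text \<open>Whether a number is a correct index is undecidable, so the uniform half works with the
  family of all correct triples of group, topology and index, and its programs only have to be right
  there. An unbounded search is a total computable function only if it ends on every input; hence
  the searches for codes carry a decidable premise that fails on meaningless input and makes the
  condition vacuous. The programs for products and inverses of paths are partial, and a search that
  ran one of them on an unsuitable string would hang. This is why they are replaced by total
  step-bounded functions, whose indices are obtained by recursion on the index of the program. For
  compact groups the uniform statements say nothing about the data at the root of the tree. Neither
  construction may therefore consult the root: compact open sets are covered by cones above nonempty
  strings, and every nonempty node of the constructed tree is compact. For the nonuniform
  equivalence the root is repaired afterwards with one number, a bound on the first entries of all
  paths.\<close>

class coded =
  fixes enc :: "'a \<Rightarrow> nat"
  assumes inj_enc: "inj enc"

text \<open>If every number is a code, it can be read back with \<open>dec\<close>. This is what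
  allows a partial function to be prescribed at every input, including where it is undefined. Truth
  values are only coded injectively.\<close>

class coded_surj = coded +
  assumes surj_enc: "surj enc"

lemma enc_eq_iff [simp]: "enc x = enc y \<longleftrightarrow> x = y"
  using inj_enc by (auto dest: injD)

definition dec :: "nat \<Rightarrow> 'a::coded_surj" where
  "dec n = inv_into UNIV enc n"

lemma enc_dec [simp]: "enc (dec n) = n"
  by (simp add: dec_def surj_enc surj_f_inv_f)

lemma dec_enc [simp]: "dec (enc x) = x"
  by (simp add: dec_def inj_enc)

instantiation nat :: coded_surj
begin
definition enc_nat :: "nat \<Rightarrow> nat" where [simp]: "enc_nat n = n"
instance by standard (auto simp: inj_def)
end

instantiation bool :: coded
begin
definition enc_bool :: "bool \<Rightarrow> nat" where [simp]: "enc_bool b = of_bool b"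
instance by standard (auto simp: inj_def)
end

instantiation prod :: (coded, coded) coded
begin
definition enc_prod :: "'a \<times> 'b \<Rightarrow> nat" where
  "enc_prod p = prod_encode (enc (fst p), enc (snd p))"
instance by standard (auto simp: inj_def enc_prod_def)
end

lemma enc_Pair [simp]: "enc (x, y) = prod_encode (enc x, enc y)"
  by (simp add: enc_prod_def)

instance prod :: (coded_surj, coded_surj) coded_surj
proof
  have "\<exists>p :: 'a \<times> 'b. n = enc p" for n
    by (rule exI[of _ "(dec (fst (prod_decode n)), dec (snd (prod_decode n)))"]) simp
  then show "surj (enc :: 'a \<times> 'b \<Rightarrow> nat)"
    by (auto simp: surj_def)
qed

lemma dec_nat_pair: "(dec n :: nat \<times> nat) = prod_decode n"
  by (metis dec_enc enc_Pair enc_nat_def prod.collapse prod_decode_inverse)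

instantiation list :: (coded) coded
begin
definition enc_list :: "'a list \<Rightarrow> nat" where
  "enc_list xs = list_encode (map enc xs)"
instance by standard (rule injI, simp add: enc_list_def inj_map_eq_map[OF inj_enc] list_encode_eq)
end

lemma enc_Nil [simp]: "enc [] = 0"
  by (simp add: enc_list_def)

lemma enc_Cons [simp]: "enc (x # xs) = Suc (prod_encode (enc x, enc xs))"
  by (simp add: enc_list_def)

lemma enc_nat_list [simp]: "enc (xs :: nat list) = list_encode xs"
  by (induction xs) simp_all

instance list :: (coded_surj) coded_surj
proof
  have "\<exists>xs :: 'a list. n = enc xs" for n
    by (rule exI[of _ "map dec (list_decode n)"]) (simp add: enc_list_def comp_def)
  then show "surj (enc :: 'a list \<Rightarrow> nat)"
    by (auto simp: surj_def)
qed

section \<open>Evaluation of compound indices, and some basic programs\<close>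

lemma phi_code_index [simp]: "phi (code_index c) = eval c"
  by (simp add: phi_def inj_code_index)

lemma obtain_code: obtains c where "code_index c = n"
  using surj_code_index by (metis surjE)

lemma phi_Pair: "phi (4 * prod_encode (a, b) + 4) x =
    Option.bind (phi a x) (\<lambda>y. Option.bind (phi b x) (\<lambda>z. Some (prod_encode (y, z))))"
proof -
  obtain c d where [symmetric, simp]: "code_index c = a" "code_index d = b"
    by (metis obtain_code)
  have "4 * prod_encode (a, b) + 4 = code_index (Code_Pair c d)"
    by simp
  then show ?thesis by (simp del: code_index.simps)
qed

lemma phi_Comp: "phi (4 * prod_encode (a, b) + 5) x = Option.bind (phi b x) (phi a)"
proof -
  obtain c d where [symmetric, simp]: "code_index c = a" "code_index d = b"
    by (metis obtain_code)
  have "4 * prod_encode (a, b) + 5 = code_index (Code_Comp c d)"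
    by simp
  then show ?thesis by (simp del: code_index.simps)
qed

lemma phi_Prec: "phi (4 * prod_encode (a, b) + 6) x =
     rec_nat (phi a (fst (prod_decode x)))
       (\<lambda>k r. Option.bind r (\<lambda>v. phi b (prod_encode (fst (prod_decode x), prod_encode (k, v)))))
       (snd (prod_decode x))"
proof -
  obtain c d where [symmetric, simp]: "code_index c = a" "code_index d = b"
    by (metis obtain_code)
  have "4 * prod_encode (a, b) + 6 = code_index (Code_Prec c d)"
    by simp
  then show ?thesis by (simp del: code_index.simps)
qed

lemma phi_Min: "phi (4 * a + 7) x =
     (if \<exists>m. phi a (prod_encode (x, m)) = Some 0 \<and>
            (\<forall>k<m. \<exists>v. phi a (prod_encode (x, k)) = Some (Suc v))
     then Some (LEAST m. phi a (prod_encode (x, m)) = Some 0)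
     else None)"
proof -
  obtain c where [symmetric, simp]: "code_index c = a"
    by (metis obtain_code)
  have "4 * a + 7 = code_index (Code_Min c)"
    by simp
  then show ?thesis by (simp del: code_index.simps)
qed

lemma obtain_id_code: obtains c where "\<And>x. eval c x = Some x"
proof
  show "eval (Code_Pair Code_Fst Code_Snd) x = Some x" for x
    by simp
qed

lemma obtain_const_code: obtains c where "\<And>x. eval c x = Some n"
proof -
  have "\<exists>c. \<forall>x. eval c x = Some n"
  proof (induction n)
    case 0
    show ?case by (intro exI[of _ Code_Zero]) simp
  next
    case (Suc n)
    then obtain c where "\<forall>x. eval c x = Some n" by blast
    then show ?case by (intro exI[of _ "Code_Comp Code_Succ c"]) simp
  qed
  then show ?thesis using that by blast
qed

lemma obtain_add_code: obtains c where "\<And>m n. eval c (prod_encode (m, n)) = Some (m + n)"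
proof -
  obtain i where i: "\<And>x. eval i x = Some x" by (metis obtain_id_code)
  \<comment> \<open>The step program receives \<open>m\<close> paired with the pair of counter and
    previous value; two projections extract the latter.\<close>
  define c where "c = Code_Prec i (Code_Comp Code_Succ (Code_Comp Code_Snd Code_Snd))"
  have "eval c (prod_encode (m, n)) = Some (m + n)" for m n
    unfolding c_def by (simp add: i) (induction n; simp)
  then show ?thesis using that by blast
qed

text \<open>
  A family over \<open>I\<close> is uniformly computable if an index of its member at \<open>i\<close> is computable from
  the parameter \<open>par i\<close>. Indices are only ever combined by the program constructors, so that no
  universal function is involved. Nothing is required of parameters that belong to no \<open>i \<in> I\<close>.
\<close>

locale uniform =
  fixes I :: "'i set" and par :: "'i \<Rightarrow> nat"
begin

definition par_computable :: "('i \<Rightarrow> nat) \<Rightarrow> bool" where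
  "par_computable s \<longleftrightarrow> (\<exists>c F. (\<forall>n. eval c n = Some (F n)) \<and> (\<forall>i\<in>I. s i = F (par i)))"

text \<open>Equality of partial functions is required, so undefinedness is prescribed too. In
  contrast, \<open>uc\<close> only fixes the values at codes of arguments and implies totality
  there.\<close>

definition upc :: "('i \<Rightarrow> nat \<Rightarrow> nat option) \<Rightarrow> bool" where
  "upc f \<longleftrightarrow> (\<exists>s. par_computable s \<and> (\<forall>i\<in>I. phi (s i) = f i))"

definition uc :: "('i \<Rightarrow> 'a::coded \<Rightarrow> 'b::coded) \<Rightarrow> bool" where
  "uc f \<longleftrightarrow> (\<exists>g. upc g \<and> (\<forall>i\<in>I. \<forall>x. g i (enc x) = Some (enc (f i x))))"

section \<open>Computable functions of the parameter\<close>

named_theorems par_intros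
named_theorems uc_intros

lemma par_computable_par [par_intros]: "par_computable par"
proof -
  obtain c where "\<And>x. eval c x = Some x" by (metis obtain_id_code)
  then show ?thesis
    unfolding par_computable_def by (intro exI[of _ c] exI[of _ "\<lambda>n. n"]) simp
qed

lemma par_computable_comp:
  assumes "\<And>x. eval c x = Some (F x)" "par_computable s"
  shows "par_computable (\<lambda>i. F (s i))"
proof -
  obtain d G where "\<forall>n. eval d n = Some (G n)" "\<forall>i\<in>I. s i = G (par i)"
    using assms(2) unfolding par_computable_def by blast
  then show ?thesis
    unfolding par_computable_def
    by (intro exI[of _ "Code_Comp c d"] exI[of _ "\<lambda>n. F (G n)"]) (simp add: assms(1))
qed

lemma par_computable_const [par_intros]: "par_computable (\<lambda>i. n)"
proof -
  obtain c where "\<And>x. eval c x = Some n" by (metis obtain_const_code)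
  then show ?thesis
    unfolding par_computable_def by (intro exI[of _ c] exI[of _ "\<lambda>_. n"]) simp
qed

lemma par_computable_Suc [par_intros]:
  "par_computable s \<Longrightarrow> par_computable (\<lambda>i. Suc (s i))"
  by (rule par_computable_comp[of Code_Succ]) simp_all

lemma par_computable_fst [par_intros]:
  "par_computable s \<Longrightarrow> par_computable (\<lambda>i. fst (prod_decode (s i)))"
  by (rule par_computable_comp[of Code_Fst "\<lambda>x. fst (prod_decode x)"]) simp_all

lemma par_computable_snd [par_intros]:
  "par_computable s \<Longrightarrow> par_computable (\<lambda>i. snd (prod_decode (s i)))"
  by (rule par_computable_comp[of Code_Snd "\<lambda>x. snd (prod_decode x)"]) simp_all

lemma par_computable_pair [par_intros]:
  assumes "par_computable s" "par_computable t"
  shows "par_computable (\<lambda>i. prod_encode (s i, t i))"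
proof -
  obtain c d F G where "\<forall>n. eval c n = Some (F n)" "\<forall>n. eval d n = Some (G n)"
      "\<forall>i\<in>I. s i = F (par i)" "\<forall>i\<in>I. t i = G (par i)"
    using assms unfolding par_computable_def by blast
  then show ?thesis
    unfolding par_computable_def
    by (intro exI[of _ "Code_Pair c d"] exI[of _ "\<lambda>n. prod_encode (F n, G n)"]) simp
qed

lemma par_computable_add [par_intros]:
  assumes "par_computable s" "par_computable t"
  shows "par_computable (\<lambda>i. s i + t i)"
proof -
  obtain a where a: "\<And>m n. eval a (prod_encode (m, n)) = Some (m + n)"
    by (metis obtain_add_code)
  then have "eval a x = Some (fst (prod_decode x) + snd (prod_decode x))" for x
    by (metis prod.collapse prod_decode_inverse)
  from par_computable_comp[OF this par_computable_pair[OF assms]] show ?thesis by simp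
qed

lemma par_computable_pred [par_intros]:
  assumes "par_computable s"
  shows "par_computable (\<lambda>i. s i - 1)"
proof -
  obtain d where d: "\<And>x. eval d x = Some x" by (metis obtain_id_code)
  \<comment> \<open>Recursion from \<open>0\<close> whose step returns the counter instead of the
    previous value yields the predecessor; the first component of the input is a dummy.\<close>
  define c where "c = Code_Comp (Code_Prec Code_Zero (Code_Comp Code_Fst Code_Snd)) (Code_Pair Code_Zero d)"
  have "eval c n = Some (n - 1)" for n
    unfolding c_def by (cases n) (simp_all add: d, induct_tac nat, simp_all)
  from par_computable_comp[OF this assms] show ?thesis by simp
qed

text \<open>The factor is the one in the numbering \<open>code_index\<close> of compound
  programs.\<close>

lemma par_computable_mult4:
  assumes "par_computable s"
  shows "par_computable (\<lambda>i. 4 * s i)"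
proof -
  have "(\<lambda>i. 4 * s i) = (\<lambda>i. s i + s i + (s i + s i))" by auto
  then show ?thesis
    by (simp only:) (intro par_intros assms)
qed

section \<open>Uniform families of partial functions\<close>

lemma upc_phi: "par_computable s \<Longrightarrow> upc (\<lambda>i. phi (s i))"
  unfolding upc_def by blast

lemma upc_index: "upc f \<Longrightarrow> \<exists>s. par_computable s \<and> (\<forall>i\<in>I. phi (s i) = f i)"
  unfolding upc_def .

lemma upc_cong: "upc f \<Longrightarrow> (\<And>i x. i \<in> I \<Longrightarrow> f i x = g i x) \<Longrightarrow> upc g"
  unfolding upc_def fun_eq_iff by metis

lemma upc_eval: "upc (\<lambda>i. eval c)"
  using upc_phi[OF par_computable_const, of "code_index c"] by simp

lemma upc_pair:
  assumes "upc f" "upc g"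
  shows "upc (\<lambda>i x. Option.bind (f i x) (\<lambda>a. Option.bind (g i x) (\<lambda>b. Some (prod_encode (a, b)))))"
proof -
  obtain s t where "par_computable s" "par_computable t"
    and st: "\<forall>i\<in>I. phi (s i) = f i" "\<forall>i\<in>I. phi (t i) = g i"
    using assms unfolding upc_def by blast
  then have "par_computable (\<lambda>i. 4 * prod_encode (s i, t i) + 4)"
    by (intro par_intros par_computable_mult4)
  with st show ?thesis
    unfolding upc_def by (intro exI conjI) (assumption, intro ballI ext, simp add: phi_Pair)
qed

lemma upc_comp:
  assumes "upc f" "upc g"
  shows "upc (\<lambda>i x. Option.bind (g i x) (f i))"
proof -
  obtain s t where "par_computable s" "par_computable t"
    and st: "\<forall>i\<in>I. phi (s i) = f i" "\<forall>i\<in>I. phi (t i) = g i"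
    using assms unfolding upc_def by blast
  then have "par_computable (\<lambda>i. 4 * prod_encode (s i, t i) + 5)"
    by (intro par_intros par_computable_mult4)
  with st show ?thesis
    unfolding upc_def by (intro exI conjI) (assumption, intro ballI ext, simp add: phi_Comp)
qed

lemma upc_prec:
  assumes "upc f" "upc g"
  shows "upc (\<lambda>i x. rec_nat (f i (fst (prod_decode x)))
       (\<lambda>k r. Option.bind r (\<lambda>v. g i (prod_encode (fst (prod_decode x), prod_encode (k, v)))))
       (snd (prod_decode x)))"
proof -
  obtain s t where "par_computable s" "par_computable t"
    and st: "\<forall>i\<in>I. phi (s i) = f i" "\<forall>i\<in>I. phi (t i) = g i"
    using assms unfolding upc_def by blast
  then have "par_computable (\<lambda>i. 4 * prod_encode (s i, t i) + 6)"
    by (intro par_intros par_computable_mult4)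
  with st show ?thesis
    unfolding upc_def by (intro exI conjI) (assumption, intro ballI ext, simp add: phi_Prec)
qed

lemma upc_min:
  assumes "upc f"
  shows "upc (\<lambda>i x. if \<exists>m. f i (prod_encode (x, m)) = Some 0 \<and>
            (\<forall>k<m. \<exists>v. f i (prod_encode (x, k)) = Some (Suc v))
     then Some (LEAST m. f i (prod_encode (x, m)) = Some 0)
     else None)"
proof -
  obtain s where "par_computable s" and s: "\<forall>i\<in>I. phi (s i) = f i"
    using assms unfolding upc_def by blast
  then have "par_computable (\<lambda>i. 4 * s i + 7)"
    by (intro par_intros par_computable_mult4)
  with s show ?thesis
    unfolding upc_def by (intro exI conjI) (assumption, intro ballI ext, simp add: phi_Min)
qed

section \<open>Closure properties of uniform families of total functions\<close>

lemma uc_upc: "uc f \<Longrightarrow> \<exists>g. upc g \<and> (\<forall>i\<in>I. \<forall>x. g i (enc x) = Some (enc (f i x)))"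
  unfolding uc_def .

lemma ucI: "upc g \<Longrightarrow> (\<And>i x. i \<in> I \<Longrightarrow> g i (enc x) = Some (enc (f i x))) \<Longrightarrow> uc f"
  unfolding uc_def by blast

lemma uc_cong: "uc f \<Longrightarrow> (\<And>i x. i \<in> I \<Longrightarrow> f i x = g i x) \<Longrightarrow> uc g"
  unfolding uc_def by force

lemma uc_index:
  "uc f \<Longrightarrow> \<exists>s. par_computable s \<and> (\<forall>i\<in>I. \<forall>x. phi (s i) (enc x) = Some (enc (f i x)))"
  unfolding uc_def upc_def by metis

lemma uc_surj_upc:
  fixes f :: "'i \<Rightarrow> 'a::coded_surj \<Rightarrow> 'b::coded"
  assumes "uc f"
  shows "upc (\<lambda>i n. Some (enc (f i (dec n))))"
proof -
  obtain g where "upc g" "\<forall>i\<in>I. \<forall>x. g i (enc x) = Some (enc (f i x))"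
    using uc_upc[OF assms] by blast
  then show ?thesis
    by (elim upc_cong) (metis enc_dec)
qed

lemma uc_compose:
  assumes "uc h" "uc f"
  shows "uc (\<lambda>i x. h i (f i x))"
proof -
  obtain g g' where "upc g" "upc g'"
    and "\<forall>i\<in>I. \<forall>x. g i (enc x) = Some (enc (h i x))" "\<forall>i\<in>I. \<forall>x. g' i (enc x) = Some (enc (f i x))"
    using uc_upc[OF assms(1)] uc_upc[OF assms(2)] by blast
  then show ?thesis
    by (intro ucI[OF upc_comp[of g g']]) simp_all
qed

lemma uc_const [uc_intros]: "uc (\<lambda>i x. c)"
proof -
  obtain d where "\<And>x. eval d x = Some (enc c)" by (metis obtain_const_code)
  then show ?thesis by (intro ucI[OF upc_eval[of d]])
qed

lemma uc_id [uc_intros]: "uc (\<lambda>i x. x)"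
proof -
  obtain d where "\<And>x. eval d x = Some x" by (metis obtain_id_code)
  then show ?thesis by (intro ucI[OF upc_eval[of d]])
qed

lemma uc_Pair [uc_intros]:
  assumes "uc f" "uc g"
  shows "uc (\<lambda>i x. (f i x, g i x))"
proof -
  obtain f' g' where "upc f'" "upc g'"
    and fg: "\<forall>i\<in>I. \<forall>x. f' i (enc x) = Some (enc (f i x))" "\<forall>i\<in>I. \<forall>x. g' i (enc x) = Some (enc (g i x))"
    using uc_upc[OF assms(1)] uc_upc[OF assms(2)] by blast
  then show ?thesis
    by (intro ucI[OF upc_pair[of f' g']]) (simp_all add: fg)
qed

lemma uc_eval:
  assumes "uc f" "\<And>i x. i \<in> I \<Longrightarrow> eval c (enc (f i x)) = Some (enc (g i x))"
  shows "uc g"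
proof -
  obtain f' where "upc f'" and f: "\<forall>i\<in>I. \<forall>x. f' i (enc x) = Some (enc (f i x))"
    using uc_upc[OF assms(1)] by blast
  then show ?thesis
    by (intro ucI[OF upc_comp[OF upc_eval[of c], of f']]) (simp_all add: assms(2))
qed

lemma uc_fst [uc_intros]: "uc f \<Longrightarrow> uc (\<lambda>i x. fst (f i x))"
  by (erule uc_eval[where c = Code_Fst]) (simp add: enc_prod_def)

lemma uc_snd [uc_intros]: "uc f \<Longrightarrow> uc (\<lambda>i x. snd (f i x))"
  by (erule uc_eval[where c = Code_Snd]) (simp add: enc_prod_def)

lemma uc_Suc [uc_intros]: "uc f \<Longrightarrow> uc (\<lambda>i x. Suc (f i x))"
  by (erule uc_eval[where c = Code_Succ]) simp

text \<open>On the level of numbers, passing from a value to its code is the identity, so the same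
  program works; the same holds for \<open>dec\<close>.\<close>

lemma uc_enc [uc_intros]: "uc f \<Longrightarrow> uc (\<lambda>i x. enc (f i x))"
  unfolding uc_def by simp

lemma uc_dec [uc_intros]: "uc f \<Longrightarrow> uc (\<lambda>i x. dec (f i x))"
  unfolding uc_def by simp

lemma uc_app2:
  assumes "uc (\<lambda>i z. h i (fst z) (snd z))" "uc f" "uc g"
  shows "uc (\<lambda>i x. h i (f i x) (g i x))"
  using uc_compose[OF assms(1) uc_Pair[OF assms(2,3)]] by simp

lemma uc_app3:
  assumes "uc (\<lambda>i z. h i (fst z) (fst (snd z)) (snd (snd z)))" "uc e" "uc f" "uc g"
  shows "uc (\<lambda>i x. h i (e i x) (f i x) (g i x))"
  using uc_compose[OF assms(1) uc_Pair[OF assms(2) uc_Pair[OF assms(3,4)]]] by simp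

lemma uc_rec_nat [uc_intros]:
  assumes "uc z" and "uc (\<lambda>i y. s i (fst y) (fst (snd y)) (snd (snd y)))" and "uc n"
  shows "uc (\<lambda>i x. rec_nat (z i x) (\<lambda>k. s i x k) (n i x))"
proof -
  obtain z' s' n' where upc: "upc z'" "upc s'" "upc n'"
    and z: "\<forall>i\<in>I. \<forall>x. z' i (enc x) = Some (enc (z i x))"
    and s: "\<forall>i\<in>I. \<forall>y. s' i (enc y) = Some (enc (s i (fst y) (fst (snd y)) (snd (snd y))))"
    and n: "\<forall>i\<in>I. \<forall>x. n' i (enc x) = Some (enc (n i x))"
    using uc_upc[OF assms(1)] uc_upc[OF assms(2)] uc_upc[OF assms(3)] by blast
  have s: "s' i (prod_encode (enc x, prod_encode (k, enc v))) = Some (enc (s i x k v))"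
    if "i \<in> I" for i x k v
    using s[rule_format, OF that, of "(x, k, v)"] by simp
  obtain d where d: "\<And>x. eval d x = Some x" by (metis obtain_id_code)
  have *: "rec_nat (z' i (enc x)) (\<lambda>k r. Option.bind r (\<lambda>v. s' i (prod_encode (enc x, prod_encode (k, v))))) m
      = Some (enc (rec_nat (z i x) (\<lambda>k. s i x k) m))" if "i \<in> I" for i x m
    by (induction m) (simp_all add: z s that)
  show ?thesis
    by (rule ucI[OF upc_comp[OF upc_prec[OF upc(1,2)] upc_pair[OF upc_eval[of d] upc(3)]]])
      (simp add: d n *)
qed

text \<open>The function \<open>g\<close> is only run where the guard \<open>P\<close> holds, so it may be partial elsewhere.\<close>

lemma uc_guarded:
  assumes "uc P" and "upc g" and "uc h"
    and g: "\<And>i x. i \<in> I \<Longrightarrow> P i x \<Longrightarrow> g i (enc x) = Some (enc (f i x))"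
  shows "uc (\<lambda>i x. if P i x then f i x else h i x)"
proof -
  obtain p h' where upc: "upc p" "upc h'"
    and p: "\<forall>i\<in>I. \<forall>x. p i (enc x) = Some (enc (P i x))"
    and h: "\<forall>i\<in>I. \<forall>x. h' i (enc x) = Some (enc (h i x))"
    using uc_upc[OF assms(1)] uc_upc[OF assms(3)] by blast
  obtain d where d: "\<And>x. eval d x = Some x" by (metis obtain_id_code)
  show ?thesis
    \<comment> \<open>The truth value of the guard is the recursion counter: zero steps return the
      value of \<open>h\<close>, one step discards it and runs \<open>g\<close>. So \<open>g\<close>
      is never evaluated where the guard fails.\<close>
    by (rule ucI[OF upc_comp[OF upc_prec[OF upc(2) upc_comp[OF assms(2) upc_eval[of Code_Fst]]]
            upc_pair[OF upc_eval[of d] upc(1)]]])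
      (simp add: d p h g)
qed

lemma uc_if [uc_intros]:
  assumes "uc P" "uc f" "uc h"
  shows "uc (\<lambda>i x. if P i x then f i x else h i x)"
proof -
  obtain g where "upc g" "\<forall>i\<in>I. \<forall>x. g i (enc x) = Some (enc (f i x))"
    using uc_upc[OF assms(2)] by blast
  then show ?thesis by (intro uc_guarded[OF assms(1) _ assms(3)]) auto
qed

lemma uc_is_zero: "uc f \<Longrightarrow> uc (\<lambda>i x. f i x = (0::nat))"
proof -
  assume "uc f"
  then have "uc (\<lambda>i x. rec_nat True (\<lambda>k r. False) (f i x))"
    by (intro uc_intros)
  moreover have "rec_nat True (\<lambda>k r. False) n = (n = 0)" for n by (cases n) auto
  ultimately show ?thesis by simp
qed

lemma uc_not [uc_intros]: "uc P \<Longrightarrow> uc (\<lambda>i x. \<not> P i x)"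
  by (rule uc_cong[where f = "\<lambda>i x. if P i x then False else True"]) (intro uc_intros, auto)

lemma uc_conj [uc_intros]: "uc P \<Longrightarrow> uc Q \<Longrightarrow> uc (\<lambda>i x. P i x \<and> Q i x)"
  by (rule uc_cong[where f = "\<lambda>i x. if P i x then Q i x else False"]) (intro uc_intros, auto)

lemma uc_disj [uc_intros]: "uc P \<Longrightarrow> uc Q \<Longrightarrow> uc (\<lambda>i x. P i x \<or> Q i x)"
  by (rule uc_cong[where f = "\<lambda>i x. if P i x then True else Q i x"]) (intro uc_intros, auto)

lemma uc_imp [uc_intros]: "uc P \<Longrightarrow> uc Q \<Longrightarrow> uc (\<lambda>i x. P i x \<longrightarrow> Q i x)"
  by (rule uc_cong[where f = "\<lambda>i x. if P i x then Q i x else True"]) (intro uc_intros, auto)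

lemma uc_add [uc_intros]:
  assumes "uc f" "uc g"
  shows "uc (\<lambda>i x. f i x + g i x :: nat)"
proof -
  have "rec_nat m (\<lambda>k r. Suc r) n = m + n" for m n by (induction n) auto
  moreover have "uc (\<lambda>i x. rec_nat (f i x) (\<lambda>k r. Suc r) (g i x))"
    by (intro uc_intros assms)
  ultimately show ?thesis by simp
qed

lemma uc_mult [uc_intros]:
  assumes "uc f" "uc g"
  shows "uc (\<lambda>i x. f i x * g i x :: nat)"
proof -
  have "rec_nat 0 (\<lambda>k r. r + m) n = m * n" for m n :: nat by (induction n) auto
  moreover have "uc (\<lambda>i x. rec_nat 0 (\<lambda>k r. r + f i x) (g i x))"
    by (intro uc_intros assms uc_compose[OF assms(1)])
  ultimately show ?thesis by simp
qed

lemma uc_diff [uc_intros]: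
  assumes "uc f" "uc g"
  shows "uc (\<lambda>i x. f i x - g i x :: nat)"
proof -
  have pred: "uc (\<lambda>i x. h i x - 1)" if "uc h" for h :: "'i \<Rightarrow> 'd::coded \<Rightarrow> nat"
  proof -
    have "rec_nat 0 (\<lambda>k r. k) n = n - 1" for n :: nat by (cases n) auto
    moreover have "uc (\<lambda>i x. rec_nat 0 (\<lambda>k r. k) (h i x))"
      by (intro uc_intros that)
    ultimately show ?thesis by simp
  qed
  have "rec_nat m (\<lambda>k r. r - 1) n = m - n" for m n :: nat by (induction n) auto
  moreover have "uc (\<lambda>i x. rec_nat (f i x) (\<lambda>k r. r - 1) (g i x))"
    by (intro uc_intros assms pred)
  ultimately show ?thesis by simp
qed

lemma uc_le [uc_intros]: "uc f \<Longrightarrow> uc g \<Longrightarrow> uc (\<lambda>i x. f i x \<le> (g i x :: nat))"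
  by (rule uc_cong[where f = "\<lambda>i x. f i x - g i x = 0"]) (intro uc_intros uc_is_zero, auto)

lemma uc_less [uc_intros]: "uc f \<Longrightarrow> uc g \<Longrightarrow> uc (\<lambda>i x. f i x < (g i x :: nat))"
  unfolding less_eq_Suc_le by (intro uc_intros)

lemma uc_eq [uc_intros]: "uc f \<Longrightarrow> uc g \<Longrightarrow> uc (\<lambda>i x. f i x = g i x)"
  by (rule uc_cong[where f = "\<lambda>i x. enc (f i x) \<le> enc (g i x) \<and> enc (g i x) \<le> enc (f i x)"])
    (intro uc_intros, auto simp: order.eq_iff[symmetric])

lemma uc_prod_encode [uc_intros]:
  fixes f g :: "'i \<Rightarrow> 'a::coded \<Rightarrow> nat"
  shows "uc f \<Longrightarrow> uc g \<Longrightarrow> uc (\<lambda>i x. prod_encode (f i x, g i x))"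
  using uc_enc[OF uc_Pair, of f g] by simp

lemma uc_prod_decode [uc_intros]: "uc f \<Longrightarrow> uc (\<lambda>i x. prod_decode (f i x))"
  unfolding dec_nat_pair[symmetric] by (rule uc_dec)

text \<open>Minimisation looks for the value \<open>0\<close>, so it is applied to the negated
  predicate. Existence for every argument makes the search total; this is the obligation behind all
  the guarded searches below.\<close>

lemma uc_LEAST:
  fixes P :: "'i \<Rightarrow> 'a::coded \<Rightarrow> nat \<Rightarrow> bool"
  assumes "uc (\<lambda>i y. P i (fst y) (snd y))" and ex: "\<And>i x. i \<in> I \<Longrightarrow> \<exists>n. P i x n"
  shows "uc (\<lambda>i x. LEAST n. P i x n)"
proof -
  obtain g where "upc g" and g: "\<forall>i\<in>I. \<forall>y. g i (enc y) = Some (enc (\<not> P i (fst y) (snd y)))"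
    using uc_upc[OF uc_not[OF assms(1)]] by blast
  have g: "g i (prod_encode (enc x, n)) = Some (of_bool (\<not> P i x n))" if "i \<in> I" for i x n
    using g[rule_format, OF that, of "(x, n)"] by simp
  have *: "\<exists>m. P i x m \<and> (\<forall>k<m. \<not> P i x k)" if "i \<in> I" for i x
    using ex[OF that] by (meson exists_least_iff)
  have pos: "(\<exists>v. of_bool b = Suc v) \<longleftrightarrow> b" for b by (cases b) auto
  show ?thesis
    by (rule ucI[OF upc_min[OF \<open>upc g\<close>]]) (use * in \<open>auto simp: g pos\<close>)
qed

section \<open>Lists, bounded quantifiers and arithmetic\<close>

lemma uc_Cons [uc_intros]:
  assumes "uc f" "uc g"
  shows "uc (\<lambda>i x. f i x # g i x)"
  by (rule uc_eval[where c = Code_Succ, OF uc_Pair[OF assms]]) simp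

text \<open>The code of a nonempty list is one more than the pair code of head and tail. Its
  predecessor can thus be passed to the second branch directly, guarded by nonemptiness.\<close>

lemma uc_case_list [uc_intros]:
  assumes "uc a" "uc (\<lambda>i z. b i (fst z) (fst (snd z)) (snd (snd z)))" "uc xs"
  shows "uc (\<lambda>i x. case xs i x of [] \<Rightarrow> a i x | y # ys \<Rightarrow> b i x y ys)"
proof -
  have "uc (\<lambda>i x. enc (xs i x) - 1)" by (intro uc_intros assms)
  then obtain b' q where upc: "upc b'" "upc q"
    and b: "\<forall>i\<in>I. \<forall>z. b' i (enc z) = Some (enc (b i (fst z) (fst (snd z)) (snd (snd z))))"
    and q: "\<forall>i\<in>I. \<forall>x. q i (enc x) = Some (enc (enc (xs i x) - 1))"
    using uc_upc[OF assms(2)] uc_upc by blast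
  have b: "b' i (prod_encode (enc x, prod_encode (enc y, enc ys))) = Some (enc (b i x y ys))"
    if "i \<in> I" for i x y ys
    using b[rule_format, OF that, of "(x, y, ys)"] by simp
  obtain d where d: "\<And>x. eval d x = Some x" by (metis obtain_id_code)
  have "uc (\<lambda>i x. if xs i x \<noteq> [] then b i x (hd (xs i x)) (tl (xs i x)) else a i x)"
  proof (rule uc_guarded)
    show "uc (\<lambda>i x. xs i x \<noteq> [])" by (intro uc_intros assms)
    show "upc (\<lambda>i x. Option.bind (Option.bind (eval d x) (\<lambda>u. Option.bind (q i x)
        (\<lambda>v. Some (prod_encode (u, v))))) (b' i))"
      by (intro upc_comp upc_pair upc_eval upc)
    show "uc a" by fact
  next
    fix i x
    assume "i \<in> I" "xs i x \<noteq> []"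
    then show "Option.bind (Option.bind (eval d (enc x)) (\<lambda>u. Option.bind (q i (enc x))
        (\<lambda>v. Some (prod_encode (u, v))))) (b' i) = Some (enc (b i x (hd (xs i x)) (tl (xs i x))))"
      by (cases "xs i x") (simp_all add: d q b)
  qed
  then show ?thesis
    by (rule uc_cong) (auto split: list.split)
qed

lemma uc_tl [uc_intros]: "uc xs \<Longrightarrow> uc (\<lambda>i x. tl (xs i x))"
  by (rule uc_cong[where f = "\<lambda>i x. case xs i x of [] \<Rightarrow> [] | y # ys \<Rightarrow> ys"])
    (intro uc_intros, auto split: list.split)

text \<open>Programs have no recursion on lists, so the list is consumed by iterating a step that
  does nothing on the empty list. The code of a list is at least its length, which gives enough
  iterations.\<close>

lemma uc_foldl [uc_intros]:
  fixes xs :: "'i \<Rightarrow> 'a::coded \<Rightarrow> 'b::coded list"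
  assumes "uc a" "uc xs" "uc (\<lambda>i z. f i (fst z) (fst (snd z)) (snd (snd z)))"
  shows "uc (\<lambda>i x. foldl (f i x) (a i x) (xs i x))"
proof -
  define step where "step i x p = (case fst p of [] \<Rightarrow> p | y # ys \<Rightarrow> (ys, f i x (snd p) y))" for i x p
  have step: "snd (rec_nat (ys, b) (\<lambda>k. step i x) n) = foldl (f i x) b ys" if "length ys \<le> n" for i x ys b n
  proof -
    \<comment> \<open>\<open>rec_nat\<close> unfolds at the last iteration, whereas a fold consumes
      the head in its first one.\<close>
    have comm: "rec_nat (step i x p) (\<lambda>k. step i x) n = step i x (rec_nat p (\<lambda>k. step i x) n)" for p n
      by (induction n) auto
    show ?thesis using that
    proof (induction n arbitrary: ys b)
      case (Suc n)
      show ?case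
      proof (cases ys)
        case Nil
        have "rec_nat ([], b) (\<lambda>k. step i x) m = ([], b)" for m
          by (induction m) (auto simp: step_def)
        from this[of "Suc n"] Nil show ?thesis by simp
      next
        case (Cons y zs)
        have "rec_nat (ys, b) (\<lambda>k. step i x) (Suc n) = rec_nat (step i x (ys, b)) (\<lambda>k. step i x) n"
          by (simp add: comm)
        also have "step i x (ys, b) = (zs, f i x b y)" by (simp add: step_def Cons)
        finally show ?thesis using Suc.IH[of zs "f i x b y"] Suc.prems Cons by simp
      qed
    qed simp
  qed
  have len: "length ys \<le> enc ys" for ys :: "'b list"
  proof (induction ys)
    case (Cons y ys)
    then show ?case using le_prod_encode_2[of "enc ys" "enc y"] by simp
  qed simp
  have "uc (\<lambda>i x. snd (rec_nat (xs i x, a i x) (\<lambda>k. step i x) (enc (xs i x))))"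
    unfolding step_def
    by (intro uc_intros assms uc_app3[OF assms(3)])
  then show ?thesis by (simp add: step len)
qed

lemma uc_rev [uc_intros]:
  fixes xs :: "'i \<Rightarrow> 'a::coded \<Rightarrow> 'b::coded list"
  assumes "uc xs"
  shows "uc (\<lambda>i x. rev (xs i x))"
proof -
  have "uc (\<lambda>i x. foldl (\<lambda>a y. y # a) [] (xs i x))"
    by (intro uc_intros assms)
  moreover have "foldl (\<lambda>a y. y # a) b ys = rev ys @ b" for b ys :: "'b list"
    by (induction ys arbitrary: b) auto
  ultimately show ?thesis by simp
qed

lemma uc_foldr [uc_intros]:
  assumes "uc (\<lambda>i z. f i (fst z) (fst (snd z)) (snd (snd z)))" "uc xs" "uc a"
  shows "uc (\<lambda>i x. foldr (f i x) (xs i x) (a i x))"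
  unfolding foldr_conv_foldl by (intro uc_intros uc_app3[OF assms(1)] assms)

lemma uc_append [uc_intros]:
  fixes xs ys :: "'i \<Rightarrow> 'a::coded \<Rightarrow> 'b::coded list"
  assumes "uc xs" "uc ys"
  shows "uc (\<lambda>i x. xs i x @ ys i x)"
proof -
  have "uc (\<lambda>i x. foldr (\<lambda>y a. y # a) (xs i x) (ys i x))"
    by (intro uc_intros assms)
  moreover have "foldr (\<lambda>y a. y # a) us vs = us @ vs" for us vs :: "'b list"
    by (induction us) auto
  ultimately show ?thesis by simp
qed

lemma uc_map [uc_intros]:
  fixes xs :: "'i \<Rightarrow> 'a::coded \<Rightarrow> 'b::coded list" and f :: "'i \<Rightarrow> 'a \<Rightarrow> 'b \<Rightarrow> 'c::coded"
  assumes "uc (\<lambda>i z. f i (fst z) (snd z))" "uc xs"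
  shows "uc (\<lambda>i x. map (f i x) (xs i x))"
proof -
  have "uc (\<lambda>i x. foldr (\<lambda>y a. f i x y # a) (xs i x) [])"
    by (intro uc_intros assms uc_app2[OF assms(1)])
  moreover have "foldr (\<lambda>y a. h y # a) us [] = map h us" for us and h :: "'b \<Rightarrow> 'c"
    by (induction us) auto
  ultimately show ?thesis by simp
qed

lemma uc_concat [uc_intros]:
  assumes "uc xs"
  shows "uc (\<lambda>i x. concat (xs i x))"
  unfolding concat_conv_foldr by (intro uc_intros assms)

lemma uc_filter [uc_intros]:
  fixes xs :: "'i \<Rightarrow> 'a::coded \<Rightarrow> 'b::coded list"
  assumes "uc (\<lambda>i z. P i (fst z) (snd z))" "uc xs"
  shows "uc (\<lambda>i x. filter (P i x) (xs i x))"
proof -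
  have "uc (\<lambda>i x. foldr (\<lambda>y a. if P i x y then y # a else a) (xs i x) [])"
    by (intro uc_intros assms uc_app2[OF assms(1)])
  moreover have "foldr (\<lambda>y a. if Q y then y # a else a) us [] = filter Q us" for Q and us :: "'b list"
    by (induction us) auto
  ultimately show ?thesis by simp
qed

lemma uc_Ball_set [uc_intros]:
  assumes "uc (\<lambda>i z. P i (fst z) (snd z))" "uc xs"
  shows "uc (\<lambda>i x. \<forall>y\<in>set (xs i x). P i x y)"
proof -
  have "uc (\<lambda>i x. filter (\<lambda>y. \<not> P i x y) (xs i x) = [])"
    by (intro uc_intros assms uc_app2[OF assms(1)])
  then show ?thesis by (simp add: filter_empty_conv)
qed

lemma uc_Bex_set [uc_intros]:
  assumes "uc (\<lambda>i z. P i (fst z) (snd z))" "uc xs"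
  shows "uc (\<lambda>i x. \<exists>y\<in>set (xs i x). P i x y)"
proof -
  have "uc (\<lambda>i x. \<not> (\<forall>y\<in>set (xs i x). \<not> P i x y))"
    by (intro uc_intros assms uc_app2[OF assms(1)])
  then show ?thesis by simp
qed

lemma uc_in_set [uc_intros]:
  assumes "uc f" "uc xs"
  shows "uc (\<lambda>i x. f i x \<in> set (xs i x))"
proof -
  have "uc (\<lambda>i x. \<exists>y\<in>set (xs i x). f i x = y)"
    by (intro uc_intros assms uc_compose[OF assms(1)])
  then show ?thesis by simp
qed

lemma uc_distinct [uc_intros]:
  fixes xs :: "'i \<Rightarrow> 'a::coded \<Rightarrow> 'b::coded list"
  assumes "uc xs"
  shows "uc (\<lambda>i x. distinct (xs i x))"
proof -
  have "uc (\<lambda>i x. snd (foldl (\<lambda>a y. (y # fst a, snd a \<and> y \<notin> set (fst a))) ([], True) (xs i x)))"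
    by (intro uc_intros assms)
  moreover have "snd (foldl (\<lambda>a y. (y # fst a, snd a \<and> y \<notin> set (fst a))) (us, b) vs)
      \<longleftrightarrow> b \<and> distinct vs \<and> set us \<inter> set vs = {}" for b and us vs :: "'b list"
    by (induction vs arbitrary: us b) auto
  ultimately show ?thesis by simp
qed

text \<open>The quotient is the least \<open>q\<close> with \<open>m < (q + 1) n\<close>. The
  disjunct for a zero divisor makes the search end at once with \<open>0\<close>, the conventional
  value.\<close>

lemma uc_div [uc_intros]:
  assumes "uc m" "uc n"
  shows "uc (\<lambda>i x. m i x div n i x :: nat)"
proof -
  have "uc (\<lambda>i x. LEAST q. n i x = 0 \<or> m i x < Suc q * n i x)"
  proof (rule uc_LEAST)
    show "uc (\<lambda>i y. n i (fst y) = 0 \<or> m i (fst y) < Suc (snd y) * n i (fst y))"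
      by (intro uc_intros uc_compose[OF assms(1)] uc_compose[OF assms(2)])
    show "\<exists>q. n i x = 0 \<or> m i x < Suc q * n i x" for i x
      by (metis dividend_less_times_div mult.commute mult_Suc_right neq0_conv)
  qed
  moreover have "(LEAST q. b = 0 \<or> a < Suc q * b) = a div b" for a b :: nat
  proof (rule Least_equality)
    show "b = 0 \<or> a < Suc (a div b) * b"
      by (metis dividend_less_times_div mult.commute mult_Suc_right neq0_conv)
    show "a div b \<le> q" if "b = 0 \<or> a < Suc q * b" for q
      using that less_mult_imp_div_less[of a "Suc q" b] by auto
  qed
  ultimately show ?thesis by simp
qed

lemma uc_mod [uc_intros]:
  assumes "uc m" "uc n"
  shows "uc (\<lambda>i x. m i x mod n i x :: nat)"
  unfolding minus_div_mult_eq_mod[symmetric] by (intro uc_intros assms)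

lemma uc_length [uc_intros]:
  fixes xs :: "'i \<Rightarrow> 'a::coded \<Rightarrow> 'b::coded list"
  assumes "uc xs"
  shows "uc (\<lambda>i x. length (xs i x))"
proof -
  have "uc (\<lambda>i x. foldl (\<lambda>a y. Suc a) 0 (xs i x))"
    by (intro uc_intros assms)
  moreover have "foldl (\<lambda>a y. Suc a) n us = n + length us" for n and us :: "'b list"
    by (induction us arbitrary: n) auto
  ultimately show ?thesis by simp
qed

lemma uc_sum_list [uc_intros]:
  fixes xs :: "'i \<Rightarrow> 'a::coded \<Rightarrow> nat list"
  assumes "uc xs"
  shows "uc (\<lambda>i x. sum_list (xs i x))"
proof -
  have "uc (\<lambda>i x. foldr (+) (xs i x) 0)"
    by (intro uc_intros assms)
  moreover have "foldr (+) us 0 = sum_list us" for us :: "nat list"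
    by (induction us) auto
  ultimately show ?thesis by simp
qed

lemma uc_upt [uc_intros]:
  fixes n :: "'i \<Rightarrow> 'a::coded \<Rightarrow> nat"
  assumes "uc n"
  shows "uc (\<lambda>i x. [0..<n i x])"
proof -
  have "uc (\<lambda>i x. rec_nat [] (\<lambda>k r. r @ [k]) (n i x))"
    by (intro uc_intros assms)
  moreover have "rec_nat [] (\<lambda>k r. r @ [k]) m = [0..<m]" for m
    by (induction m) auto
  ultimately show ?thesis by simp
qed

lemma uc_All_less [uc_intros]:
  fixes n :: "'i \<Rightarrow> 'a::coded \<Rightarrow> nat"
  assumes "uc (\<lambda>i z. P i (fst z) (snd z))" "uc n"
  shows "uc (\<lambda>i x. \<forall>k<n i x. P i x k)"
proof -
  have "uc (\<lambda>i x. \<forall>k\<in>set [0..<n i x]. P i x k)"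
    by (intro uc_intros assms uc_app2[OF assms(1)])
  then show ?thesis by (simp add: Ball_def)
qed

lemma uc_Ex_le [uc_intros]:
  fixes n :: "'i \<Rightarrow> 'a::coded \<Rightarrow> nat"
  assumes "uc (\<lambda>i z. P i (fst z) (snd z))" "uc n"
  shows "uc (\<lambda>i x. \<exists>k\<le>n i x. P i x k)"
proof -
  have "uc (\<lambda>i x. \<exists>k\<in>set [0..<Suc (n i x)]. P i x k)"
    by (intro uc_intros assms uc_app2[OF assms(1)])
  then show ?thesis by (simp add: Bex_def less_Suc_eq_le del: upt_Suc)
qed

lemma uc_drop [uc_intros]:
  fixes xs :: "'i \<Rightarrow> 'a::coded \<Rightarrow> 'b::coded list" and n :: "'i \<Rightarrow> 'a \<Rightarrow> nat"
  assumes "uc n" "uc xs"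
  shows "uc (\<lambda>i x. drop (n i x) (xs i x))"
proof -
  have "uc (\<lambda>i x. rec_nat (xs i x) (\<lambda>k r. tl r) (n i x))"
    by (intro uc_intros assms)
  moreover have "rec_nat ys (\<lambda>k r. tl r) m = drop m ys" for m and ys :: "'b list"
    by (induction m) (auto simp: drop_Suc tl_drop)
  ultimately show ?thesis by simp
qed

lemma uc_take [uc_intros]:
  fixes xs :: "'i \<Rightarrow> 'a::coded \<Rightarrow> 'b::coded list" and n :: "'i \<Rightarrow> 'a \<Rightarrow> nat"
  assumes "uc n" "uc xs"
  shows "uc (\<lambda>i x. take (n i x) (xs i x))"
proof -
  have "uc (\<lambda>i x. rev (drop (length (xs i x) - n i x) (rev (xs i x))))"
    by (intro uc_intros assms)
  then show ?thesis
    by (rule uc_cong) (metis rev_drop length_rev rev_rev_ident diff_diff_cancel nle_le diff_is_0_eq diff_zero take_all)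
qed

lemma uc_prefix [uc_intros]:
  fixes xs ys :: "'i \<Rightarrow> 'a::coded \<Rightarrow> 'b::coded list"
  assumes "uc xs" "uc ys"
  shows "uc (\<lambda>i x. prefix (xs i x) (ys i x))"
proof -
  have "uc (\<lambda>i x. take (length (xs i x)) (ys i x) = xs i x)"
    by (intro uc_intros assms)
  moreover have "take (length us) vs = us \<longleftrightarrow> prefix us vs" for us vs :: "'b list"
    by (metis append_eq_conv_conj prefix_def)
  ultimately show ?thesis by simp
qed

end

text \<open>The default \<open>0\<close> makes indexing total and hence computable on all
  inputs.\<close>

definition nth0 :: "nat list \<Rightarrow> nat \<Rightarrow> nat" where
  "nth0 xs n = (if n < length xs then xs ! n else 0)"

lemma nth0_eq [simp]: "n < length xs \<Longrightarrow> nth0 xs n = xs ! n"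
  by (simp add: nth0_def)

lemma (in uniform) uc_nth0 [uc_intros]:
  assumes "uc n" "uc xs"
  shows "uc (\<lambda>i x. nth0 (xs i x) (n i x))"
proof -
  have "uc (\<lambda>i x. case drop (n i x) (xs i x) of [] \<Rightarrow> 0 | y # ys \<Rightarrow> y)"
    by (intro uc_intros assms)
  moreover have "(case drop m ys of [] \<Rightarrow> 0 | z # zs \<Rightarrow> z) = nth0 ys m" for m ys
    by (cases "m < length ys") (simp_all add: nth0_def flip: Cons_nth_drop_Suc)
  ultimately show ?thesis by simp
qed

subsection \<open>Stage-bounded evaluation\<close>

text \<open>A family with one member and a constant parameter: \<open>plain.uc\<close> is ordinary
  computability of a total function.\<close>

interpretation plain: uniform "UNIV :: unit set" "\<lambda>_. 0" .

lemma plain_code: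
  assumes "plain.uc (\<lambda>_. f)"
  obtains c where "\<And>x. eval c (enc x) = Some (enc (f x))"
proof -
  obtain s where "\<forall>x. phi (s ()) (enc x) = Some (enc (f x))"
    using plain.uc_index[OF assms] by auto
  moreover obtain c where "code_index c = s ()"
    by (metis obtain_code)
  ultimately show ?thesis
    using that by (metis phi_code_index)
qed

lemma (in uniform) uc_plain:
  assumes "plain.uc (\<lambda>_. F)" "uc f"
  shows "uc (\<lambda>i x. F (f i x))"
  using plain_code[OF assms(1)] uc_eval[OF assms(2)] by metis

lemma plain_if_code:
  assumes "\<And>x. eval c (enc x) = Some (enc (f x))"
  shows "plain.uc (\<lambda>_. f)"
  using plain.uc_eval[OF plain.uc_id, of c "\<lambda>_. f"] assms by simp

text \<open>
  In the stage functions below the value \<open>0\<close> stands for an unfinished computation and \<open>Suc y\<close> for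
  the output \<open>y\<close>. The stage only bounds the unbounded searches.
\<close>

definition stage_pair :: "(nat \<times> nat \<Rightarrow> nat) \<Rightarrow> (nat \<times> nat \<Rightarrow> nat) \<Rightarrow> nat \<times> nat \<Rightarrow> nat" where
  "stage_pair F G y = (if F y = 0 \<or> G y = 0 then 0 else Suc (prod_encode (F y - 1, G y - 1)))"

definition stage_comp :: "(nat \<times> nat \<Rightarrow> nat) \<Rightarrow> (nat \<times> nat \<Rightarrow> nat) \<Rightarrow> nat \<times> nat \<Rightarrow> nat" where
  "stage_comp F G y = (if G y = 0 then 0 else F (fst y, G y - 1))"

definition stage_prec :: "(nat \<times> nat \<Rightarrow> nat) \<Rightarrow> (nat \<times> nat \<Rightarrow> nat) \<Rightarrow> nat \<times> nat \<Rightarrow> nat" where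
  "stage_prec F G y = rec_nat (F (fst y, fst (prod_decode (snd y))))
     (\<lambda>k r. if r = 0 then 0
        else G (fst y, prod_encode (fst (prod_decode (snd y)), prod_encode (k, r - 1))))
     (snd (prod_decode (snd y)))"

text \<open>In the encoding of outputs, \<open>1\<close> is the output \<open>0\<close> and values
  from \<open>2\<close> on are nonzero outputs. The disjunct with the stage ends the search; a zero
  counts only below the stage and only if all earlier candidates have finished with a nonzero
  output.\<close>

definition stage_min :: "(nat \<times> nat \<Rightarrow> nat) \<Rightarrow> nat \<times> nat \<Rightarrow> nat" where
  "stage_min F y =
     (if (LEAST m. F (fst y, prod_encode (snd y, m)) = 1 \<or> fst y \<le> m) < fst y \<and>
         (\<forall>k<(LEAST m. F (fst y, prod_encode (snd y, m)) = 1 \<or> fst y \<le> m).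
            2 \<le> F (fst y, prod_encode (snd y, k)))
      then Suc (LEAST m. F (fst y, prod_encode (snd y, m)) = 1 \<or> fst y \<le> m) else 0)"

primrec stage_eval :: "code \<Rightarrow> nat \<times> nat \<Rightarrow> nat" where
  "stage_eval Code_Zero = (\<lambda>y. Suc 0)"
| "stage_eval Code_Succ = (\<lambda>y. Suc (Suc (snd y)))"
| "stage_eval Code_Fst = (\<lambda>y. Suc (fst (prod_decode (snd y))))"
| "stage_eval Code_Snd = (\<lambda>y. Suc (snd (prod_decode (snd y))))"
| "stage_eval (Code_Pair c d) = stage_pair (stage_eval c) (stage_eval d)"
| "stage_eval (Code_Comp c d) = stage_comp (stage_eval c) (stage_eval d)"
| "stage_eval (Code_Prec c d) = stage_prec (stage_eval c) (stage_eval d)"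
| "stage_eval (Code_Min c) = stage_min (stage_eval c)"

lemma stage_prec_Pair:
  "stage_prec F G (s, x) = rec_nat (F (s, fst (prod_decode x)))
     (\<lambda>k r. if r = 0 then 0
        else G (s, prod_encode (fst (prod_decode x), prod_encode (k, r - 1))))
     (snd (prod_decode x))"
  by (simp only: stage_prec_def fst_conv snd_conv)

lemma stage_prec_encode:
  "stage_prec F G (s, prod_encode (a, n)) = rec_nat (F (s, a))
     (\<lambda>k r. if r = 0 then 0 else G (s, prod_encode (a, prod_encode (k, r - 1)))) n"
  by (simp only: stage_prec_def fst_conv snd_conv prod_encode_inverse)

lemma stage_min_iff:
  "stage_min F (s, x) = Suc m \<longleftrightarrow>
     m < s \<and> F (s, prod_encode (x, m)) = 1 \<and> (\<forall>k<m. 2 \<le> F (s, prod_encode (x, k)))"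
proof -
  define g where "g = (LEAST m. F (s, prod_encode (x, m)) = 1 \<or> s \<le> m)"
  have g: "F (s, prod_encode (x, g)) = 1 \<or> s \<le> g"
    unfolding g_def by (rule LeastI[of _ s]) simp
  have least: "g \<le> k" if "F (s, prod_encode (x, k)) = 1 \<or> s \<le> k" for k
    unfolding g_def by (rule Least_le) fact
  have st: "stage_min F (s, x) = (if g < s \<and> (\<forall>k<g. 2 \<le> F (s, prod_encode (x, k))) then Suc g else 0)"
    unfolding stage_min_def g_def by simp
  have "g = m" if "m < s" "F (s, prod_encode (x, m)) = 1" "\<forall>k<m. 2 \<le> F (s, prod_encode (x, k))"
    using g least[of m] that by (metis One_nat_def Suc_1 le_neq_implies_less le_trans not_less_eq_eq order.refl less_le_not_le)
  then show ?thesis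
    using g unfolding st by auto
qed

text \<open>The stage occurs only as the bound of searches. A search that succeeded has seen
  finished computations for all candidates up to its result, and by induction these keep their
  outputs at later stages.\<close>

lemma stage_eval_mono:
  "stage_eval c (s, x) = Suc y \<Longrightarrow> s \<le> s' \<Longrightarrow> stage_eval c (s', x) = Suc y"
proof (induction c arbitrary: x y)
  case (Code_Pair c d)
  then show ?case
    by (cases "stage_eval c (s, x)"; cases "stage_eval d (s, x)") (auto simp: stage_pair_def)
next
  case (Code_Comp c d)
  then show ?case
    by (cases "stage_eval d (s, x)") (auto simp: stage_comp_def)
next
  case (Code_Prec c d)
  let ?R = "\<lambda>s n. rec_nat (stage_eval c (s, fst (prod_decode x)))
     (\<lambda>k r. if r = 0 then 0
        else stage_eval d (s, prod_encode (fst (prod_decode x), prod_encode (k, r - 1)))) n"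
  have "?R s n = Suc y \<Longrightarrow> ?R s' n = Suc y" for n y
  proof (induction n arbitrary: y)
    case 0
    then show ?case using Code_Prec by simp
  next
    case (Suc n)
    then obtain v where v: "?R s n = Suc v" by (cases "?R s n") auto
    with Suc.IH have "?R s' n = Suc v" by blast
    with v Suc.prems Code_Prec.IH(2) Code_Prec.prems(2) show ?case by simp
  qed
  then show ?case using Code_Prec.prems(1) by (simp add: stage_prec_Pair)
next
  case (Code_Min c)
  have *: "2 \<le> stage_eval c (s', z)" if "2 \<le> stage_eval c (s, z)" for z
    using Code_Min.IH[of z "stage_eval c (s, z) - 1"] that Code_Min.prems(2) by simp
  show ?case
    using Code_Min.prems Code_Min.IH[of _ 0] * by (auto simp: stage_min_iff)
qed simp_all

lemma stage_eval_sound: "stage_eval c (s, x) = Suc y \<Longrightarrow> eval c x = Some y"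
proof (induction c arbitrary: x y)
  case (Code_Pair c d)
  then show ?case
    by (cases "stage_eval c (s, x)"; cases "stage_eval d (s, x)") (auto simp: stage_pair_def)
next
  case (Code_Comp c d)
  then show ?case
    by (cases "stage_eval d (s, x)") (auto simp: stage_comp_def)
next
  case (Code_Prec c d)
  let ?R = "\<lambda>n. rec_nat (stage_eval c (s, fst (prod_decode x)))
     (\<lambda>k r. if r = 0 then 0
        else stage_eval d (s, prod_encode (fst (prod_decode x), prod_encode (k, r - 1)))) n"
  let ?E = "\<lambda>n. rec_nat (eval c (fst (prod_decode x)))
       (\<lambda>k r. Option.bind r (\<lambda>v. eval d (prod_encode (fst (prod_decode x), prod_encode (k, v))))) n"
  have "?R n = Suc y \<Longrightarrow> ?E n = Some y" for n y
  proof (induction n arbitrary: y)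
    case 0
    then show ?case using Code_Prec by simp
  next
    case (Suc n)
    then obtain v where v: "?R n = Suc v" by (cases "?R n") auto
    with Suc.IH have "?E n = Some v" by blast
    with v Suc.prems Code_Prec.IH(2) show ?case by simp
  qed
  then show ?case using Code_Prec.prems by (simp add: stage_prec_Pair)
next
  case (Code_Min c)
  have min: "eval c (prod_encode (x, y)) = Some 0"
    using Code_Min.prems Code_Min.IH[of _ 0] by (auto simp: stage_min_iff)
  have "\<exists>v. eval c (prod_encode (x, k)) = Some (Suc v)" if "k < y" for k
  proof -
    have "2 \<le> stage_eval c (s, prod_encode (x, k))"
      using Code_Min.prems that by (auto simp: stage_min_iff)
    then have "stage_eval c (s, prod_encode (x, k)) = Suc (Suc (stage_eval c (s, prod_encode (x, k)) - 2))"
      by simp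
    then show ?thesis using Code_Min.IH by blast
  qed
  moreover from this have "(LEAST m. eval c (prod_encode (x, m)) = Some 0) = y"
    using min by (intro Least_equality) (simp, metis linorder_not_less option.inject old.nat.distinct(1))
  ultimately show ?case
    using min by auto
qed simp_all

lemma mono_bound:
  fixes m :: nat and P :: "nat \<Rightarrow> nat \<Rightarrow> bool"
  assumes "\<And>k. k < m \<Longrightarrow> \<exists>s. P k s" "\<And>k s s'. P k s \<Longrightarrow> s \<le> s' \<Longrightarrow> P k s'"
  obtains s where "\<And>k. k < m \<Longrightarrow> P k s"
proof -
  from assms(1) obtain f where f: "\<And>k. k < m \<Longrightarrow> P k (f k)" by metis
  have "P k (Max (f ` {..<m}))" if "k < m" for k
    using f[OF that] by (rule assms(2)) (use that in simp)
  then show ?thesis using that by blast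
qed

text \<open>A halting computation has finitely many subcomputations, each finished at some stage; by
  monotonicity their maximum serves for all. For a search the stage must also exceed its
  result.\<close>

lemma stage_eval_complete: "eval c x = Some y \<Longrightarrow> \<exists>s. stage_eval c (s, x) = Suc y"
proof (induction c arbitrary: x y)
  case (Code_Pair c d)
  then obtain a b where ab: "eval c x = Some a" "eval d x = Some b" "y = prod_encode (a, b)"
    by (auto simp: bind_eq_Some_conv)
  then obtain s t where "stage_eval c (s, x) = Suc a" "stage_eval d (t, x) = Suc b"
    using Code_Pair.IH by blast
  then have "stage_eval c (max s t, x) = Suc a" "stage_eval d (max s t, x) = Suc b"
    using stage_eval_mono max.cobounded1 max.cobounded2 by blast+
  with ab(3) show ?case by (auto simp: stage_pair_def intro!: exI[of _ "max s t"])
next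
  case (Code_Comp c d)
  then obtain a where a: "eval d x = Some a" "eval c a = Some y"
    by (auto simp: bind_eq_Some_conv)
  then obtain s t where "stage_eval d (s, x) = Suc a" "stage_eval c (t, a) = Suc y"
    using Code_Comp.IH by blast
  then have "stage_eval d (max s t, x) = Suc a" "stage_eval c (max s t, a) = Suc y"
    using stage_eval_mono max.cobounded1 max.cobounded2 by blast+
  then show ?case by (auto simp: stage_comp_def intro!: exI[of _ "max s t"])
next
  case (Code_Prec c d)
  let ?R = "\<lambda>s n. rec_nat (stage_eval c (s, fst (prod_decode x)))
     (\<lambda>k r. if r = 0 then 0
        else stage_eval d (s, prod_encode (fst (prod_decode x), prod_encode (k, r - 1)))) n"
  let ?E = "\<lambda>n. rec_nat (eval c (fst (prod_decode x)))
       (\<lambda>k r. Option.bind r (\<lambda>v. eval d (prod_encode (fst (prod_decode x), prod_encode (k, v))))) n"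
  have mono: "?R s' n = Suc y" if "?R s n = Suc y" "s \<le> s'" for s s' n y
    using stage_eval_mono[of "Code_Prec c d" s "prod_encode (fst (prod_decode x), n)" y s'] that
    by (simp add: stage_prec_encode)
  have "?E n = Some y \<Longrightarrow> \<exists>s. ?R s n = Suc y" for n y
  proof (induction n arbitrary: y)
    case 0
    then show ?case using Code_Prec by simp
  next
    case (Suc n)
    then obtain v where v: "?E n = Some v"
        "eval d (prod_encode (fst (prod_decode x), prod_encode (n, v))) = Some y"
      by (auto simp: bind_eq_Some_conv)
    then obtain s t where st: "?R s n = Suc v"
        "stage_eval d (t, prod_encode (fst (prod_decode x), prod_encode (n, v))) = Suc y"
      using Suc.IH Code_Prec.IH(2) by blast
    have "?R (max s t) n = Suc v"
      using st(1) by (rule mono) simp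
    moreover have "stage_eval d (max s t, prod_encode (fst (prod_decode x), prod_encode (n, v))) = Suc y"
      using st(2) by (rule stage_eval_mono) simp
    ultimately have "?R (max s t) (Suc n) = Suc y" by simp
    then show ?case by blast
  qed
  then show ?case using Code_Prec.prems by (simp add: stage_prec_Pair)
next
  case (Code_Min c)
  then obtain m where m: "eval c (prod_encode (x, m)) = Some 0"
      "\<forall>k<m. \<exists>v. eval c (prod_encode (x, k)) = Some (Suc v)"
    and y: "y = (LEAST m. eval c (prod_encode (x, m)) = Some 0)"
    by (auto split: if_splits)
  have "y = m"
    unfolding y using m by (intro Least_equality) (auto simp: not_less[symmetric])
  \<comment> \<open>Candidate \<open>k\<close> has finished at stage \<open>s\<close>, with output
    zero exactly if it is the result \<open>m\<close>.\<close>
  define Q where "Q k s \<longleftrightarrow> (\<exists>v. stage_eval c (s, prod_encode (x, k)) = Suc v \<and> (v = 0 \<longleftrightarrow> k = m))" for k s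
  have "\<exists>s. Q k s" if "k < Suc m" for k
    using that m Code_Min.IH unfolding Q_def less_Suc_eq
    by (metis nat.distinct(1) order_less_irrefl)
  moreover have "Q k s'" if "Q k s" "s \<le> s'" for k s s'
    using that stage_eval_mono unfolding Q_def by blast
  ultimately obtain s where s: "\<And>k. k < Suc m \<Longrightarrow> Q k s"
    using mono_bound[of "Suc m" Q] by metis
  have Q: "Q k (max s (Suc m))" if "k < Suc m" for k
    using s[OF that] stage_eval_mono unfolding Q_def by (meson max.cobounded1)
  have "stage_eval c (max s (Suc m), prod_encode (x, m)) = 1"
    using Q[of m] by (auto simp: Q_def)
  moreover have "2 \<le> stage_eval c (max s (Suc m), prod_encode (x, k))" if "k < m" for k
    using Q[of k] that by (auto simp: Q_def)
  ultimately have "stage_min (stage_eval c) (max s (Suc m), x) = Suc m"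
    unfolding stage_min_iff by auto
  then show ?case
    unfolding stage_eval.simps \<open>y = m\<close> by blast
qed simp_all

definition total_index :: "nat \<Rightarrow> (nat \<times> nat \<Rightarrow> nat) \<Rightarrow> bool" where
  "total_index a A \<longleftrightarrow> (\<forall>y. phi a (enc y) = Some (A y))"

text \<open>Turns a closure property of uniform families into a computable function on indices. The
  family consists of all pairs of total functions together with indices of them, and its parameter
  is the pair of indices.\<close>

lemma index_transform:
  assumes "\<And>(I :: (nat \<times> nat \<times> (nat \<times> nat \<Rightarrow> nat) \<times> (nat \<times> nat \<Rightarrow> nat)) set) par A B.
     uniform.uc I par A \<Longrightarrow> uniform.uc I par B \<Longrightarrow> uniform.uc I par (\<lambda>i. K (A i) (B i))"
  shows "\<exists>t. plain.uc (\<lambda>_. t) \<and> (\<forall>a b A B. total_index a A \<longrightarrow> total_index b B \<longrightarrow>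
    total_index (t (a, b)) (K A B))"
proof -
  define I where "I = {(a, b, A, B). total_index a A \<and> total_index b B}"
  define par where "par = (\<lambda>(a :: nat, b :: nat, A :: nat \<times> nat \<Rightarrow> nat, B :: nat \<times> nat \<Rightarrow> nat). prod_encode (a, b))"
  interpret uniform I par .
  have "upc (\<lambda>i. phi (fst (prod_decode (par i))))" "upc (\<lambda>i. phi (snd (prod_decode (par i))))"
    by (intro upc_phi par_intros)+
  then have "uc (\<lambda>(a, b, A, B). A)" "uc (\<lambda>(a, b, A, B). B)"
    by - (erule ucI; clarsimp simp: I_def par_def total_index_def)+
  from uc_index[OF assms[OF this]] obtain s where s: "par_computable s"
    "\<forall>i\<in>I. \<forall>x. phi (s i) (enc x) = Some (enc (K ((\<lambda>(a, b, A, B). A) i) ((\<lambda>(a, b, A, B). B) i) x))"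
    by blast
  then obtain c F where F: "\<forall>n. eval c n = Some (F n)" "\<forall>i\<in>I. s i = F (par i)"
    unfolding par_computable_def by blast
  show ?thesis
  proof (intro exI[of _ "\<lambda>y. F (enc y)"] conjI allI impI)
    show "plain.uc (\<lambda>_ y. F (enc y))"
      by (rule plain_if_code[of c]) (simp add: F(1))
    fix a b A B
    assume "total_index a A" "total_index b B"
    then have "(a, b, A, B) \<in> I" by (simp add: I_def)
    with s(2) F(2) show "total_index (F (enc (a, b))) (K A B)"
      by (force simp: total_index_def par_def)
  qed
qed

definition stage :: "nat \<Rightarrow> nat \<times> nat \<Rightarrow> nat" where
  "stage e = stage_eval (inv_into UNIV code_index e)"

lemma stage_iff: "phi e x = Some y \<longleftrightarrow> (\<exists>s. stage e (s, x) = Suc y)"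
  unfolding stage_def phi_def using stage_eval_sound stage_eval_complete by blast

text \<open>Course-of-values recursion: a subprogram has a smaller index than the program, so an
  index of \<open>stage e\<close> can be assembled from the indices found for smaller
  numbers.\<close>

lemma stage_index:
  obtains t where "plain.uc (\<lambda>_. t)" "\<And>e. total_index (t e) (stage e)"
proof -
  have "\<exists>t. plain.uc (\<lambda>_. t) \<and> (\<forall>a b A B. total_index a A \<longrightarrow> total_index b B \<longrightarrow>
    total_index (t (a, b)) (stage_pair A B))"
  proof (rule index_transform[of stage_pair])
    fix I :: "(nat \<times> nat \<times> (nat \<times> nat \<Rightarrow> nat) \<times> (nat \<times> nat \<Rightarrow> nat)) set" and par and A B :: "_ \<Rightarrow> nat \<times> nat \<Rightarrow> nat"
    interpret uniform I par .
    assume AB: "uc A" "uc B"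
    show "uc (\<lambda>i. stage_pair (A i) (B i))"
      unfolding stage_pair_def by (intro uc_intros AB)
  qed
  then obtain tp where tp: "plain.uc (\<lambda>_. tp)"
    "\<And>a b A B. total_index a A \<Longrightarrow> total_index b B \<Longrightarrow> total_index (tp (a, b)) (stage_pair A B)"
    by blast
  have "\<exists>t. plain.uc (\<lambda>_. t) \<and> (\<forall>a b A B. total_index a A \<longrightarrow> total_index b B \<longrightarrow>
    total_index (t (a, b)) (stage_comp A B))"
  proof (rule index_transform[of stage_comp])
    fix I :: "(nat \<times> nat \<times> (nat \<times> nat \<Rightarrow> nat) \<times> (nat \<times> nat \<Rightarrow> nat)) set" and par and A B :: "_ \<Rightarrow> nat \<times> nat \<Rightarrow> nat"
    interpret uniform I par .
    assume AB: "uc A" "uc B"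
    show "uc (\<lambda>i. stage_comp (A i) (B i))"
      unfolding stage_comp_def by (intro uc_intros AB uc_compose[OF AB(1)])
  qed
  then obtain tc where tc: "plain.uc (\<lambda>_. tc)"
    "\<And>a b A B. total_index a A \<Longrightarrow> total_index b B \<Longrightarrow> total_index (tc (a, b)) (stage_comp A B)"
    by blast
  have "\<exists>t. plain.uc (\<lambda>_. t) \<and> (\<forall>a b A B. total_index a A \<longrightarrow> total_index b B \<longrightarrow>
    total_index (t (a, b)) (stage_prec A B))"
  proof (rule index_transform[of stage_prec])
    fix I :: "(nat \<times> nat \<times> (nat \<times> nat \<Rightarrow> nat) \<times> (nat \<times> nat \<Rightarrow> nat)) set" and par and A B :: "_ \<Rightarrow> nat \<times> nat \<Rightarrow> nat"
    interpret uniform I par .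
    assume AB: "uc A" "uc B"
    show "uc (\<lambda>i. stage_prec (A i) (B i))"
      unfolding stage_prec_def
      by (intro uc_intros AB uc_compose[OF AB(1)] uc_compose[OF AB(2)])
  qed
  then obtain tr where tr: "plain.uc (\<lambda>_. tr)"
    "\<And>a b A B. total_index a A \<Longrightarrow> total_index b B \<Longrightarrow> total_index (tr (a, b)) (stage_prec A B)"
    by blast
  have "\<exists>t. plain.uc (\<lambda>_. t) \<and> (\<forall>a b A B. total_index a A \<longrightarrow> total_index b B \<longrightarrow>
    total_index (t (a, b)) (stage_min A))"
  proof (rule index_transform[of "\<lambda>A B. stage_min A"])
    fix I :: "(nat \<times> nat \<times> (nat \<times> nat \<Rightarrow> nat) \<times> (nat \<times> nat \<Rightarrow> nat)) set" and par and A B :: "_ \<Rightarrow> nat \<times> nat \<Rightarrow> nat"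
    interpret uniform I par .
    assume AB: "uc A" "uc B"
    have L: "uc (\<lambda>i y. LEAST m. A i (fst y, prod_encode (snd y, m)) = 1 \<or> fst y \<le> m)"
      by (rule uc_LEAST) (intro uc_intros uc_compose[OF AB(1)], auto)
    show "uc (\<lambda>i. stage_min (A i))"
      unfolding stage_min_def
      by (intro uc_intros L uc_compose[OF L] uc_compose[OF AB(1)])
  qed
  then obtain tm where tm: "plain.uc (\<lambda>_. tm)"
    "\<And>a b A B. total_index a A \<Longrightarrow> total_index b B \<Longrightarrow> total_index (tm (a, b)) (stage_min A)"
    by blast
  have ex: "\<exists>z. total_index z f" if "plain.uc (\<lambda>_. f)" for f
    using plain_code[OF that] unfolding total_index_def
    by (metis enc_nat_def phi_code_index)
  have "plain.uc (\<lambda>_. stage_eval Code_Zero)" "plain.uc (\<lambda>_. stage_eval Code_Succ)"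
    "plain.uc (\<lambda>_. stage_eval Code_Fst)" "plain.uc (\<lambda>_. stage_eval Code_Snd)"
    by (simp_all, (intro plain.uc_intros)+)
  from this[THEN ex] obtain z0 z1 z2 z3 where z: "total_index z0 (stage_eval Code_Zero)"
    "total_index z1 (stage_eval Code_Succ)" "total_index z2 (stage_eval Code_Fst)"
    "total_index z3 (stage_eval Code_Snd)"
    by (elim exE)
  \<comment> \<open>Inverts the numbering of programs: \<open>0\<close> to \<open>3\<close> are the
    basic ones, and from \<open>4\<close> on the remainder modulo \<open>4\<close> selects the
    constructor and the quotient holds its arguments. The list \<open>l\<close> contains the results
    for all smaller indices. Minimisation has one argument, which is passed twice.\<close>
  define step where "step k l =
    (if k = 0 then z0 else if k = 1 then z1 else if k = 2 then z2 else if k = 3 then z3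
     else if (k - 4) mod 4 = 0
       then tp (nth0 l (fst (prod_decode ((k - 4) div 4))), nth0 l (snd (prod_decode ((k - 4) div 4))))
     else if (k - 4) mod 4 = 1
       then tc (nth0 l (fst (prod_decode ((k - 4) div 4))), nth0 l (snd (prod_decode ((k - 4) div 4))))
     else if (k - 4) mod 4 = 2
       then tr (nth0 l (fst (prod_decode ((k - 4) div 4))), nth0 l (snd (prod_decode ((k - 4) div 4))))
     else tm (nth0 l ((k - 4) div 4), nth0 l ((k - 4) div 4)))" for k l
  define tab where "tab n = rec_nat [] (\<lambda>k l. l @ [step k l]) n" for n
  define t where "t n = nth0 (tab (Suc n)) n" for n
  have len: "length (tab n) = n" for n
    by (induction n) (auto simp: tab_def)
  have tab: "nth0 (tab n) k = t k" if "k < n" for n k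
    using that
  proof (induction n)
    case (Suc n)
    show ?case
    proof (cases "k = n")
      case False
      then have "nth0 (tab (Suc n)) k = nth0 (tab n) k"
        using Suc.prems len[of n] by (simp add: tab_def nth0_def nth_append)
      then show ?thesis using Suc False by simp
    qed (simp add: t_def)
  qed simp
  have t: "t n = step n (tab n)" for n
    using len[of n] by (simp add: t_def tab_def nth0_def nth_append)
  show ?thesis
  proof
    note plain_uc = plain.uc_plain[OF tp(1)] plain.uc_plain[OF tc(1)] plain.uc_plain[OF tr(1)] plain.uc_plain[OF tm(1)]
    have "plain.uc (\<lambda>_ y. nth0 (rec_nat [] (\<lambda>k l. l @ [step k l]) (Suc y)) y)"
      unfolding step_def
      by (intro plain.uc_intros plain_uc)
    then show "plain.uc (\<lambda>_. t)"
      by (simp add: t_def[abs_def] tab_def)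
  next
    have d4: "Suc (4 * m) div 4 = m" "Suc (Suc (4 * m)) div 4 = m" "Suc (Suc (Suc (4 * m))) div 4 = m"
      "(4 * m + 2) div 4 = m" "(4 * m + 3) div 4 = m"
      "Suc (4 * m) mod 4 = 1" "Suc (Suc (4 * m)) mod 4 = 2" "Suc (Suc (Suc (4 * m))) mod 4 = 3"
      "(4 * m + 2) mod 4 = 2" "(4 * m + 3) mod 4 = 3" for m :: nat
      by presburger+
    have ix: "total_index (t (code_index c)) (stage_eval c)" for c
    proof (induction c)
      case (Code_Pair c d)
      have "code_index c < code_index (Code_Pair c d)" "code_index d < code_index (Code_Pair c d)"
        using le_prod_encode_1[of "code_index c" "code_index d"] le_prod_encode_2[of "code_index d" "code_index c"] by simp_all
      then show ?case
        using tp(2)[OF Code_Pair.IH] by (simp add: t[of "code_index (Code_Pair c d)", simplified] step_def tab d4)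
    next
      case (Code_Comp c d)
      have "code_index c < code_index (Code_Comp c d)" "code_index d < code_index (Code_Comp c d)"
        using le_prod_encode_1[of "code_index c" "code_index d"] le_prod_encode_2[of "code_index d" "code_index c"] by simp_all
      then show ?case
        using tc(2)[OF Code_Comp.IH] by (simp add: t[of "code_index (Code_Comp c d)", simplified] step_def tab d4)
    next
      case (Code_Prec c d)
      have "code_index c < code_index (Code_Prec c d)" "code_index d < code_index (Code_Prec c d)"
        using le_prod_encode_1[of "code_index c" "code_index d"] le_prod_encode_2[of "code_index d" "code_index c"] by simp_all
      then show ?case
        using tr(2)[OF Code_Prec.IH] by (simp add: t[of "code_index (Code_Prec c d)", simplified] step_def tab d4)
    next
      case (Code_Min c)
      then show ?case
        using tm(2)[OF Code_Min.IH Code_Min.IH] by (simp add: t[of "code_index (Code_Min c)", simplified] step_def tab d4)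
    qed (use z in \<open>simp_all add: t step_def\<close>)
    show "total_index (t e) (stage e)" for e
      using ix[of "inv_into UNIV code_index e"] surj_f_inv_f[OF surj_code_index]
      by (simp add: stage_def)
  qed
qed

text \<open>Here the index of the simulated program may vary with the parameter. The result is a
  total family, so it may occur inside a search even if the program diverges.\<close>

lemma (in uniform) uc_stage:
  assumes "par_computable e"
  shows "uc (\<lambda>i. stage (e i))"
proof -
  obtain t where t: "plain.uc (\<lambda>_. t)" "\<And>e. total_index (t e) (stage e)"
    using stage_index by blast
  obtain c where "\<And>x. eval c x = Some (t x)"
    using plain_code[OF t(1)] by auto
  then have "par_computable (\<lambda>i. t (e i))"
    using assms by (rule par_computable_comp)
  from ucI[OF upc_phi[OF this], of "\<lambda>i. stage (e i)"] show ?thesis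
    using t(2) unfolding total_index_def by simp
qed

section \<open>Cosets in topological groups\<close>

context group
begin

text \<open>
  A nonempty set is a left coset iff it is a right coset iff it is closed under
  \<open>(x, y, z) \<mapsto> x y\<^sup>-\<^sup>1 z\<close>; it is then a right coset of \<open>A A\<^sup>-\<^sup>1\<close> and a left coset of \<open>A\<^sup>-\<^sup>1 A\<close>.
\<close>

definition is_coset :: "'a set \<Rightarrow> bool" where
  "is_coset A \<longleftrightarrow> A \<subseteq> carrier G \<and> A \<noteq> {} \<and> (\<forall>x\<in>A. \<forall>y\<in>A. \<forall>z\<in>A. x \<otimes> inv y \<otimes> z \<in> A)"

definition lgrp :: "'a set \<Rightarrow> 'a set" where
  "lgrp A = {x \<otimes> inv y |x y. x \<in> A \<and> y \<in> A}"

definition rgrp :: "'a set \<Rightarrow> 'a set" where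
  "rgrp A = {inv x \<otimes> y |x y. x \<in> A \<and> y \<in> A}"

lemma is_coset_subset: "is_coset A \<Longrightarrow> A \<subseteq> carrier G"
  by (simp add: is_coset_def)

lemma is_coset_closed: "is_coset A \<Longrightarrow> x \<in> A \<Longrightarrow> y \<in> A \<Longrightarrow> z \<in> A \<Longrightarrow> x \<otimes> inv y \<otimes> z \<in> A"
  by (simp add: is_coset_def)

lemma mult_inv_cancel:
  assumes "x \<in> carrier G" "y \<in> carrier G"
  shows "x \<otimes> (inv x \<otimes> y) = y" "inv x \<otimes> (x \<otimes> y) = y"
    "y \<otimes> x \<otimes> inv x = y" "y \<otimes> inv x \<otimes> x = y"
  using assms by (simp_all add: m_assoc[symmetric], simp_all add: m_assoc)

lemma rgrp_subgroup:
  assumes "is_coset A"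
  shows "subgroup (rgrp A) G"
proof (rule subgroupI)
  note [simp] = subsetD[OF is_coset_subset[OF assms]]
  obtain a where "a \<in> A" using assms by (auto simp: is_coset_def)
  then have "inv a \<otimes> a \<in> rgrp A" unfolding rgrp_def by blast
  then show "rgrp A \<subseteq> carrier G" "rgrp A \<noteq> {}"
    by (auto simp: rgrp_def)
  show "inv u \<in> rgrp A" if u: "u \<in> rgrp A" for u
  proof -
    obtain x y where "u = inv x \<otimes> y" "x \<in> A" "y \<in> A" using u by (auto simp: rgrp_def)
    then have "inv u = inv y \<otimes> x" by (simp add: inv_mult_group)
    with \<open>x \<in> A\<close> \<open>y \<in> A\<close> show ?thesis unfolding rgrp_def by blast
  qed
  show "u \<otimes> v \<in> rgrp A" if uv: "u \<in> rgrp A" "v \<in> rgrp A" for u v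
  proof -
    obtain x y z w where *: "u = inv x \<otimes> y" "x \<in> A" "y \<in> A" "v = inv z \<otimes> w" "z \<in> A" "w \<in> A"
      using uv by (auto simp: rgrp_def)
    then have "u \<otimes> v = inv x \<otimes> (y \<otimes> inv z \<otimes> w)" by (simp add: m_assoc)
    with * is_coset_closed[OF assms, of y z w] show ?thesis unfolding rgrp_def by blast
  qed
qed

lemma lgrp_subgroup:
  assumes "is_coset A"
  shows "subgroup (lgrp A) G"
proof (rule subgroupI)
  note [simp] = subsetD[OF is_coset_subset[OF assms]]
  obtain a where "a \<in> A" using assms by (auto simp: is_coset_def)
  then have "a \<otimes> inv a \<in> lgrp A" unfolding lgrp_def by blast
  then show "lgrp A \<subseteq> carrier G" "lgrp A \<noteq> {}"
    by (auto simp: lgrp_def)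
  show "inv u \<in> lgrp A" if u: "u \<in> lgrp A" for u
  proof -
    obtain x y where "u = x \<otimes> inv y" "x \<in> A" "y \<in> A" using u by (auto simp: lgrp_def)
    then have "inv u = y \<otimes> inv x" by (simp add: inv_mult_group)
    with \<open>x \<in> A\<close> \<open>y \<in> A\<close> show ?thesis unfolding lgrp_def by blast
  qed
  show "u \<otimes> v \<in> lgrp A" if uv: "u \<in> lgrp A" "v \<in> lgrp A" for u v
  proof -
    obtain x y z w where *: "u = x \<otimes> inv y" "x \<in> A" "y \<in> A" "v = z \<otimes> inv w" "z \<in> A" "w \<in> A"
      using uv by (auto simp: lgrp_def)
    then have "u \<otimes> v = (x \<otimes> inv y \<otimes> z) \<otimes> inv w" by (simp add: m_assoc)
    with * is_coset_closed[OF assms, of x y z] show ?thesis unfolding lgrp_def by blast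
  qed
qed

lemma is_coset_l_coset:
  assumes "is_coset A" "a \<in> A"
  shows "A = a <# rgrp A"
proof -
  note [simp] = subsetD[OF is_coset_subset[OF assms(1)]]
  have "x \<in> a <# rgrp A" if "x \<in> A" for x
  proof -
    have "x = a \<otimes> (inv a \<otimes> x)" using assms(2) that by (simp add: mult_inv_cancel)
    moreover have "inv a \<otimes> x \<in> rgrp A" using assms(2) that by (auto simp: rgrp_def)
    ultimately show ?thesis unfolding l_coset_def by blast
  qed
  moreover have "a \<otimes> (inv x \<otimes> y) \<in> A" if "x \<in> A" "y \<in> A" for x y
    using is_coset_closed[OF assms that] assms(2) that by (simp add: m_assoc)
  ultimately show ?thesis by (auto simp: l_coset_def rgrp_def)
qed

lemma is_coset_r_coset:
  assumes "is_coset A" "a \<in> A"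
  shows "A = lgrp A #> a"
proof -
  note [simp] = subsetD[OF is_coset_subset[OF assms(1)]]
  have "x \<in> lgrp A #> a" if "x \<in> A" for x
  proof -
    have "x = (x \<otimes> inv a) \<otimes> a" using assms(2) that by (simp add: mult_inv_cancel)
    moreover have "x \<otimes> inv a \<in> lgrp A" using assms(2) that by (auto simp: lgrp_def)
    ultimately show ?thesis unfolding r_coset_def by blast
  qed
  moreover have "(x \<otimes> inv y) \<otimes> a \<in> A" if "x \<in> A" "y \<in> A" for x y
    using is_coset_closed[OF assms(1) that assms(2)] .
  ultimately show ?thesis by (auto simp: r_coset_def lgrp_def)
qed

lemma lcosets_is_coset:
  assumes "subgroup V G" "A \<in> lcosets V"
  shows "is_coset A" "rgrp A = V"
proof -
  obtain a where a: "a \<in> carrier G" "A = a <# V"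
    using assms(2) by (auto simp: LCOSETS_def)
  note [simp] = subgroup.mem_carrier[OF assms(1)] a(1)
  have eq: "a \<otimes> u \<otimes> inv (a \<otimes> v) \<otimes> (a \<otimes> w) = a \<otimes> (u \<otimes> inv v \<otimes> w)"
    if "u \<in> V" "v \<in> V" "w \<in> V" for u v w
    using that by (simp add: inv_mult_group m_assoc mult_inv_cancel)
  have "u \<otimes> inv v \<otimes> w \<in> V" if "u \<in> V" "v \<in> V" "w \<in> V" for u v w
    using that assms(1) by (simp add: subgroup.m_closed subgroup.m_inv_closed)
  with eq show "is_coset A"
    unfolding a(2) is_coset_def l_coset_def using subgroup.one_closed[OF assms(1)] by auto
  have "inv (a \<otimes> u) \<otimes> (a \<otimes> v) = inv u \<otimes> v" if "u \<in> V" "v \<in> V" for u v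
    using that by (simp add: inv_mult_group m_assoc mult_inv_cancel)
  then have "rgrp A \<subseteq> V"
    using assms(1) by (auto simp: rgrp_def a(2) l_coset_def subgroup.m_closed subgroup.m_inv_closed)
  moreover have "v \<in> rgrp A" if "v \<in> V" for v
  proof -
    have "v = inv (a \<otimes> \<one>) \<otimes> (a \<otimes> v)" using that by (simp add: mult_inv_cancel)
    moreover have "a \<otimes> \<one> \<in> A" "a \<otimes> v \<in> A"
      using that subgroup.one_closed[OF assms(1)] by (auto simp: a(2) l_coset_def)
    ultimately show ?thesis unfolding rgrp_def by blast
  qed
  ultimately show "rgrp A = V" by blast
qed

lemma rcosets_is_coset:
  assumes "subgroup V G" "A \<in> rcosets V"
  shows "is_coset A" "lgrp A = V"
proof -
  obtain a where a: "a \<in> carrier G" "A = V #> a"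
    using assms(2) by (auto simp: RCOSETS_def)
  note [simp] = subgroup.mem_carrier[OF assms(1)] a(1)
  have eq: "u \<otimes> a \<otimes> inv (v \<otimes> a) \<otimes> (w \<otimes> a) = u \<otimes> inv v \<otimes> w \<otimes> a"
    if "u \<in> V" "v \<in> V" "w \<in> V" for u v w
    using that by (simp add: inv_mult_group m_assoc mult_inv_cancel)
  have "u \<otimes> inv v \<otimes> w \<in> V" if "u \<in> V" "v \<in> V" "w \<in> V" for u v w
    using that assms(1) by (simp add: subgroup.m_closed subgroup.m_inv_closed)
  with eq show "is_coset A"
    unfolding a(2) is_coset_def r_coset_def using subgroup.one_closed[OF assms(1)] by auto
  have "u \<otimes> a \<otimes> inv (v \<otimes> a) = u \<otimes> inv v" if "u \<in> V" "v \<in> V" for u v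
    using that by (simp add: inv_mult_group m_assoc mult_inv_cancel)
  then have "lgrp A \<subseteq> V"
    using assms(1) by (auto simp: lgrp_def a(2) r_coset_def subgroup.m_closed subgroup.m_inv_closed)
  moreover have "v \<in> lgrp A" if "v \<in> V" for v
  proof -
    have "v = (v \<otimes> a) \<otimes> inv (\<one> \<otimes> a)" using that by (simp add: mult_inv_cancel)
    moreover have "\<one> \<otimes> a \<in> A" "v \<otimes> a \<in> A"
      using that subgroup.one_closed[OF assms(1)] unfolding a(2) r_coset_def by blast+
    ultimately show ?thesis unfolding lgrp_def by blast
  qed
  ultimately show "lgrp A = V" by blast
qed

lemma is_coset_lcosets: "is_coset A \<Longrightarrow> A \<in> lcosets (rgrp A)"
  using is_coset_l_coset is_coset_subset unfolding is_coset_def LCOSETS_def by blast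

lemma is_coset_rcosets: "is_coset A \<Longrightarrow> A \<in> rcosets (lgrp A)"
  using is_coset_r_coset is_coset_subset unfolding is_coset_def RCOSETS_def by blast

lemma is_coset_iff:
  "is_coset A \<longleftrightarrow> (\<exists>V. subgroup V G \<and> (A \<in> lcosets V \<or> A \<in> rcosets V))"
  using lcosets_is_coset(1) rcosets_is_coset(1) rgrp_subgroup is_coset_lcosets by blast

lemma set_inv_set_inv: "A \<subseteq> carrier G \<Longrightarrow> set_inv (set_inv A) = A"
  by (force simp: SET_INV_def)

lemma lgrp_set_inv: "A \<subseteq> carrier G \<Longrightarrow> lgrp (set_inv A) = rgrp A"
  unfolding lgrp_def rgrp_def SET_INV_def by (force simp: subset_iff)

lemma rgrp_set_inv: "A \<subseteq> carrier G \<Longrightarrow> rgrp (set_inv A) = lgrp A"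
  unfolding lgrp_def rgrp_def SET_INV_def by (force simp: subset_iff)

lemma is_coset_set_inv:
  assumes "is_coset A"
  shows "is_coset (set_inv A)"
proof -
  note [simp] = subsetD[OF is_coset_subset[OF assms]]
  have "inv x \<otimes> inv (inv y) \<otimes> inv z = inv (z \<otimes> inv y \<otimes> x)" if "x \<in> A" "y \<in> A" "z \<in> A" for x y z
    using that by (simp add: inv_mult_group m_assoc)
  then have "inv x \<otimes> inv (inv y) \<otimes> inv z \<in> set_inv A" if "x \<in> A" "y \<in> A" "z \<in> A" for x y z
    using that is_coset_closed[OF assms] by (auto simp: SET_INV_def)
  then have "\<forall>x\<in>set_inv A. \<forall>y\<in>set_inv A. \<forall>z\<in>set_inv A. x \<otimes> inv y \<otimes> z \<in> set_inv A"
    unfolding SET_INV_def by blast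
  moreover have "set_inv A \<subseteq> carrier G" "set_inv A \<noteq> {}"
    using assms by (auto simp: is_coset_def SET_INV_def)
  ultimately show ?thesis unfolding is_coset_def by blast
qed

lemma is_coset_Int: "is_coset A \<Longrightarrow> is_coset B \<Longrightarrow> A \<inter> B \<noteq> {} \<Longrightarrow> is_coset (A \<inter> B)"
  unfolding is_coset_def by blast

lemma subgroup_is_coset:
  assumes "subgroup V G"
  shows "is_coset V" "lgrp V = V" "rgrp V = V"
proof -
  have "V = \<one> <# V" "V = V #> \<one>"
    using subgroup.subset[OF assms] by (simp_all add: lcos_mult_one coset_mult_one)
  then have "V \<in> lcosets V" "V \<in> rcosets V"
    unfolding LCOSETS_def RCOSETS_def by auto
  then show "is_coset V" "lgrp V = V" "rgrp V = V"
    using lcosets_is_coset rcosets_is_coset assms by blast+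
qed

text \<open>For \<open>x\<close> in \<open>A\<close> the quotient \<open>inv a \<otimes> x\<close>
  lies in \<open>rgrp A\<close>, which equals \<open>lgrp B\<close> and hence maps \<open>B\<close>
  into itself. All left translates of \<open>B\<close> by elements of \<open>A\<close> thus
  coincide.\<close>

lemma set_mult_coset:
  assumes "is_coset A" "is_coset B" "rgrp A = lgrp B" "a \<in> A"
  shows "A <#> B = a <# B"
proof -
  note [simp] = subsetD[OF is_coset_subset[OF assms(1)]] subsetD[OF is_coset_subset[OF assms(2)]]
  have "x \<otimes> b \<in> a <# B" if "x \<in> A" "b \<in> B" for x b
  proof -
    have "inv a \<otimes> x \<in> lgrp B" using assms(3,4) that by (auto simp: rgrp_def)
    then obtain y z where yz: "inv a \<otimes> x = y \<otimes> inv z" "y \<in> B" "z \<in> B"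
      by (auto simp: lgrp_def)
    have "x \<otimes> b = a \<otimes> (inv a \<otimes> x \<otimes> b)"
      using assms(4) that by (simp add: m_assoc mult_inv_cancel)
    also have "\<dots> = a \<otimes> (y \<otimes> inv z \<otimes> b)" by (simp add: yz)
    finally show ?thesis
      using is_coset_closed[OF assms(2) yz(2,3) that(2)] unfolding l_coset_def by blast
  qed
  then show ?thesis
    using assms(4) unfolding set_mult_def l_coset_def by blast
qed

lemma is_coset_translate:
  assumes "is_coset B" "a \<in> carrier G"
  shows "is_coset (a <# B)" "rgrp (a <# B) = rgrp B"
proof -
  obtain b where "b \<in> B" using assms(1) by (auto simp: is_coset_def)
  then have "b \<in> carrier G" "B = b <# rgrp B"
    using assms is_coset_l_coset is_coset_subset by blast+
  then have "a <# B = (a \<otimes> b) <# rgrp B"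
    using lcos_m_assoc[of "rgrp B" a b] assms(2) subgroup.subset[OF rgrp_subgroup[OF assms(1)]] by simp
  then have "a <# B \<in> lcosets (rgrp B)"
    using assms(2) \<open>b \<in> carrier G\<close> by (auto simp: LCOSETS_def)
  then show "is_coset (a <# B)" "rgrp (a <# B) = rgrp B"
    using lcosets_is_coset[OF rgrp_subgroup[OF assms(1)]] by auto
qed

lemma is_coset_set_mult:
  assumes "is_coset A" "is_coset B" "rgrp A = lgrp B"
  shows "is_coset (A <#> B)" "rgrp (A <#> B) = rgrp B"
proof -
  obtain a where "a \<in> A" using assms(1) by (auto simp: is_coset_def)
  moreover from this have "a \<in> carrier G" using assms(1) is_coset_subset by blast
  ultimately show "is_coset (A <#> B)" "rgrp (A <#> B) = rgrp B"
    using set_mult_coset[OF assms] is_coset_translate[OF assms(2)] by simp_all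
qed

text \<open>Both inclusions become conditions of the form \<open>X Y \<subseteq> Z\<close>.\<close>

lemma set_mult_eq_iff:
  assumes "is_coset A" "is_coset B" "rgrp A = lgrp B" "C \<subseteq> carrier G"
  shows "C = A <#> B \<longleftrightarrow> (\<forall>x\<in>A. \<forall>y\<in>B. x \<otimes> y \<in> C) \<and> (\<forall>x\<in>A. \<forall>z\<in>C. inv x \<otimes> z \<in> B)"
proof -
  note [simp] = subsetD[OF is_coset_subset[OF assms(1)]] subsetD[OF is_coset_subset[OF assms(2)]]
    subsetD[OF assms(4)]
  have "inv x \<otimes> z \<in> B" if C: "C = A <#> B" and "x \<in> A" "z \<in> C" for x z
  proof -
    have "z \<in> x <# B" using set_mult_coset[OF assms(1-3) that(2)] C that(3) by simp
    then obtain b where "z = x \<otimes> b" "b \<in> B"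
      by (auto simp: l_coset_def)
    with that show ?thesis by (simp add: mult_inv_cancel)
  qed
  moreover have "C \<subseteq> A <#> B" if "\<forall>x\<in>A. \<forall>z\<in>C. inv x \<otimes> z \<in> B"
  proof
    fix z assume "z \<in> C"
    obtain a where "a \<in> A" using assms(1) by (auto simp: is_coset_def)
    then have "z = a \<otimes> (inv a \<otimes> z)" "inv a \<otimes> z \<in> B"
      using \<open>z \<in> C\<close> that by (simp_all add: mult_inv_cancel)
    with \<open>a \<in> A\<close> show "z \<in> A <#> B" unfolding set_mult_def by blast
  qed
  ultimately show ?thesis
    unfolding set_mult_def by blast
qed

text \<open>If \<open>a\<close> and \<open>a \<otimes> a\<close> are in \<open>A\<close>, then
  \<open>a = inv a \<otimes> (a \<otimes> a)\<close> is in \<open>rgrp A\<close>, so the left coset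
  \<open>A\<close> of \<open>rgrp A\<close> meets this subgroup and equals it. This is how subgroups
  are recognised inside the meet groupoid.\<close>

lemma idempotent_coset:
  assumes "is_coset A" "rgrp A = lgrp A" "A <#> A = A"
  shows "subgroup A G"
proof -
  obtain a where a: "a \<in> A" using assms(1) by (auto simp: is_coset_def)
  note [simp] = subsetD[OF is_coset_subset[OF assms(1)]]
  have "a \<otimes> a \<in> A" using a assms(3) unfolding set_mult_def by blast
  with a have "inv a \<otimes> (a \<otimes> a) \<in> rgrp A" unfolding rgrp_def by blast
  then have "a \<in> rgrp A" using a by (simp add: mult_inv_cancel)
  then have "a <# rgrp A = rgrp A"
    using rgrp_subgroup[OF assms(1)] a by (simp add: coset_join3)
  then show ?thesis
    using is_coset_l_coset[OF assms(1) a] rgrp_subgroup[OF assms(1)] by simp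
qed

lemma subgroup_set_mult_self:
  assumes "subgroup V G"
  shows "V <#> V = V"
  using set_mult_coset[of V V \<one>] subgroup_is_coset[OF assms] subgroup.one_closed[OF assms]
    subgroup.subset[OF assms] lcos_mult_one by simp

text \<open>Describes the cosets counted by \<open>group_index\<close> without a representative;
  each of the conditions can be decided on codes.\<close>

lemma subgroup_Int_rcosets:
  assumes "subgroup U G" "subgroup W G" "W \<subseteq> U"
  shows "A \<in> rcosets\<^bsub>G\<lparr>carrier := U\<rparr>\<^esub> W \<longleftrightarrow> is_coset A \<and> A \<subseteq> U \<and> lgrp A = W"
proof
  assume "A \<in> rcosets\<^bsub>G\<lparr>carrier := U\<rparr>\<^esub> W"
  then obtain a where a: "a \<in> U" "A = W #> a"
    by (auto simp: RCOSETS_def r_coset_def)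
  then have "A \<in> rcosets W"
    using subgroup.mem_carrier[OF assms(1)] by (auto simp: RCOSETS_def)
  moreover have "A \<subseteq> U"
    using a assms(1,3) by (auto simp: r_coset_def subgroup.m_closed)
  ultimately show "is_coset A \<and> A \<subseteq> U \<and> lgrp A = W"
    using rcosets_is_coset[OF assms(2)] by auto
next
  assume A: "is_coset A \<and> A \<subseteq> U \<and> lgrp A = W"
  then obtain a where "a \<in> A" by (auto simp: is_coset_def)
  with A is_coset_r_coset have "A = W #> a" "a \<in> U" by auto
  then show "A \<in> rcosets\<^bsub>G\<lparr>carrier := U\<rparr>\<^esub> W"
    by (auto simp: RCOSETS_def r_coset_def)
qed

lemma r_coset_in_rcosets:
  assumes "subgroup U G" "subgroup W G" "a \<in> U"
  shows "W #> a \<in> rcosets\<^bsub>G\<lparr>carrier := U\<rparr>\<^esub> W" "a \<in> W #> a"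
proof -
  show "W #> a \<in> rcosets\<^bsub>G\<lparr>carrier := U\<rparr>\<^esub> W"
    unfolding RCOSETS_def r_coset_def by (rule UN_I[of a]) (use assms(3) in simp_all)
  show "a \<in> W #> a"
    by (rule rcos_self[OF subgroup.mem_carrier[OF assms(1,3)] assms(2)])
qed

end

section \<open>Compact open cosets in topological groups\<close>

locale top_group = group G for G :: "('a, 'b) monoid_scheme" (structure) +
  fixes X :: "'a topology"
  assumes topspace_eq: "topspace X = carrier G"
    and mult_cont: "continuous_map (prod_topology X X) X (\<lambda>(x, y). x \<otimes> y)"
    and inv_cont: "continuous_map X X (\<lambda>x. inv x)"

lemma top_groupI: "topological_group G X \<Longrightarrow> top_group G X"
  by (simp add: topological_group_def top_group_def top_group_axioms_def)

context top_group
begin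

lemma l_translation_cont:
  assumes "a \<in> carrier G"
  shows "continuous_map X X (\<lambda>x. a \<otimes> x)"
proof -
  have "continuous_map X (prod_topology X X) (\<lambda>x. (a, x))"
    using assms by (simp add: continuous_map_pairwise comp_def topspace_eq)
  from continuous_map_compose[OF this mult_cont] show ?thesis
    by (simp add: comp_def)
qed

lemma r_translation_cont:
  assumes "a \<in> carrier G"
  shows "continuous_map X X (\<lambda>x. x \<otimes> a)"
proof -
  have "continuous_map X (prod_topology X X) (\<lambda>x. (x, a))"
    using assms by (simp add: continuous_map_pairwise comp_def topspace_eq)
  from continuous_map_compose[OF this mult_cont] show ?thesis
    by (simp add: comp_def)
qed

lemma l_translation_homeo:
  assumes "a \<in> carrier G"
  shows "homeomorphic_map X X (\<lambda>x. a \<otimes> x)"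
proof (rule homeomorphic_maps_imp_map)
  show "homeomorphic_maps X X (\<lambda>x. a \<otimes> x) (\<lambda>x. inv a \<otimes> x)"
    using assms by (auto simp: homeomorphic_maps_def l_translation_cont topspace_eq mult_inv_cancel)
qed

lemma r_translation_homeo:
  assumes "a \<in> carrier G"
  shows "homeomorphic_map X X (\<lambda>x. x \<otimes> a)"
proof (rule homeomorphic_maps_imp_map)
  show "homeomorphic_maps X X (\<lambda>x. x \<otimes> a) (\<lambda>x. x \<otimes> inv a)"
    using assms by (auto simp: homeomorphic_maps_def r_translation_cont topspace_eq mult_inv_cancel)
qed

lemma inv_homeo: "homeomorphic_map X X (\<lambda>x. inv x)"
proof (rule homeomorphic_maps_imp_map)
  show "homeomorphic_maps X X (\<lambda>x. inv x) (\<lambda>x. inv x)"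
    by (auto simp: homeomorphic_maps_def inv_cont topspace_eq)
qed

definition compact_open :: "'a set \<Rightarrow> bool" where
  "compact_open A \<longleftrightarrow> openin X A \<and> compactin X A"

lemma compact_open_image:
  "homeomorphic_map X X f \<Longrightarrow> compact_open A \<Longrightarrow> compact_open (f ` A)"
  unfolding compact_open_def
  using homeomorphic_imp_open_map homeomorphic_imp_continuous_map image_compactin
  by (metis open_map_def)

lemma compact_open_l_coset: "a \<in> carrier G \<Longrightarrow> compact_open A \<Longrightarrow> compact_open (a <# A)"
  using compact_open_image[OF l_translation_homeo] by (simp add: l_coset_def UNION_singleton_eq_range)

lemma compact_open_r_coset: "a \<in> carrier G \<Longrightarrow> compact_open A \<Longrightarrow> compact_open (A #> a)"
  using compact_open_image[OF r_translation_homeo] by (simp add: r_coset_def UNION_singleton_eq_range)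

lemma compact_open_set_inv: "compact_open A \<Longrightarrow> compact_open (set_inv A)"
  using compact_open_image[OF inv_homeo] by (simp add: SET_INV_def UNION_singleton_eq_range)

lemma compact_open_coset_iff: "compact_open_coset G X A \<longleftrightarrow> compact_open A \<and> is_coset A"
  unfolding compact_open_coset_def is_coset_iff compact_open_def by blast

text \<open>\<open>rgrp A\<close> is the translate of \<open>A\<close> by the inverse of any of its
  elements.\<close>

lemma compact_open_rgrp:
  assumes "compact_open A" "is_coset A"
  shows "compact_open (rgrp A)"
proof -
  obtain a where a: "a \<in> A" "a \<in> carrier G" using assms(2) by (auto simp: is_coset_def)
  have "inv a <# A = inv a <# (a <# rgrp A)"
    using is_coset_l_coset[OF assms(2) a(1)] by simp
  also have "\<dots> = rgrp A"
    using a subgroup.subset[OF rgrp_subgroup[OF assms(2)]] by (simp add: lcos_m_assoc lcos_mult_one)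
  finally show ?thesis using compact_open_l_coset[of "inv a" A] assms(1) a by simp
qed

lemma compact_open_lgrp:
  assumes "compact_open A" "is_coset A"
  shows "compact_open (lgrp A)"
  using compact_open_rgrp[OF compact_open_set_inv is_coset_set_inv] assms rgrp_set_inv
  by (simp add: is_coset_subset)

lemma compact_open_subset: "compact_open A \<Longrightarrow> A \<subseteq> carrier G"
  using openin_subset[of X A] by (simp add: compact_open_def topspace_eq)

abbreviation mg :: "'a set meet_groupoid" where
  "mg \<equiv> meet_groupoid_of G X"

lemma mg_dom_iff: "A \<in> mg_dom mg \<longleftrightarrow> A = {} \<or> compact_open A \<and> is_coset A"
  by (simp add: meet_groupoid_of_def compact_open_coset_iff)

text \<open>The subgroup in the definition of the product is forced: it is both the right group of
  \<open>A\<close> and the left group of \<open>B\<close>. This removes the quantifier over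
  subgroups.\<close>

lemma mg_prod_iff:
  assumes "A \<in> mg_dom mg" "B \<in> mg_dom mg"
  shows "mg_prod mg A B =
    (if A \<noteq> {} \<and> B \<noteq> {} \<and> rgrp A = lgrp B then Some (A <#> B) else None)"
proof -
  have "(\<exists>V. compact_open_subgroup G X V \<and> A \<in> lcosets V \<and> B \<in> rcosets V) \<longleftrightarrow>
      A \<noteq> {} \<and> B \<noteq> {} \<and> rgrp A = lgrp B" (is "?L \<longleftrightarrow> ?R")
  proof
    assume ?L
    then obtain V where "subgroup V G" "A \<in> lcosets V" "B \<in> rcosets V"
      by (auto simp: compact_open_subgroup_def)
    then have "is_coset A" "rgrp A = V" "is_coset B" "lgrp B = V"
      using lcosets_is_coset rcosets_is_coset by blast+
    then show ?R by (auto simp: is_coset_def)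
  next
    assume R: ?R
    then have AB: "is_coset A" "is_coset B" "compact_open A"
      using assms by (auto simp: mg_dom_iff)
    then have "compact_open_subgroup G X (rgrp A)"
      using rgrp_subgroup compact_open_rgrp by (auto simp: compact_open_subgroup_def compact_open_def)
    moreover have "A \<in> lcosets (rgrp A)" "B \<in> rcosets (rgrp A)"
      using is_coset_lcosets[OF AB(1)] is_coset_rcosets[OF AB(2)] R by simp_all
    ultimately show ?L by blast
  qed
  then show ?thesis by (simp add: meet_groupoid_of_def)
qed

lemma mg_inv_closed: "A \<in> mg_dom mg \<Longrightarrow> set_inv A \<in> mg_dom mg"
  using compact_open_set_inv is_coset_set_inv by (auto simp: mg_dom_iff SET_INV_def)

lemma mg_meet_closed:
  assumes "A \<in> mg_dom mg" "B \<in> mg_dom mg" "Hausdorff_space X"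
  shows "A \<inter> B \<in> mg_dom mg"
  using assms is_coset_Int compactin_Int by (auto simp: mg_dom_iff compact_open_def openin_Int)

lemma mg_prod_closed:
  assumes "A \<in> mg_dom mg" "B \<in> mg_dom mg" "mg_prod mg A B = Some C"
  shows "C \<in> mg_dom mg"
proof -
  have AB: "A \<noteq> {}" "B \<noteq> {}" "rgrp A = lgrp B" and C: "C = A <#> B"
    using assms(3) mg_prod_iff[OF assms(1,2)] by (auto split: if_splits)
  then have AB': "is_coset A" "is_coset B" "compact_open B"
    using assms by (auto simp: mg_dom_iff)
  then obtain a where "a \<in> A" "a \<in> carrier G" by (auto simp: is_coset_def)
  then have "compact_open (A <#> B)"
    using set_mult_coset[OF AB'(1,2) AB(3)] compact_open_l_coset[OF _ AB'(3)] by simp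
  then show ?thesis
    using is_coset_set_mult(1)[OF AB'(1,2) AB(3)] by (simp add: mg_dom_iff C)
qed

lemma mg_idempotent_iff:
  assumes "A \<in> mg_dom mg"
  shows "mg_prod mg A A = Some A \<longleftrightarrow> subgroup A G"
proof
  assume "mg_prod mg A A = Some A"
  then show "subgroup A G"
    using assms idempotent_coset[of A] unfolding mg_prod_iff[OF assms assms] mg_dom_iff
    by (metis option.distinct(1) option.inject)
next
  assume "subgroup A G"
  then show "mg_prod mg A A = Some A"
    using subgroup_is_coset[of A] subgroup_set_mult_self[of A] is_coset_def[of A]
    unfolding mg_prod_iff[OF assms assms] by simp
qed

text \<open>The cosets of the open subgroup \<open>W\<close> form an open cover of the compact set
  \<open>U\<close>. Cosets with a common point are equal, so a finite subcover already contains
  every one of them.\<close>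

lemma finite_rcosets:
  assumes "subgroup U G" "compact_open U" "subgroup W G" "compact_open W" "W \<subseteq> U"
  shows "finite (rcosets\<^bsub>G\<lparr>carrier := U\<rparr>\<^esub> W)"
proof -
  let ?R = "rcosets\<^bsub>G\<lparr>carrier := U\<rparr>\<^esub> W"
  have R: "A \<in> ?R \<longleftrightarrow> is_coset A \<and> A \<subseteq> U \<and> lgrp A = W" for A
    by (rule subgroup_Int_rcosets[OF assms(1,3,5)])
  have coset: "W #> a \<in> ?R" "a \<in> W #> a" if "a \<in> U" for a
    using r_coset_in_rcosets[OF assms(1,3) that] by blast+
  have "openin X A" if "A \<in> ?R" for A
    using that compact_open_r_coset[OF _ assms(4)] subgroup.mem_carrier[OF assms(1)]
    by (auto simp: RCOSETS_def r_coset_def compact_open_def)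
  moreover have "U \<subseteq> \<Union> ?R" using coset by blast
  ultimately obtain F where F: "finite F" "F \<subseteq> ?R" "U \<subseteq> \<Union> F"
    using assms(2) unfolding compact_open_def compactin_def by meson
  have "A \<in> F" if "A \<in> ?R" for A
  proof -
    have A: "is_coset A" "A \<subseteq> U" "lgrp A = W" using that R by auto
    then obtain a where "a \<in> A" by (auto simp: is_coset_def)
    then obtain C where C: "C \<in> F" "a \<in> C" using A F by blast
    then have "is_coset C" "lgrp C = W" using R F by auto
    then show ?thesis
      using is_coset_r_coset[OF A(1) \<open>a \<in> A\<close>] is_coset_r_coset[of C a] A C by simp
  qed
  then have "?R \<subseteq> F" by (rule subsetI)
  then show ?thesis using F(1) by (rule finite_subset)
qed

text \<open>
  van Dantzig: a neighbourhood of the identity contains a compact open set \<open>K\<close> containing the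
  identity, and the group of all \<open>g\<close> with \<open>K g = K\<close> is then open.
\<close>

lemma compact_open_neighbourhood:
  assumes "Hausdorff_space X" "totally_disconnected_space X" "locally_compact_space X"
    and "openin X W" "x \<in> W"
  obtains K where "openin X K" "compactin X K" "x \<in> K" "K \<subseteq> W"
proof -
  have "neighbourhood_base_of (compactin X) X"
    using assms(1,3) locally_compact_space_neighbourhood_base by blast
  then obtain N C where NC: "openin X N" "compactin X C" "x \<in> N" "N \<subseteq> C" "C \<subseteq> W"
    using assms(4,5) unfolding neighbourhood_base_of by meson
  define Y where "Y = subtopology X C"
  have "C \<subseteq> topspace X" using NC(2) compactin_subset_topspace by blast
  then have topY: "topspace Y = C" by (auto simp: Y_def)
  have Y: "compact_space Y" "Hausdorff_space Y"
    using NC(2) assms(1) by (simp_all add: Y_def compact_space_subtopology Hausdorff_space_subtopology)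
  have "x \<in> topspace X" using NC(1,3) openin_subset by blast
  \<comment> \<open>In a compact Hausdorff space components and quasi-components coincide, and a
    quasi-component is separated from a disjoint compact set by a clopen one. Total disconnectedness
    makes the quasi-component of \<open>x\<close> a singleton.\<close>
  have "quasi_component_of_set Y x = connected_component_of_set Y x"
    using Y quasi_eq_connected_components_of[of Y] quasi_eq_connected_components_of_pointwise_alt[of Y]
    by auto
  also have "connected_component_of_set Y x \<subseteq> connected_component_of_set X x"
    by (auto simp: Y_def connected_component_of_def connectedin_subtopology)
  also have "\<dots> = {x}"
    using assms(2) \<open>x \<in> topspace X\<close> by (simp add: totally_disconnected_space_def)
  finally have "quasi_component_of_set Y x \<subseteq> {x}" .
  moreover have "x \<in> topspace Y" using NC topY by blast
  ultimately have "quasi_component_of_set Y x = {x}" by fastforce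
  then have x: "{x} \<in> quasi_components_of Y"
    unfolding quasi_components_of_def using \<open>x \<in> topspace Y\<close> by (metis imageI)
  have "closedin Y (C - N)"
    using NC(1) by (simp add: closedin_def topY Diff_Diff_Int) (simp add: Y_def openin_subtopology_Int2)
  then have "compactin Y (C - N)"
    using Y(1) closedin_compact_space by blast
  then have "separated_between Y {x} (C - N)"
    using separated_between_quasi_component_compact[OF x] NC(3) by (simp add: disjnt_iff)
  then obtain D where D: "closedin Y D" "openin Y D" "x \<in> D" "C - N \<subseteq> topspace Y - D"
    unfolding separated_between by auto
  have "D \<subseteq> C" using D(1) closedin_subset topY by blast
  with D(4) have "D \<subseteq> N" by blast
  obtain O' where O': "openin X O'" "D = O' \<inter> C"
    using D(2) by (auto simp: Y_def openin_subtopology)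
  \<comment> \<open>So far \<open>D\<close> is only relatively open in \<open>C\<close>; lying
    inside the open set \<open>N\<close> makes it open in \<open>X\<close>.\<close>
  then have "D = O' \<inter> N" using \<open>D \<subseteq> N\<close> NC(4) by blast
  then have "openin X D" using O'(1) NC(1) by auto
  moreover have "compactin X D"
    using D(1) Y(1) closedin_compact_space compactin_subtopology unfolding Y_def by blast
  ultimately show ?thesis
    using that[of D] D(3) \<open>D \<subseteq> C\<close> NC(5) by blast
qed

text \<open>If \<open>K g\<close> is contained in \<open>K\<close>, then the open preimage of
  \<open>K\<close> under multiplication contains \<open>K \<times> {g}\<close>, and the tube lemma
  thickens \<open>g\<close> to a neighbourhood.\<close>

lemma openin_right_stabilizer:
  assumes "openin X K" "compactin X K"
  shows "openin X {g \<in> carrier G. \<forall>k\<in>K. k \<otimes> g \<in> K}"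
proof (subst openin_subopen, intro ballI)
  fix g assume g: "g \<in> {g \<in> carrier G. \<forall>k\<in>K. k \<otimes> g \<in> K}"
  define P where "P = {p \<in> topspace (prod_topology X X). (\<lambda>(x, y). x \<otimes> y) p \<in> K}"
  have "openin (prod_topology X X) P"
    unfolding P_def using mult_cont assms(1) openin_continuous_map_preimage by blast
  moreover have "K \<times> {g} \<subseteq> P"
    using g assms(2) compactin_subset_topspace by (fastforce simp: P_def topspace_eq)
  ultimately obtain U V where UV: "openin X U" "openin X V" "K \<subseteq> U" "g \<in> V" "U \<times> V \<subseteq> P"
    using tube_lemma_left[of X X P K g] assms(2) g topspace_eq by auto
  have "V \<subseteq> {g \<in> carrier G. \<forall>k\<in>K. k \<otimes> g \<in> K}"
  proof
    fix h assume h: "h \<in> V"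
    then have "(k, h) \<in> P" if "k \<in> K" for k using UV that by blast
    then show "h \<in> {g \<in> carrier G. \<forall>k\<in>K. k \<otimes> g \<in> K}"
      using h openin_subset[OF UV(2)] by (auto simp: P_def topspace_eq)
  qed
  with UV show "\<exists>T. openin X T \<and> g \<in> T \<and> T \<subseteq> {g \<in> carrier G. \<forall>k\<in>K. k \<otimes> g \<in> K}"
    by blast
qed

text \<open>\<open>H\<close> consists of the \<open>g\<close> for which both \<open>K g\<close> and
  \<open>K g^-1\<close> lie in \<open>K\<close>. As \<open>K\<close> contains the identity,
  \<open>H\<close> is a subset of \<open>K\<close>. Membership is an intersection of closed
  conditions, so \<open>H\<close> is closed in a compact set; openness comes from the previous
  lemma.\<close>

lemma van_Dantzig:
  assumes "Hausdorff_space X" "totally_disconnected_space X" "locally_compact_space X"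
    and "openin X W" "\<one> \<in> W"
  obtains V where "subgroup V G" "compact_open V" "V \<subseteq> W"
proof -
  obtain K where K: "openin X K" "compactin X K" "\<one> \<in> K" "K \<subseteq> W"
    using compact_open_neighbourhood[OF assms] by blast
  define S where "S = {g \<in> carrier G. \<forall>k\<in>K. k \<otimes> g \<in> K}"
  define H where "H = {g \<in> S. inv g \<in> S}"
  have Kc: "K \<subseteq> carrier G" using K(1) openin_subset topspace_eq by blast
  have "openin X S" unfolding S_def using openin_right_stabilizer K by blast
  moreover have "H = S \<inter> {g \<in> topspace X. inv g \<in> S}"
    using topspace_eq by (auto simp: H_def S_def)
  ultimately have openH: "openin X H"
    using inv_cont openin_continuous_map_preimage[of X X "\<lambda>x. inv x" S] by auto
  have HK: "H \<subseteq> K" using K(3) by (auto simp: H_def S_def)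
  have "closedin X K" using K(2) assms(1) compactin_imp_closedin by blast
  have "closedin X {g \<in> topspace X. k \<otimes> g \<in> K}" if "k \<in> K" for k
    using closedin_continuous_map_preimage[OF l_translation_cont \<open>closedin X K\<close>] that Kc by blast
  then have "closedin X (\<Inter>k\<in>K. {g \<in> topspace X. k \<otimes> g \<in> K})"
    using K(3) by (intro closedin_INT) auto
  also have "(\<Inter>k\<in>K. {g \<in> topspace X. k \<otimes> g \<in> K}) = S"
    using K(3) topspace_eq by (auto simp: S_def)
  finally have "closedin X S" .
  then have "closedin X H"
    using \<open>H = S \<inter> {g \<in> topspace X. inv g \<in> S}\<close> inv_cont closedin_continuous_map_preimage[of X X "\<lambda>x. inv x" S]
    by auto
  then have "compactin X H" using K(2) HK closed_compactin by blast
  moreover have "subgroup H G"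
  proof (rule subgroupI)
    show "H \<subseteq> carrier G" by (auto simp: H_def S_def)
    have "\<one> \<in> H" using Kc by (auto simp: H_def S_def subset_iff)
    then show "H \<noteq> {}" by blast
    show "inv g \<in> H" if "g \<in> H" for g
      using that by (auto simp: H_def S_def)
    have S: "g \<otimes> h \<in> S" if "g \<in> S" "h \<in> S" for g h
      using that Kc by (auto simp: S_def subset_iff simp flip: m_assoc)
    show "g \<otimes> h \<in> H" if "g \<in> H" "h \<in> H" for g h
    proof -
      have "inv (g \<otimes> h) = inv h \<otimes> inv g"
        using that by (auto simp: H_def S_def inv_mult_group)
      then show ?thesis using S that by (auto simp: H_def)
    qed
  qed
  ultimately show ?thesis
    using that openH HK K(4) by (auto simp: compact_open_def)
qed

end

section \<open>Path spaces\<close>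

lemma length_restrict_to [simp]: "length (restrict_to f n) = n"
  by (simp add: restrict_to_def)

lemma nth_restrict_to [simp]: "i < n \<Longrightarrow> restrict_to f n ! i = f i"
  by (simp add: restrict_to_def)

lemma take_restrict_to: "k \<le> n \<Longrightarrow> take k (restrict_to f n) = restrict_to f k"
  by (simp add: restrict_to_def take_map take_upt)

lemma restrict_to_eq_iff: "restrict_to f n = restrict_to g n \<longleftrightarrow> (\<forall>i<n. f i = g i)"
  by (auto simp: list_eq_iff_nth_eq)

lemma restrict_to_Suc: "restrict_to f (Suc n) = restrict_to f n @ [f n]"
  by (simp add: restrict_to_def)

lemma prefix_restrict_to: "n \<le> m \<Longrightarrow> prefix (restrict_to f n) (restrict_to f m)"
  by (metis take_restrict_to take_is_prefix)

lemma prefix_restrict_toD: "prefix \<sigma> (restrict_to f n) \<Longrightarrow> \<sigma> = restrict_to f (length \<sigma>)"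
  by (metis prefix_length_le length_restrict_to take_restrict_to append_eq_conv_conj prefix_def)

lemma paths_through_iff: "f \<in> paths_through T \<sigma> \<longleftrightarrow> f \<in> paths T \<and> restrict_to f (length \<sigma>) = \<sigma>"
  by (simp add: paths_through_def)

lemma paths_throughI: "f \<in> paths T \<Longrightarrow> prefix \<sigma> (restrict_to f n) \<Longrightarrow> f \<in> paths_through T \<sigma>"
  using prefix_restrict_toD by (auto simp: paths_through_iff)

lemma paths_through_prefix: "f \<in> paths_through T \<sigma> \<Longrightarrow> length \<sigma> \<le> n \<Longrightarrow> prefix \<sigma> (restrict_to f n)"
  using prefix_restrict_to[of "length \<sigma>" n f] by (simp add: paths_through_iff)

lemma paths_through_mono: "prefix \<sigma> \<tau> \<Longrightarrow> paths_through T \<tau> \<subseteq> paths_through T \<sigma>"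
  by (metis order_refl paths_throughI paths_through_iff prefix_order.trans subsetI)

text \<open>A choice of successors is iterated from \<open>\<sigma>\<close>. Since every node lies
  on a path, tests on nodes of a given length can be read as statements about paths.\<close>

lemma leafless_extend:
  assumes "is_tree T" "leafless T" "\<sigma> \<in> T"
  obtains f where "f \<in> paths_through T \<sigma>"
proof -
  obtain next_entry where next_entry: "\<And>\<rho>. \<rho> \<in> T \<Longrightarrow> \<rho> @ [next_entry \<rho>] \<in> T"
    using assms(2) unfolding leafless_def by metis
  define s where "s n = rec_nat \<sigma> (\<lambda>_ \<rho>. \<rho> @ [next_entry \<rho>]) n" for n
  have s0: "s 0 = \<sigma>" and sSuc: "s (Suc n) = s n @ [next_entry (s n)]" for n
    by (simp_all add: s_def)
  have len: "length (s n) = length \<sigma> + n" for n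
    by (induction n) (simp_all add: s0 sSuc)
  have inT: "s n \<in> T" for n
    by (induction n) (use assms(3) next_entry in \<open>simp_all add: s0 sSuc\<close>)
  have pre: "prefix (s n) (s (n + k))" for n k
    by (induction k) (auto simp: sSuc intro: prefix_order.trans)
  have pre: "prefix (s n) (s m)" if "n \<le> m" for n m
    using pre[of n "m - n"] that by simp
  define f where "f i = s (Suc i) ! i" for i
  have f: "f i = s n ! i" if "i < length (s n)" for i n
  proof -
    have "prefix (s (Suc i)) (s n) \<or> prefix (s n) (s (Suc i))"
      using pre by (meson nat_le_linear)
    then show ?thesis
      using that len[of "Suc i"] by (auto simp: f_def prefix_def nth_append)
  qed
  have r: "restrict_to f (length (s n)) = s n" for n
    by (rule nth_equalityI) (simp_all add: f)
  have "restrict_to f n \<in> T" for n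
  proof -
    have "prefix (restrict_to f n) (restrict_to f (length (s n)))"
      by (rule prefix_restrict_to) (simp add: len)
    then show ?thesis
      using inT[of n] assms(1) unfolding r is_tree_def by blast
  qed
  then have "f \<in> paths_through T \<sigma>"
    using r[of 0] by (simp add: paths_through_iff paths_def s0)
  then show ?thesis using that by blast
qed

lemma topspace_path_space [simp]: "topspace (path_space T) = paths T"
  by (simp add: path_space_def)

lemma Hausdorff_path_space: "Hausdorff_space (path_space T)"
  unfolding path_space_def
  by (intro Hausdorff_space_subtopology) (simp add: Hausdorff_space_product_topology)

lemma openin_paths_through: "openin (path_space T) (paths_through T \<sigma>)"
proof -
  let ?U = "\<lambda>i. if i < length \<sigma> then {\<sigma> ! i} else UNIV"
  have "openin (product_topology (\<lambda>_. discrete_topology UNIV) UNIV) (Pi\<^sub>E UNIV ?U)"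
    by (subst openin_PiE_gen)
       (auto intro: finite_subset[of _ "{..<length \<sigma>}"])
  moreover have "paths_through T \<sigma> = Pi\<^sub>E UNIV ?U \<inter> paths T"
    by (auto simp: paths_through_iff list_eq_iff_nth_eq PiE_def Pi_def split: if_splits)
  ultimately show ?thesis
    unfolding path_space_def openin_subtopology by blast
qed

text \<open>A basic open set of the product restricts finitely many coordinates, so it contains the
  cone of a long enough initial segment of each of its points.\<close>

lemma openin_path_space_iff:
  "openin (path_space T) W \<longleftrightarrow>
     W \<subseteq> paths T \<and> (\<forall>f\<in>W. \<exists>n. paths_through T (restrict_to f n) \<subseteq> W)"
proof
  assume W: "openin (path_space T) W"
  then have "W \<subseteq> paths T" using openin_subset by fastforce
  moreover have "\<exists>n. paths_through T (restrict_to f n) \<subseteq> W" if "f \<in> W" for f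
  proof -
    obtain V where V: "openin (product_topology (\<lambda>_. discrete_topology UNIV) UNIV) V" "W = V \<inter> paths T"
      using W by (auto simp: path_space_def openin_subtopology)
    then have "f \<in> V" using that by blast
    from bspec[OF iffD1[OF openin_product_topology_alt V(1)] this]
    obtain U where U: "finite {i. U i \<noteq> (UNIV :: nat set)}" "f \<in> Pi\<^sub>E UNIV U" "Pi\<^sub>E UNIV U \<subseteq> V"
      by auto
    obtain n where n: "{i. U i \<noteq> UNIV} \<subseteq> {..<n}"
      using U(1) finite_nat_iff_bounded by blast
    have "g \<in> V" if "\<forall>i<n. g i = f i" for g
    proof -
      have "g i \<in> U i" for i
        using n U(2) that by (cases "i < n") (auto simp: PiE_def Pi_def)
      then show ?thesis using U(3) by (auto simp: PiE_def Pi_def)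
    qed
    then have "paths_through T (restrict_to f n) \<subseteq> W"
      by (auto simp: V(2) paths_through_iff restrict_to_eq_iff)
    then show ?thesis by blast
  qed
  ultimately show "W \<subseteq> paths T \<and> (\<forall>f\<in>W. \<exists>n. paths_through T (restrict_to f n) \<subseteq> W)" by blast
next
  assume W: "W \<subseteq> paths T \<and> (\<forall>f\<in>W. \<exists>n. paths_through T (restrict_to f n) \<subseteq> W)"
  then show "openin (path_space T) W"
    by (subst openin_subopen) (metis openin_paths_through paths_through_iff length_restrict_to subsetD)
qed

lemma closedin_paths_through: "closedin (path_space T) (paths_through T \<sigma>)"
proof -
  have "openin (path_space T) (paths T - paths_through T \<sigma>)"
    unfolding openin_path_space_iff
  proof (intro conjI ballI)
    fix f assume f: "f \<in> paths T - paths_through T \<sigma>"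
    have "paths_through T (restrict_to f (length \<sigma>)) \<subseteq> paths T - paths_through T \<sigma>"
      using f by (auto simp: paths_through_iff)
    then show "\<exists>n. paths_through T (restrict_to f n) \<subseteq> paths T - paths_through T \<sigma>" by blast
  qed auto
  then show ?thesis
    by (simp add: closedin_def) (auto simp: paths_through_iff)
qed

text \<open>The sets of pairs satisfying \<open>Q n\<close> are open, because \<open>Q n\<close>
  depends only on the first \<open>n\<close> entries, and they increase with \<open>n\<close>; a
  finite subcover of \<open>K \<times> L\<close> thus reduces to a single \<open>n\<close>. This is
  the source of uniform moduli of continuity.\<close>

lemma compact_uniform:
  assumes K: "compactin (path_space T) K" "compactin (path_space T) L"
    and ex: "\<And>x y. x \<in> K \<Longrightarrow> y \<in> L \<Longrightarrow> \<exists>n. Q n x y"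
    and mono: "\<And>n m x y. Q n x y \<Longrightarrow> n \<le> m \<Longrightarrow> Q m x y"
    and loc: "\<And>n x y x' y'. Q n x y \<Longrightarrow> restrict_to x n = restrict_to x' n \<Longrightarrow>
        restrict_to y n = restrict_to y' n \<Longrightarrow> Q n x' y'"
  shows "\<exists>n. \<forall>x\<in>K. \<forall>y\<in>L. Q n x y"
proof -
  let ?X = "prod_topology (path_space T) (path_space T)"
  define W where "W n = {(x, y). x \<in> paths T \<and> y \<in> paths T \<and> Q n x y}" for n
  have "openin ?X (W n)" for n
  proof (subst openin_subopen, intro ballI)
    fix p assume "p \<in> W n"
    then obtain x y where p: "p = (x, y)" "x \<in> paths T" "y \<in> paths T" "Q n x y"
      by (auto simp: W_def)
    let ?V = "paths_through T (restrict_to x n) \<times> paths_through T (restrict_to y n)"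
    have "openin ?X ?V" by (simp add: openin_prod_Times_iff openin_paths_through)
    moreover have "p \<in> ?V" using p by (simp add: paths_through_iff)
    moreover have "?V \<subseteq> W n"
      using loc[OF p(4)] by (auto simp: W_def paths_through_iff)
    ultimately show "\<exists>V. openin ?X V \<and> p \<in> V \<and> V \<subseteq> W n" by blast
  qed
  moreover have KL: "K \<subseteq> paths T" "L \<subseteq> paths T"
    using K compactin_subset_topspace by fastforce+
  moreover have "compactin ?X (K \<times> L)" using K by (simp add: compactin_Times)
  moreover have "K \<times> L \<subseteq> \<Union> (range W)"
    using ex KL by (fastforce simp: W_def)
  ultimately obtain F where F: "finite F" "F \<subseteq> range W" "K \<times> L \<subseteq> \<Union> F"
    unfolding compactin_def by (metis (no_types, lifting) imageE)
  then obtain N where N: "finite N" "F = W ` N"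
    by (meson finite_subset_image)
  have "Q (Max (insert 0 N)) x y" if "x \<in> K" "y \<in> L" for x y
  proof -
    have "(x, y) \<in> \<Union> F" using F(3) that by blast
    then obtain n where "n \<in> N" "(x, y) \<in> W n" using N(2) by blast
    then show ?thesis using mono[of n x y] N(1) by (auto simp: W_def)
  qed
  then show ?thesis by blast
qed

section \<open>Clopen sets of paths\<close>

definition extend1 ::
    "nat list set \<Rightarrow> (nat list \<Rightarrow> nat \<Rightarrow> nat) \<Rightarrow> nat list \<Rightarrow> nat list list \<Rightarrow> nat list list" where
  "extend1 T H \<sigma> \<rho>s =
     concat (map (\<lambda>\<rho>. map (\<lambda>j. \<rho> @ [j]) (filter (\<lambda>j. \<rho> @ [j] \<in> T) [0..<Suc (H \<sigma> (length \<rho>))])) \<rho>s)"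

text \<open>Above a compact nonempty node \<open>H\<close> bounds all entries, so this finite list
  contains every extension by \<open>n\<close> entries, see \<open>set_extn\<close>.\<close>

definition extn ::
    "nat list set \<Rightarrow> (nat list \<Rightarrow> nat \<Rightarrow> nat) \<Rightarrow> nat list \<Rightarrow> nat \<Rightarrow> nat list list" where
  "extn T H \<sigma> n = rec_nat [\<sigma>] (\<lambda>k. extend1 T H \<sigma>) n"

definition pts :: "nat list set \<Rightarrow> nat list list \<Rightarrow> (nat \<Rightarrow> nat) set" where
  "pts T u = (\<Union>\<sigma>\<in>set u. paths_through T \<sigma>)"

text \<open>The root is never used as a code, because nothing may be known about it.\<close>

definition clopen_code :: "nat list set \<Rightarrow> nat list list \<Rightarrow> bool" where
  "clopen_code T u \<longleftrightarrow> (\<forall>\<sigma>\<in>set u. \<sigma> \<noteq> [] \<and> \<sigma> \<in> compact_nodes T)"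

text \<open>The added depth is the total length of the strings in \<open>v\<close> and
  \<open>w\<close>, a crude bound for each single length. A node that deep decides for all paths
  through it whether they lie in the sets coded by \<open>v\<close> and \<open>w\<close>.\<close>

definition inter_covered ::
    "nat list set \<Rightarrow> (nat list \<Rightarrow> nat \<Rightarrow> nat) \<Rightarrow> nat list list \<Rightarrow> nat list list \<Rightarrow> nat list list \<Rightarrow> bool" where
  "inter_covered T H u v w \<longleftrightarrow>
     (\<forall>\<sigma>\<in>set u. \<forall>\<rho>\<in>set (extn T H \<sigma> (length (concat v) + length (concat w))).
        (\<exists>\<tau>\<in>set v. prefix \<tau> \<rho>) \<longrightarrow> (\<exists>\<tau>\<in>set w. prefix \<tau> \<rho>))"

definition covered ::
    "nat list set \<Rightarrow> (nat list \<Rightarrow> nat \<Rightarrow> nat) \<Rightarrow> nat list list \<Rightarrow> nat list list \<Rightarrow> bool" where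
  "covered T H u v = inter_covered T H u u v"

definition same_pts ::
    "nat list set \<Rightarrow> (nat list \<Rightarrow> nat \<Rightarrow> nat) \<Rightarrow> nat list list \<Rightarrow> nat list list \<Rightarrow> bool" where
  "same_pts T H u v \<longleftrightarrow> covered T H u v \<and> covered T H v u"

text \<open>\<open>S\<close> is a total step-bounded version of a program for \<open>\<Phi>\<close>:
  the value \<open>0\<close> means no output yet, and \<open>Suc r\<close> outputs the string coded
  by \<open>r\<close>. Outputs are initial segments of the image path and become arbitrarily
  long.\<close>

definition approximates ::
    "nat list set \<Rightarrow> (nat \<times> nat list \<times> nat list \<Rightarrow> nat) \<Rightarrow>
     ((nat \<Rightarrow> nat) \<Rightarrow> (nat \<Rightarrow> nat) \<Rightarrow> nat \<Rightarrow> nat) \<Rightarrow> bool" where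
  "approximates T S \<Phi> \<longleftrightarrow> (\<forall>x\<in>paths T. \<forall>y\<in>paths T. \<Phi> x y \<in> paths T \<and>
     (\<forall>t k r. S (t, restrict_to x k, restrict_to y k) = Suc r \<longrightarrow>
        list_decode r = restrict_to (\<Phi> x y) (length (list_decode r))) \<and>
     (\<forall>L. \<exists>t k r. S (t, restrict_to x k, restrict_to y k) = Suc r \<and> L < length (list_decode r)))"

text \<open>A depth at which every pair of extensions has produced an output longer than all strings
  in \<open>w\<close>; again the total length serves as bound. The extensions of different nodes may
  differ in length, while the program expects equal lengths, whence the truncation to a common
  \<open>k\<close>.\<close>

definition modulus ::
    "nat list set \<Rightarrow> (nat list \<Rightarrow> nat \<Rightarrow> nat) \<Rightarrow> (nat \<times> nat list \<times> nat list \<Rightarrow> nat) \<Rightarrow>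
     nat list list \<Rightarrow> nat list list \<Rightarrow> nat list list \<Rightarrow> nat" where
  "modulus T H S u v w = (LEAST n. clopen_code T u \<and> clopen_code T v \<longrightarrow>
     (\<forall>\<sigma>\<in>set u. \<forall>\<rho>\<in>set (extn T H \<sigma> n). \<forall>\<sigma>'\<in>set v. \<forall>\<tau>\<in>set (extn T H \<sigma>' n).
        \<exists>k\<le>n. \<exists>t\<le>n. S (t, take k \<rho>, take k \<tau>) \<noteq> 0 \<and>
          length (concat w) < length (list_decode (S (t, take k \<rho>, take k \<tau>) - 1))))"

definition maps_into ::
    "nat list set \<Rightarrow> (nat list \<Rightarrow> nat \<Rightarrow> nat) \<Rightarrow> (nat \<times> nat list \<times> nat list \<Rightarrow> nat) \<Rightarrow>
     nat list list \<Rightarrow> nat list list \<Rightarrow> nat list list \<Rightarrow> bool" where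
  "maps_into T H S u v w \<longleftrightarrow>
     (\<forall>\<sigma>\<in>set u. \<forall>\<rho>\<in>set (extn T H \<sigma> (modulus T H S u v w)).
      \<forall>\<sigma>'\<in>set v. \<forall>\<tau>\<in>set (extn T H \<sigma>' (modulus T H S u v w)).
        \<exists>k\<le>modulus T H S u v w. \<exists>t\<le>modulus T H S u v w. S (t, take k \<rho>, take k \<tau>) \<noteq> 0 \<and>
          (\<exists>\<upsilon>\<in>set w. prefix \<upsilon> (list_decode (S (t, take k \<rho>, take k \<tau>) - 1))))"

locale bounded_tree =
  fixes T :: "nat list set" and H :: "nat list \<Rightarrow> nat \<Rightarrow> nat"
  assumes tree: "is_tree T" and leafless: "leafless T"
    and bound: "\<sigma> \<in> compact_nodes T \<Longrightarrow> \<sigma> \<noteq> [] \<Longrightarrow> \<rho> \<in> T \<Longrightarrow> prefix \<sigma> \<rho> \<Longrightarrow> i < length \<rho> \<Longrightarrow>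
      \<rho> ! i \<le> H \<sigma> i"
begin

lemma set_extn:
  assumes "\<sigma> \<in> compact_nodes T" "\<sigma> \<noteq> []"
  shows "set (extn T H \<sigma> n) = {\<rho> \<in> T. prefix \<sigma> \<rho> \<and> length \<rho> = length \<sigma> + n}"
proof (induction n)
  case 0
  have "\<sigma> \<in> T" using assms(1) by (simp add: compact_nodes_def)
  then show ?case by (auto simp: extn_def prefix_def)
next
  case (Suc n)
  have "set (extn T H \<sigma> (Suc n)) = (\<Union>\<rho>\<in>set (extn T H \<sigma> n). {\<rho> @ [j] |j. \<rho> @ [j] \<in> T \<and> j \<le> H \<sigma> (length \<rho>)})"
    by (auto simp: extn_def extend1_def less_Suc_eq_le simp del: upt_Suc)
  also have "\<dots> = {\<rho> \<in> T. prefix \<sigma> \<rho> \<and> length \<rho> = length \<sigma> + Suc n}"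
  proof (intro equalityI subsetI)
    fix \<rho> assume "\<rho> \<in> {\<rho> \<in> T. prefix \<sigma> \<rho> \<and> length \<rho> = length \<sigma> + Suc n}"
    then have \<rho>: "\<rho> \<in> T" "prefix \<sigma> \<rho>" "length \<rho> = length \<sigma> + Suc n" by auto
    then obtain \<rho>' j where j: "\<rho> = \<rho>' @ [j]"
      by (metis add_Suc_right list.size(3) nat.distinct(1) rev_exhaust)
    with \<rho> have len: "length \<rho>' = length \<sigma> + n" by simp
    with \<rho> j have "prefix \<sigma> \<rho>'"
      by (metis le_add1 prefix_length_prefix prefixI)
    moreover have "prefix \<rho>' \<rho>" using j by simp
    then have "\<rho>' \<in> T" using tree \<rho>(1) unfolding is_tree_def by blast
    moreover have "j \<le> H \<sigma> (length \<rho>')"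
      using bound[OF assms \<rho>(1,2), of "length \<rho>'"] j by simp
    ultimately show "\<rho> \<in> (\<Union>\<rho>\<in>set (extn T H \<sigma> n). {\<rho> @ [j] |j. \<rho> @ [j] \<in> T \<and> j \<le> H \<sigma> (length \<rho>)})"
      using len \<rho>(1) j by (auto simp: Suc.IH)
  qed (auto simp: Suc.IH)
  finally show ?case .
qed

lemma restrict_in_extn:
  assumes "\<sigma> \<in> compact_nodes T" "\<sigma> \<noteq> []" "f \<in> paths_through T \<sigma>"
  shows "restrict_to f (length \<sigma> + n) \<in> set (extn T H \<sigma> n)"
  using assms(3) paths_through_prefix[OF assms(3)]
  by (simp add: set_extn[OF assms(1,2)] paths_through_iff paths_def)

lemma extn_path:
  assumes "\<sigma> \<in> compact_nodes T" "\<sigma> \<noteq> []" "\<rho> \<in> set (extn T H \<sigma> n)"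
  obtains f where "f \<in> paths_through T \<sigma>" "restrict_to f (length \<rho>) = \<rho>" "length \<rho> = length \<sigma> + n"
proof -
  have \<rho>: "\<rho> \<in> T" "prefix \<sigma> \<rho>" "length \<rho> = length \<sigma> + n"
    using assms(3) by (auto simp: set_extn[OF assms(1,2)])
  then obtain f where f: "f \<in> paths_through T \<rho>"
    using leafless_extend[OF tree leafless] by metis
  then have "f \<in> paths_through T \<sigma>" "restrict_to f (length \<rho>) = \<rho>"
    using paths_through_mono[OF \<rho>(2), of T] by (blast, simp add: paths_through_iff)
  with \<rho>(3) show ?thesis using that by blast
qed

lemma length_le_concat: "\<tau> \<in> set v \<Longrightarrow> length \<tau> \<le> length (concat v)"
  by (induction v) auto

lemma in_pts_iff:
  assumes "f \<in> paths T" "length (concat v) \<le> n"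
  shows "f \<in> pts T v \<longleftrightarrow> (\<exists>\<tau>\<in>set v. prefix \<tau> (restrict_to f n))"
proof
  assume "f \<in> pts T v"
  then obtain \<tau> where "\<tau> \<in> set v" "f \<in> paths_through T \<tau>" by (auto simp: pts_def)
  then show "\<exists>\<tau>\<in>set v. prefix \<tau> (restrict_to f n)"
    using paths_through_prefix length_le_concat assms(2) by (meson le_trans)
next
  assume "\<exists>\<tau>\<in>set v. prefix \<tau> (restrict_to f n)"
  then show "f \<in> pts T v"
    using paths_throughI[OF assms(1)] unfolding pts_def by blast
qed

lemma pts_subset: "pts T u \<subseteq> paths T"
  by (auto simp: pts_def paths_through_iff)

text \<open>Every node of a leafless tree carries a path, so emptiness of a coded set is visible on
  the code.\<close>

lemma pts_empty_iff: "clopen_code T u \<Longrightarrow> pts T u = {} \<longleftrightarrow> u = []"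
proof
  assume u: "clopen_code T u" and "pts T u = {}"
  show "u = []"
  proof (rule ccontr)
    assume "u \<noteq> []"
    then have "hd u \<in> T" "hd u \<in> set u" using u by (auto simp: clopen_code_def compact_nodes_def)
    then obtain f where "f \<in> paths_through T (hd u)"
      using leafless_extend[OF tree leafless] by metis
    with \<open>hd u \<in> set u\<close> \<open>pts T u = {}\<close> show False by (auto simp: pts_def)
  qed
qed (simp add: pts_def)

text \<open>At the chosen depth, nodes and paths pass the same tests: each path in the set passes
  through a listed node, and by leaflessness each listed node lies on such a path.\<close>

lemma inter_covered_iff:
  assumes "clopen_code T u"
  shows "inter_covered T H u v w \<longleftrightarrow> pts T u \<inter> pts T v \<subseteq> pts T w"
proof
  let ?n = "length (concat v) + length (concat w)"
  assume L: "inter_covered T H u v w"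
  show "pts T u \<inter> pts T v \<subseteq> pts T w"
  proof
    fix f assume f: "f \<in> pts T u \<inter> pts T v"
    then obtain \<sigma> where \<sigma>: "\<sigma> \<in> set u" "f \<in> paths_through T \<sigma>" by (auto simp: pts_def)
    then have "restrict_to f (length \<sigma> + ?n) \<in> set (extn T H \<sigma> ?n)"
      using restrict_in_extn assms by (auto simp: clopen_code_def)
    moreover have "f \<in> paths T" using \<sigma> by (simp add: paths_through_iff)
    ultimately show "f \<in> pts T w"
      using L \<sigma>(1) f in_pts_iff[of f v "length \<sigma> + ?n"] in_pts_iff[of f w "length \<sigma> + ?n"]
      unfolding inter_covered_def by auto
  qed
next
  let ?n = "length (concat v) + length (concat w)"
  assume R: "pts T u \<inter> pts T v \<subseteq> pts T w"
  show "inter_covered T H u v w"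
    unfolding inter_covered_def
  proof (intro ballI impI)
    fix \<sigma> \<rho> assume \<sigma>: "\<sigma> \<in> set u" and \<rho>: "\<rho> \<in> set (extn T H \<sigma> ?n)" and ex: "\<exists>\<tau>\<in>set v. prefix \<tau> \<rho>"
    have "\<sigma> \<in> compact_nodes T" "\<sigma> \<noteq> []" using \<sigma> assms by (auto simp: clopen_code_def)
    then obtain f where f: "f \<in> paths_through T \<sigma>" "restrict_to f (length \<rho>) = \<rho>"
        "length \<rho> = length \<sigma> + ?n"
      using extn_path \<rho> by metis
    then have "f \<in> paths T" "f \<in> pts T u" using \<sigma> by (auto simp: paths_through_iff pts_def)
    then show "\<exists>\<tau>\<in>set w. prefix \<tau> \<rho>"
      using R ex f in_pts_iff[of f v "length \<rho>"] in_pts_iff[of f w "length \<rho>"] by auto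
  qed
qed

lemma covered_iff: "clopen_code T u \<Longrightarrow> covered T H u v \<longleftrightarrow> pts T u \<subseteq> pts T v"
  by (simp add: covered_def inter_covered_iff)

lemma same_pts_iff:
  "clopen_code T u \<Longrightarrow> clopen_code T v \<Longrightarrow> same_pts T H u v \<longleftrightarrow> pts T u = pts T v"
  by (auto simp: same_pts_def covered_iff)

lemma pts_compact: "clopen_code T u \<Longrightarrow> compactin (path_space T) (pts T u)"
  unfolding pts_def
  by (intro compactin_Union[of "paths_through T ` set u", simplified])
    (auto simp: clopen_code_def compact_nodes_def)

lemma pts_open: "openin (path_space T) (pts T u)"
  unfolding pts_def by (auto intro: openin_paths_through)

text \<open>The cones contained in \<open>A\<close> are closed subsets of a compact set, hence
  compact, and finitely many of them cover \<open>A\<close>.\<close>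

lemma compact_open_code:
  assumes A: "openin (path_space T) A" "compactin (path_space T) A"
  obtains u where "clopen_code T u" "pts T u = A"
proof -
  define N where "N = {\<sigma> \<in> T. \<sigma> \<noteq> [] \<and> paths_through T \<sigma> \<subseteq> A}"
  have N: "\<sigma> \<in> compact_nodes T" if "\<sigma> \<in> N" for \<sigma>
  proof -
    have "closedin (path_space T) (paths_through T \<sigma>)" by (rule closedin_paths_through)
    then have "compactin (path_space T) (paths_through T \<sigma>)"
      using A(2) that closed_compactin by (auto simp: N_def)
    then show ?thesis using that by (simp add: compact_nodes_def N_def)
  qed
  have "A \<subseteq> \<Union> (paths_through T ` N)"
  proof
    fix f assume f: "f \<in> A"
    then obtain n where "paths_through T (restrict_to f n) \<subseteq> A" "f \<in> paths T"
      using A(1) unfolding openin_path_space_iff by blast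
    \<comment> \<open>The initial segment \<open>restrict_to f n\<close> could be the root, so one
      more entry is taken.\<close>
    moreover have "paths_through T (restrict_to f (Suc n)) \<subseteq> paths_through T (restrict_to f n)"
      by (rule paths_through_mono) (simp add: prefix_restrict_to)
    moreover have "restrict_to f (Suc n) \<noteq> []"
      by (simp add: restrict_to_Suc)
    ultimately have "restrict_to f (Suc n) \<in> N" "f \<in> paths_through T (restrict_to f (Suc n))"
      by (auto simp: N_def paths_def paths_through_iff)
    then show "f \<in> \<Union> (paths_through T ` N)" by blast
  qed
  moreover have "\<forall>U\<in>paths_through T ` N. openin (path_space T) U"
    by (auto intro: openin_paths_through)
  ultimately obtain F where F: "finite F" "F \<subseteq> paths_through T ` N" "A \<subseteq> \<Union> F"
    using A(2) unfolding compactin_def by meson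
  then obtain M where M: "finite M" "M \<subseteq> N" "F = paths_through T ` M"
    by (meson finite_subset_image)
  then obtain u where u: "set u = M" using finite_list by blast
  have "pts T u = A"
    using F(3) M u by (auto simp: pts_def N_def)
  moreover have "clopen_code T u"
    using M u N by (auto simp: clopen_code_def N_def)
  ultimately show ?thesis using that by blast
qed

lemma modulus_exists:
  assumes S: "approximates T S \<Phi>" and uv: "clopen_code T u" "clopen_code T v"
  shows "\<exists>n. \<forall>\<sigma>\<in>set u. \<forall>\<rho>\<in>set (extn T H \<sigma> n). \<forall>\<sigma>'\<in>set v. \<forall>\<tau>\<in>set (extn T H \<sigma>' n).
        \<exists>k\<le>n. \<exists>t\<le>n. S (t, take k \<rho>, take k \<tau>) \<noteq> 0 \<and>
          L < length (list_decode (S (t, take k \<rho>, take k \<tau>) - 1))"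
proof -
  define Q where "Q n x y \<longleftrightarrow> (\<exists>k\<le>n. \<exists>t\<le>n. S (t, restrict_to x k, restrict_to y k) \<noteq> 0 \<and>
    L < length (list_decode (S (t, restrict_to x k, restrict_to y k) - 1)))" for n x y
  have "\<exists>n. \<forall>x\<in>pts T u. \<forall>y\<in>pts T v. Q n x y"
  proof (rule compact_uniform[OF pts_compact[OF uv(1)] pts_compact[OF uv(2)], of Q])
    fix x y assume "x \<in> pts T u" "y \<in> pts T v"
    then have "x \<in> paths T" "y \<in> paths T" using pts_subset by blast+
    then obtain t k r where "S (t, restrict_to x k, restrict_to y k) = Suc r" "L < length (list_decode r)"
      using S unfolding approximates_def by blast
    \<comment> \<open>One number has to bound both the stage and the length of the strings.\<close>
    then have "Q (max t k) x y" unfolding Q_def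
      by (intro exI[of _ k] conjI exI[of _ t]) auto
    then show "\<exists>n. Q n x y" by blast
  next
    show "Q m x y" if "Q n x y" "n \<le> m" for n m x y
      using that unfolding Q_def by (meson le_trans)
  next
    fix n x y x' y' assume Q: "Q n x y" and eq: "restrict_to x n = restrict_to x' n" "restrict_to y n = restrict_to y' n"
    have "restrict_to x k = restrict_to x' k" "restrict_to y k = restrict_to y' k" if "k \<le> n" for k
      using eq take_restrict_to[OF that] by metis+
    then show "Q n x' y'" using Q unfolding Q_def by metis
  qed
  then obtain n where n: "\<And>x y. x \<in> pts T u \<Longrightarrow> y \<in> pts T v \<Longrightarrow> Q n x y"
    by blast
  show ?thesis
  proof (rule exI[of _ n], intro ballI)
    fix \<sigma> \<rho> \<sigma>' \<tau>
    assume *: "\<sigma> \<in> set u" "\<rho> \<in> set (extn T H \<sigma> n)" "\<sigma>' \<in> set v" "\<tau> \<in> set (extn T H \<sigma>' n)"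
    then have "\<sigma> \<in> compact_nodes T" "\<sigma> \<noteq> []" "\<sigma>' \<in> compact_nodes T" "\<sigma>' \<noteq> []"
      using uv by (auto simp: clopen_code_def)
    then obtain f g where f: "f \<in> paths_through T \<sigma>" "restrict_to f (length \<rho>) = \<rho>" "length \<rho> = length \<sigma> + n"
      and g: "g \<in> paths_through T \<sigma>'" "restrict_to g (length \<tau>) = \<tau>" "length \<tau> = length \<sigma>' + n"
      using extn_path * by metis
    \<comment> \<open>Both strings have length at least \<open>n\<close>, so truncations to
      \<open>k \<le> n\<close> are initial segments of the chosen paths.\<close>
    have "take k \<rho> = restrict_to f k" "take k \<tau> = restrict_to g k" if "k \<le> n" for k
      using f(2,3) g(2,3) that take_restrict_to[of k "length \<rho>" f] take_restrict_to[of k "length \<tau>" g] by simp_all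
    moreover have "Q n f g" using n f(1) g(1) * by (auto simp: pts_def)
    ultimately show "\<exists>k\<le>n. \<exists>t\<le>n. S (t, take k \<rho>, take k \<tau>) \<noteq> 0 \<and>
          L < length (list_decode (S (t, take k \<rho>, take k \<tau>) - 1))"
      unfolding Q_def by metis
  qed
qed

text \<open>All outputs on initial segments of \<open>x\<close> and \<open>y\<close> are initial
  segments of the same path. One output extending a string of \<open>w\<close> therefore places this
  path in the coded set; conversely an output longer than all strings of \<open>w\<close> must
  extend the one that witnesses membership.\<close>

lemma maps_into_iff:
  assumes S: "approximates T S \<Phi>" and uv: "clopen_code T u" "clopen_code T v"
  shows "maps_into T H S u v w \<longleftrightarrow> (\<forall>x\<in>pts T u. \<forall>y\<in>pts T v. \<Phi> x y \<in> pts T w)"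
proof -
  define n where "n = modulus T H S u v w"
  have long: "\<exists>k\<le>n. \<exists>t\<le>n. S (t, take k \<rho>, take k \<tau>) \<noteq> 0 \<and>
          length (concat w) < length (list_decode (S (t, take k \<rho>, take k \<tau>) - 1))"
    if "\<sigma> \<in> set u" "\<rho> \<in> set (extn T H \<sigma> n)" "\<sigma>' \<in> set v" "\<tau> \<in> set (extn T H \<sigma>' n)" for \<sigma> \<rho> \<sigma>' \<tau>
  proof -
    have "clopen_code T u \<and> clopen_code T v \<longrightarrow>
      (\<forall>\<sigma>\<in>set u. \<forall>\<rho>\<in>set (extn T H \<sigma> n). \<forall>\<sigma>'\<in>set v. \<forall>\<tau>\<in>set (extn T H \<sigma>' n).
        \<exists>k\<le>n. \<exists>t\<le>n. S (t, take k \<rho>, take k \<tau>) \<noteq> 0 \<and>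
          length (concat w) < length (list_decode (S (t, take k \<rho>, take k \<tau>) - 1)))"
      unfolding n_def modulus_def
      by (rule LeastI_ex) (use modulus_exists[OF S uv] in blast)
    with uv that show ?thesis by blast
  qed
  have pre: "list_decode (S (t, take k \<rho>, take k \<tau>) - 1) =
        restrict_to (\<Phi> f g) (length (list_decode (S (t, take k \<rho>, take k \<tau>) - 1)))"
    if "f \<in> paths T" "g \<in> paths T" "take k \<rho> = restrict_to f k" "take k \<tau> = restrict_to g k"
      "S (t, take k \<rho>, take k \<tau>) \<noteq> 0" for f g \<rho> \<tau> k t
    using S that unfolding approximates_def
    by (metis Suc_pred' bot_nat_0.not_eq_extremum)
  show ?thesis
  proof
    assume L: "maps_into T H S u v w"
    show "\<forall>x\<in>pts T u. \<forall>y\<in>pts T v. \<Phi> x y \<in> pts T w"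
    proof (intro ballI)
      fix f g assume fg: "f \<in> pts T u" "g \<in> pts T v"
      then obtain \<sigma> \<sigma>' where \<sigma>: "\<sigma> \<in> set u" "f \<in> paths_through T \<sigma>" "\<sigma>' \<in> set v" "g \<in> paths_through T \<sigma>'"
        by (auto simp: pts_def)
      have paths: "f \<in> paths T" "g \<in> paths T" using fg pts_subset by blast+
      let ?\<rho> = "restrict_to f (length \<sigma> + n)" and ?\<tau> = "restrict_to g (length \<sigma>' + n)"
      have "?\<rho> \<in> set (extn T H \<sigma> n)" "?\<tau> \<in> set (extn T H \<sigma>' n)"
        using restrict_in_extn \<sigma> uv by (auto simp: clopen_code_def)
      then obtain k t \<upsilon> where k: "k \<le> n" "S (t, take k ?\<rho>, take k ?\<tau>) \<noteq> 0" "\<upsilon> \<in> set w"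
          "prefix \<upsilon> (list_decode (S (t, take k ?\<rho>, take k ?\<tau>) - 1))"
        using L \<sigma> unfolding maps_into_def n_def[symmetric] by blast
      have "prefix \<upsilon> (restrict_to (\<Phi> f g) (length (list_decode (S (t, take k ?\<rho>, take k ?\<tau>) - 1))))"
        using pre[OF paths _ _ k(2)] k by (simp add: take_restrict_to)
      moreover have "\<Phi> f g \<in> paths T" using S paths unfolding approximates_def by blast
      ultimately show "\<Phi> f g \<in> pts T w"
        using k(3) paths_throughI unfolding pts_def by blast
    qed
  next
    assume R: "\<forall>x\<in>pts T u. \<forall>y\<in>pts T v. \<Phi> x y \<in> pts T w"
    show "maps_into T H S u v w"
      unfolding maps_into_def n_def[symmetric]
    proof (intro ballI)
      fix \<sigma> \<rho> \<sigma>' \<tau>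
      assume *: "\<sigma> \<in> set u" "\<rho> \<in> set (extn T H \<sigma> n)" "\<sigma>' \<in> set v" "\<tau> \<in> set (extn T H \<sigma>' n)"
      then have "\<sigma> \<in> compact_nodes T" "\<sigma> \<noteq> []" "\<sigma>' \<in> compact_nodes T" "\<sigma>' \<noteq> []"
        using uv by (auto simp: clopen_code_def)
      then obtain f g where f: "f \<in> paths_through T \<sigma>" "restrict_to f (length \<rho>) = \<rho>" "length \<rho> = length \<sigma> + n"
        and g: "g \<in> paths_through T \<sigma>'" "restrict_to g (length \<tau>) = \<tau>" "length \<tau> = length \<sigma>' + n"
        using extn_path * by metis
      have paths: "f \<in> paths T" "g \<in> paths T" using f g by (auto simp: paths_through_iff)
      obtain k t where k: "k \<le> n" "t \<le> n" "S (t, take k \<rho>, take k \<tau>) \<noteq> 0"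
          "length (concat w) < length (list_decode (S (t, take k \<rho>, take k \<tau>) - 1))"
        using long[OF *] by blast
      have take: "take k \<rho> = restrict_to f k" "take k \<tau> = restrict_to g k"
        using f(2,3) g(2,3) k(1) take_restrict_to[of k "length \<rho>" f] take_restrict_to[of k "length \<tau>" g] by simp_all
      have "\<Phi> f g \<in> pts T w" "\<Phi> f g \<in> paths T"
        using R f(1) g(1) * S paths unfolding approximates_def by (auto simp: pts_def)
      then have "\<exists>\<upsilon>\<in>set w. prefix \<upsilon> (list_decode (S (t, take k \<rho>, take k \<tau>) - 1))"
        using pre[OF paths take k(3)] k(4) in_pts_iff[of "\<Phi> f g" w] by (metis less_imp_le)
      then show "\<exists>k\<le>n. \<exists>t\<le>n. S (t, take k \<rho>, take k \<tau>) \<noteq> 0 \<and>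
          (\<exists>\<upsilon>\<in>set w. prefix \<upsilon> (list_decode (S (t, take k \<rho>, take k \<tau>) - 1)))"
        using k by blast
    qed
  qed
qed

end

section \<open>From Baire presentations to meet groupoids\<close>

type_synonym quad = "nat list list \<times> nat list list \<times> nat list list \<times> nat list list"

abbreviation q_set :: "quad \<Rightarrow> nat list list" where "q_set q \<equiv> fst q"
abbreviation q_inv :: "quad \<Rightarrow> nat list list" where "q_inv q \<equiv> fst (snd q)"
abbreviation q_left :: "quad \<Rightarrow> nat list list" where "q_left q \<equiv> fst (snd (snd q))"
abbreviation q_right :: "quad \<Rightarrow> nat list list" where "q_right q \<equiv> snd (snd (snd q))"

text \<open>
  A compact open coset \<open>A\<close> is coded together with witnesses \<open>A\<^sup>-\<^sup>1\<close>, \<open>A A\<^sup>-\<^sup>1\<close> and \<open>A\<^sup>-\<^sup>1 A\<close> for its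
  being a coset, which makes the codes decidable.
\<close>

definition quad_valid ::
    "nat list set \<Rightarrow> (nat list \<Rightarrow> nat \<Rightarrow> nat) \<Rightarrow> (nat \<times> nat list \<times> nat list \<Rightarrow> nat) \<Rightarrow>
     (nat \<times> nat list \<times> nat list \<Rightarrow> nat) \<Rightarrow> quad \<Rightarrow> bool" where
  "quad_valid T H P J q \<longleftrightarrow> clopen_code T (q_set q) \<and> (q_set q = [] \<or>
     clopen_code T (q_inv q) \<and> clopen_code T (q_left q) \<and> clopen_code T (q_right q) \<and>
     maps_into T H J (q_set q) (q_set q) (q_inv q) \<and> maps_into T H J (q_inv q) (q_inv q) (q_set q) \<and>
     maps_into T H J (q_left q) (q_left q) (q_left q) \<and> maps_into T H P (q_left q) (q_left q) (q_left q) \<and>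
     maps_into T H P (q_left q) (q_set q) (q_set q) \<and> maps_into T H P (q_set q) (q_inv q) (q_left q) \<and>
     maps_into T H J (q_right q) (q_right q) (q_right q) \<and> maps_into T H P (q_right q) (q_right q) (q_right q) \<and>
     maps_into T H P (q_set q) (q_right q) (q_set q) \<and> maps_into T H P (q_inv q) (q_set q) (q_right q))"

definition quad_dom ::
    "nat list set \<Rightarrow> (nat list \<Rightarrow> nat \<Rightarrow> nat) \<Rightarrow> (nat \<times> nat list \<times> nat list \<Rightarrow> nat) \<Rightarrow>
     (nat \<times> nat list \<times> nat list \<Rightarrow> nat) \<Rightarrow> nat \<Rightarrow> bool" where
  "quad_dom T H P J n \<longleftrightarrow> quad_valid T H P J (dec n) \<and>
     (\<forall>m<n. \<not> (quad_valid T H P J (dec m) \<and> same_pts T H (q_set (dec m)) (q_set (dec n))))"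

definition quad_set :: "nat list set \<Rightarrow> nat \<Rightarrow> (nat \<Rightarrow> nat) set" where
  "quad_set T n = pts T (q_set (dec n))"

text \<open>The least valid code of a set is automatically its canonical one, so only
  \<open>quad_valid\<close> is demanded of \<open>m\<close>. The inclusions in both directions say
  that the coded set is the inverse. For \<open>x\<close> outside the domain the condition is
  vacuous.\<close>

definition quad_inv where
  "quad_inv T H P J x = (LEAST m. quad_dom T H P J x \<longrightarrow> quad_valid T H P J (dec m) \<and>
     maps_into T H J (q_set (dec x)) (q_set (dec x)) (q_set (dec m)) \<and>
     maps_into T H J (q_set (dec m)) (q_set (dec m)) (q_set (dec x)))"

definition quad_meet where
  "quad_meet T H P J x y = (LEAST m. quad_dom T H P J x \<and> quad_dom T H P J y \<longrightarrow>
     quad_valid T H P J (dec m) \<and> covered T H (q_set (dec m)) (q_set (dec x)) \<and>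
     covered T H (q_set (dec m)) (q_set (dec y)) \<and>
     inter_covered T H (q_set (dec x)) (q_set (dec y)) (q_set (dec m)))"

definition quad_def where
  "quad_def T H P J x y \<longleftrightarrow> quad_dom T H P J x \<and> quad_dom T H P J y \<and>
     q_set (dec x) \<noteq> [] \<and> q_set (dec y) \<noteq> [] \<and> same_pts T H (q_right (dec x)) (q_left (dec y))"

text \<open>For composable cosets, \<open>A B \<subseteq> C\<close> and
  \<open>A^-1 C \<subseteq> B\<close> together say \<open>C = A B\<close>, see
  \<open>set_mult_eq_iff\<close>. The witness \<open>q_inv\<close> provides the code of
  \<open>A^-1\<close>.\<close>

definition quad_prod where
  "quad_prod T H P J x y = (LEAST m. quad_def T H P J x y \<longrightarrow> quad_valid T H P J (dec m) \<and>
     maps_into T H P (q_set (dec x)) (q_set (dec y)) (q_set (dec m)) \<and>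
     maps_into T H P (q_inv (dec x)) (q_set (dec m)) (q_set (dec y)))"

definition quad_subgroup where
  "quad_subgroup T H P J x \<longleftrightarrow> quad_dom T H P J x \<and> q_set (dec x) \<noteq> [] \<and>
     same_pts T H (q_left (dec x)) (q_set (dec x))"

text \<open>Searches for a complete list, without repetition, of the right cosets of
  \<open>U \<inter> V\<close> in \<open>U\<close>, where \<open>U\<close> and \<open>V\<close> are
  the coded subgroups. The three conditions on \<open>q_left\<close> say that the left group of the
  coset is \<open>U \<inter> V\<close>. The index is the length of the list.\<close>

definition quad_cosets where
  "quad_cosets T H P J x y = (LEAST n. quad_subgroup T H P J x \<and> quad_subgroup T H P J y \<longrightarrow>
     distinct (list_decode n) \<and>
     (\<forall>c\<in>set (list_decode n). quad_dom T H P J c \<and> q_set (dec c) \<noteq> [] \<and>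
        covered T H (q_set (dec c)) (q_set (dec x)) \<and>
        covered T H (q_left (dec c)) (q_set (dec x)) \<and> covered T H (q_left (dec c)) (q_set (dec y)) \<and>
        inter_covered T H (q_set (dec x)) (q_set (dec y)) (q_left (dec c))) \<and>
     covered T H (q_set (dec x)) (concat (map (\<lambda>c. q_set (dec c)) (list_decode n))))"

lemma pullback_iso:
  assumes bij: "bij_betw \<beta> D (mg_dom N)"
    and inv: "\<And>A. A \<in> mg_dom N \<Longrightarrow> mg_inv N A \<in> mg_dom N"
    and meet: "\<And>A B. A \<in> mg_dom N \<Longrightarrow> B \<in> mg_dom N \<Longrightarrow> mg_meet N A B \<in> mg_dom N"
    and prod: "\<And>A B C. A \<in> mg_dom N \<Longrightarrow> B \<in> mg_dom N \<Longrightarrow> mg_prod N A B = Some C \<Longrightarrow> C \<in> mg_dom N"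
    and g: "\<And>A. A \<in> mg_dom N \<Longrightarrow> g A \<in> D \<and> \<beta> (g A) = A"
  shows "meet_groupoid_iso \<beta> \<lparr>mg_dom = D, mg_inv = \<lambda>x. g (mg_inv N (\<beta> x)),
     mg_meet = \<lambda>x y. g (mg_meet N (\<beta> x) (\<beta> y)),
     mg_prod = \<lambda>x y. map_option g (mg_prod N (\<beta> x) (\<beta> y))\<rparr> N"
proof -
  define M where "M = \<lparr>mg_dom = D, mg_inv = \<lambda>x. g (mg_inv N (\<beta> x)),
     mg_meet = \<lambda>x y. g (mg_meet N (\<beta> x) (\<beta> y)),
     mg_prod = \<lambda>x y. map_option g (mg_prod N (\<beta> x) (\<beta> y))\<rparr>"
  have M: "mg_dom M = D" "mg_inv M x = g (mg_inv N (\<beta> x))" "mg_meet M x y = g (mg_meet N (\<beta> x) (\<beta> y))"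
    "mg_prod M x y = map_option g (mg_prod N (\<beta> x) (\<beta> y))" for x y
    by (simp_all add: M_def)
  have \<beta>: "\<beta> x \<in> mg_dom N" if "x \<in> D" for x
    using bij that by (auto simp: bij_betw_def)
  have "set_option (map_option g z) \<subseteq> D \<and> map_option \<beta> (map_option g z) = z"
    if "x \<in> D" "y \<in> D" "z = mg_prod N (\<beta> x) (\<beta> y)" for x y z
  proof (cases z)
    case (Some C)
    then have "C \<in> mg_dom N" using prod[OF \<beta> \<beta>] that by simp
    with g Some show ?thesis by simp
  qed simp
  then have "meet_groupoid_iso \<beta> M N"
    unfolding meet_groupoid_iso_def M using bij \<beta> g inv meet by simp
  then show ?thesis by (simp only: M_def)
qed

text \<open>Inversion is treated as a binary map that ignores its second argument, so
  \<open>maps_into\<close> serves for both operations.\<close>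

locale baire = top_group B "path_space T" + bounded_tree T H
  for B :: "(nat \<Rightarrow> nat) monoid" (structure) and T and H +
  fixes P J :: "nat \<times> nat list \<times> nat list \<Rightarrow> nat"
  assumes P: "approximates T P (\<lambda>x y. x \<otimes> y)" and J: "approximates T J (\<lambda>x y. inv x)"
begin

lemma carrier_eq: "carrier B = paths T"
  using topspace_eq by simp

lemma pts_compact_open: "clopen_code T u \<Longrightarrow> compact_open (pts T u)"
  by (simp add: compact_open_def pts_compact pts_open)

lemma pts_carrier: "pts T u \<subseteq> carrier B"
  using pts_subset carrier_eq by simp

lemma maps_into_mult:
  "clopen_code T u \<Longrightarrow> clopen_code T v \<Longrightarrow>
     maps_into T H P u v w \<longleftrightarrow> (\<forall>x\<in>pts T u. \<forall>y\<in>pts T v. x \<otimes> y \<in> pts T w)"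
  by (rule maps_into_iff[OF P])

lemma maps_into_inv:
  "clopen_code T u \<Longrightarrow> maps_into T H J u u w \<longleftrightarrow> (\<forall>x\<in>pts T u. inv x \<in> pts T w)"
  using maps_into_iff[OF J, of u u w] by blast

text \<open>Let \<open>A\<close> and \<open>L\<close> be the sets coded by \<open>q_set\<close> and
  \<open>q_left\<close>. From \<open>A A^-1 \<subseteq> L\<close> and
  \<open>L A \<subseteq> A\<close> follows closure of \<open>A\<close> under
  \<open>x y^-1 z\<close>. For \<open>a\<close> in \<open>A\<close>, each \<open>l\<close> in
  \<open>L\<close> is \<open>(l a) a^-1\<close>, so \<open>L\<close> is no larger than
  \<open>A A^-1\<close>; similarly on the right.\<close>

lemma quad_valid_coset:
  assumes "quad_valid T H P J q" "q_set q \<noteq> []"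
  shows "is_coset (pts T (q_set q))" "pts T (q_inv q) = set_inv (pts T (q_set q))"
    "pts T (q_left q) = lgrp (pts T (q_set q))" "pts T (q_right q) = rgrp (pts T (q_set q))"
    "clopen_code T (q_inv q)" "clopen_code T (q_left q)" "clopen_code T (q_right q)"
proof -
  obtain u v l r where q: "q = (u, v, l, r)" by (metis prod.collapse)
  let ?u = "pts T u" and ?v = "pts T v" and ?l = "pts T l" and ?r = "pts T r"
  have cc: "clopen_code T u" "clopen_code T v" "clopen_code T l" "clopen_code T r"
    using assms by (auto simp: quad_valid_def q)
  then show "clopen_code T (q_inv q)" "clopen_code T (q_left q)" "clopen_code T (q_right q)"
    by (simp_all add: q)
  note iffs = maps_into_mult[OF cc(1) cc(2)] maps_into_mult[OF cc(3) cc(3)] maps_into_mult[OF cc(3) cc(1)]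
    maps_into_mult[OF cc(4) cc(4)] maps_into_mult[OF cc(1) cc(4)] maps_into_mult[OF cc(2) cc(1)]
    maps_into_inv[OF cc(1)] maps_into_inv[OF cc(2)] maps_into_inv[OF cc(3)] maps_into_inv[OF cc(4)]
  have *: "\<And>x. x \<in> ?u \<Longrightarrow> inv x \<in> ?v" "\<And>x. x \<in> ?v \<Longrightarrow> inv x \<in> ?u"
      "\<And>x. x \<in> ?l \<Longrightarrow> inv x \<in> ?l" "\<And>x y. x \<in> ?l \<Longrightarrow> y \<in> ?l \<Longrightarrow> x \<otimes> y \<in> ?l"
      "\<And>x y. x \<in> ?l \<Longrightarrow> y \<in> ?u \<Longrightarrow> x \<otimes> y \<in> ?u" "\<And>x y. x \<in> ?u \<Longrightarrow> y \<in> ?v \<Longrightarrow> x \<otimes> y \<in> ?l"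
      "\<And>x. x \<in> ?r \<Longrightarrow> inv x \<in> ?r" "\<And>x y. x \<in> ?r \<Longrightarrow> y \<in> ?r \<Longrightarrow> x \<otimes> y \<in> ?r"
      "\<And>x y. x \<in> ?u \<Longrightarrow> y \<in> ?r \<Longrightarrow> x \<otimes> y \<in> ?u" "\<And>x y. x \<in> ?v \<Longrightarrow> y \<in> ?u \<Longrightarrow> x \<otimes> y \<in> ?r"
    using assms unfolding quad_valid_def q fst_conv snd_conv iffs by blast+
  note [simp] = subsetD[OF pts_carrier]
  have "?u \<noteq> {}" using assms(2) pts_empty_iff[OF cc(1)] by (simp add: q)
  then show coset: "is_coset (pts T (q_set q))"
    using * pts_carrier by (simp add: q is_coset_def)
  have "x \<in> set_inv ?u" if "x \<in> ?v" for x
    using *(2)[OF that] that unfolding SET_INV_def by (auto intro!: bexI[of _ "inv x"])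
  then show "pts T (q_inv q) = set_inv (pts T (q_set q))"
    using *(1) by (auto simp: q SET_INV_def)
  obtain a where a: "a \<in> ?u" using \<open>?u \<noteq> {}\<close> by blast
  have "x \<in> lgrp ?u" if "x \<in> ?l" for x
  proof -
    have "x = (x \<otimes> a) \<otimes> inv a" using a that by (simp add: mult_inv_cancel)
    then show ?thesis using *(5)[OF that a] a unfolding lgrp_def by blast
  qed
  then show "pts T (q_left q) = lgrp (pts T (q_set q))"
    using *(1,6) by (auto simp: q lgrp_def)
  have "x \<in> rgrp ?u" if "x \<in> ?r" for x
  proof -
    have "x = inv a \<otimes> (a \<otimes> x)" using a that by (simp add: mult_inv_cancel)
    then show ?thesis using *(9)[OF a that] a unfolding rgrp_def by blast
  qed
  then show "pts T (q_right q) = rgrp (pts T (q_set q))"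
    using *(1,10) by (auto simp: q rgrp_def)
qed

lemma quad_valid_exists:
  assumes "A \<in> mg_dom mg"
  obtains q where "quad_valid T H P J q" "pts T (q_set q) = A"
proof (cases "A = {}")
  case True
  have "quad_valid T H P J ([], [], [], [])"
    by (simp add: quad_valid_def clopen_code_def)
  with True that[of "([], [], [], [])"] show ?thesis by (simp add: pts_def)
next
  case False
  then have A: "compact_open A" "is_coset A" using assms by (auto simp: mg_dom_iff)
  then have "compact_open (set_inv A)" "compact_open (lgrp A)" "compact_open (rgrp A)"
    using compact_open_set_inv compact_open_lgrp compact_open_rgrp by blast+
  then obtain u v l r where cc: "clopen_code T u" "clopen_code T v" "clopen_code T l" "clopen_code T r"
    and eq: "pts T u = A" "pts T v = set_inv A" "pts T l = lgrp A" "pts T r = rgrp A"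
    using A(1) compact_open_code unfolding compact_open_def by metis
  note [simp] = subsetD[OF is_coset_subset[OF A(2)]]
  have L: "subgroup (lgrp A) B" and R: "subgroup (rgrp A) B"
    using lgrp_subgroup rgrp_subgroup A by blast+
  have 1: "\<forall>x\<in>lgrp A. \<forall>y\<in>A. x \<otimes> y \<in> A"
    using is_coset_closed[OF A(2)] by (auto simp: lgrp_def)
  have 2: "\<forall>x\<in>A. \<forall>y\<in>rgrp A. x \<otimes> y \<in> A"
    using is_coset_closed[OF A(2)] by (auto simp: rgrp_def simp flip: m_assoc)
  have 3: "\<forall>x\<in>A. \<forall>y\<in>set_inv A. x \<otimes> y \<in> lgrp A" "\<forall>x\<in>set_inv A. \<forall>y\<in>A. x \<otimes> y \<in> rgrp A"
    by (auto simp: SET_INV_def lgrp_def rgrp_def)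
  have 4: "\<forall>x\<in>A. inv x \<in> set_inv A" "\<forall>x\<in>set_inv A. inv x \<in> A"
    by (auto simp: SET_INV_def)
  have "quad_valid T H P J (u, v, l, r)"
    unfolding quad_valid_def fst_conv snd_conv
      maps_into_mult[OF cc(1) cc(2)] maps_into_mult[OF cc(3) cc(3)] maps_into_mult[OF cc(3) cc(1)]
      maps_into_mult[OF cc(4) cc(4)] maps_into_mult[OF cc(1) cc(4)] maps_into_mult[OF cc(2) cc(1)]
      maps_into_inv[OF cc(1)] maps_into_inv[OF cc(2)] maps_into_inv[OF cc(3)] maps_into_inv[OF cc(4)] eq
    using cc 1 2 3 4 subgroup.m_closed[OF L] subgroup.m_closed[OF R]
      subgroup.m_inv_closed[OF L] subgroup.m_inv_closed[OF R] by blast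
  with that[of "(u, v, l, r)"] eq show ?thesis by simp
qed

lemma quad_set_dom:
  assumes "quad_valid T H P J (dec n)"
  shows "quad_set T n \<in> mg_dom mg"
  using assms quad_valid_coset[OF assms] pts_compact_open
  unfolding quad_set_def mg_dom_iff by (metis quad_valid_def UN_empty list.set(1) pts_def)

text \<open>\<open>R\<close> stands for a decidable reformulation, valid for valid codes, of having
  \<open>A\<close> as the coded set. The least solution of the search is then the canonical code of
  \<open>A\<close>.\<close>

lemma quad_least:
  assumes A: "A \<in> mg_dom mg"
    and R: "\<And>m. quad_valid T H P J (dec m) \<Longrightarrow> R m \<longleftrightarrow> quad_set T m = A"
  defines "n \<equiv> LEAST m. quad_valid T H P J (dec m) \<and> R m"
  shows "quad_dom T H P J n" "quad_set T n = A"
    "\<And>m. quad_dom T H P J m \<Longrightarrow> quad_set T m = A \<Longrightarrow> m = n"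
proof -
  obtain q where "quad_valid T H P J q" "pts T (q_set q) = A"
    using quad_valid_exists[OF A] by metis
  then have "quad_valid T H P J (dec (enc q))" "quad_set T (enc q) = A"
    by (simp_all add: quad_set_def)
  then have ex: "\<exists>m. quad_valid T H P J (dec m) \<and> R m" using R by blast
  then have n: "quad_valid T H P J (dec n)" "R n"
    unfolding n_def by (metis (mono_tags, lifting) LeastI_ex)+
  then show set: "quad_set T n = A" using R by blast
  have least: "n \<le> m" if "quad_valid T H P J (dec m)" "quad_set T m = A" for m
    unfolding n_def by (rule Least_le) (use that R in blast)
  have same: "same_pts T H (q_set (dec m)) (q_set (dec m')) \<longleftrightarrow> quad_set T m = quad_set T m'"
    if "quad_valid T H P J (dec m)" "quad_valid T H P J (dec m')" for m m'
    using that same_pts_iff by (simp add: quad_valid_def quad_set_def)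
  show "quad_dom T H P J n"
    unfolding quad_dom_def using n(1) same least set by (metis not_less)
  show "m = n" if "quad_dom T H P J m" "quad_set T m = A" for m
    using that n(1) same least[of m] set unfolding quad_dom_def
    by (metis le_neq_implies_less)
qed

lemma quad_bij: "bij_betw (quad_set T) {n. quad_dom T H P J n} (mg_dom mg)"
proof (rule bij_betw_imageI)
  show "inj_on (quad_set T) {n. quad_dom T H P J n}"
  proof (rule inj_onI)
    fix x y assume *: "x \<in> {n. quad_dom T H P J n}" "y \<in> {n. quad_dom T H P J n}" "quad_set T x = quad_set T y"
    then have "quad_set T x \<in> mg_dom mg" using quad_set_dom by (simp add: quad_dom_def)
    note eq = quad_least(3)[OF this, of "\<lambda>m. quad_set T m = quad_set T x"]
    show "x = y"
      using eq[of x] eq[of y] * by (metis (no_types, lifting) mem_Collect_eq)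
  qed
  show "quad_set T ` {n. quad_dom T H P J n} = mg_dom mg"
  proof (intro equalityI subsetI)
    fix A assume "A \<in> mg_dom mg"
    from quad_least(1,2)[OF this, of "\<lambda>m. quad_set T m = A"] show "A \<in> quad_set T ` {n. quad_dom T H P J n}"
      by (metis (no_types, lifting) imageI mem_Collect_eq)
  qed (use quad_set_dom in \<open>auto simp: quad_dom_def\<close>)
qed

section \<open>The copy of the meet groupoid and the correctness of the searches\<close>

definition pick :: "(nat \<Rightarrow> nat) set \<Rightarrow> nat" where
  "pick A = (LEAST m. quad_valid T H P J (dec m) \<and> quad_set T m = A)"

lemma pick:
  assumes "A \<in> mg_dom mg"
  shows "quad_dom T H P J (pick A)" "quad_set T (pick A) = A"
  using quad_least(1,2)[OF assms, of "\<lambda>m. quad_set T m = A"] by (simp_all add: pick_def)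

lemma pick_eq:
  assumes A: "A \<in> mg_dom mg" and R: "\<And>m. quad_valid T H P J (dec m) \<Longrightarrow> R m \<longleftrightarrow> quad_set T m = A"
  shows "(LEAST m. quad_valid T H P J (dec m) \<and> R m) = pick A"
  unfolding pick_def using R by metis

lemma pick_exists:
  assumes "A \<in> mg_dom mg" "\<And>m. quad_valid T H P J (dec m) \<Longrightarrow> R m \<longleftrightarrow> quad_set T m = A"
  shows "\<exists>m. quad_valid T H P J (dec m) \<and> R m"
  using pick[OF assms(1)] assms(2) unfolding quad_dom_def by blast

lemma mg_simps: "mg_inv mg A = set_inv A" "mg_meet mg A A' = A \<inter> A'"
  by (simp_all add: meet_groupoid_of_def)

definition copy :: "nat meet_groupoid" where
  "copy = \<lparr>mg_dom = {n. quad_dom T H P J n}, mg_inv = \<lambda>x. pick (mg_inv mg (quad_set T x)),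
     mg_meet = \<lambda>x y. pick (mg_meet mg (quad_set T x) (quad_set T y)),
     mg_prod = \<lambda>x y. map_option pick (mg_prod mg (quad_set T x) (quad_set T y))\<rparr>"

lemma copy_iso: "meet_groupoid_iso (quad_set T) copy mg"
  unfolding copy_def
proof (rule pullback_iso)
  show "bij_betw (quad_set T) {n. quad_dom T H P J n} (mg_dom mg)" by (rule quad_bij)
  show "mg_inv mg A \<in> mg_dom mg" if "A \<in> mg_dom mg" for A
    using mg_inv_closed[OF that] by (simp add: mg_simps)
  show "mg_meet mg A C \<in> mg_dom mg" if "A \<in> mg_dom mg" "C \<in> mg_dom mg" for A C
    using mg_meet_closed[OF that Hausdorff_path_space] by (simp add: mg_simps)
  show "D \<in> mg_dom mg" if "A \<in> mg_dom mg" "C \<in> mg_dom mg" "mg_prod mg A C = Some D" for A C D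
    using mg_prod_closed[OF that] .
  show "pick A \<in> {n. quad_dom T H P J n} \<and> quad_set T (pick A) = A" if "A \<in> mg_dom mg" for A
    using pick[OF that] by blast
qed

lemma quad_dom_valid: "quad_dom T H P J x \<Longrightarrow> quad_valid T H P J (dec x)"
  by (simp add: quad_dom_def)

lemma quad_valid_code: "quad_valid T H P J q \<Longrightarrow> clopen_code T (q_set q)"
  by (simp add: quad_valid_def)

text \<open>The second claim says that the search succeeds, as required by \<open>uc_LEAST\<close>;
  the lemmas on the other operations have the same form.\<close>

lemma quad_inv_eq:
  assumes "quad_dom T H P J x"
  shows "quad_inv T H P J x = mg_inv copy x"
    and "\<exists>m. quad_valid T H P J (dec m) \<and>
     maps_into T H J (q_set (dec x)) (q_set (dec x)) (q_set (dec m)) \<and>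
     maps_into T H J (q_set (dec m)) (q_set (dec m)) (q_set (dec x))"
proof -
  note x = quad_dom_valid[OF assms]
  have "maps_into T H J (q_set (dec x)) (q_set (dec x)) (q_set (dec m)) \<and>
     maps_into T H J (q_set (dec m)) (q_set (dec m)) (q_set (dec x)) \<longleftrightarrow>
     quad_set T m = set_inv (quad_set T x)" if "quad_valid T H P J (dec m)" for m
  proof -
    have eq: "(\<forall>a\<in>A. inv a \<in> C) \<and> (\<forall>c\<in>C. inv c \<in> A) \<longleftrightarrow> C = set_inv A"
      if AC: "A \<subseteq> carrier B" "C \<subseteq> carrier B" for A C
    proof -
      have "c \<in> set_inv A" if "\<forall>c\<in>C. inv c \<in> A" "c \<in> C" for c
      proof -
        have "c = inv (inv c)" using AC that by auto
        then show ?thesis using that unfolding SET_INV_def by blast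
      qed
      moreover have "inv c \<in> A" if "C = set_inv A" "c \<in> C" for c
        using that AC by (auto simp: SET_INV_def)
      ultimately show ?thesis by (auto simp: SET_INV_def)
    qed
    show ?thesis
      unfolding maps_into_inv[OF quad_valid_code[OF that]] maps_into_inv[OF quad_valid_code[OF x]]
        quad_set_def by (rule eq[OF pts_carrier pts_carrier])
  qed
  from pick_eq[OF mg_inv_closed[OF quad_set_dom[OF x]] this] assms
    pick_exists[OF mg_inv_closed[OF quad_set_dom[OF x]] this]
  show "quad_inv T H P J x = mg_inv copy x" "\<exists>m. quad_valid T H P J (dec m) \<and>
     maps_into T H J (q_set (dec x)) (q_set (dec x)) (q_set (dec m)) \<and>
     maps_into T H J (q_set (dec m)) (q_set (dec m)) (q_set (dec x))"
    by (simp_all add: quad_inv_def copy_def mg_simps)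
qed

lemma quad_meet_eq:
  assumes "quad_dom T H P J x" "quad_dom T H P J y"
  shows "quad_meet T H P J x y = mg_meet copy x y"
    and "\<exists>m. quad_valid T H P J (dec m) \<and> covered T H (q_set (dec m)) (q_set (dec x)) \<and>
     covered T H (q_set (dec m)) (q_set (dec y)) \<and>
     inter_covered T H (q_set (dec x)) (q_set (dec y)) (q_set (dec m))"
proof -
  note x = quad_dom_valid[OF assms(1)] quad_dom_valid[OF assms(2)]
  have "covered T H (q_set (dec m)) (q_set (dec x)) \<and> covered T H (q_set (dec m)) (q_set (dec y)) \<and>
     inter_covered T H (q_set (dec x)) (q_set (dec y)) (q_set (dec m)) \<longleftrightarrow>
     quad_set T m = quad_set T x \<inter> quad_set T y" if "quad_valid T H P J (dec m)" for m
    unfolding covered_iff[OF quad_valid_code[OF that]] inter_covered_iff[OF quad_valid_code[OF x(1)]] quad_set_def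
    by blast
  from pick_eq[OF mg_meet_closed[OF quad_set_dom[OF x(1)] quad_set_dom[OF x(2)] Hausdorff_path_space] this] assms
    pick_exists[OF mg_meet_closed[OF quad_set_dom[OF x(1)] quad_set_dom[OF x(2)] Hausdorff_path_space] this]
  show "quad_meet T H P J x y = mg_meet copy x y"
    "\<exists>m. quad_valid T H P J (dec m) \<and> covered T H (q_set (dec m)) (q_set (dec x)) \<and>
     covered T H (q_set (dec m)) (q_set (dec y)) \<and>
     inter_covered T H (q_set (dec x)) (q_set (dec y)) (q_set (dec m))"
    by (simp_all add: quad_meet_def copy_def mg_simps)
qed

lemma quad_set_empty_iff: "quad_valid T H P J (dec x) \<Longrightarrow> quad_set T x = {} \<longleftrightarrow> q_set (dec x) = []"
  by (simp add: quad_set_def pts_empty_iff quad_valid_code)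

lemma quad_def_iff:
  assumes "quad_dom T H P J x" "quad_dom T H P J y"
  shows "quad_def T H P J x y \<longleftrightarrow>
    quad_set T x \<noteq> {} \<and> quad_set T y \<noteq> {} \<and> rgrp (quad_set T x) = lgrp (quad_set T y)"
proof -
  note x = quad_dom_valid[OF assms(1)] quad_dom_valid[OF assms(2)]
  have "same_pts T H (q_right (dec x)) (q_left (dec y)) \<longleftrightarrow> rgrp (quad_set T x) = lgrp (quad_set T y)"
    if "q_set (dec x) \<noteq> []" "q_set (dec y) \<noteq> []"
    using quad_valid_coset[OF x(1) that(1)] quad_valid_coset[OF x(2) that(2)]
    by (simp add: same_pts_iff quad_set_def)
  then show ?thesis
    using assms quad_set_empty_iff x by (auto simp: quad_def_def)
qed

lemma quad_prod_eq:
  assumes "quad_dom T H P J x" "quad_dom T H P J y"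
  shows "mg_prod copy x y = (if quad_def T H P J x y then Some (quad_prod T H P J x y) else None) \<and>
    (\<exists>m. quad_def T H P J x y \<longrightarrow> quad_valid T H P J (dec m) \<and>
     maps_into T H P (q_set (dec x)) (q_set (dec y)) (q_set (dec m)) \<and>
     maps_into T H P (q_inv (dec x)) (q_set (dec m)) (q_set (dec y)))"
proof -
  note x = quad_dom_valid[OF assms(1)] quad_dom_valid[OF assms(2)]
  note xm = quad_set_dom[OF x(1)] quad_set_dom[OF x(2)]
  show ?thesis
  proof (cases "quad_def T H P J x y")
    case True
    then have d: "quad_set T x \<noteq> {}" "quad_set T y \<noteq> {}" "rgrp (quad_set T x) = lgrp (quad_set T y)"
      using quad_def_iff[OF assms] by auto
    then have coset: "is_coset (quad_set T x)" "is_coset (quad_set T y)"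
      using xm by (auto simp: mg_dom_iff)
    have prod: "mg_prod mg (quad_set T x) (quad_set T y) = Some (quad_set T x <#> quad_set T y)"
      using mg_prod_iff[OF xm] d by simp
    have ne: "q_set (dec x) \<noteq> []" using d(1) quad_set_empty_iff x by blast
    have "maps_into T H P (q_set (dec x)) (q_set (dec y)) (q_set (dec m)) \<and>
        maps_into T H P (q_inv (dec x)) (q_set (dec m)) (q_set (dec y)) \<longleftrightarrow>
        quad_set T m = quad_set T x <#> quad_set T y" if m: "quad_valid T H P J (dec m)" for m
    proof -
      have "(\<forall>a\<in>pts T (q_inv (dec x)). \<forall>c\<in>C. a \<otimes> c \<in> D) \<longleftrightarrow> (\<forall>a\<in>quad_set T x. \<forall>c\<in>C. inv a \<otimes> c \<in> D)" for C D
        unfolding quad_valid_coset(2)[OF x(1) ne] by (auto simp: SET_INV_def quad_set_def)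
      moreover have "quad_set T m \<subseteq> carrier B" by (simp add: quad_set_def pts_carrier)
      ultimately show ?thesis
        unfolding maps_into_mult[OF quad_valid_code[OF x(1)] quad_valid_code[OF x(2)]]
          maps_into_mult[OF quad_valid_coset(5)[OF x(1) ne] quad_valid_code[OF m]]
        using set_mult_eq_iff[OF coset d(3), of "quad_set T m"] by (simp add: quad_set_def)
    qed
    from pick_eq[OF mg_prod_closed[OF xm prod] this] pick_exists[OF mg_prod_closed[OF xm prod] this] True
    show ?thesis
      by (simp add: quad_prod_def copy_def prod)
  next
    case False
    then show ?thesis
      using mg_prod_iff[OF xm] quad_def_iff[OF assms] by (auto simp: copy_def)
  qed
qed

lemma quad_subgroup_iff:
  assumes "quad_dom T H P J x"
  shows "quad_subgroup T H P J x \<longleftrightarrow> subgroup (quad_set T x) B"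
proof -
  note x = quad_dom_valid[OF assms]
  have "same_pts T H (q_left (dec x)) (q_set (dec x)) \<longleftrightarrow> lgrp (quad_set T x) = quad_set T x"
    if "q_set (dec x) \<noteq> []"
    using quad_valid_coset[OF x that] by (simp add: same_pts_iff quad_set_def quad_valid_code[OF x])
  moreover have "subgroup (quad_set T x) B" if "q_set (dec x) \<noteq> []" "lgrp (quad_set T x) = quad_set T x"
    using lgrp_subgroup[of "quad_set T x"] quad_valid_coset(1)[OF x that(1)] that(2) by (simp add: quad_set_def)
  ultimately show ?thesis
    using assms subgroup_is_coset[of "quad_set T x"] quad_set_empty_iff[OF x] is_coset_def[of "quad_set T x"]
    unfolding quad_subgroup_def by metis
qed

text \<open>Canonical codes turn a repetition-free list of numbers into one of cosets. Cosets of the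
  same subgroup with a common point are equal, so a list covering \<open>U\<close> misses none.
  Finiteness of the index, from compactness, gives existence.\<close>

lemma quad_cosets_length:
  assumes dom: "quad_dom T H P J x" "quad_dom T H P J y"
    and sub: "subgroup (quad_set T x) B" "subgroup (quad_set T y) B"
  shows "length (list_decode (quad_cosets T H P J x y)) =
      group_index B (quad_set T x) (quad_set T x \<inter> quad_set T y)"
    and "\<exists>n. distinct (list_decode n) \<and>
     (\<forall>c\<in>set (list_decode n). quad_dom T H P J c \<and> q_set (dec c) \<noteq> [] \<and>
        covered T H (q_set (dec c)) (q_set (dec x)) \<and>
        covered T H (q_left (dec c)) (q_set (dec x)) \<and> covered T H (q_left (dec c)) (q_set (dec y)) \<and>
        inter_covered T H (q_set (dec x)) (q_set (dec y)) (q_left (dec c))) \<and>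
     covered T H (q_set (dec x)) (concat (map (\<lambda>c. q_set (dec c)) (list_decode n)))"
proof -
  define U W where "U = quad_set T x" and "W = quad_set T x \<inter> quad_set T y"
  have "subgroup W B" unfolding W_def using sub by (rule subgroups_Inter_pair)
  have UW: "subgroup U B" "W \<subseteq> U" "compact_open U" "compact_open W"
    using sub(1) quad_set_dom[OF quad_dom_valid[OF dom(1)]] quad_set_dom[OF quad_dom_valid[OF dom(2)]]
      mg_meet_closed[OF _ _ Hausdorff_path_space, of "quad_set T x" "quad_set T y"]
      subgroup.one_closed[OF sub(1)] subgroup.one_closed[OF sub(2)]
    by (auto simp: U_def W_def mg_dom_iff)
  let ?R = "rcosets\<^bsub>B\<lparr>carrier := U\<rparr>\<^esub> W"
  have R: "A \<in> ?R \<longleftrightarrow> is_coset A \<and> A \<subseteq> U \<and> lgrp A = W" for A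
    by (rule subgroup_Int_rcosets[OF UW(1) \<open>subgroup W B\<close> UW(2)])
  have fin: "finite ?R"
    by (rule finite_rcosets[OF UW(1,3) \<open>subgroup W B\<close> UW(4,2)])
  define good where "good n \<longleftrightarrow> distinct (list_decode n) \<and>
     (\<forall>c\<in>set (list_decode n). quad_dom T H P J c \<and> q_set (dec c) \<noteq> [] \<and>
        covered T H (q_set (dec c)) (q_set (dec x)) \<and>
        covered T H (q_left (dec c)) (q_set (dec x)) \<and> covered T H (q_left (dec c)) (q_set (dec y)) \<and>
        inter_covered T H (q_set (dec x)) (q_set (dec y)) (q_left (dec c))) \<and>
     covered T H (q_set (dec x)) (concat (map (\<lambda>c. q_set (dec c)) (list_decode n)))" for n
  note cx = quad_valid_code[OF quad_dom_valid[OF dom(1)]]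
  have member: "q_set (dec c) \<noteq> [] \<and> covered T H (q_set (dec c)) (q_set (dec x)) \<and>
        covered T H (q_left (dec c)) (q_set (dec x)) \<and> covered T H (q_left (dec c)) (q_set (dec y)) \<and>
        inter_covered T H (q_set (dec x)) (q_set (dec y)) (q_left (dec c)) \<longleftrightarrow> quad_set T c \<in> ?R"
    if c: "quad_dom T H P J c" for c
  proof (cases "q_set (dec c) = []")
    case True
    then have "quad_set T c = {}" by (simp add: quad_set_def pts_def)
    then show ?thesis using True unfolding R by (auto simp: is_coset_def)
  next
    case False
    note v = quad_valid_coset[OF quad_dom_valid[OF c] False]
    show ?thesis
      unfolding R inter_covered_iff[OF cx] covered_iff[OF v(6)]
        covered_iff[OF quad_valid_code[OF quad_dom_valid[OF c]]] v(3)
      using False v(1) by (auto simp: quad_set_def U_def W_def)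
  qed
  have union: "pts T (concat (map (\<lambda>c. q_set (dec c)) cs)) = (\<Union>c\<in>set cs. quad_set T c)" for cs
    by (auto simp: pts_def quad_set_def)
  have good_iff: "good n \<longleftrightarrow> distinct (list_decode n) \<and>
      (\<forall>c\<in>set (list_decode n). quad_dom T H P J c \<and> quad_set T c \<in> ?R) \<and>
      U \<subseteq> (\<Union>c\<in>set (list_decode n). quad_set T c)" for n
    unfolding good_def covered_iff[OF cx, of "concat _"] union U_def[symmetric] quad_set_def[symmetric]
    using member by blast
  have ex: "\<exists>n. good n"
  proof -
    have Rdom: "A \<in> mg_dom mg" if "A \<in> ?R" for A
      using that R[of A] compact_open_r_coset[OF _ UW(4)] subgroup.mem_carrier[OF UW(1)]
      by (auto simp: mg_dom_iff RCOSETS_def r_coset_def)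
    obtain cs where cs: "set cs = pick ` ?R" "distinct cs"
      using fin finite_distinct_list by (metis finite_imageI)
    have "U \<subseteq> (\<Union>c\<in>set cs. quad_set T c)"
    proof
      fix a assume a: "a \<in> U"
      then have "W #> a \<in> ?R" "a \<in> W #> a"
        using r_coset_in_rcosets[OF UW(1) \<open>subgroup W B\<close>] by blast+
      then show "a \<in> (\<Union>c\<in>set cs. quad_set T c)"
        using pick(2)[OF Rdom] cs(1) by force
    qed
    then have "good (list_encode cs)"
      unfolding good_iff using cs pick Rdom by auto
    then show ?thesis by blast
  qed
  have "quad_cosets T H P J x y = (LEAST n. good n)"
    unfolding quad_cosets_def good_def
    using quad_subgroup_iff[OF dom(1)] quad_subgroup_iff[OF dom(2)] sub by simp
  then have "good (quad_cosets T H P J x y)" using LeastI_ex[OF ex] by simp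
  then have g: "distinct (list_decode (quad_cosets T H P J x y))"
      "\<And>c. c \<in> set (list_decode (quad_cosets T H P J x y)) \<Longrightarrow> quad_dom T H P J c \<and> quad_set T c \<in> ?R"
      "U \<subseteq> (\<Union>c\<in>set (list_decode (quad_cosets T H P J x y)). quad_set T c)"
    unfolding good_iff by auto
  let ?C = "set (list_decode (quad_cosets T H P J x y))"
  have "quad_set T ` ?C = ?R"
  proof
    show "quad_set T ` ?C \<subseteq> ?R" using g(2) by blast
    show "?R \<subseteq> quad_set T ` ?C"
    proof
      fix A assume "A \<in> ?R"
      then have A: "is_coset A" "A \<subseteq> U" "lgrp A = W" using R by auto
      then obtain a where "a \<in> A" by (auto simp: is_coset_def)
      then obtain c where c: "c \<in> ?C" "a \<in> quad_set T c" using g(3) A(2) by blast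
      then have "is_coset (quad_set T c)" "lgrp (quad_set T c) = W" using g(2) R by auto
      then have "A = quad_set T c"
        using is_coset_r_coset[OF A(1) \<open>a \<in> A\<close>] is_coset_r_coset[of "quad_set T c" a] A(3) c(2) by simp
      then show "A \<in> quad_set T ` ?C" using c(1) by blast
    qed
  qed
  moreover have "inj_on (quad_set T) ?C"
    by (rule inj_on_subset[OF bij_betw_imp_inj_on[OF quad_bij]]) (use g(2) in blast)
  ultimately have "card ?R = card ?C" using card_image[of "quad_set T" ?C] by simp
  then show "length (list_decode (quad_cosets T H P J x y)) =
      group_index B (quad_set T x) (quad_set T x \<inter> quad_set T y)"
    using distinct_card[OF g(1)] by (simp add: group_index_def U_def W_def)
  from ex show "\<exists>n. distinct (list_decode n) \<and>
     (\<forall>c\<in>set (list_decode n). quad_dom T H P J c \<and> q_set (dec c) \<noteq> [] \<and>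
        covered T H (q_set (dec c)) (q_set (dec x)) \<and>
        covered T H (q_left (dec c)) (q_set (dec x)) \<and> covered T H (q_left (dec c)) (q_set (dec y)) \<and>
        inter_covered T H (q_set (dec x)) (q_set (dec y)) (q_left (dec c))) \<and>
     covered T H (q_set (dec x)) (concat (map (\<lambda>c. q_set (dec c)) (list_decode n)))"
    unfolding good_def .
qed

end

section \<open>Coded strings, and partial functions with a decidable domain\<close>

lemma dec_nat_list: "(dec n :: nat list) = list_decode n"
  by (metis dec_enc enc_nat_list list_decode_inverse)

context uniform
begin

lemma uc_list_decode [uc_intros]: "uc f \<Longrightarrow> uc (\<lambda>i x. list_decode (f i x))"
  unfolding dec_nat_list[symmetric] by (rule uc_dec)

lemma uc_list_encode [uc_intros]:
  fixes f :: "'i \<Rightarrow> 'a::coded \<Rightarrow> nat list"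
  shows "uc f \<Longrightarrow> uc (\<lambda>i x. list_encode (f i x))"
  unfolding enc_nat_list[symmetric] by (rule uc_enc)

text \<open>Undefinedness is produced by a search whose condition ignores the candidate: it ends at
  \<open>0\<close> if \<open>P\<close> holds and never otherwise. The program for \<open>f\<close>
  is run after this search.\<close>

lemma upc_restrict:
  fixes f :: "'i \<Rightarrow> 'a::coded_surj \<Rightarrow> 'b::coded"
  assumes "uc P" "uc f"
  shows "upc (\<lambda>i n. if P i (dec n) then Some (enc (f i (dec n))) else None)"
proof -
  have "uc (\<lambda>i z. \<not> P i (dec (fst (z :: nat \<times> nat))))"
    by (intro uc_intros uc_compose[OF assms(1)])
  note min = upc_min[OF uc_surj_upc[OF this]]
  have f: "upc (\<lambda>i n. Some (enc (f i (dec (fst (prod_decode n))))))"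
    using upc_comp[OF uc_surj_upc[OF assms(2)] upc_eval[of Code_Fst]] by simp
  obtain d where d: "\<And>x. eval d x = Some x" by (metis obtain_id_code)
  note pair = upc_pair[OF upc_eval[of d] min]
  show ?thesis
    by (rule upc_cong[OF upc_comp[OF f pair]]) (auto simp: d dec_nat_pair Least_equality)
qed

end

lemma meet_groupoid_iso_comp:
  assumes "meet_groupoid_iso \<beta> M N" "meet_groupoid_iso \<gamma> N K"
  shows "meet_groupoid_iso (\<gamma> \<circ> \<beta>) M K"
proof -
  have \<beta>: "\<beta> x \<in> mg_dom N" if "x \<in> mg_dom M" for x
    using assms(1) that unfolding meet_groupoid_iso_def by (metis bij_betwE)
  have "bij_betw (\<gamma> \<circ> \<beta>) (mg_dom M) (mg_dom K)"
    using assms unfolding meet_groupoid_iso_def by (meson bij_betw_trans)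
  with \<beta> assms show ?thesis
    unfolding meet_groupoid_iso_def by (simp add: option.map_comp[symmetric] flip: option.map_comp)
qed

section \<open>Transfer along isomorphisms of topological groups\<close>

locale top_group_iso = G: top_group G X + B: top_group B Y
  for G :: "('a, 'b) monoid_scheme" and X and B :: "('c, 'd) monoid_scheme" and Y +
  fixes g :: "'c \<Rightarrow> 'a"
  assumes iso: "g \<in> iso B G" and homeo: "homeomorphic_map Y X g" and Hausdorff: "Hausdorff_space Y"
begin

sublocale gh: group_hom B G g
  using iso by (unfold_locales) (auto simp: iso_def)

lemma inj: "inj_on g (carrier B)" and surj: "g ` carrier B = carrier G"
  using iso by (auto simp: iso_def bij_betw_def)

lemma image_eq_iff: "A \<subseteq> carrier B \<Longrightarrow> C \<subseteq> carrier B \<Longrightarrow> g ` A = g ` C \<longleftrightarrow> A = C"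
  using inj by (rule inj_on_image_eq_iff)

lemma image_mem_iff: "A \<subseteq> carrier B \<Longrightarrow> x \<in> carrier B \<Longrightarrow> g x \<in> g ` A \<longleftrightarrow> x \<in> A"
  using inj by (rule inj_on_image_mem_iff)

lemma image_is_coset:
  assumes "A \<subseteq> carrier B"
  shows "G.is_coset (g ` A) \<longleftrightarrow> B.is_coset A"
proof -
  note [simp] = subsetD[OF assms]
  have "g x \<otimes>\<^bsub>G\<^esub> inv\<^bsub>G\<^esub> g y \<otimes>\<^bsub>G\<^esub> g z \<in> g ` A \<longleftrightarrow> x \<otimes>\<^bsub>B\<^esub> inv\<^bsub>B\<^esub> y \<otimes>\<^bsub>B\<^esub> z \<in> A"
    if "x \<in> A" "y \<in> A" "z \<in> A" for x y z
  proof -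
    have "g x \<otimes>\<^bsub>G\<^esub> inv\<^bsub>G\<^esub> g y \<otimes>\<^bsub>G\<^esub> g z = g (x \<otimes>\<^bsub>B\<^esub> inv\<^bsub>B\<^esub> y \<otimes>\<^bsub>B\<^esub> z)"
      using that by simp
    moreover have "x \<otimes>\<^bsub>B\<^esub> inv\<^bsub>B\<^esub> y \<otimes>\<^bsub>B\<^esub> z \<in> carrier B" using that by simp
    ultimately show ?thesis by (simp only: image_mem_iff[OF assms])
  qed
  then show ?thesis
    unfolding G.is_coset_def B.is_coset_def using assms surj by auto
qed

lemma image_lgrp: "A \<subseteq> carrier B \<Longrightarrow> G.lgrp (g ` A) = g ` B.lgrp A"
proof -
  assume "A \<subseteq> carrier B"
  note [simp] = subsetD[OF this]
  have eq: "g (x \<otimes>\<^bsub>B\<^esub> inv\<^bsub>B\<^esub> y) = g x \<otimes>\<^bsub>G\<^esub> inv\<^bsub>G\<^esub> g y" if "x \<in> A" "y \<in> A" for x y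
    using that by simp
  have "G.lgrp (g ` A) = {g x \<otimes>\<^bsub>G\<^esub> inv\<^bsub>G\<^esub> g y |x y. x \<in> A \<and> y \<in> A}"
    unfolding G.lgrp_def by blast
  also have "\<dots> = {g (x \<otimes>\<^bsub>B\<^esub> inv\<^bsub>B\<^esub> y) |x y. x \<in> A \<and> y \<in> A}"
    by (intro Collect_cong) (metis eq)
  also have "\<dots> = g ` B.lgrp A"
    unfolding B.lgrp_def by blast
  finally show ?thesis .
qed

lemma image_rgrp: "A \<subseteq> carrier B \<Longrightarrow> G.rgrp (g ` A) = g ` B.rgrp A"
proof -
  assume "A \<subseteq> carrier B"
  note [simp] = subsetD[OF this]
  have eq: "g (inv\<^bsub>B\<^esub> x \<otimes>\<^bsub>B\<^esub> y) = inv\<^bsub>G\<^esub> g x \<otimes>\<^bsub>G\<^esub> g y" if "x \<in> A" "y \<in> A" for x y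
    using that by simp
  have "G.rgrp (g ` A) = {inv\<^bsub>G\<^esub> g x \<otimes>\<^bsub>G\<^esub> g y |x y. x \<in> A \<and> y \<in> A}"
    unfolding G.rgrp_def by blast
  also have "\<dots> = {g (inv\<^bsub>B\<^esub> x \<otimes>\<^bsub>B\<^esub> y) |x y. x \<in> A \<and> y \<in> A}"
    by (intro Collect_cong) (metis eq)
  also have "\<dots> = g ` B.rgrp A"
    unfolding B.rgrp_def by blast
  finally show ?thesis .
qed

lemma image_set_mult:
  assumes "A \<subseteq> carrier B" "C \<subseteq> carrier B"
  shows "g ` (A <#>\<^bsub>B\<^esub> C) = g ` A <#>\<^bsub>G\<^esub> g ` C"
proof -
  note [simp] = subsetD[OF assms(1)] subsetD[OF assms(2)]
  have "g (x \<otimes>\<^bsub>B\<^esub> y) = g x \<otimes>\<^bsub>G\<^esub> g y" if "x \<in> A" "y \<in> C" for x y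
    using that by simp
  then show ?thesis by (simp add: set_mult_def image_UN)
qed

lemma image_set_inv:
  assumes "A \<subseteq> carrier B"
  shows "g ` (set_inv\<^bsub>B\<^esub> A) = set_inv\<^bsub>G\<^esub> (g ` A)"
proof -
  note [simp] = subsetD[OF assms]
  have "g (inv\<^bsub>B\<^esub> x) = inv\<^bsub>G\<^esub> g x" if "x \<in> A" for x
    using that by simp
  then show ?thesis by (simp add: SET_INV_def image_UN)
qed

lemma image_compact_open:
  assumes "A \<subseteq> carrier B"
  shows "G.compact_open (g ` A) \<longleftrightarrow> B.compact_open A"
  unfolding G.compact_open_def B.compact_open_def
  using homeomorphic_map_openness[OF homeo] homeomorphic_map_compactness[OF homeo] assms B.topspace_eq
  by simp

lemma mg_iso: "meet_groupoid_iso (image g) B.mg G.mg"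
proof -
  have sub: "A \<subseteq> carrier B" if "A \<in> mg_dom B.mg" for A
    using that B.is_coset_subset by (auto simp: B.mg_dom_iff)
  have dom: "g ` A \<in> mg_dom G.mg" if "A \<in> mg_dom B.mg" for A
    using that image_is_coset[OF sub[OF that]] image_compact_open[OF sub[OF that]]
    by (auto simp: B.mg_dom_iff G.mg_dom_iff)
  have bij: "bij_betw (image g) (mg_dom B.mg) (mg_dom G.mg)"
  proof (rule bij_betw_imageI)
    show "inj_on (image g) (mg_dom B.mg)"
      using image_eq_iff sub by (auto intro!: inj_onI)
    show "image g ` mg_dom B.mg = mg_dom G.mg"
    proof (intro equalityI subsetI)
      fix A assume A: "A \<in> mg_dom G.mg"
      then have "A \<subseteq> carrier G" using G.is_coset_subset by (auto simp: G.mg_dom_iff)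
      then obtain C where C: "C \<subseteq> carrier B" "A = g ` C"
        unfolding surj[symmetric] by (metis subset_imageE)
      then have "C \<in> mg_dom B.mg"
        using A image_is_coset[OF C(1)] image_compact_open[OF C(1)]
        by (auto simp: B.mg_dom_iff G.mg_dom_iff)
      then show "A \<in> image g ` mg_dom B.mg" using C(2) by blast
    qed (use dom in auto)
  qed
  show ?thesis
    unfolding meet_groupoid_iso_def
  proof (intro conjI ballI)
    fix A C assume AC: "A \<in> mg_dom B.mg" "C \<in> mg_dom B.mg"
    note s = sub[OF AC(1)] sub[OF AC(2)]
    show "mg_inv B.mg A \<in> mg_dom B.mg" "g ` mg_inv B.mg A = mg_inv G.mg (g ` A)"
      using B.mg_inv_closed[OF AC(1)] image_set_inv[OF s(1)] by (simp_all add: meet_groupoid_of_def)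
    show "mg_meet B.mg A C \<in> mg_dom B.mg" "g ` mg_meet B.mg A C = mg_meet G.mg (g ` A) (g ` C)"
      using B.mg_meet_closed[OF AC Hausdorff] inj_on_image_Int[OF inj s] by (simp_all add: meet_groupoid_of_def)
    show "set_option (mg_prod B.mg A C) \<subseteq> mg_dom B.mg"
      using B.mg_prod_closed[OF AC] by (cases "mg_prod B.mg A C") auto
    have "G.rgrp (g ` A) = G.lgrp (g ` C) \<longleftrightarrow> B.rgrp A = B.lgrp C" if "A \<noteq> {}" "C \<noteq> {}"
    proof -
      have "B.is_coset A" "B.is_coset C" using AC that by (auto simp: B.mg_dom_iff)
      then have "B.rgrp A \<subseteq> carrier B" "B.lgrp C \<subseteq> carrier B"
        using B.rgrp_subgroup B.lgrp_subgroup subgroup.subset by blast+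
      then show ?thesis by (simp add: image_rgrp image_lgrp s image_eq_iff)
    qed
    then show "map_option (image g) (mg_prod B.mg A C) = mg_prod G.mg (g ` A) (g ` C)"
      unfolding B.mg_prod_iff[OF AC] G.mg_prod_iff[OF dom[OF AC(1)] dom[OF AC(2)]]
      using image_set_mult[OF s] by (cases "A = {}"; cases "C = {}"; simp)
  qed (rule bij)
qed

lemma group_index_image:
  assumes "subgroup U B" "W \<subseteq> U"
  shows "group_index G (g ` U) (g ` W) = group_index B U W"
proof -
  have UW: "U \<subseteq> carrier B" "W \<subseteq> carrier B" using assms subgroup.subset by blast+
  have img: "g ` (W #>\<^bsub>B\<^esub> a) = g ` W #>\<^bsub>G\<^esub> g a" if "a \<in> U" for a
  proof -
    have "g (w \<otimes>\<^bsub>B\<^esub> a) = g w \<otimes>\<^bsub>G\<^esub> g a" if "w \<in> W" for w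
      using that \<open>a \<in> U\<close> UW by (intro gh.hom_mult) auto
    then show ?thesis by (simp add: r_coset_def image_UN)
  qed
  have "rcosets\<^bsub>B\<lparr>carrier := U\<rparr>\<^esub> W = (\<lambda>a. W #>\<^bsub>B\<^esub> a) ` U"
    "rcosets\<^bsub>G\<lparr>carrier := g ` U\<rparr>\<^esub> (g ` W) = (\<lambda>a. g ` W #>\<^bsub>G\<^esub> a) ` (g ` U)"
    by (auto simp: RCOSETS_def r_coset_def)
  then have "rcosets\<^bsub>G\<lparr>carrier := g ` U\<rparr>\<^esub> (g ` W) = image g ` (rcosets\<^bsub>B\<lparr>carrier := U\<rparr>\<^esub> W)"
    by (simp add: image_image img)
  moreover have "inj_on (image g) (rcosets\<^bsub>B\<lparr>carrier := U\<rparr>\<^esub> W)"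
  proof (rule inj_on_subset[of _ "Pow (carrier B)"])
    show "inj_on (image g) (Pow (carrier B))"
      using image_eq_iff by (auto intro!: inj_onI)
    show "rcosets\<^bsub>B\<lparr>carrier := U\<rparr>\<^esub> W \<subseteq> Pow (carrier B)"
      using UW by (auto simp: RCOSETS_def r_coset_def)
  qed
  ultimately show ?thesis
    by (simp add: group_index_def card_image)
qed

end

text \<open>The copy and its programs stay the same; only the isomorphism onto the meet groupoid is
  composed with taking images.\<close>

lemma haar_index_iso:
  assumes "haar_index q B Y" "topological_group_isomorphic G X B Y"
    and "topological_group G X" "topological_group B Y" "Hausdorff_space Y"
  shows "haar_index q G X"
proof -
  obtain h where h: "h \<in> iso G B" "homeomorphic_map X Y h"
    using assms(2) by (auto simp: topological_group_isomorphic_def)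
  interpret G: top_group G X using assms(3) by (rule top_groupI)
  interpret B: top_group B Y using assms(4) by (rule top_groupI)
  define g where "g = inv_into (carrier G) h"
  have "g \<in> iso B G" unfolding g_def using h(1) by (rule G.iso_set_sym)
  moreover have "homeomorphic_map Y X g"
  proof -
    obtain k where k: "homeomorphic_maps X Y h k" using h(2) by (auto simp: homeomorphic_map_maps)
    \<comment> \<open>The algebraic and the topological inverse of \<open>h\<close> are chosen
      separately, but they agree on the space.\<close>
    have "k y = g y" if "y \<in> topspace Y" for y
    proof -
      have "h (k y) = y" "k y \<in> carrier G"
        using k that G.topspace_eq by (auto simp: homeomorphic_maps_def continuous_map_def)
      moreover have "inj_on h (carrier G)" using h(1) by (auto simp: iso_def bij_betw_def)
      ultimately show ?thesis unfolding g_def by (metis inv_into_f_f)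
    qed
    moreover have "homeomorphic_map Y X k"
      using k homeomorphic_maps_map homeomorphic_maps_sym by blast
    ultimately show ?thesis by (metis homeomorphic_map_eq)
  qed
  ultimately interpret top_group_iso G X B Y g
    using assms(5) by unfold_locales
  obtain eD eInv eMeet eDef eProd eHaar M \<beta> where *: "q = list_encode [eD, eInv, eMeet, eDef, eProd, eHaar]"
    and \<beta>: "meet_groupoid_iso \<beta> M (meet_groupoid_of B Y)"
    and ind: "decides eD (mg_dom M)"
        "\<forall>x\<in>mg_dom M. phi eInv x = Some (mg_inv M x)"
        "\<forall>x\<in>mg_dom M. \<forall>y\<in>mg_dom M. phi eMeet (prod_encode (x, y)) = Some (mg_meet M x y)"
        "\<forall>x\<in>mg_dom M. \<forall>y\<in>mg_dom M.
           phi eDef (prod_encode (x, y)) = Some (of_bool (mg_prod M x y \<noteq> None))"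
        "\<forall>x\<in>mg_dom M. \<forall>y\<in>mg_dom M. phi eProd (prod_encode (x, y)) = mg_prod M x y"
    and haar: "\<forall>u\<in>mg_dom M. \<forall>v\<in>mg_dom M. mg_prod M u u = Some u \<and> mg_prod M v v = Some v \<longrightarrow>
           phi eHaar (prod_encode (u, v)) = Some (group_index B (\<beta> u) (\<beta> u \<inter> \<beta> v))"
    using assms(1) unfolding haar_index_def by blast
  have dom: "\<beta> u \<in> mg_dom B.mg" if "u \<in> mg_dom M" for u
    using \<beta> that unfolding meet_groupoid_iso_def by (metis bij_betwE)
  have sub: "subgroup (\<beta> u) B" if "u \<in> mg_dom M" "mg_prod M u u = Some u" for u
  proof -
    have "mg_prod B.mg (\<beta> u) (\<beta> u) = map_option \<beta> (mg_prod M u u)"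
      using \<beta> that(1) unfolding meet_groupoid_iso_def by metis
    then show ?thesis using B.mg_idempotent_iff[OF dom[OF that(1)]] that(2) by simp
  qed
  have "group_index G (g ` \<beta> u) (g ` \<beta> u \<inter> g ` \<beta> v) = group_index B (\<beta> u) (\<beta> u \<inter> \<beta> v)"
    if "u \<in> mg_dom M" "v \<in> mg_dom M" "mg_prod M u u = Some u" "mg_prod M v v = Some v" for u v
  proof -
    have "g ` \<beta> u \<inter> g ` \<beta> v = g ` (\<beta> u \<inter> \<beta> v)"
      using inj_on_image_Int[OF inj, of "\<beta> u" "\<beta> v"] subgroup.subset sub that by metis
    then show ?thesis using group_index_image[OF sub[OF that(1,3)], of "\<beta> u \<inter> \<beta> v"] by simp
  qed
  then have haar': "\<forall>u\<in>mg_dom M. \<forall>v\<in>mg_dom M. mg_prod M u u = Some u \<and> mg_prod M v v = Some v \<longrightarrow>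
     phi eHaar (prod_encode (u, v)) = Some (group_index G ((image g \<circ> \<beta>) u) ((image g \<circ> \<beta>) u \<inter> (image g \<circ> \<beta>) v))"
    using haar by simp
  show ?thesis
    unfolding haar_index_def
    using * meet_groupoid_iso_comp[OF \<beta> mg_iso] ind haar' by blast
qed

section \<open>Uniform computability of the copy from the presentation\<close>

locale baire_family = uniform I par for I :: "'i set" and par +
  fixes T :: "'i \<Rightarrow> nat list set" and H :: "'i \<Rightarrow> nat list \<Rightarrow> nat \<Rightarrow> nat"
    and P J :: "'i \<Rightarrow> nat \<times> nat list \<times> nat list \<Rightarrow> nat" and B :: "'i \<Rightarrow> (nat \<Rightarrow> nat) monoid"
  assumes uc_T: "uc (\<lambda>i \<sigma>. \<sigma> \<in> T i)"
    and uc_compact: "uc (\<lambda>i \<sigma>. \<sigma> \<noteq> [] \<and> \<sigma> \<in> compact_nodes (T i))"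
    and uc_H: "uc (\<lambda>i z. H i (fst z) (snd z))"
    and uc_P: "uc P" and uc_J: "uc J"
    and baire: "i \<in> I \<Longrightarrow> baire (B i) (T i) (H i) (P i) (J i)"
begin

lemma bounded_tree: "i \<in> I \<Longrightarrow> bounded_tree (T i) (H i)"
  using baire baire.axioms(2) by blast

lemmas uc_H' = uc_app2[OF uc_H]

lemma uc_extn:
  assumes "uc f" "uc g"
  shows "uc (\<lambda>i x. extn (T i) (H i) (f i x) (g i x))"
  unfolding extn_def extend1_def
  by (intro uc_intros assms uc_compose[OF assms(1)] uc_compose[OF uc_T] uc_H')

lemma uc_clopen_code:
  assumes "uc f"
  shows "uc (\<lambda>i x. clopen_code (T i) (f i x))"
  unfolding clopen_code_def
  by (intro uc_Ball_set uc_compose[OF uc_compact] uc_intros assms)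

lemma uc_inter_covered:
  assumes "uc u" "uc v" "uc w"
  shows "uc (\<lambda>i x. inter_covered (T i) (H i) (u i x) (v i x) (w i x))"
  unfolding inter_covered_def
  by (intro uc_intros assms uc_extn uc_compose[OF assms(1)] uc_compose[OF assms(2)] uc_compose[OF assms(3)])

lemma uc_covered:
  assumes "uc u" "uc v"
  shows "uc (\<lambda>i x. covered (T i) (H i) (u i x) (v i x))"
  unfolding covered_def by (intro uc_inter_covered assms)

lemma uc_same_pts:
  assumes "uc u" "uc v"
  shows "uc (\<lambda>i x. same_pts (T i) (H i) (u i x) (v i x))"
  unfolding same_pts_def by (intro uc_intros uc_covered assms)

lemma uc_maps_into:
  assumes S: "uc S" and approx: "\<And>i. i \<in> I \<Longrightarrow> \<exists>\<Phi>. approximates (T i) (S i) \<Phi>"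
    and uvw: "uc u" "uc v" "uc w"
  shows "uc (\<lambda>i x. maps_into (T i) (H i) (S i) (u i x) (v i x) (w i x))"
proof -
  note comp = uc_compose[OF uvw(1)] uc_compose[OF uvw(2)] uc_compose[OF uvw(3)]
  have m: "uc (\<lambda>i x. modulus (T i) (H i) (S i) (u i x) (v i x) (w i x))"
    unfolding modulus_def
  proof (rule uc_LEAST)
    show "uc (\<lambda>i y. clopen_code (T i) (u i (fst y)) \<and> clopen_code (T i) (v i (fst y)) \<longrightarrow>
       (\<forall>\<sigma>\<in>set (u i (fst y)). \<forall>\<rho>\<in>set (extn (T i) (H i) \<sigma> (snd y)).
        \<forall>\<sigma>'\<in>set (v i (fst y)). \<forall>\<tau>\<in>set (extn (T i) (H i) \<sigma>' (snd y)).
        \<exists>k\<le>snd y. \<exists>t\<le>snd y. S i (t, take k \<rho>, take k \<tau>) \<noteq> 0 \<and>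
          length (concat (w i (fst y))) < length (list_decode (S i (t, take k \<rho>, take k \<tau>) - 1))))"
      by (intro uc_intros uc_clopen_code uc_extn uc_compose[OF S] comp)
    show "\<exists>n. clopen_code (T i) (u i x) \<and> clopen_code (T i) (v i x) \<longrightarrow>
       (\<forall>\<sigma>\<in>set (u i x). \<forall>\<rho>\<in>set (extn (T i) (H i) \<sigma> n).
        \<forall>\<sigma>'\<in>set (v i x). \<forall>\<tau>\<in>set (extn (T i) (H i) \<sigma>' n).
        \<exists>k\<le>n. \<exists>t\<le>n. S i (t, take k \<rho>, take k \<tau>) \<noteq> 0 \<and>
          length (concat (w i x)) < length (list_decode (S i (t, take k \<rho>, take k \<tau>) - 1)))"
      if "i \<in> I" for i x
      using bounded_tree.modulus_exists[OF bounded_tree[OF that]] approx[OF that] by meson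
  qed
  show ?thesis
    unfolding maps_into_def
    by (intro uc_intros uc_extn uc_compose[OF S] comp uc_compose[OF m] uvw)
qed

lemma approx_P: "i \<in> I \<Longrightarrow> \<exists>\<Phi>. approximates (T i) (P i) \<Phi>"
  and approx_J: "i \<in> I \<Longrightarrow> \<exists>\<Phi>. approximates (T i) (J i) \<Phi>"
  using baire.P[OF baire] baire.J[OF baire] by blast+

lemmas uc_maps_P = uc_maps_into[OF uc_P approx_P]
lemmas uc_maps_J = uc_maps_into[OF uc_J approx_J]

lemma uc_quad_valid:
  assumes "uc q"
  shows "uc (\<lambda>i x. quad_valid (T i) (H i) (P i) (J i) (q i x))"
  unfolding quad_valid_def by (intro uc_intros uc_clopen_code uc_maps_P uc_maps_J assms)

lemma uc_quad_dom:
  assumes "uc n"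
  shows "uc (\<lambda>i x. quad_dom (T i) (H i) (P i) (J i) (n i x))"
  unfolding quad_dom_def
  by (intro uc_intros uc_quad_valid uc_same_pts uc_compose[OF assms] assms)

lemma uc_quad_inv: "uc (\<lambda>i x. quad_inv (T i) (H i) (P i) (J i) x)"
  unfolding quad_inv_def
proof (rule uc_LEAST)
  show "\<exists>n. quad_dom (T i) (H i) (P i) (J i) x \<longrightarrow> quad_valid (T i) (H i) (P i) (J i) (dec n) \<and>
     maps_into (T i) (H i) (J i) (q_set (dec x)) (q_set (dec x)) (q_set (dec n)) \<and>
     maps_into (T i) (H i) (J i) (q_set (dec n)) (q_set (dec n)) (q_set (dec x))" if "i \<in> I" for i x
    using baire.quad_inv_eq(2)[OF baire[OF that], of x] by blast
qed (intro uc_intros uc_quad_dom uc_quad_valid uc_maps_J)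

lemma uc_quad_meet: "uc (\<lambda>i z. quad_meet (T i) (H i) (P i) (J i) (fst z) (snd z))"
  unfolding quad_meet_def
proof (rule uc_LEAST)
  show "\<exists>n. quad_dom (T i) (H i) (P i) (J i) (fst z) \<and> quad_dom (T i) (H i) (P i) (J i) (snd z) \<longrightarrow>
     quad_valid (T i) (H i) (P i) (J i) (dec n) \<and>
     covered (T i) (H i) (q_set (dec n)) (q_set (dec (fst z))) \<and>
     covered (T i) (H i) (q_set (dec n)) (q_set (dec (snd z))) \<and>
     inter_covered (T i) (H i) (q_set (dec (fst z))) (q_set (dec (snd z))) (q_set (dec n))" if "i \<in> I" for i z
    using baire.quad_meet_eq(2)[OF baire[OF that], of "fst z" "snd z"] by blast
qed (intro uc_intros uc_quad_dom uc_quad_valid uc_covered uc_inter_covered)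

lemma uc_quad_def: "uc f \<Longrightarrow> uc g \<Longrightarrow> uc (\<lambda>i x. quad_def (T i) (H i) (P i) (J i) (f i x) (g i x))"
  unfolding quad_def_def by (intro uc_intros uc_quad_dom uc_same_pts)

lemma uc_quad_prod: "uc (\<lambda>i z. quad_prod (T i) (H i) (P i) (J i) (fst z) (snd z))"
  unfolding quad_prod_def
proof (rule uc_LEAST)
  show "\<exists>n. quad_def (T i) (H i) (P i) (J i) (fst z) (snd z) \<longrightarrow>
     quad_valid (T i) (H i) (P i) (J i) (dec n) \<and>
     maps_into (T i) (H i) (P i) (q_set (dec (fst z))) (q_set (dec (snd z))) (q_set (dec n)) \<and>
     maps_into (T i) (H i) (P i) (q_inv (dec (fst z))) (q_set (dec n)) (q_set (dec (snd z)))"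
    if "i \<in> I" for i z
    using baire.quad_prod_eq[OF baire[OF that], of "fst z" "snd z"]
    by (cases "quad_def (T i) (H i) (P i) (J i) (fst z) (snd z)") (auto simp: quad_def_def)
qed (intro uc_intros uc_quad_def uc_quad_valid uc_maps_P)

lemma uc_quad_subgroup: "uc f \<Longrightarrow> uc (\<lambda>i x. quad_subgroup (T i) (H i) (P i) (J i) (f i x))"
  unfolding quad_subgroup_def by (intro uc_intros uc_quad_dom uc_same_pts)

lemma uc_quad_cosets: "uc (\<lambda>i z. quad_cosets (T i) (H i) (P i) (J i) (fst z) (snd z))"
  unfolding quad_cosets_def
proof (rule uc_LEAST)
  show "\<exists>n. quad_subgroup (T i) (H i) (P i) (J i) (fst z) \<and> quad_subgroup (T i) (H i) (P i) (J i) (snd z) \<longrightarrow>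
     distinct (list_decode n) \<and>
     (\<forall>c\<in>set (list_decode n). quad_dom (T i) (H i) (P i) (J i) c \<and> q_set (dec c) \<noteq> [] \<and>
        covered (T i) (H i) (q_set (dec c)) (q_set (dec (fst z))) \<and>
        covered (T i) (H i) (q_left (dec c)) (q_set (dec (fst z))) \<and>
        covered (T i) (H i) (q_left (dec c)) (q_set (dec (snd z))) \<and>
        inter_covered (T i) (H i) (q_set (dec (fst z))) (q_set (dec (snd z))) (q_left (dec c))) \<and>
     covered (T i) (H i) (q_set (dec (fst z))) (concat (map (\<lambda>c. q_set (dec c)) (list_decode n)))"
    if "i \<in> I" for i z
  proof (cases "quad_subgroup (T i) (H i) (P i) (J i) (fst z) \<and> quad_subgroup (T i) (H i) (P i) (J i) (snd z)")
    case True
    then have d: "quad_dom (T i) (H i) (P i) (J i) (fst z)" "quad_dom (T i) (H i) (P i) (J i) (snd z)"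
      by (auto simp: quad_subgroup_def)
    with True have "subgroup (quad_set (T i) (fst z)) (B i)" "subgroup (quad_set (T i) (snd z)) (B i)"
      using baire.quad_subgroup_iff[OF baire[OF that]] by blast+
    from baire.quad_cosets_length(2)[OF baire[OF that] d this] show ?thesis by meson
  qed blast
qed (intro uc_intros uc_quad_subgroup uc_quad_dom uc_covered uc_inter_covered)

theorem haar_index_computable:
  obtains s where "par_computable s" "\<And>i. i \<in> I \<Longrightarrow> haar_index (s i) (B i) (path_space (T i))"
proof -
  from uc_index[OF uc_quad_dom[OF uc_id]] obtain sD where sD: "par_computable sD"
    "\<forall>i\<in>I. \<forall>x. phi (sD i) (enc x) = Some (enc (quad_dom (T i) (H i) (P i) (J i) x))" by blast
  from uc_index[OF uc_quad_inv] obtain sI where sI: "par_computable sI"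
    "\<forall>i\<in>I. \<forall>x. phi (sI i) (enc x) = Some (enc (quad_inv (T i) (H i) (P i) (J i) x))" by blast
  from uc_index[OF uc_quad_meet] obtain sM where sM: "par_computable sM"
    "\<forall>i\<in>I. \<forall>z. phi (sM i) (enc z) = Some (enc (quad_meet (T i) (H i) (P i) (J i) (fst z) (snd z)))" by blast
  have "uc (\<lambda>i z. quad_def (T i) (H i) (P i) (J i) (fst z) (snd z))" by (intro uc_quad_def uc_intros)
  note ucdef = this
  from uc_index[OF ucdef] obtain sF where sF: "par_computable sF"
    "\<forall>i\<in>I. \<forall>z. phi (sF i) (enc z) = Some (enc (quad_def (T i) (H i) (P i) (J i) (fst z) (snd z)))" by blast
  from upc_index[OF upc_restrict[OF ucdef uc_quad_prod]] obtain sP where sP: "par_computable sP"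
    "\<forall>i\<in>I. phi (sP i) = (\<lambda>n. if quad_def (T i) (H i) (P i) (J i) (fst (dec n :: nat \<times> nat)) (snd (dec n :: nat \<times> nat))
       then Some (enc (quad_prod (T i) (H i) (P i) (J i) (fst (dec n :: nat \<times> nat)) (snd (dec n :: nat \<times> nat)))) else None)"
    by blast
  have "uc (\<lambda>i z. length (list_decode (quad_cosets (T i) (H i) (P i) (J i) (fst z) (snd z))))"
    by (intro uc_intros uc_quad_cosets)
  from uc_index[OF this] obtain sH where sH: "par_computable sH"
    "\<forall>i\<in>I. \<forall>z. phi (sH i) (enc z) =
       Some (enc (length (list_decode (quad_cosets (T i) (H i) (P i) (J i) (fst z) (snd z)))))" by blast
  show ?thesis
  proof
    show "par_computable (\<lambda>i. list_encode [sD i, sI i, sM i, sF i, sP i, sH i])"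
      unfolding list_encode.simps
      by (intro par_intros sD(1) sI(1) sM(1) sF(1) sP(1) sH(1))
  next
    fix i assume i: "i \<in> I"
    interpret b: baire "B i" "T i" "H i" "P i" "J i" using baire[OF i] .
    have dom: "mg_dom b.copy = {n. quad_dom (T i) (H i) (P i) (J i) n}"
      by (simp add: b.copy_def)
    have meet: "phi (sM i) (prod_encode (x, y)) = Some (mg_meet b.copy x y)"
      if "x \<in> mg_dom b.copy" "y \<in> mg_dom b.copy" for x y
      using sM(2)[rule_format, OF i, of "(x, y)"] b.quad_meet_eq(1)[of x y] that by (simp add: dom)
    have inv: "phi (sI i) x = Some (mg_inv b.copy x)" if "x \<in> mg_dom b.copy" for x
      using sI(2)[rule_format, OF i, of x] b.quad_inv_eq(1)[of x] that by (simp add: dom)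
    have df: "phi (sF i) (prod_encode (x, y)) = Some (of_bool (mg_prod b.copy x y \<noteq> None))"
      if "x \<in> mg_dom b.copy" "y \<in> mg_dom b.copy" for x y
      using sF(2)[rule_format, OF i, of "(x, y)"] b.quad_prod_eq[of x y] that by (simp add: dom)
    have pr: "phi (sP i) (prod_encode (x, y)) = mg_prod b.copy x y"
      if "x \<in> mg_dom b.copy" "y \<in> mg_dom b.copy" for x y
      using sP(2)[rule_format, OF i] b.quad_prod_eq[of x y] that by (simp add: dom dec_nat_pair)
    have haar: "phi (sH i) (prod_encode (u, v)) = Some (group_index (B i) (quad_set (T i) u) (quad_set (T i) u \<inter> quad_set (T i) v))"
      if uv: "u \<in> mg_dom b.copy" "v \<in> mg_dom b.copy" "mg_prod b.copy u u = Some u" "mg_prod b.copy v v = Some v" for u v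
    proof -
      have "subgroup (quad_set (T i) w) (B i)" if "w \<in> mg_dom b.copy" "mg_prod b.copy w w = Some w" for w
      proof -
        have "mg_prod b.mg (quad_set (T i) w) (quad_set (T i) w) = map_option (quad_set (T i)) (mg_prod b.copy w w)"
          using b.copy_iso that(1) unfolding meet_groupoid_iso_def by metis
        then show ?thesis
          using b.mg_idempotent_iff[OF b.quad_set_dom[OF b.quad_dom_valid]] that by (simp add: dom)
      qed
      from b.quad_cosets_length(1)[OF _ _ this this, of u v] uv sH(2)[rule_format, OF i, of "(u, v)"]
      show ?thesis by (simp add: dom)
    qed
    have "decides (sD i) (mg_dom b.copy)"
      using sD(2) i by (simp add: decides_def dom)
    then show "haar_index (list_encode [sD i, sI i, sM i, sF i, sP i, sH i]) (B i) (path_space (T i))"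
      unfolding haar_index_def
      using b.copy_iso inv meet df pr haar by blast
  qed
qed

end

section \<open>From meet groupoids to Baire presentations\<close>

text \<open>
  The operations of a copy \<open>M\<close> are made total, so that they are computable functions. In names,
  \<open>le\<close> is inclusion, \<open>conj\<close> maps (a code of) \<open>A\<close> to \<open>A A\<^sup>-\<^sup>1\<close>, and \<open>chain\<close> is a descending sequence
  of compact open subgroups which is eventually contained in every compact open subgroup.
\<close>

definition g_def :: "nat meet_groupoid \<Rightarrow> nat \<Rightarrow> nat \<Rightarrow> bool" where
  "g_def M x y \<longleftrightarrow> x \<in> mg_dom M \<and> y \<in> mg_dom M \<and> mg_prod M x y \<noteq> None"

definition g_prod :: "nat meet_groupoid \<Rightarrow> nat \<Rightarrow> nat \<Rightarrow> nat" where
  "g_prod M x y = (if g_def M x y then the (mg_prod M x y) else 0)"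

definition g_inv :: "nat meet_groupoid \<Rightarrow> nat \<Rightarrow> nat" where
  "g_inv M x = (if x \<in> mg_dom M then mg_inv M x else 0)"

definition g_meet :: "nat meet_groupoid \<Rightarrow> nat \<Rightarrow> nat \<Rightarrow> nat" where
  "g_meet M x y = (if x \<in> mg_dom M \<and> y \<in> mg_dom M then mg_meet M x y else 0)"

definition g_le :: "nat meet_groupoid \<Rightarrow> nat \<Rightarrow> nat \<Rightarrow> bool" where
  "g_le M x y \<longleftrightarrow> x \<in> mg_dom M \<and> y \<in> mg_dom M \<and> g_meet M x y = x"

definition g_sub :: "nat meet_groupoid \<Rightarrow> nat \<Rightarrow> bool" where
  "g_sub M x \<longleftrightarrow> g_def M x x \<and> g_prod M x x = x"

definition g_conj :: "nat meet_groupoid \<Rightarrow> nat \<Rightarrow> nat" where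
  "g_conj M x = g_prod M x (g_inv M x)"

definition g_chain :: "nat meet_groupoid \<Rightarrow> nat \<Rightarrow> nat" where
  "g_chain M n = rec_nat (LEAST x. g_sub M x) (\<lambda>k u. if g_sub M k then g_meet M u k else u) n"

definition g_lcoset :: "nat meet_groupoid \<Rightarrow> nat \<Rightarrow> nat \<Rightarrow> bool" where
  "g_lcoset M a n \<longleftrightarrow> g_def M a (g_chain M n)"

definition g_tree :: "nat meet_groupoid \<Rightarrow> nat list set" where
  "g_tree M = {\<sigma>. (\<forall>j<length \<sigma>. g_lcoset M (nth0 \<sigma> j) j) \<and>
     (\<forall>j<length \<sigma> - 1. g_le M (nth0 \<sigma> (Suc j)) (nth0 \<sigma> j))}"

definition g_last :: "nat list \<Rightarrow> nat" where
  "g_last \<sigma> = nth0 \<sigma> (length \<sigma> - 1)"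

text \<open>This is where the index function enters: a coset of the subgroup at level
  \<open>length \<sigma> - 1\<close> contains exactly \<open>idx\<close> many left cosets of the one
  at level \<open>i\<close>, so a list of that many distinct ones is known to be complete.\<close>

definition g_cosets :: "nat meet_groupoid \<Rightarrow> (nat \<Rightarrow> nat \<Rightarrow> nat) \<Rightarrow> nat list \<Rightarrow> nat \<Rightarrow> nat" where
  "g_cosets M idx \<sigma> i = (LEAST n. \<sigma> \<in> g_tree M \<and> \<sigma> \<noteq> [] \<and> length \<sigma> \<le> i \<longrightarrow>
     distinct (list_decode n) \<and>
     length (list_decode n) = idx (g_chain M (length \<sigma> - 1)) (g_chain M i) \<and>
     (\<forall>b\<in>set (list_decode n). g_lcoset M b i \<and> g_le M b (g_last \<sigma>)))"

text \<open>An entry at a position inside \<open>\<sigma>\<close> is a summand of the first sum, a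
  later one a summand of the second.\<close>

definition g_bound :: "nat meet_groupoid \<Rightarrow> (nat \<Rightarrow> nat \<Rightarrow> nat) \<Rightarrow> nat list \<Rightarrow> nat \<Rightarrow> nat" where
  "g_bound M idx \<sigma> i = sum_list \<sigma> + sum_list (list_decode (g_cosets M idx \<sigma> i))"

text \<open>If the last entry is \<open>g V_k\<close>, then \<open>g_conj\<close> yields
  \<open>g V_k g^-1\<close>, and the test asks whether this is contained in \<open>V_J\<close>. The
  first failure is the length of the output; the length of \<open>\<sigma>\<close> caps the search,
  which also settles the empty string.\<close>

definition g_inv_len :: "nat meet_groupoid \<Rightarrow> nat list \<Rightarrow> nat" where
  "g_inv_len M \<sigma> = (LEAST J. J = length \<sigma> \<or> \<not> g_le M (g_conj M (g_last \<sigma>)) (g_chain M J))"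

definition g_inv_entry :: "nat meet_groupoid \<Rightarrow> nat list \<Rightarrow> nat \<Rightarrow> nat" where
  "g_inv_entry M \<sigma> j = (LEAST b. \<sigma> \<in> g_tree M \<and> j < g_inv_len M \<sigma> \<longrightarrow>
     g_lcoset M b j \<and> g_le M (g_inv M (g_last \<sigma>)) b)"

definition g_inv_str :: "nat meet_groupoid \<Rightarrow> nat list \<Rightarrow> nat list" where
  "g_inv_str M \<sigma> = map (g_inv_entry M \<sigma>) [0..<g_inv_len M \<sigma>]"

text \<open>For last entry \<open>g V_k\<close> of \<open>\<sigma>\<close> and entry
  \<open>h V_J\<close> of \<open>\<tau>\<close>, the test asks whether \<open>V_k\<close> is
  contained in \<open>h V_J h^-1\<close>.\<close>

definition g_mul_len :: "nat meet_groupoid \<Rightarrow> nat list \<Rightarrow> nat list \<Rightarrow> nat" where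
  "g_mul_len M \<sigma> \<tau> = (LEAST J. J = length \<sigma> \<or>
     \<not> g_le M (g_chain M (length \<sigma> - 1)) (g_conj M (nth0 \<tau> J)))"

text \<open>Put \<open>L = h V_j h^-1\<close>. The coset sought is \<open>g L\<close>, the only left
  coset of \<open>L\<close> that contains \<open>g V_k\<close>. It can be composed with
  \<open>h V_j\<close>, which is a right coset of \<open>L\<close>, and
  \<open>g L h V_j = g h V_j\<close>.\<close>

definition g_mul_left :: "nat meet_groupoid \<Rightarrow> nat list \<Rightarrow> nat list \<Rightarrow> nat \<Rightarrow> nat" where
  "g_mul_left M \<sigma> \<tau> j =
     (LEAST c. \<sigma> \<in> g_tree M \<and> \<tau> \<in> g_tree M \<and> length \<sigma> = length \<tau> \<and> j < g_mul_len M \<sigma> \<tau> \<longrightarrow>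
        g_def M c (g_conj M (nth0 \<tau> j)) \<and> g_le M (g_last \<sigma>) c)"

definition g_mul_str :: "nat meet_groupoid \<Rightarrow> nat list \<Rightarrow> nat list \<Rightarrow> nat list" where
  "g_mul_str M \<sigma> \<tau> = map (\<lambda>j. g_prod M (g_mul_left M \<sigma> \<tau> j) (nth0 \<tau> j)) [0..<g_mul_len M \<sigma> \<tau>]"

section \<open>The meaning of the operations of the copy in the group\<close>

locale haar_copy = top_group G X for G :: "('a, 'b) monoid_scheme" (structure) and X +
  fixes M :: "nat meet_groupoid" and \<beta> :: "nat \<Rightarrow> 'a set" and idx :: "nat \<Rightarrow> nat \<Rightarrow> nat"
  assumes iso: "meet_groupoid_iso \<beta> M mg"
    and Hausdorff: "Hausdorff_space X" and tot_disc: "totally_disconnected_space X"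
    and loc_compact: "locally_compact_space X"
    and idx: "g_sub M u \<Longrightarrow> g_sub M v \<Longrightarrow> idx u v = group_index G (\<beta> u) (\<beta> u \<inter> \<beta> v)"
begin

lemma bij: "bij_betw \<beta> (mg_dom M) (mg_dom mg)"
  using iso by (simp add: meet_groupoid_iso_def)

lemma dom: "x \<in> mg_dom M \<Longrightarrow> \<beta> x \<in> mg_dom mg"
  using bij by (auto dest: bij_betwE)

lemma coset: "x \<in> mg_dom M \<Longrightarrow> \<beta> x \<noteq> {} \<Longrightarrow> is_coset (\<beta> x) \<and> compact_open (\<beta> x)"
  using dom by (auto simp: mg_dom_iff)

lemma \<beta>_subset: "x \<in> mg_dom M \<Longrightarrow> \<beta> x \<subseteq> carrier G"
  using dom is_coset_subset by (auto simp: mg_dom_iff)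

definition cd :: "'a set \<Rightarrow> nat" where
  "cd A = inv_into (mg_dom M) \<beta> A"

lemma cd: "A \<in> mg_dom mg \<Longrightarrow> cd A \<in> mg_dom M \<and> \<beta> (cd A) = A"
  unfolding cd_def using bij by (metis bij_betw_def f_inv_into_f inv_into_into)

lemma \<beta>_inj: "x \<in> mg_dom M \<Longrightarrow> y \<in> mg_dom M \<Longrightarrow> \<beta> x = \<beta> y \<Longrightarrow> x = y"
  using bij by (auto simp: bij_betw_def inj_on_def)

lemma \<beta>_prod: "x \<in> mg_dom M \<Longrightarrow> y \<in> mg_dom M \<Longrightarrow>
    map_option \<beta> (mg_prod M x y) =
      (if \<beta> x \<noteq> {} \<and> \<beta> y \<noteq> {} \<and> rgrp (\<beta> x) = lgrp (\<beta> y) then Some (\<beta> x <#> \<beta> y) else None)"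
  using iso mg_prod_iff[OF dom dom, of x y] by (simp add: meet_groupoid_iso_def)

lemma g_def_iff: "g_def M x y \<longleftrightarrow> x \<in> mg_dom M \<and> y \<in> mg_dom M \<and>
    \<beta> x \<noteq> {} \<and> \<beta> y \<noteq> {} \<and> rgrp (\<beta> x) = lgrp (\<beta> y)"
  using \<beta>_prod[of x y] unfolding g_def_def
  by (cases "mg_prod M x y") (auto split: if_splits)

lemma g_prod:
  assumes "g_def M x y"
  shows "g_prod M x y \<in> mg_dom M" "\<beta> (g_prod M x y) = \<beta> x <#> \<beta> y"
proof -
  obtain z where z: "mg_prod M x y = Some z" "x \<in> mg_dom M" "y \<in> mg_dom M"
    using assms unfolding g_def_def by blast
  then have "set_option (mg_prod M x y) \<subseteq> mg_dom M"
    using iso unfolding meet_groupoid_iso_def by blast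
  then show "g_prod M x y \<in> mg_dom M" using z assms by (simp add: g_prod_def)
  show "\<beta> (g_prod M x y) = \<beta> x <#> \<beta> y"
    using \<beta>_prod[OF z(2,3)] z(1) assms by (simp add: g_prod_def split: if_splits)
qed

lemma g_inv:
  assumes "x \<in> mg_dom M"
  shows "g_inv M x \<in> mg_dom M" "\<beta> (g_inv M x) = set_inv (\<beta> x)"
proof -
  have "mg_inv M x \<in> mg_dom M \<and> \<beta> (mg_inv M x) = mg_inv mg (\<beta> x)"
    using iso assms unfolding meet_groupoid_iso_def by blast
  then show "g_inv M x \<in> mg_dom M" "\<beta> (g_inv M x) = set_inv (\<beta> x)"
    using assms by (simp_all add: g_inv_def meet_groupoid_of_def)
qed

lemma g_meet:
  assumes "x \<in> mg_dom M" "y \<in> mg_dom M"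
  shows "g_meet M x y \<in> mg_dom M" "\<beta> (g_meet M x y) = \<beta> x \<inter> \<beta> y"
proof -
  have "mg_meet M x y \<in> mg_dom M \<and> \<beta> (mg_meet M x y) = mg_meet mg (\<beta> x) (\<beta> y)"
    using iso assms unfolding meet_groupoid_iso_def by blast
  then show "g_meet M x y \<in> mg_dom M" "\<beta> (g_meet M x y) = \<beta> x \<inter> \<beta> y"
    using assms by (simp_all add: g_meet_def meet_groupoid_of_def)
qed

lemma g_le_iff: "g_le M x y \<longleftrightarrow> x \<in> mg_dom M \<and> y \<in> mg_dom M \<and> \<beta> x \<subseteq> \<beta> y"
proof (cases "x \<in> mg_dom M \<and> y \<in> mg_dom M")
  case True
  then have "g_meet M x y = x \<longleftrightarrow> \<beta> (g_meet M x y) = \<beta> x"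
    using g_meet(1)[of x y] \<beta>_inj[of "g_meet M x y" x] by metis
  with True show ?thesis using g_meet(2)[of x y] by (auto simp: g_le_def)
qed (auto simp: g_le_def)

lemma g_sub_iff: "g_sub M x \<longleftrightarrow> x \<in> mg_dom M \<and> subgroup (\<beta> x) G"
proof
  assume "g_sub M x"
  then have x: "g_def M x x" "g_prod M x x = x" "x \<in> mg_dom M" by (auto simp: g_sub_def g_def_def)
  then have "is_coset (\<beta> x)" "rgrp (\<beta> x) = lgrp (\<beta> x)" "\<beta> x <#> \<beta> x = \<beta> x"
    using g_prod[OF x(1)] coset[OF x(3)] by (auto simp: g_def_iff)
  then show "x \<in> mg_dom M \<and> subgroup (\<beta> x) G" using idempotent_coset x(3) by blast
next
  assume x: "x \<in> mg_dom M \<and> subgroup (\<beta> x) G"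
  then have "\<beta> x \<noteq> {}" using subgroup.one_closed by blast
  with x have d: "g_def M x x" using subgroup_is_coset[of "\<beta> x"] by (simp add: g_def_iff)
  then have "g_prod M x x = x"
    using g_prod[OF d] subgroup_set_mult_self[of "\<beta> x"] x by (intro \<beta>_inj) auto
  with d show "g_sub M x" by (simp add: g_sub_def)
qed

lemma g_conj:
  assumes "x \<in> mg_dom M" "\<beta> x \<noteq> {}"
  shows "g_conj M x \<in> mg_dom M" "\<beta> (g_conj M x) = lgrp (\<beta> x)"
proof -
  note s = \<beta>_subset[OF assms(1)]
  have "set_inv (\<beta> x) \<noteq> {}" using assms(2) by (auto simp: SET_INV_def)
  then have d: "g_def M x (g_inv M x)"
    using g_inv[OF assms(1)] assms lgrp_set_inv[OF s] by (simp add: g_def_iff)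
  show "g_conj M x \<in> mg_dom M" using g_prod(1)[OF d] by (simp add: g_conj_def)
  have "\<beta> x <#> set_inv (\<beta> x) = lgrp (\<beta> x)"
    unfolding set_mult_def SET_INV_def lgrp_def by blast
  then show "\<beta> (g_conj M x) = lgrp (\<beta> x)"
    using g_prod(2)[OF d] g_inv(2)[OF assms(1)] by (simp add: g_conj_def)
qed

lemma subgroup_dom: "subgroup V G \<Longrightarrow> compact_open V \<Longrightarrow> V \<in> mg_dom mg"
  using subgroup_is_coset by (simp add: mg_dom_iff)

lemma ex_g_sub: "\<exists>x. g_sub M x"
proof -
  have "openin X (carrier G)" using topspace_eq openin_topspace by metis
  then obtain V where "subgroup V G" "compact_open V"
    using van_Dantzig[OF Hausdorff tot_disc loc_compact] one_closed by metis
  then show ?thesis using cd[OF subgroup_dom] unfolding g_sub_iff by metis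
qed

section \<open>The chain of subgroups as a basis at the identity\<close>

definition V :: "nat \<Rightarrow> 'a set" where
  "V n = \<beta> (g_chain M n)"

lemma g_sub_chain: "g_sub M (g_chain M n)"
proof (induction n)
  case 0
  show ?case using LeastI_ex[OF ex_g_sub] by (simp add: g_chain_def)
next
  case (Suc n)
  show ?case
  proof (cases "g_sub M n")
    case True
    have eq: "g_chain M (Suc n) = g_meet M (g_chain M n) n" using True by (simp add: g_chain_def)
    have d: "g_chain M n \<in> mg_dom M" "n \<in> mg_dom M"
      and s: "subgroup (\<beta> (g_chain M n)) G" "subgroup (\<beta> n) G"
      using Suc True by (auto simp: g_sub_iff)
    show ?thesis
      using g_meet[OF d] subgroups_Inter_pair[OF s] by (simp add: eq g_sub_iff)
  next
    case False
    then have "g_chain M (Suc n) = g_chain M n" by (simp add: g_chain_def)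
    with Suc show ?thesis by simp
  qed
qed

lemma chain_dom: "g_chain M n \<in> mg_dom M"
  using g_sub_chain by (simp add: g_sub_iff)

lemma V_subgroup: "subgroup (V n) G"
  using g_sub_chain by (simp add: g_sub_iff V_def)

lemma V_ne: "V n \<noteq> {}"
  using subgroup.one_closed[OF V_subgroup] by blast

lemma V_compact_open: "compact_open (V n)"
  using coset[OF chain_dom] V_ne by (simp add: V_def)

lemma V_carrier: "V n \<subseteq> carrier G"
  using subgroup.subset[OF V_subgroup] .

lemma V_Suc: "V (Suc n) \<subseteq> V n" "g_sub M n \<Longrightarrow> V (Suc n) \<subseteq> \<beta> n"
proof -
  have "V (Suc n) = V n \<inter> \<beta> n" if "g_sub M n"
  proof -
    have "n \<in> mg_dom M" using that by (simp add: g_sub_iff)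
    then show ?thesis using g_meet(2)[OF chain_dom, of n n] that by (simp add: V_def g_chain_def)
  qed
  moreover have "V (Suc n) = V n" if "\<not> g_sub M n"
    using that by (simp add: V_def g_chain_def)
  ultimately show "V (Suc n) \<subseteq> V n" "g_sub M n \<Longrightarrow> V (Suc n) \<subseteq> \<beta> n" by blast+
qed

lemma V_mono: "m \<le> n \<Longrightarrow> V n \<subseteq> V m"
  by (rule lift_Suc_antimono_le[of V]) (rule V_Suc)

text \<open>Van Dantzig's theorem gives a compact open subgroup inside \<open>W\<close>. The step
  numbered by its code intersects the chain with it.\<close>

lemma V_small:
  assumes "openin X W" "\<one> \<in> W"
  obtains n where "V n \<subseteq> W"
proof -
  obtain U where U: "subgroup U G" "compact_open U" "U \<subseteq> W"
    using van_Dantzig[OF Hausdorff tot_disc loc_compact assms] by metis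
  then have "g_sub M (cd U)" "\<beta> (cd U) = U" using cd[OF subgroup_dom] by (auto simp: g_sub_iff)
  then show ?thesis using that V_Suc(2) U(3) by blast
qed

lemma V_coset_compact_open: "x \<in> carrier G \<Longrightarrow> compact_open (x <# V n)"
  by (rule compact_open_l_coset[OF _ V_compact_open])

lemma V_coset:
  assumes "x \<in> carrier G"
  shows "is_coset (x <# V n)" "rgrp (x <# V n) = V n" "x \<in> x <# V n"
proof -
  have "x <# V n \<in> lcosets (V n)" using assms by (auto simp: LCOSETS_def)
  then show "is_coset (x <# V n)" "rgrp (x <# V n) = V n"
    using lcosets_is_coset[OF V_subgroup] by blast+
  show "x \<in> x <# V n" using lcos_self[OF assms V_subgroup] .
qed

lemma V_coset_mono: "m \<le> n \<Longrightarrow> x <# V n \<subseteq> x <# V m"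
  using V_mono[of m n] by (auto simp: l_coset_def)

lemma V_coset_small:
  assumes "openin X W" "x \<in> W"
  obtains n where "x <# V n \<subseteq> W"
proof -
  have x: "x \<in> carrier G" using assms openin_subset topspace_eq by blast
  have "openin X {y \<in> topspace X. x \<otimes> y \<in> W}"
    using openin_continuous_map_preimage[OF l_translation_cont[OF x] assms(1)] .
  moreover have "\<one> \<in> {y \<in> topspace X. x \<otimes> y \<in> W}" using x assms(2) by (simp add: topspace_eq)
  ultimately obtain n where "V n \<subseteq> {y \<in> topspace X. x \<otimes> y \<in> W}" using V_small by metis
  then show ?thesis using that by (auto simp: l_coset_def)
qed

lemma g_lcoset_iff: "g_lcoset M a n \<longleftrightarrow> a \<in> mg_dom M \<and> \<beta> a \<noteq> {} \<and> rgrp (\<beta> a) = V n"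
  unfolding g_lcoset_def g_def_iff
  using chain_dom V_ne subgroup_is_coset(2)[OF V_subgroup, of n] by (auto simp: V_def)

lemma g_lcoset_eq:
  assumes "g_lcoset M a n" "x \<in> \<beta> a"
  shows "\<beta> a = x <# V n"
  using is_coset_l_coset[of "\<beta> a" x] coset[of a] assms by (auto simp: g_lcoset_iff)

section \<open>Group elements as paths of the tree\<close>

definition theta :: "'a \<Rightarrow> nat \<Rightarrow> nat" where
  "theta x n = cd (x <# V n)"

lemma theta:
  assumes "x \<in> carrier G"
  shows "theta x n \<in> mg_dom M" "\<beta> (theta x n) = x <# V n" "g_lcoset M (theta x n) n"
proof -
  have "x <# V n \<in> mg_dom mg"
    using V_coset[OF assms] V_coset_compact_open[OF assms] by (simp add: mg_dom_iff)
  then show "theta x n \<in> mg_dom M" "\<beta> (theta x n) = x <# V n"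
    using cd by (simp_all add: theta_def)
  then show "g_lcoset M (theta x n) n"
    using V_coset(2,3)[OF assms, of n] unfolding g_lcoset_iff by (metis empty_iff)
qed

lemma theta_eqI:
  assumes "g_lcoset M a n" "x \<in> \<beta> a"
  shows "a = theta x n"
proof -
  have a: "a \<in> mg_dom M" using assms(1) by (simp add: g_lcoset_iff)
  then have x: "x \<in> carrier G" using assms(2) \<beta>_subset by blast
  show ?thesis
    using \<beta>_inj[OF a theta(1)[OF x]] theta(2)[OF x] g_lcoset_eq[OF assms] by simp
qed

lemma restrict_theta_tree:
  assumes "x \<in> carrier G"
  shows "restrict_to (theta x) n \<in> g_tree M"
  using theta[OF assms] V_coset_mono by (auto simp: g_tree_def g_le_iff)

lemma theta_paths: "x \<in> carrier G \<Longrightarrow> theta x \<in> paths (g_tree M)"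
  using restrict_theta_tree by (simp add: paths_def)

lemma g_treeD:
  assumes "\<sigma> \<in> g_tree M"
  shows "j < length \<sigma> \<Longrightarrow> g_lcoset M (\<sigma> ! j) j"
    and "i \<le> j \<Longrightarrow> j < length \<sigma> \<Longrightarrow> \<beta> (\<sigma> ! j) \<subseteq> \<beta> (\<sigma> ! i)"
proof -
  show "j < length \<sigma> \<Longrightarrow> g_lcoset M (\<sigma> ! j) j" using assms by (auto simp: g_tree_def)
  have next_le: "\<beta> (\<sigma> ! Suc j) \<subseteq> \<beta> (\<sigma> ! j)" if "Suc j < length \<sigma>" for j
    using assms that by (auto simp: g_tree_def g_le_iff)
  show "\<beta> (\<sigma> ! j) \<subseteq> \<beta> (\<sigma> ! i)" if "i \<le> j" "j < length \<sigma>"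
    using that
  proof (induction j rule: dec_induct)
    case (step n)
    then have "\<beta> (\<sigma> ! n) \<subseteq> \<beta> (\<sigma> ! i)" by simp
    with next_le[OF step.prems] show ?case by blast
  qed simp
qed

lemma g_last_eq: "\<sigma> \<noteq> [] \<Longrightarrow> g_last \<sigma> = \<sigma> ! (length \<sigma> - 1)"
  by (simp add: g_last_def)

lemma g_last_lcoset:
  assumes "\<sigma> \<in> g_tree M" "\<sigma> \<noteq> []"
  shows "g_lcoset M (g_last \<sigma>) (length \<sigma> - 1)"
  using g_treeD(1)[OF assms(1), of "length \<sigma> - 1"] assms(2) by (simp add: g_last_eq)

text \<open>The entries are descending, so a point of the last coset lies in all of them, and there
  is only one left coset of \<open>V j\<close> through a given point.\<close>

lemma tree_eq_restrict:
  assumes "\<sigma> \<in> g_tree M" "\<sigma> \<noteq> []" "x \<in> \<beta> (g_last \<sigma>)"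
  shows "\<sigma> = restrict_to (theta x) (length \<sigma>)"
proof (rule nth_equalityI)
  fix j assume j: "j < length \<sigma>"
  then have "j \<le> length \<sigma> - 1" by simp
  then have "x \<in> \<beta> (\<sigma> ! j)"
    using g_treeD(2)[OF assms(1), of j "length \<sigma> - 1"] assms(2,3) by (auto simp: g_last_eq)
  then show "\<sigma> ! j = restrict_to (theta x) (length \<sigma>) ! j"
    using theta_eqI[OF g_treeD(1)[OF assms(1) j]] j by simp
qed simp

lemma tree_ex_restrict:
  assumes "\<sigma> \<in> g_tree M"
  obtains x where "x \<in> carrier G" "\<sigma> = restrict_to (theta x) (length \<sigma>)"
proof (cases "\<sigma> = []")
  case True
  then show ?thesis using that[of \<one>] by (simp add: restrict_to_def)
next
  case False
  have "g_last \<sigma> \<in> mg_dom M" "\<beta> (g_last \<sigma>) \<noteq> {}"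
    using g_last_lcoset[OF assms False] by (auto simp: g_lcoset_iff)
  then obtain x where "x \<in> \<beta> (g_last \<sigma>)" "x \<in> carrier G" using \<beta>_subset by blast
  then show ?thesis using that tree_eq_restrict[OF assms False] by blast
qed

lemma g_tree_is_tree: "is_tree (g_tree M)"
  unfolding is_tree_def
proof (intro conjI ballI allI impI)
  show "g_tree M \<noteq> {}" using restrict_theta_tree[OF one_closed] by blast
  fix \<sigma> \<tau> assume "\<sigma> \<in> g_tree M" "prefix \<tau> \<sigma>"
  then show "\<tau> \<in> g_tree M"
    using tree_ex_restrict restrict_theta_tree prefix_restrict_toD by metis
qed

lemma g_tree_leafless: "leafless (g_tree M)"
  unfolding leafless_def
proof
  fix \<sigma> assume "\<sigma> \<in> g_tree M"
  then obtain x where "x \<in> carrier G" "\<sigma> = restrict_to (theta x) (length \<sigma>)"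
    using tree_ex_restrict by metis
  then show "\<exists>n. \<sigma> @ [n] \<in> g_tree M"
    using restrict_theta_tree[of x "Suc (length \<sigma>)"] by (auto simp: restrict_to_Suc)
qed

lemma theta_inj: "inj_on theta (carrier G)"
proof (rule inj_onI, rule ccontr)
  fix x y assume xy: "x \<in> carrier G" "y \<in> carrier G" "theta x = theta y" "x \<noteq> y"
  then obtain W where W: "openin X W" "x \<in> W" "y \<notin> W"
    using Hausdorff unfolding Hausdorff_space_def topspace_eq disjnt_iff by metis
  then obtain n where "x <# V n \<subseteq> W" using V_coset_small by metis
  moreover have "x <# V n = y <# V n" using theta(2) xy(1-3) by metis
  ultimately show False using V_coset(3)[OF xy(2), of n] W(3) by blast
qed

text \<open>The entries of a path denote a descending sequence of nonempty compact sets, closed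
  because the space is Hausdorff. Such a sequence has a common point \<open>x\<close>, and each
  entry is then the coset through \<open>x\<close>.\<close>

lemma theta_surj:
  assumes f: "f \<in> paths (g_tree M)"
  obtains x where "x \<in> carrier G" "f = theta x"
proof -
  have tree: "restrict_to f n \<in> g_tree M" for n using f by (simp add: paths_def)
  have lc: "g_lcoset M (f n) n" for n using g_treeD(1)[OF tree[of "Suc n"], of n] by simp
  have mono: "\<beta> (f n) \<subseteq> \<beta> (f m)" if "m \<le> n" for m n
    using g_treeD(2)[OF tree[of "Suc n"], of m n] that by simp
  have co: "compact_open (\<beta> (f n))" "\<beta> (f n) \<noteq> {}" "\<beta> (f n) \<subseteq> carrier G" for n
    using lc coset \<beta>_subset by (auto simp: g_lcoset_iff)
  have "(\<Inter>n. \<beta> (f n)) \<noteq> {}"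
  proof
    assume empty: "(\<Inter>n. \<beta> (f n)) = {}"
    define W where "W n = carrier G - \<beta> (f n)" for n
    have "closedin X (\<beta> (f n))" for n
      using co(1) Hausdorff compactin_imp_closedin by (auto simp: compact_open_def)
    then have "openin X (W n)" for n
      unfolding W_def topspace_eq[symmetric] by blast
    moreover have "\<beta> (f 0) \<subseteq> \<Union> (range W)"
      using empty co(3)[of 0] by (auto simp: W_def)
    ultimately obtain F where F: "finite F" "F \<subseteq> range W" "\<beta> (f 0) \<subseteq> \<Union> F"
      using co(1)[of 0] unfolding compact_open_def compactin_def by (metis (no_types, lifting) imageE)
    then obtain N where N: "finite N" "F = W ` N" by (meson finite_subset_image)
    obtain y where y: "y \<in> \<beta> (f (Max (insert 0 N)))" using co(2) by blast
    then have "y \<in> \<beta> (f 0)" using mono[of 0] by blast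
    then obtain n where "n \<in> N" "y \<in> W n" using F(3) N(2) by blast
    moreover have "y \<in> \<beta> (f n)" if "n \<in> N" using y mono[of n "Max (insert 0 N)"] N(1) that by auto
    ultimately show False by (auto simp: W_def)
  qed
  then obtain x where x: "\<And>n. x \<in> \<beta> (f n)" by blast
  then have "f = theta x" using theta_eqI[OF lc] by blast
  then show ?thesis using that x co(3) by blast
qed

lemma theta_image: "theta ` carrier G = paths (g_tree M)"
  using theta_paths theta_surj by (metis (no_types, opaque_lifting) imageE imageI subsetI subset_antisym)

text \<open>Entries are numbered from \<open>0\<close>, so \<open>n + 1\<close> of them are needed
  to fix the coset \<open>x <# V n\<close>; this coset determines the earlier ones.\<close>

lemma paths_through_theta:
  assumes "x \<in> carrier G"
  shows "paths_through (g_tree M) (restrict_to (theta x) (Suc n)) = theta ` (x <# V n)"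
proof (intro equalityI subsetI)
  fix f assume f: "f \<in> paths_through (g_tree M) (restrict_to (theta x) (Suc n))"
  then obtain y where y: "y \<in> carrier G" "f = theta y"
    using theta_surj by (metis paths_through_iff)
  have "restrict_to f (Suc n) = restrict_to (theta x) (Suc n)" using f by (simp add: paths_through_iff)
  then have "theta y n = theta x n" unfolding restrict_to_eq_iff y by blast
  then have "y \<in> x <# V n" using theta(2) assms y(1) V_coset(3) by metis
  then show "f \<in> theta ` (x <# V n)" using y(2) by blast
next
  fix f assume "f \<in> theta ` (x <# V n)"
  then obtain y where y: "y \<in> x <# V n" "f = theta y" by blast
  then have yc: "y \<in> carrier G" using is_coset_subset V_coset(1)[OF assms] by blast
  have "theta x i = theta y i" if "i < Suc n" for i
    using theta_eqI[OF theta(3)[OF assms, of i], of y] y(1) V_coset_mono[of i n x] that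
    by (auto simp: theta(2)[OF assms])
  then show "f \<in> paths_through (g_tree M) (restrict_to (theta x) (Suc n))"
    using theta_paths[OF yc] by (auto simp: paths_through_iff y(2) restrict_to_eq_iff)
qed

text \<open>Under \<open>theta\<close> the cosets \<open>x <# V n\<close> correspond to the cones
  above nonempty strings, and both form bases.\<close>

lemma theta_homeo: "homeomorphic_map X (path_space (g_tree M)) theta"
proof (rule bijective_open_imp_homeomorphic_map)
  show "continuous_map X (path_space (g_tree M)) theta"
    unfolding continuous_map
  proof (intro conjI allI impI)
    show "theta ` topspace X \<subseteq> topspace (path_space (g_tree M))"
      using theta_paths by (auto simp: topspace_eq)
    fix W assume W: "openin (path_space (g_tree M)) W"
    show "openin X {x \<in> topspace X. theta x \<in> W}"
    proof (subst openin_subopen, intro ballI)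
      fix x assume "x \<in> {x \<in> topspace X. theta x \<in> W}"
      then have x: "x \<in> carrier G" "theta x \<in> W" by (auto simp: topspace_eq)
      then obtain n where n: "paths_through (g_tree M) (restrict_to (theta x) n) \<subseteq> W"
        using W unfolding openin_path_space_iff by blast
      have "paths_through (g_tree M) (restrict_to (theta x) (Suc n)) \<subseteq> paths_through (g_tree M) (restrict_to (theta x) n)"
        by (rule paths_through_mono) (simp add: prefix_restrict_to)
      then have "theta ` (x <# V n) \<subseteq> W" using n paths_through_theta[OF x(1)] by blast
      then have "x <# V n \<subseteq> {x \<in> topspace X. theta x \<in> W}"
        using compact_open_subset[OF V_coset_compact_open[OF x(1)]] by (auto simp: topspace_eq)
      then show "\<exists>T. openin X T \<and> x \<in> T \<and> T \<subseteq> {x \<in> topspace X. theta x \<in> W}"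
        using V_coset_compact_open[OF x(1)] V_coset(3)[OF x(1)] by (auto simp: compact_open_def)
    qed
  qed
  show "open_map X (path_space (g_tree M)) theta"
    unfolding open_map_def
  proof (intro allI impI)
    fix W assume W: "openin X W"
    then have Wc: "W \<subseteq> carrier G" using openin_subset topspace_eq by blast
    show "openin (path_space (g_tree M)) (theta ` W)"
      unfolding openin_path_space_iff
    proof (intro conjI ballI)
      show "theta ` W \<subseteq> paths (g_tree M)" using theta_paths Wc by blast
      fix f assume "f \<in> theta ` W"
      then obtain x where x: "x \<in> W" "f = theta x" by blast
      then obtain n where "x <# V n \<subseteq> W" using V_coset_small[OF W] by metis
      then have "paths_through (g_tree M) (restrict_to f (Suc n)) \<subseteq> theta ` W"
        using paths_through_theta[of x n] x Wc by blast
      then show "\<exists>n. paths_through (g_tree M) (restrict_to f n) \<subseteq> theta ` W" by blast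
    qed
  qed
  show "theta ` topspace X = topspace (path_space (g_tree M))"
    by (simp add: topspace_eq theta_image)
  show "inj_on theta (topspace X)" by (simp add: topspace_eq theta_inj)
qed

lemma node_compact:
  assumes "\<sigma> \<in> g_tree M" "\<sigma> \<noteq> []"
  shows "\<sigma> \<in> compact_nodes (g_tree M)"
proof -
  obtain x where x: "x \<in> carrier G" "\<sigma> = restrict_to (theta x) (length \<sigma>)"
    using tree_ex_restrict[OF assms(1)] by metis
  obtain n where "length \<sigma> = Suc n" using assms(2) by (cases \<sigma>) auto
  then have "paths_through (g_tree M) \<sigma> = theta ` (x <# V n)"
    using paths_through_theta[OF x(1), of n] x(2) by simp
  moreover have "compactin (path_space (g_tree M)) (theta ` (x <# V n))"
    using image_compactin[OF _ homeomorphic_imp_continuous_map[OF theta_homeo]]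
      V_coset_compact_open[OF x(1)] by (simp add: compact_open_def)
  ultimately show ?thesis using assms(1) by (simp add: compact_nodes_def)
qed

lemma root_compact: "[] \<in> compact_nodes (g_tree M) \<longleftrightarrow> compact_space X"
proof -
  have "[] \<in> g_tree M" using restrict_theta_tree[OF one_closed, of 0] by (simp add: restrict_to_def)
  moreover have "paths_through (g_tree M) [] = topspace (path_space (g_tree M))"
    by (auto simp: paths_through_iff restrict_to_def)
  ultimately have "[] \<in> compact_nodes (g_tree M) \<longleftrightarrow> compact_space (path_space (g_tree M))"
    by (simp add: compact_nodes_def compact_space_def)
  also have "\<dots> \<longleftrightarrow> compact_space X"
    using homeomorphic_compact_space[OF homeomorphic_map_imp_homeomorphic_space[OF theta_homeo]] by simp
  finally show ?thesis .
qed

lemma path_space_locally_compact: "locally_compact_space (path_space (g_tree M))"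
  using homeomorphic_locally_compact_spaceD[OF loc_compact] homeomorphic_map_imp_homeomorphic_space[OF theta_homeo]
  by blast

text \<open>Translation moves the last coset \<open>x <# V k\<close> onto the subgroup
  \<open>V k\<close>, and inversion turns the left cosets of \<open>V i\<close> contained in it into
  the right cosets counted by \<open>group_index\<close>.\<close>

lemma coset_count:
  assumes \<sigma>: "\<sigma> \<in> g_tree M" "\<sigma> \<noteq> []" "length \<sigma> \<le> i"
  shows "finite {b. g_lcoset M b i \<and> g_le M b (g_last \<sigma>)}"
    and "card {b. g_lcoset M b i \<and> g_le M b (g_last \<sigma>)} =
      idx (g_chain M (length \<sigma> - 1)) (g_chain M i)"
proof -
  define k where "k = length \<sigma> - 1"
  have Vik: "V i \<subseteq> V k" using V_mono[of k i] assms(3) by (simp add: k_def)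
  define a where "a = g_last \<sigma>"
  have a: "g_lcoset M a k" using g_last_lcoset[OF \<sigma>(1,2)] by (simp add: a_def k_def)
  then have ad: "a \<in> mg_dom M" "\<beta> a \<noteq> {}" by (auto simp: g_lcoset_iff)
  then obtain x where x: "x \<in> \<beta> a" "x \<in> carrier G" using \<beta>_subset by blast
  have ax: "\<beta> a = x <# V k" using g_lcoset_eq[OF a x(1)] .
  let ?S = "{b. g_lcoset M b i \<and> g_le M b a}"
  let ?R = "rcosets\<^bsub>G\<lparr>carrier := V k\<rparr>\<^esub> V i"
  note R = subgroup_Int_rcosets[OF V_subgroup V_subgroup Vik]
  \<comment> \<open>A left coset \<open>y V_i\<close> inside \<open>x V_k\<close> becomes the right
    coset \<open>V_i y^-1 x\<close> inside \<open>V_k\<close>.\<close>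
  define F where "F b = set_inv (inv x <# \<beta> b)" for b
  define F' where "F' C = cd (x <# set_inv C)" for C
  have trans: "inv x <# (x <# A) = A" "x <# (inv x <# A) = A" if "A \<subseteq> carrier G" for A
    using that x(2) by (simp_all add: lcos_m_assoc lcos_mult_one)
  have mono: "y <# A \<subseteq> y <# C" if "A \<subseteq> C" for A C y
    using that by (auto simp: l_coset_def)
  have "bij_betw F ?S ?R"
  proof (rule bij_betw_byWitness[where f' = F'])
    have S: "is_coset (\<beta> b)" "\<beta> b \<subseteq> carrier G" "rgrp (\<beta> b) = V i" "\<beta> b \<subseteq> x <# V k" "b \<in> mg_dom M"
      if "b \<in> ?S" for b
      using that coset[of b] \<beta>_subset[of b] ax by (auto simp: g_lcoset_iff g_le_iff)
    have tb: "is_coset (inv x <# \<beta> b)" "rgrp (inv x <# \<beta> b) = V i" "inv x <# \<beta> b \<subseteq> carrier G"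
      if "b \<in> ?S" for b
      using is_coset_translate[OF S(1)[OF that], of "inv x"] S(3)[OF that] x(2) is_coset_subset by auto
    show "\<forall>b\<in>?S. F' (F b) = b"
    proof
      fix b assume b: "b \<in> ?S"
      then have "x <# set_inv (F b) = \<beta> b"
        using set_inv_set_inv[OF tb(3)[OF b]] trans(2)[OF S(2)[OF b]] by (simp add: F_def)
      then show "F' (F b) = b"
        using cd[OF dom[OF S(5)[OF b]]] \<beta>_inj S(5)[OF b] by (simp add: F'_def)
    qed
    have RC: "is_coset C" "C \<subseteq> V k" "lgrp C = V i" "C \<subseteq> carrier G" "set_inv C \<subseteq> V k"
      if "C \<in> ?R" for C
    proof -
      show C: "is_coset C" "C \<subseteq> V k" "lgrp C = V i" using that R by auto
      then show "C \<subseteq> carrier G" using is_coset_subset by blast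
      show "set_inv C \<subseteq> V k"
        using C(2) subgroup.m_inv_closed[OF V_subgroup] by (auto simp: SET_INV_def)
    qed
    have tc: "is_coset (x <# set_inv C)" "rgrp (x <# set_inv C) = V i" "compact_open (x <# set_inv C)"
      if "C \<in> ?R" for C
    proof -
      have ic: "is_coset (set_inv C)" "rgrp (set_inv C) = V i"
        using is_coset_set_inv RC[OF that] rgrp_set_inv by auto
      then show "is_coset (x <# set_inv C)" "rgrp (x <# set_inv C) = V i"
        using is_coset_translate[OF ic(1) x(2)] by auto
      then obtain y where y: "y \<in> x <# set_inv C" by (auto simp: is_coset_def)
      then have "y \<in> carrier G" using \<open>is_coset (x <# set_inv C)\<close> is_coset_subset by blast
      then show "compact_open (x <# set_inv C)"
        using is_coset_l_coset[OF \<open>is_coset (x <# set_inv C)\<close> y] V_coset_compact_open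
          \<open>rgrp (x <# set_inv C) = V i\<close> by metis
    qed
    have cdC: "cd (x <# set_inv C) \<in> mg_dom M" "\<beta> (cd (x <# set_inv C)) = x <# set_inv C"
      if "C \<in> ?R" for C
      using cd tc[OF that] by (simp_all add: mg_dom_iff)
    show "\<forall>C\<in>?R. F (F' C) = C"
    proof
      fix C assume C: "C \<in> ?R"
      have "set_inv C \<subseteq> carrier G" using RC(5)[OF C] V_carrier by blast
      then show "F (F' C) = C"
        using cdC[OF C] trans(1) set_inv_set_inv[OF RC(4)[OF C]] by (simp add: F_def F'_def)
    qed
    show "F ` ?S \<subseteq> ?R"
    proof
      fix C assume "C \<in> F ` ?S"
      then obtain b where b: "b \<in> ?S" "C = F b" by blast
      have "inv x <# \<beta> b \<subseteq> V k"
        using mono[OF S(4)[OF b(1)], of "inv x"] trans(1)[OF V_carrier] by simp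
      then have "C \<subseteq> V k"
        using subgroup.m_inv_closed[OF V_subgroup] by (auto simp: b(2) F_def SET_INV_def)
      moreover have "is_coset C" "lgrp C = V i"
        using is_coset_set_inv[OF tb(1)[OF b(1)]] lgrp_set_inv[OF tb(3)[OF b(1)]] tb(2)[OF b(1)]
        by (simp_all add: b(2) F_def)
      ultimately show "C \<in> ?R" using R by blast
    qed
    show "F' ` ?R \<subseteq> ?S"
    proof
      fix b assume "b \<in> F' ` ?R"
      then obtain C where C: "C \<in> ?R" "b = cd (x <# set_inv C)" by (auto simp: F'_def)
      have "x <# set_inv C \<noteq> {}" using tc(1)[OF C(1)] by (simp add: is_coset_def)
      then show "b \<in> ?S"
        using cdC[OF C(1)] tc[OF C(1)] mono[OF RC(5)[OF C(1)], of x] ad(1)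
        by (simp add: C(2) g_lcoset_iff g_le_iff ax)
    qed
  qed
  moreover have "finite ?R"
    by (rule finite_rcosets[OF V_subgroup V_compact_open V_subgroup V_compact_open Vik])
  ultimately have "finite ?S" "card ?S = card ?R"
    using bij_betw_finite bij_betw_same_card by blast+
  moreover have "card ?R = idx (g_chain M k) (g_chain M i)"
    using idx[OF g_sub_chain g_sub_chain, of k i] Vik by (simp add: group_index_def V_def Int_absorb1)
  ultimately show "finite {b. g_lcoset M b i \<and> g_le M b (g_last \<sigma>)}"
    "card {b. g_lcoset M b i \<and> g_le M b (g_last \<sigma>)} =
      idx (g_chain M (length \<sigma> - 1)) (g_chain M i)"
    by (simp_all add: a_def k_def)
qed

lemma g_cosets_exists:
  assumes \<sigma>: "\<sigma> \<in> g_tree M" "\<sigma> \<noteq> []" "length \<sigma> \<le> i"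
  shows "\<exists>n. distinct (list_decode n) \<and>
     length (list_decode n) = idx (g_chain M (length \<sigma> - 1)) (g_chain M i) \<and>
     (\<forall>b\<in>set (list_decode n). g_lcoset M b i \<and> g_le M b (g_last \<sigma>))"
proof -
  obtain bs where bs: "set bs = {b. g_lcoset M b i \<and> g_le M b (g_last \<sigma>)}" "distinct bs"
    using coset_count(1)[OF \<sigma>] finite_distinct_list by metis
  then show ?thesis
    using coset_count(2)[OF \<sigma>] distinct_card[OF bs(2)] by (intro exI[of _ "list_encode bs"]) auto
qed

lemma g_bound:
  assumes \<sigma>: "\<sigma> \<in> g_tree M" "\<sigma> \<noteq> []" and \<rho>: "\<rho> \<in> g_tree M" "prefix \<sigma> \<rho>" "i < length \<rho>"
  shows "\<rho> ! i \<le> g_bound M idx \<sigma> i"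
proof (cases "i < length \<sigma>")
  case True
  then have "\<rho> ! i = \<sigma> ! i" using \<rho>(2) by (auto simp: prefix_def nth_append)
  then show ?thesis
    using True member_le_sum_list[of "\<sigma> ! i" \<sigma>] by (simp add: g_bound_def)
next
  case False
  then have i: "length \<sigma> \<le> i" by simp
  let ?bs = "list_decode (g_cosets M idx \<sigma> i)"
  let ?S = "{b. g_lcoset M b i \<and> g_le M b (g_last \<sigma>)}"
  have "distinct ?bs \<and> length ?bs = idx (g_chain M (length \<sigma> - 1)) (g_chain M i) \<and> set ?bs \<subseteq> ?S"
  proof -
    define good where "good n \<longleftrightarrow> distinct (list_decode n) \<and>
     length (list_decode n) = idx (g_chain M (length \<sigma> - 1)) (g_chain M i) \<and>
     (\<forall>b\<in>set (list_decode n). g_lcoset M b i \<and> g_le M b (g_last \<sigma>))" for n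
    have "g_cosets M idx \<sigma> i = (LEAST n. good n)"
      unfolding g_cosets_def good_def using \<sigma> i by simp
    moreover have "\<exists>n. good n" unfolding good_def by (rule g_cosets_exists[OF \<sigma> i])
    ultimately have "good (g_cosets M idx \<sigma> i)" using LeastI_ex[of good] by simp
    then show ?thesis unfolding good_def by blast
  qed
  then have "set ?bs = ?S"
    using coset_count[OF \<sigma> i] by (intro card_subset_eq) (auto simp: distinct_card)
  moreover have "\<sigma> ! (length \<sigma> - 1) = \<rho> ! (length \<sigma> - 1)"
    using \<rho>(2) \<sigma>(2) by (auto simp: prefix_def nth_append)
  then have "\<rho> ! i \<in> ?S"
    using g_treeD(1)[OF \<rho>(1,3)] g_treeD(2)[OF \<rho>(1), of "length \<sigma> - 1" i] \<rho>(3) i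
      g_last_lcoset[OF \<sigma>] by (auto simp: g_le_iff g_lcoset_iff g_last_eq[OF \<sigma>(2)])
  ultimately show ?thesis
    using member_le_sum_list[of "\<rho> ! i" ?bs] by (simp add: g_bound_def)
qed

section \<open>Inversion and multiplication on strings\<close>

lemma restrict_last:
  "g_last (restrict_to (theta x) (Suc n)) = theta x n"
  by (simp add: g_last_def)

lemma least_le:
  fixes R :: "nat \<Rightarrow> bool"
  assumes "\<And>j. j < N \<Longrightarrow> \<not> R j" "R K"
  shows "N \<le> (LEAST J. R J)"
  using LeastI[of R K] assms by (meson linorder_not_less)

lemma Least_eq_self: "(LEAST b::nat. b = c) = c"
  by (rule Least_equality) auto

lemma inv_len_less:
  assumes "j < g_inv_len M \<sigma>"
  shows "j < length \<sigma>" "g_le M (g_conj M (g_last \<sigma>)) (g_chain M j)"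
proof -
  have "g_inv_len M \<sigma> \<le> length \<sigma>" unfolding g_inv_len_def by (rule Least_le) simp
  with assms show "j < length \<sigma>" by simp
  show "g_le M (g_conj M (g_last \<sigma>)) (g_chain M j)"
    using not_less_Least[OF assms[unfolded g_inv_len_def]] by blast
qed

lemma conj_theta:
  assumes "x \<in> carrier G"
  shows "g_conj M (theta x n) \<in> mg_dom M" "\<beta> (g_conj M (theta x n)) = lgrp (x <# V n)"
  using g_conj[of "theta x n"] theta[OF assms, of n] by (auto simp: g_lcoset_iff)

text \<open>For \<open>y\<close> in \<open>x V_k\<close>, the inverse of \<open>y\<close> is
  \<open>x^-1 (x y^-1)\<close> with second factor in \<open>x V_k x^-1\<close>, which the test
  places in \<open>V_j\<close>. So the inverted coset lies in \<open>x^-1 V_j\<close>, and the point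
  \<open>x^-1\<close> singles this coset out.\<close>

lemma inv_entry_iff:
  assumes x: "x \<in> carrier G" and j: "j < g_inv_len M (restrict_to (theta x) n)"
  shows "g_lcoset M b j \<and> g_le M (g_inv M (g_last (restrict_to (theta x) n))) b \<longleftrightarrow> b = theta (inv x) j"
proof -
  obtain k where k: "n = Suc k" using inv_len_less(1)[OF j] by (cases n) auto
  have le: "lgrp (x <# V k) \<subseteq> V j"
    using inv_len_less(2)[OF j] conj_theta(2)[OF x, of k]
    by (simp add: k restrict_last g_le_iff V_def)
  have iv: "g_inv M (theta x k) \<in> mg_dom M" "\<beta> (g_inv M (theta x k)) = set_inv (x <# V k)"
    using g_inv theta[OF x, of k] by auto
  have "inv x \<in> set_inv (x <# V k)" using V_coset(3)[OF x, of k] by (auto simp: SET_INV_def)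
  then have "b = theta (inv x) j" if "g_lcoset M b j" "g_le M (g_inv M (theta x k)) b"
    using theta_eqI[OF that(1)] that(2) iv(2) by (auto simp: g_le_iff)
  moreover have "set_inv (x <# V k) \<subseteq> inv x <# V j"
  proof
    fix z assume "z \<in> set_inv (x <# V k)"
    then obtain y where y: "y \<in> x <# V k" "z = inv y" by (auto simp: SET_INV_def)
    then have yc: "y \<in> carrier G" using is_coset_subset V_coset(1)[OF x] by blast
    have "x \<otimes> inv y \<in> V j" using le V_coset(3)[OF x, of k] y(1) unfolding lgrp_def by blast
    moreover have "z = inv x \<otimes> (x \<otimes> inv y)" using x yc y(2) by (simp add: mult_inv_cancel)
    ultimately show "z \<in> inv x <# V j" by (auto simp: l_coset_def)
  qed
  then have "g_le M (g_inv M (theta x k)) (theta (inv x) j)"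
    using theta[OF inv_closed[OF x], of j] iv by (simp add: g_le_iff)
  ultimately show ?thesis
    using theta(3)[OF inv_closed[OF x], of j] by (auto simp: k restrict_last)
qed

lemma inv_str:
  assumes x: "x \<in> carrier G"
  shows "g_inv_str M (restrict_to (theta x) n) =
    restrict_to (theta (inv x)) (g_inv_len M (restrict_to (theta x) n))"
proof -
  have "g_inv_entry M (restrict_to (theta x) n) j = theta (inv x) j"
    if "j < g_inv_len M (restrict_to (theta x) n)" for j
    using inv_entry_iff[OF x that] restrict_theta_tree[OF x, of n] that
    by (simp add: g_inv_entry_def Least_eq_self)
  then show ?thesis by (simp add: g_inv_str_def restrict_to_def)
qed

lemma inv_len_ge:
  assumes x: "x \<in> carrier G" and "N \<le> n" "0 < n"
    and le: "\<And>j. j < N \<Longrightarrow> lgrp (x <# V (n - 1)) \<subseteq> V j"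
  shows "N \<le> g_inv_len M (restrict_to (theta x) n)"
  unfolding g_inv_len_def
proof (rule least_le)
  obtain k where k: "n = Suc k" using assms(3) by (cases n) auto
  show "\<not> (j = length (restrict_to (theta x) n) \<or>
      \<not> g_le M (g_conj M (g_last (restrict_to (theta x) n))) (g_chain M j))" if "j < N" for j
    using le[OF that] that assms(2) conj_theta[OF x, of k] chain_dom
    by (simp add: k restrict_last g_le_iff V_def)
qed auto

text \<open>A longer string ends in a smaller coset, so tests that succeeded once keep succeeding.
  This yields the monotonicity demanded of a program for a computable map.\<close>

lemma inv_len_mono:
  assumes x: "x \<in> carrier G" and "n \<le> m"
  shows "g_inv_len M (restrict_to (theta x) n) \<le> g_inv_len M (restrict_to (theta x) m)"
proof (cases "n = 0")
  case True
  have "g_inv_len M (restrict_to (theta x) 0) \<le> 0"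
    unfolding g_inv_len_def by (rule Least_le) simp
  with True show ?thesis by simp
next
  case False
  have len: "g_inv_len M (restrict_to (theta x) n) \<le> n"
    unfolding g_inv_len_def by (rule Least_le) simp
  show ?thesis
  proof (rule inv_len_ge[OF x])
    fix j assume "j < g_inv_len M (restrict_to (theta x) n)"
    then have "g_le M (g_conj M (theta x (n - 1))) (g_chain M j)"
      using inv_len_less(2)[of j "restrict_to (theta x) n"] restrict_last[of x "n - 1"] False by simp
    then have "lgrp (x <# V (n - 1)) \<subseteq> V j"
      using conj_theta(2)[OF x] by (simp add: g_le_iff V_def)
    moreover have "x <# V (m - 1) \<subseteq> x <# V (n - 1)" using assms(2) by (intro V_coset_mono) simp
    ultimately show "lgrp (x <# V (m - 1)) \<subseteq> V j" unfolding lgrp_def by blast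
  qed (use len assms(2) False in auto)
qed

text \<open>The right coset \<open>V_N x\<close> is an open set containing \<open>x\<close>, so it
  contains some \<open>x V_k\<close>; then \<open>x V_k x^-1\<close> is contained in
  \<open>V_N\<close>.\<close>

lemma inv_len_unbounded:
  assumes x: "x \<in> carrier G"
  shows "\<exists>n. N < g_inv_len M (restrict_to (theta x) n)"
proof -
  have "openin X (V N #> x)" using compact_open_r_coset[OF x V_compact_open] by (simp add: compact_open_def)
  moreover have "x \<in> V N #> x" using rcos_self[OF x V_subgroup] .
  ultimately obtain k where k: "x <# V k \<subseteq> V N #> x" using V_coset_small by metis
  \<comment> \<open>The last entry of a string of this length is at level \<open>max k N\<close>:
    deep enough for the inclusion, and the cap on the output length exceeds
    \<open>N\<close>.\<close>
  define n where "n = Suc (max k N)"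
  have "x <# V (n - 1) \<subseteq> V N #> x" using k V_coset_mono[of k "n - 1" x] by (auto simp: n_def)
  then have "lgrp (x <# V (n - 1)) \<subseteq> lgrp (V N #> x)" unfolding lgrp_def by blast
  also have "lgrp (V N #> x) = V N"
    using rcosets_is_coset(2)[OF V_subgroup] x by (auto simp: RCOSETS_def)
  finally have "lgrp (x <# V (n - 1)) \<subseteq> V j" if "j < Suc N" for j
    using V_mono[of j N] that by auto
  then have "Suc N \<le> g_inv_len M (restrict_to (theta x) n)"
    by (intro inv_len_ge[OF x]) (auto simp: n_def)
  then show ?thesis by (intro exI[of _ n]) simp
qed

lemma mul_len_less:
  assumes "j < g_mul_len M \<sigma> \<tau>"
  shows "j < length \<sigma>" "g_le M (g_chain M (length \<sigma> - 1)) (g_conj M (nth0 \<tau> j))"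
proof -
  have "g_mul_len M \<sigma> \<tau> \<le> length \<sigma>" unfolding g_mul_len_def by (rule Least_le) simp
  with assms show "j < length \<sigma>" by simp
  show "g_le M (g_chain M (length \<sigma> - 1)) (g_conj M (nth0 \<tau> j))"
    using not_less_Least[OF assms[unfolded g_mul_len_def]] by blast
qed

text \<open>Both the existence and the uniqueness of the left factor come from \<open>x\<close>: the
  coset must be \<open>x L\<close> for the conjugate \<open>L\<close>, and this contains
  \<open>x V_k\<close> since the test places \<open>V_k\<close> in \<open>L\<close>.\<close>

lemma mul_left_iff:
  assumes x: "x \<in> carrier G" and y: "y \<in> carrier G"
    and j: "j < g_mul_len M (restrict_to (theta x) n) (restrict_to (theta y) n)"
  shows "g_def M c (g_conj M (nth0 (restrict_to (theta y) n) j)) \<and> g_le M (g_last (restrict_to (theta x) n)) c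
    \<longleftrightarrow> c = cd (x <# lgrp (y <# V j))"
    and "g_prod M (cd (x <# lgrp (y <# V j))) (theta y j) = theta (x \<otimes> y) j"
proof -
  obtain k where k: "n = Suc k" using mul_len_less(1)[OF j] by (cases n) auto
  have jn: "j < n" using mul_len_less(1)[OF j] by simp
  define L where "L = lgrp (y <# V j)"
  have cj: "g_conj M (theta y j) \<in> mg_dom M" "\<beta> (g_conj M (theta y j)) = L"
    using conj_theta[OF y, of j] by (simp_all add: L_def)
  have VL: "V k \<subseteq> L"
    using mul_len_less(2)[OF j] cj jn by (simp add: k g_le_iff V_def)
  have L: "subgroup L G" "compact_open L"
    using lgrp_subgroup[OF V_coset(1)[OF y]] compact_open_lgrp[OF V_coset_compact_open[OF y] V_coset(1)[OF y]]
    by (simp_all add: L_def)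
  have "x <# L \<in> lcosets L" using x by (auto simp: LCOSETS_def)
  then have xL: "is_coset (x <# L)" "rgrp (x <# L) = L" using lcosets_is_coset[OF L(1)] by auto
  then have "x <# L \<in> mg_dom mg" using compact_open_l_coset[OF x L(2)] by (simp add: mg_dom_iff)
  note c = cd[OF this]
  have Lne: "L \<noteq> {}" "x <# L \<noteq> {}" using subgroup.one_closed[OF L(1)] xL(1) by (auto simp: is_coset_def)
  have "x <# V k \<subseteq> x <# L" using VL by (auto simp: l_coset_def)
  then have "g_def M (cd (x <# L)) (g_conj M (theta y j)) \<and> g_le M (theta x k) (cd (x <# L))"
    using c cj theta[OF x, of k] xL subgroup_is_coset(2)[OF L(1)] Lne by (simp add: g_def_iff g_le_iff)
  moreover have "c = cd (x <# L)" if "g_def M c (g_conj M (theta y j))" "g_le M (theta x k) c" for c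
  proof -
    have cc: "c \<in> mg_dom M" "is_coset (\<beta> c)" "rgrp (\<beta> c) = L"
      using that(1) cj subgroup_is_coset(2)[OF L(1)] coset by (auto simp: g_def_iff)
    have "x \<in> \<beta> c" using that(2) theta(2)[OF x, of k] V_coset(3)[OF x, of k] by (auto simp: g_le_iff)
    then have "\<beta> c = x <# L" using is_coset_l_coset[OF cc(2)] cc(3) by simp
    then show ?thesis using \<beta>_inj[OF cc(1)] \<open>x <# L \<in> mg_dom mg\<close> cd by auto
  qed
  ultimately show "g_def M c (g_conj M (nth0 (restrict_to (theta y) n) j)) \<and> g_le M (g_last (restrict_to (theta x) n)) c
    \<longleftrightarrow> c = cd (x <# lgrp (y <# V j))"
    using jn unfolding L_def[symmetric] by (auto simp: k restrict_last)
  have d: "g_def M (cd (x <# L)) (theta y j)"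
    using c theta[OF y, of j] xL Lne V_coset(3)[OF y, of j] by (auto simp: g_def_iff L_def)
  have "x \<in> x <# L" using lcos_self[OF x L(1)] .
  then have "(x <# L) <#> (y <# V j) = x <# (y <# V j)"
    using set_mult_coset[OF xL(1) V_coset(1)[OF y]] xL(2) by (simp add: L_def)
  also have "\<dots> = (x \<otimes> y) <# V j" using x y V_carrier by (simp add: lcos_m_assoc)
  finally have "\<beta> (g_prod M (cd (x <# L)) (theta y j)) = \<beta> (theta (x \<otimes> y) j)"
    using g_prod(2)[OF d] c theta(2)[OF y] theta(2)[OF m_closed[OF x y]] by simp
  then show "g_prod M (cd (x <# lgrp (y <# V j))) (theta y j) = theta (x \<otimes> y) j"
    using \<beta>_inj g_prod(1)[OF d] theta(1)[OF m_closed[OF x y]] by (simp add: L_def)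
qed

lemma mul_str:
  assumes x: "x \<in> carrier G" and y: "y \<in> carrier G"
  shows "g_mul_str M (restrict_to (theta x) n) (restrict_to (theta y) n) =
    restrict_to (theta (x \<otimes> y)) (g_mul_len M (restrict_to (theta x) n) (restrict_to (theta y) n))"
proof -
  have "g_prod M (g_mul_left M (restrict_to (theta x) n) (restrict_to (theta y) n) j) (nth0 (restrict_to (theta y) n) j)
      = theta (x \<otimes> y) j"
    if j: "j < g_mul_len M (restrict_to (theta x) n) (restrict_to (theta y) n)" for j
  proof -
    have "g_mul_left M (restrict_to (theta x) n) (restrict_to (theta y) n) j = cd (x <# lgrp (y <# V j))"
      using mul_left_iff(1)[OF x y j] restrict_theta_tree[OF x, of n] restrict_theta_tree[OF y, of n] j
      by (simp add: g_mul_left_def Least_eq_self)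
    then show ?thesis
      using mul_left_iff(2)[OF x y j] mul_len_less(1)[OF j] by simp
  qed
  then show ?thesis by (simp add: g_mul_str_def restrict_to_def)
qed

lemma mul_len_ge:
  assumes y: "y \<in> carrier G" and "N \<le> n" "0 < n"
    and le: "\<And>j. j < N \<Longrightarrow> V (n - 1) \<subseteq> lgrp (y <# V j)"
  shows "N \<le> g_mul_len M (restrict_to (theta x) n) (restrict_to (theta y) n)"
  unfolding g_mul_len_def
proof (rule least_le)
  show "\<not> (j = length (restrict_to (theta x) n) \<or>
      \<not> g_le M (g_chain M (length (restrict_to (theta x) n) - 1)) (g_conj M (nth0 (restrict_to (theta y) n) j)))"
    if "j < N" for j
    using le[OF that] that assms(2) conj_theta[OF y, of j] chain_dom
    by (simp add: g_le_iff V_def)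
qed auto

lemma mul_len_mono:
  assumes y: "y \<in> carrier G" and "n \<le> m"
  shows "g_mul_len M (restrict_to (theta x) n) (restrict_to (theta y) n)
    \<le> g_mul_len M (restrict_to (theta x) m) (restrict_to (theta y) m)"
proof -
  have len: "g_mul_len M (restrict_to (theta x) n) (restrict_to (theta y) n) \<le> n"
    unfolding g_mul_len_def by (rule Least_le) simp
  show ?thesis
  proof (cases "n = 0")
    case False
    show ?thesis
    proof (rule mul_len_ge[OF y])
      fix j assume j: "j < g_mul_len M (restrict_to (theta x) n) (restrict_to (theta y) n)"
      then have "V (n - 1) \<subseteq> lgrp (y <# V j)"
        using mul_len_less[OF j] conj_theta(2)[OF y, of j] by (simp add: g_le_iff V_def)
      then show "V (m - 1) \<subseteq> lgrp (y <# V j)" using V_mono[of "n - 1" "m - 1"] assms(2)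
        by (meson diff_le_mono subset_trans)
    qed (use len assms(2) False in auto)
  qed (use len in simp)
qed

text \<open>The conjugate \<open>y V_N y^-1\<close> is an open subgroup, so some \<open>V_k\<close>
  is contained in it, and in the larger conjugates for smaller levels as well.\<close>

lemma mul_len_unbounded:
  assumes y: "y \<in> carrier G"
  shows "\<exists>n. N < g_mul_len M (restrict_to (theta x) n) (restrict_to (theta y) n)"
proof -
  have "openin X (lgrp (y <# V N))"
    using compact_open_lgrp[OF V_coset_compact_open[OF y] V_coset(1)[OF y]] by (simp add: compact_open_def)
  then obtain k where k: "V k \<subseteq> lgrp (y <# V N)"
    using V_small subgroup.one_closed[OF lgrp_subgroup[OF V_coset(1)[OF y]]] by metis
  define n where "n = Suc (max k N)"
  have "V (n - 1) \<subseteq> lgrp (y <# V j)" if "j < Suc N" for j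
  proof -
    have "V (n - 1) \<subseteq> V k" by (rule V_mono) (simp add: n_def)
    moreover have "lgrp (y <# V N) \<subseteq> lgrp (y <# V j)"
      using V_coset_mono[of j N y] that unfolding lgrp_def by auto
    ultimately show ?thesis using k by blast
  qed
  then have "Suc N \<le> g_mul_len M (restrict_to (theta x) n) (restrict_to (theta y) n)"
    by (intro mul_len_ge[OF y]) (auto simp: n_def)
  then show ?thesis by (intro exI[of _ n]) simp
qed

end

section \<open>Computable maps from functions on strings\<close>

lemma string_graph_restrict_to: "string_graph (restrict_to g l) = {(i, g i) |i. i < l}"
  by (auto simp: string_graph_def)

lemma string_graph_subset_prefix:
  assumes "string_graph \<rho> \<subseteq> path_graph g"
  shows "\<rho> = restrict_to g (length \<rho>)"
proof (rule nth_equalityI)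
  fix i assume "i < length \<rho>"
  then have "(i, \<rho> ! i) \<in> path_graph g" using assms by (auto simp: string_graph_def)
  then show "\<rho> ! i = restrict_to g (length \<rho>) ! i"
    using \<open>i < length \<rho>\<close> by (simp add: path_graph_def)
qed simp

lemma path_graph_eq:
  fixes len :: "nat \<Rightarrow> nat"
  assumes "\<And>N. \<exists>n. N < len n"
  shows "path_graph g = (\<Union>n. string_graph (restrict_to g (len n)))"
  using assms by (fastforce simp: path_graph_def string_graph_restrict_to)

text \<open>Outputs are given as initial segments of the image path, of monotone and unbounded
  length. Monotonicity along nodes reduces to monotonicity along paths, because every node lies on a
  path.\<close>

lemma computable_mapI:
  assumes T: "is_tree T" "leafless T"
    and e: "\<And>\<sigma>. phi e (list_encode \<sigma>) = (if \<sigma> \<in> T then Some (list_encode (F \<sigma>)) else None)"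
    and \<Phi>: "\<And>f. f \<in> paths T \<Longrightarrow> \<Phi> f \<in> paths S"
    and F: "\<And>f n. f \<in> paths T \<Longrightarrow> F (restrict_to f n) = restrict_to (\<Phi> f) (len (restrict_to f n))"
    and mono: "\<And>f n m. f \<in> paths T \<Longrightarrow> n \<le> m \<Longrightarrow> len (restrict_to f n) \<le> len (restrict_to f m)"
    and unb: "\<And>f N. f \<in> paths T \<Longrightarrow> \<exists>n. N < len (restrict_to f n)"
  shows "computable_map_index e T S \<Phi>"
  unfolding computable_map_index_def
proof (intro exI[of _ "\<lambda>\<sigma>. if \<sigma> \<in> T then Some (F \<sigma>) else None"] conjI allI ballI impI)
  let ?P = "\<lambda>\<sigma>. if \<sigma> \<in> T then Some (F \<sigma>) else None"
  have dom: "dom ?P = T" by (auto simp: dom_def)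
  have ex: "\<exists>f\<in>paths T. \<sigma> = restrict_to f (length \<sigma>)" if "\<sigma> \<in> T" for \<sigma>
    using leafless_extend[OF T that] by (metis paths_through_iff)
  show "phi e (list_encode \<sigma>) = map_option list_encode (?P \<sigma>)" for \<sigma>
    by (simp add: e)
  show "dom ?P \<subseteq> T" by (simp add: dom)
  have "F \<sigma> \<in> S" if "\<sigma> \<in> T" for \<sigma>
    using ex[OF that] F \<Phi> by (metis (mono_tags, lifting) mem_Collect_eq paths_def)
  then show "ran ?P \<subseteq> S" by (auto simp: ran_def)
  show "prefix (the (?P \<sigma>)) (the (?P \<tau>))" if d: "\<sigma> \<in> dom ?P" "\<tau> \<in> dom ?P" and pre: "prefix \<sigma> \<tau>" for \<sigma> \<tau>
  proof -
    obtain f where f: "f \<in> paths T" "\<tau> = restrict_to f (length \<tau>)" using ex d(2) dom by blast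
    then have \<sigma>: "\<sigma> = restrict_to f (length \<sigma>)" using pre prefix_restrict_toD by metis
    have "length \<sigma> \<le> length \<tau>" using pre prefix_length_le by blast
    then have "prefix (F (restrict_to f (length \<sigma>))) (F (restrict_to f (length \<tau>)))"
      by (simp add: F[OF f(1)] prefix_restrict_to mono[OF f(1)])
    then show ?thesis using f(2) \<sigma> d dom by simp
  qed
  fix f assume f: "f \<in> paths T"
  then show "\<Phi> f \<in> paths S" by (rule \<Phi>)
  have fT: "restrict_to f n \<in> T" for n using f by (simp add: paths_def)
  show "path_graph (\<Phi> f) = (\<Union>n\<in>{n. restrict_to f n \<in> dom ?P}. string_graph (the (?P (restrict_to f n))))"
    using path_graph_eq[OF unb[OF f], of "\<Phi> f"] by (simp add: dom fT F[OF f])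
qed

lemma computable_map2I:
  assumes T: "is_tree T" "leafless T"
    and e: "\<And>\<sigma> \<tau>. phi e (prod_encode (list_encode \<sigma>, list_encode \<tau>)) =
        (if \<sigma> \<in> T \<and> \<tau> \<in> T \<and> length \<sigma> = length \<tau> then Some (list_encode (F \<sigma> \<tau>)) else None)"
    and \<Phi>: "\<And>f g. f \<in> paths T \<Longrightarrow> g \<in> paths T \<Longrightarrow> \<Phi> f g \<in> paths S"
    and F: "\<And>f g n. f \<in> paths T \<Longrightarrow> g \<in> paths T \<Longrightarrow> F (restrict_to f n) (restrict_to g n) =
        restrict_to (\<Phi> f g) (len (restrict_to f n) (restrict_to g n))"
    and mono: "\<And>f g n m. f \<in> paths T \<Longrightarrow> g \<in> paths T \<Longrightarrow> n \<le> m \<Longrightarrow>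
        len (restrict_to f n) (restrict_to g n) \<le> len (restrict_to f m) (restrict_to g m)"
    and unb: "\<And>f g N. f \<in> paths T \<Longrightarrow> g \<in> paths T \<Longrightarrow> \<exists>n. N < len (restrict_to f n) (restrict_to g n)"
  shows "computable_map2_index e T S \<Phi>"
proof -
  define P where "P = (\<lambda>(\<sigma>, \<tau>). if \<sigma> \<in> T \<and> \<tau> \<in> T \<and> length \<sigma> = length \<tau> then Some (F \<sigma> \<tau>) else None)"
  have P: "P (\<sigma>, \<tau>) = (if \<sigma> \<in> T \<and> \<tau> \<in> T \<and> length \<sigma> = length \<tau> then Some (F \<sigma> \<tau>) else None)" for \<sigma> \<tau>
    by (simp add: P_def)
  have dom: "p \<in> dom P \<longleftrightarrow> fst p \<in> T \<and> snd p \<in> T \<and> length (fst p) = length (snd p)" for p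
    by (cases p) (simp add: dom_def P)
  have ex: "\<exists>f\<in>paths T. \<sigma> = restrict_to f (length \<sigma>)" if "\<sigma> \<in> T" for \<sigma>
    using leafless_extend[OF T that] by (metis paths_through_iff)
  have "F \<sigma> \<tau> \<in> S" if \<sigma>\<tau>: "\<sigma> \<in> T" "\<tau> \<in> T" "length \<sigma> = length \<tau>" for \<sigma> \<tau>
  proof -
    obtain f g where fg: "f \<in> paths T" "\<sigma> = restrict_to f (length \<sigma>)" "g \<in> paths T" "\<tau> = restrict_to g (length \<sigma>)"
      using ex \<sigma>\<tau> by metis
    then have "F \<sigma> \<tau> = restrict_to (\<Phi> f g) (len \<sigma> \<tau>)" using F[OF fg(1,3)] by metis
    then show ?thesis using \<Phi>[OF fg(1,3)] by (simp add: paths_def)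
  qed
  then have ran: "ran P \<subseteq> S" by (auto simp: ran_def P_def split: if_splits)
  have pre: "prefix (the (P (\<sigma>, \<tau>))) (the (P (\<sigma>', \<tau>')))"
    if d: "(\<sigma>, \<tau>) \<in> dom P" "(\<sigma>', \<tau>') \<in> dom P" and p: "prefix \<sigma> \<sigma>'" "prefix \<tau> \<tau>'" for \<sigma> \<tau> \<sigma>' \<tau>'
  proof -
    have len: "length \<sigma> = length \<tau>" "length \<sigma>' = length \<tau>'" "\<sigma>' \<in> T" "\<tau>' \<in> T" "\<sigma> \<in> T" "\<tau> \<in> T"
      using d by (simp_all add: dom)
    then obtain f g where fg: "f \<in> paths T" "\<sigma>' = restrict_to f (length \<sigma>')" "g \<in> paths T" "\<tau>' = restrict_to g (length \<sigma>')"
      using ex by metis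
    then have \<sigma>: "\<sigma> = restrict_to f (length \<sigma>)" "\<tau> = restrict_to g (length \<sigma>)"
      using p prefix_restrict_toD len(1) by metis+
    have le: "length \<sigma> \<le> length \<sigma>'" using p(1) prefix_length_le by blast
    have "prefix (F (restrict_to f (length \<sigma>)) (restrict_to g (length \<sigma>)))
        (F (restrict_to f (length \<sigma>')) (restrict_to g (length \<sigma>')))"
      by (simp add: F[OF fg(1,3)] prefix_restrict_to mono[OF fg(1,3) le])
    then have "prefix (F \<sigma> \<tau>) (F \<sigma>' \<tau>')" using fg \<sigma> by simp
    then show ?thesis using len by (simp add: P)
  qed
  have graph: "path_graph (\<Phi> f g) = (\<Union>n\<in>{n. (restrict_to f n, restrict_to g n) \<in> dom P}.
      string_graph (the (P (restrict_to f n, restrict_to g n))))"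
    if fg: "f \<in> paths T" "g \<in> paths T" for f g
  proof -
    have fT: "restrict_to f n \<in> T" "restrict_to g n \<in> T" for n using fg by (simp_all add: paths_def)
    show ?thesis
      using path_graph_eq[OF unb[OF fg], of "\<Phi> f g"] by (simp add: dom P fT F[OF fg])
  qed
  show ?thesis
    unfolding computable_map2_index_def
  proof (intro exI[of _ P] conjI allI)
    show "phi e (prod_encode (list_encode \<sigma>, list_encode \<tau>)) = map_option list_encode (P (\<sigma>, \<tau>))" for \<sigma> \<tau>
      by (simp add: e P)
    show "dom P \<subseteq> {(\<sigma>, \<tau>). \<sigma> \<in> T \<and> \<tau> \<in> T \<and> length \<sigma> = length \<tau>}"
    proof
      show "p \<in> {(\<sigma>, \<tau>). \<sigma> \<in> T \<and> \<tau> \<in> T \<and> length \<sigma> = length \<tau>}" if "p \<in> dom P" for p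
        using that unfolding dom by (cases p) simp
    qed
    show "ran P \<subseteq> S" by (rule ran)
    show "\<forall>(\<sigma>, \<tau>)\<in>dom P. \<forall>(\<sigma>', \<tau>')\<in>dom P. prefix \<sigma> \<sigma>' \<and> prefix \<tau> \<tau>' \<longrightarrow>
        prefix (the (P (\<sigma>, \<tau>))) (the (P (\<sigma>', \<tau>')))"
      using pre by blast
    show "\<forall>f\<in>paths T. \<forall>g\<in>paths T. \<Phi> f g \<in> paths S \<and> path_graph (\<Phi> f g) =
        (\<Union>n\<in>{n. (restrict_to f n, restrict_to g n) \<in> dom P}. string_graph (the (P (restrict_to f n, restrict_to g n))))"
      using \<Phi> graph by blast
  qed
qed

section \<open>The group structure transported to the path space\<close>

context haar_copy
begin

definition kappa :: "(nat \<Rightarrow> nat) \<Rightarrow> 'a" where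
  "kappa f = inv_into (carrier G) theta f"

lemma kappa_theta: "x \<in> carrier G \<Longrightarrow> kappa (theta x) = x"
  by (simp add: kappa_def theta_inj)

lemma kappa: "f \<in> paths (g_tree M) \<Longrightarrow> kappa f \<in> carrier G \<and> theta (kappa f) = f"
  using theta_surj kappa_theta by metis

definition path_group :: "(nat \<Rightarrow> nat) monoid" where
  "path_group = \<lparr>carrier = paths (g_tree M), monoid.mult = \<lambda>f g. theta (kappa f \<otimes> kappa g), one = theta \<one>\<rparr>"

lemma path_group_simps:
  "carrier path_group = paths (g_tree M)" "f \<otimes>\<^bsub>path_group\<^esub> g = theta (kappa f \<otimes> kappa g)"
  "\<one>\<^bsub>path_group\<^esub> = theta \<one>"
  by (simp_all add: path_group_def)

lemma path_group_group: "group path_group"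
proof (rule groupI)
  fix f assume "f \<in> carrier path_group"
  then have f: "kappa f \<in> carrier G" "theta (kappa f) = f" using kappa by (auto simp: path_group_simps)
  show "\<one>\<^bsub>path_group\<^esub> \<otimes>\<^bsub>path_group\<^esub> f = f"
    using f by (simp add: path_group_simps kappa_theta)
  show "\<exists>g\<in>carrier path_group. g \<otimes>\<^bsub>path_group\<^esub> f = \<one>\<^bsub>path_group\<^esub>"
    using f theta_paths by (intro bexI[of _ "theta (inv (kappa f))"]) (simp_all add: path_group_simps kappa_theta)
qed (use kappa theta_paths in \<open>simp_all add: path_group_simps kappa_theta m_assoc\<close>)

lemma theta_iso: "theta \<in> iso G path_group"
  using theta_paths theta_inj theta_image
  by (auto simp: iso_def hom_def bij_betw_def path_group_simps kappa_theta)

lemma path_group_inv: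
  assumes "f \<in> paths (g_tree M)"
  shows "inv\<^bsub>path_group\<^esub> f = theta (inv (kappa f))"
proof (rule group.inv_equality[OF path_group_group])
  show "theta (inv (kappa f)) \<otimes>\<^bsub>path_group\<^esub> f = \<one>\<^bsub>path_group\<^esub>"
    using kappa[OF assms] by (simp add: path_group_simps kappa_theta)
qed (use assms kappa[OF assms] theta_paths in \<open>simp_all add: path_group_simps\<close>)

lemma kappa_cont: "continuous_map (path_space (g_tree M)) X kappa"
proof -
  obtain k where k: "homeomorphic_maps X (path_space (g_tree M)) theta k"
    using theta_homeo by (auto simp: homeomorphic_map_maps)
  have "k f = kappa f" if "f \<in> paths (g_tree M)" for f
  proof -
    have "k f \<in> carrier G" "theta (k f) = f"
      using k that topspace_eq by (auto simp: homeomorphic_maps_def continuous_map_def)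
    then show ?thesis using kappa_theta by metis
  qed
  then show ?thesis
    using k continuous_map_eq[of "path_space (g_tree M)" X k kappa] by (simp add: homeomorphic_maps_def)
qed

lemma path_group_topological: "topological_group path_group (path_space (g_tree M))"
proof -
  let ?Y = "path_space (g_tree M)"
  have theta: "continuous_map X ?Y theta" using homeomorphic_imp_continuous_map[OF theta_homeo] .
  have "continuous_map (prod_topology ?Y ?Y) X (\<lambda>p. kappa (fst p))"
    using continuous_map_compose[OF continuous_map_fst kappa_cont] by (simp add: comp_def)
  moreover have "continuous_map (prod_topology ?Y ?Y) X (\<lambda>p. kappa (snd p))"
    using continuous_map_compose[OF continuous_map_snd kappa_cont] by (simp add: comp_def)
  ultimately have "continuous_map (prod_topology ?Y ?Y) (prod_topology X X) (\<lambda>p. (kappa (fst p), kappa (snd p)))"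
    by (simp add: continuous_map_pairwise comp_def)
  from continuous_map_compose[OF continuous_map_compose[OF this mult_cont] theta]
  have mult: "continuous_map (prod_topology ?Y ?Y) ?Y (\<lambda>(f, g). f \<otimes>\<^bsub>path_group\<^esub> g)"
    by (simp add: comp_def case_prod_unfold path_group_simps)
  have inv: "continuous_map ?Y ?Y (\<lambda>f. inv\<^bsub>path_group\<^esub> f)"
    using continuous_map_eq[OF continuous_map_compose[OF continuous_map_compose[OF kappa_cont inv_cont] theta]]
      path_group_inv by simp
  show ?thesis
    using path_group_group mult inv by (simp add: topological_group_def path_group_simps)
qed

end

section \<open>Uniform computability of the presentation from the copy\<close>

locale haar_family = uniform I par for I :: "'i set" and par +
  fixes G :: "'i \<Rightarrow> ('a, 'b) monoid_scheme" and X :: "'i \<Rightarrow> 'a topology"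
    and M :: "'i \<Rightarrow> nat meet_groupoid" and \<beta> :: "'i \<Rightarrow> nat \<Rightarrow> 'a set" and idx :: "'i \<Rightarrow> nat \<Rightarrow> nat \<Rightarrow> nat"
  assumes uc_inv: "uc (\<lambda>i x. g_inv (M i) x)"
    and uc_dom: "uc (\<lambda>i x. x \<in> mg_dom (M i))"
    and uc_meet: "uc (\<lambda>i z. g_meet (M i) (fst z) (snd z))"
    and uc_def: "uc (\<lambda>i z. g_def (M i) (fst z) (snd z))"
    and uc_prod: "uc (\<lambda>i z. g_prod (M i) (fst z) (snd z))"
    and uc_idx: "uc (\<lambda>i z. idx i (fst z) (snd z))"
    and haar: "i \<in> I \<Longrightarrow> haar_copy (G i) (X i) (M i) (\<beta> i) (idx i)"
begin

lemmas uc_def' = uc_app2[OF uc_def]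
lemmas uc_prod' = uc_app2[OF uc_prod]
lemmas uc_inv' = uc_compose[OF uc_inv]
lemmas uc_dom' = uc_compose[OF uc_dom]

lemma uc_sub: "uc f \<Longrightarrow> uc (\<lambda>i x. g_sub (M i) (f i x))"
  unfolding g_sub_def by (intro uc_intros uc_def' uc_prod')

lemma uc_g_le: "uc f \<Longrightarrow> uc g \<Longrightarrow> uc (\<lambda>i x. g_le (M i) (f i x) (g i x))"
  unfolding g_le_def by (intro uc_intros uc_dom' uc_app2[OF uc_meet])

lemma uc_conj_code: "uc f \<Longrightarrow> uc (\<lambda>i x. g_conj (M i) (f i x))"
  unfolding g_conj_def by (intro uc_prod' uc_inv')

lemma uc_chain: "uc n \<Longrightarrow> uc (\<lambda>i x. g_chain (M i) (n i x))"
proof -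
  have "uc (\<lambda>i x. LEAST y. g_sub (M i) y)"
    by (rule uc_LEAST) (intro uc_sub uc_intros, rule haar_copy.ex_g_sub[OF haar])
  then show "uc n \<Longrightarrow> uc (\<lambda>i x. g_chain (M i) (n i x))"
    unfolding g_chain_def by (intro uc_intros uc_sub uc_app2[OF uc_meet])
qed

lemma uc_lcoset: "uc f \<Longrightarrow> uc g \<Longrightarrow> uc (\<lambda>i x. g_lcoset (M i) (f i x) (g i x))"
  unfolding g_lcoset_def by (intro uc_def' uc_chain)

lemma uc_tree:
  assumes "uc s"
  shows "uc (\<lambda>i x. s i x \<in> g_tree (M i))"
  unfolding g_tree_def mem_Collect_eq
  by (intro uc_intros uc_lcoset uc_g_le assms uc_compose[OF assms])

lemma uc_last: "uc s \<Longrightarrow> uc (\<lambda>i x. g_last (s i x))"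
  unfolding g_last_def by (intro uc_intros)

lemma uc_cosets: "uc (\<lambda>i z. g_cosets (M i) (idx i) (fst z) (snd z))"
  unfolding g_cosets_def
proof (rule uc_LEAST)
  show "\<exists>n. fst z \<in> g_tree (M i) \<and> fst z \<noteq> [] \<and> length (fst z) \<le> snd z \<longrightarrow>
     distinct (list_decode n) \<and>
     length (list_decode n) = idx i (g_chain (M i) (length (fst z) - 1)) (g_chain (M i) (snd z)) \<and>
     (\<forall>b\<in>set (list_decode n). g_lcoset (M i) b (snd z) \<and> g_le (M i) b (g_last (fst z)))" if "i \<in> I" for i z
    using haar_copy.g_cosets_exists[OF haar[OF that]] by meson
qed (intro uc_intros uc_tree uc_lcoset uc_g_le uc_last uc_chain uc_app2[OF uc_idx])

lemma uc_bound: "uc (\<lambda>i z. g_bound (M i) (idx i) (fst z) (snd z))"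
  unfolding g_bound_def by (intro uc_intros uc_cosets)

lemma uc_inv_len: "uc s \<Longrightarrow> uc (\<lambda>i x. g_inv_len (M i) (s i x))"
proof -
  have "uc (\<lambda>i \<sigma>. g_inv_len (M i) \<sigma>)"
    unfolding g_inv_len_def
    by (rule uc_LEAST) (intro uc_intros uc_g_le uc_conj_code uc_last uc_chain, blast)
  then show "uc s \<Longrightarrow> uc (\<lambda>i x. g_inv_len (M i) (s i x))" by (rule uc_compose)
qed

lemma uc_inv_entry: "uc (\<lambda>i z. g_inv_entry (M i) (fst z) (snd z))"
  unfolding g_inv_entry_def
proof (rule uc_LEAST)
  show "\<exists>b. fst z \<in> g_tree (M i) \<and> snd z < g_inv_len (M i) (fst z) \<longrightarrow>
     g_lcoset (M i) b (snd z) \<and> g_le (M i) (g_inv (M i) (g_last (fst z))) b" if i: "i \<in> I" for i z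
  proof (cases "fst z \<in> g_tree (M i)")
    case True
    then show ?thesis
      using haar_copy.tree_ex_restrict[OF haar[OF i] True] haar_copy.inv_entry_iff[OF haar[OF i]] by metis
  qed blast
qed (intro uc_intros uc_tree uc_inv_len uc_lcoset uc_g_le uc_inv' uc_last)

lemma uc_inv_str: "uc (\<lambda>i \<sigma>. g_inv_str (M i) \<sigma>)"
  unfolding g_inv_str_def by (intro uc_intros uc_app2[OF uc_inv_entry] uc_inv_len)

lemma uc_mul_len: "uc s \<Longrightarrow> uc t \<Longrightarrow> uc (\<lambda>i x. g_mul_len (M i) (s i x) (t i x))"
proof -
  have "uc (\<lambda>i z. g_mul_len (M i) (fst z) (snd z))"
    unfolding g_mul_len_def
    by (rule uc_LEAST) (intro uc_intros uc_g_le uc_conj_code uc_last uc_chain, blast)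
  then show "uc s \<Longrightarrow> uc t \<Longrightarrow> uc (\<lambda>i x. g_mul_len (M i) (s i x) (t i x))" by (rule uc_app2)
qed

lemma uc_mul_left: "uc (\<lambda>i z. g_mul_left (M i) (fst z) (fst (snd z)) (snd (snd z)))"
  unfolding g_mul_left_def
proof (rule uc_LEAST)
  show "\<exists>c. fst z \<in> g_tree (M i) \<and> fst (snd z) \<in> g_tree (M i) \<and> length (fst z) = length (fst (snd z)) \<and>
       snd (snd z) < g_mul_len (M i) (fst z) (fst (snd z)) \<longrightarrow>
     g_def (M i) c (g_conj (M i) (nth0 (fst (snd z)) (snd (snd z)))) \<and> g_le (M i) (g_last (fst z)) c"
    if i: "i \<in> I" for i z
  proof (cases "fst z \<in> g_tree (M i) \<and> fst (snd z) \<in> g_tree (M i) \<and> length (fst z) = length (fst (snd z))")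
    case True
    then obtain x y where "x \<in> carrier (G i)" "y \<in> carrier (G i)"
      "fst z = restrict_to (haar_copy.theta (G i) (M i) (\<beta> i) x) (length (fst z))"
      "fst (snd z) = restrict_to (haar_copy.theta (G i) (M i) (\<beta> i) y) (length (fst z))"
      using haar_copy.tree_ex_restrict[OF haar[OF i]] by metis
    then show ?thesis
      using haar_copy.mul_left_iff(1)[OF haar[OF i]] by metis
  qed blast
qed (intro uc_intros uc_tree uc_mul_len uc_def' uc_g_le uc_conj_code uc_last)

lemma uc_mul_str: "uc (\<lambda>i z. g_mul_str (M i) (fst z) (snd z))"
  unfolding g_mul_str_def by (intro uc_intros uc_prod' uc_app3[OF uc_mul_left] uc_mul_len)

theorem baire_index_computable:
  obtains s where "par_computable s" "\<And>i. i \<in> I \<Longrightarrow> baire_index (s i) (G i) (X i)"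
proof -
  have "uc (\<lambda>i \<sigma>. \<sigma> \<in> g_tree (M i))" by (intro uc_tree uc_intros)
  note tree = this
  have "uc (\<lambda>i \<sigma>. \<sigma> \<in> g_tree (M i) \<and> \<sigma> \<noteq> [])" by (intro uc_tree uc_intros)
  from uc_index[OF this] obtain sC where sC: "par_computable sC"
    "\<forall>i\<in>I. \<forall>\<sigma>. phi (sC i) (enc \<sigma>) = Some (enc (\<sigma> \<in> g_tree (M i) \<and> \<sigma> \<noteq> []))" by blast
  from uc_index[OF tree] obtain sT where sT: "par_computable sT"
    "\<forall>i\<in>I. \<forall>\<sigma>. phi (sT i) (enc \<sigma>) = Some (enc (\<sigma> \<in> g_tree (M i)))" by blast
  from uc_index[OF uc_bound] obtain sH where sH: "par_computable sH"
    "\<forall>i\<in>I. \<forall>z. phi (sH i) (enc z) = Some (enc (g_bound (M i) (idx i) (fst z) (snd z)))" by blast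
  from upc_index[OF upc_restrict[OF tree uc_inv_str]] obtain sI where sI: "par_computable sI"
    "\<forall>i\<in>I. phi (sI i) = (\<lambda>n. if dec n \<in> g_tree (M i) then Some (enc (g_inv_str (M i) (dec n))) else None)"
    by blast
  have "uc (\<lambda>i z. fst z \<in> g_tree (M i) \<and> snd z \<in> g_tree (M i) \<and> length (fst z) = length (snd z))"
    by (intro uc_tree uc_intros)
  from upc_index[OF upc_restrict[OF this uc_mul_str]] obtain sO where sO: "par_computable sO"
    "\<forall>i\<in>I. phi (sO i) = (\<lambda>n. if fst (dec n :: nat list \<times> nat list) \<in> g_tree (M i) \<and>
        snd (dec n :: nat list \<times> nat list) \<in> g_tree (M i) \<and>
        length (fst (dec n :: nat list \<times> nat list)) = length (snd (dec n :: nat list \<times> nat list))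
      then Some (enc (g_mul_str (M i) (fst (dec n :: nat list \<times> nat list)) (snd (dec n :: nat list \<times> nat list)))) else None)"
    by blast
  show ?thesis
  proof
    show "par_computable (\<lambda>i. list_encode [sT i, sC i, sH i, sO i, sI i])"
      unfolding list_encode.simps by (intro par_intros sT(1) sC(1) sH(1) sO(1) sI(1))
  next
    fix i assume i: "i \<in> I"
    interpret h: haar_copy "G i" "X i" "M i" "\<beta> i" "idx i" using haar[OF i] .
    let ?T = "g_tree (M i)"
    define R where "R = (if compact_space (X i) then {\<sigma> :: nat list. \<sigma> \<noteq> []} else UNIV)"
    have "phi (sT i) n = Some (of_bool (n \<in> list_encode ` ?T))" for n
    proof -
      have "n \<in> list_encode ` ?T \<longleftrightarrow> list_decode n \<in> ?T"
        by (metis image_iff list_decode_inverse list_encode_inverse)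
      then show ?thesis using sT(2)[rule_format, OF i, of "list_decode n"] by simp
    qed
    then have dT: "decides (sT i) (list_encode ` ?T)" by (simp add: decides_def)
    \<comment> \<open>The program answers negatively at the root. This is correct if the group is
      not compact, and otherwise the root does not belong to \<open>R\<close>.\<close>
    have root: "\<sigma> \<in> ?T \<and> \<sigma> \<noteq> [] \<longleftrightarrow> \<sigma> \<in> compact_nodes ?T" if "\<sigma> \<in> R" for \<sigma>
      using that h.root_compact h.node_compact[of \<sigma>]
      by (cases "\<sigma> = []") (auto simp: R_def compact_nodes_def)
    have dC: "\<forall>\<sigma>\<in>R. phi (sC i) (list_encode \<sigma>) = Some (of_bool (\<sigma> \<in> compact_nodes ?T))"
      using sC(2)[rule_format, OF i] root by (simp add: enc_nat_list[symmetric] del: enc_nat_list)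
    have dH: "\<forall>\<sigma>\<in>R. \<forall>k. phi (sH i) (prod_encode (list_encode \<sigma>, k)) = Some (g_bound (M i) (idx i) \<sigma> k)"
    proof (intro ballI allI)
      show "phi (sH i) (prod_encode (list_encode \<sigma>, k)) = Some (g_bound (M i) (idx i) \<sigma> k)" for \<sigma> k
        using sH(2)[rule_format, OF i, of "(\<sigma>, k)"] by simp
    qed
    have bound: "\<forall>\<sigma>\<in>R \<inter> compact_nodes ?T. \<forall>\<rho>\<in>?T. prefix \<sigma> \<rho> \<longrightarrow> (\<forall>k<length \<rho>. \<rho> ! k \<le> g_bound (M i) (idx i) \<sigma> k)"
      using root h.g_bound by blast
    have clc: "clc_tree_index R (sT i) (sC i) (sH i) ?T"
      unfolding clc_tree_index_def
      using h.g_tree_is_tree h.g_tree_leafless h.path_space_locally_compact dT dC dH bound by blast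
    have inv: "computable_map_index (sI i) ?T ?T (\<lambda>f. inv\<^bsub>h.path_group\<^esub> f)"
    proof (rule computable_mapI[OF h.g_tree_is_tree h.g_tree_leafless, where F = "g_inv_str (M i)" and len = "g_inv_len (M i)"])
      show "phi (sI i) (list_encode \<sigma>) = (if \<sigma> \<in> ?T then Some (list_encode (g_inv_str (M i) \<sigma>)) else None)" for \<sigma>
        using sI(2) i by (simp add: dec_nat_list)
      fix f assume f: "f \<in> paths ?T"
      note k = h.kappa[OF f]
      show "inv\<^bsub>h.path_group\<^esub> f \<in> paths ?T"
        using h.path_group_inv[OF f] h.theta_paths k by simp
      show "g_inv_str (M i) (restrict_to f n) = restrict_to (inv\<^bsub>h.path_group\<^esub> f) (g_inv_len (M i) (restrict_to f n))" for n
        using h.inv_str[of "h.kappa f" n] h.path_group_inv[OF f] k by simp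
      show "g_inv_len (M i) (restrict_to f n) \<le> g_inv_len (M i) (restrict_to f m)" if "n \<le> m" for n m
        using h.inv_len_mono[of "h.kappa f" n m] k that by simp
      show "\<exists>n. N < g_inv_len (M i) (restrict_to f n)" for N
        using h.inv_len_unbounded[of "h.kappa f" N] k by simp
    qed
    have mult: "computable_map2_index (sO i) ?T ?T (\<lambda>f g. f \<otimes>\<^bsub>h.path_group\<^esub> g)"
    proof (rule computable_map2I[OF h.g_tree_is_tree h.g_tree_leafless, where F = "g_mul_str (M i)" and len = "g_mul_len (M i)"])
      show "phi (sO i) (prod_encode (list_encode \<sigma>, list_encode \<tau>)) =
        (if \<sigma> \<in> ?T \<and> \<tau> \<in> ?T \<and> length \<sigma> = length \<tau> then Some (list_encode (g_mul_str (M i) \<sigma> \<tau>)) else None)" for \<sigma> \<tau>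
      proof -
        have "prod_encode (list_encode \<sigma>, list_encode \<tau>) = enc (\<sigma>, \<tau>)" by simp
        then have "dec (prod_encode (list_encode \<sigma>, list_encode \<tau>)) = (\<sigma>, \<tau>)" by (metis dec_enc)
        then show ?thesis using sO(2) i by simp
      qed
      fix f g assume f: "f \<in> paths ?T" and g: "g \<in> paths ?T"
      note k = h.kappa[OF f] h.kappa[OF g]
      show "f \<otimes>\<^bsub>h.path_group\<^esub> g \<in> paths ?T"
        using h.theta_paths k by (simp add: h.path_group_simps)
      show "g_mul_str (M i) (restrict_to f n) (restrict_to g n) =
        restrict_to (f \<otimes>\<^bsub>h.path_group\<^esub> g) (g_mul_len (M i) (restrict_to f n) (restrict_to g n))" for n
        using h.mul_str[of "h.kappa f" "h.kappa g" n] k by (simp add: h.path_group_simps)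
      show "g_mul_len (M i) (restrict_to f n) (restrict_to g n) \<le> g_mul_len (M i) (restrict_to f m) (restrict_to g m)"
        if "n \<le> m" for n m
        using h.mul_len_mono[of "h.kappa g" n m "h.kappa f"] k that by simp
      show "\<exists>n. N < g_mul_len (M i) (restrict_to f n) (restrict_to g n)" for N
        using h.mul_len_unbounded[of "h.kappa g" N "h.kappa f"] k by simp
    qed
    have "topological_group_isomorphic (G i) (X i) h.path_group (path_space ?T)"
      unfolding topological_group_isomorphic_def using h.theta_iso h.theta_homeo by blast
    then show "baire_index (list_encode [sT i, sC i, sH i, sO i, sI i]) (G i) (X i)"
      unfolding baire_index_def baire_presentation_index_def R_def[symmetric]
      using clc inv mult h.path_group_topological h.path_group_simps(1) by blast
  qed
qed

end

section \<open>The equivalence\<close>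

text \<open>Reads an entry of a coded list: a nonempty list is coded by the successor of the pair of
  its head and the code of its tail.\<close>

primrec entry :: "nat \<Rightarrow> nat \<Rightarrow> nat" where
  "entry 0 p = fst (prod_decode (p - 1))"
| "entry (Suc k) p = entry k (snd (prod_decode (p - 1)))"

lemma entry_list_encode: "k < length xs \<Longrightarrow> entry k (list_encode xs) = xs ! k"
proof (induction xs arbitrary: k)
  case (Cons x xs)
  then show ?case by (cases k) simp_all
qed simp

lemma (in uniform) par_computable_entry: "par_computable s \<Longrightarrow> par_computable (\<lambda>i. entry k (s i))"
proof (induction k arbitrary: s)
  case 0
  then show ?case unfolding entry.simps by (intro par_intros)
next
  case (Suc k)
  show ?case unfolding entry.simps by (rule Suc.IH) (intro par_intros Suc.prems)
qed

lemma (in uniform) par_computable_index: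
  assumes "par_computable s"
  shows "\<exists>e. \<forall>i\<in>I. phi e (par i) = Some (s i)"
proof -
  obtain c F where "\<forall>n. eval c n = Some (F n)" "\<forall>i\<in>I. s i = F (par i)"
    using assms unfolding par_computable_def by blast
  then have "\<forall>i\<in>I. phi (code_index c) (par i) = Some (s i)" by simp
  then show ?thesis by blast
qed

text \<open>A defined value of the program appears at some stage. Its graph is part of the graph of
  the image path, so it is an initial segment of it; and as the union of these graphs contains
  position \<open>L\<close>, some output is longer than \<open>L\<close>.\<close>

lemma approximates_stage2:
  assumes "computable_map2_index e T T \<Phi>"
  shows "approximates T (\<lambda>(t, \<sigma>, \<tau>). stage e (t, prod_encode (list_encode \<sigma>, list_encode \<tau>))) \<Phi>"
proof -
  obtain P where P: "\<forall>\<sigma> \<tau>. phi e (prod_encode (list_encode \<sigma>, list_encode \<tau>)) = map_option list_encode (P (\<sigma>, \<tau>))"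
    and \<Phi>: "\<forall>f\<in>paths T. \<forall>g\<in>paths T. \<Phi> f g \<in> paths T \<and> path_graph (\<Phi> f g) =
          (\<Union>n \<in> {n. (restrict_to f n, restrict_to g n) \<in> dom P}.
             string_graph (the (P (restrict_to f n, restrict_to g n))))"
    using assms unfolding computable_map2_index_def by blast
  have some: "phi e (prod_encode (list_encode \<sigma>, list_encode \<tau>)) = Some r \<longleftrightarrow> P (\<sigma>, \<tau>) = Some (list_decode r)"
    for \<sigma> \<tau> r
    by (simp add: P) (metis list_decode_inverse list_encode_inverse)
  show ?thesis
    unfolding approximates_def
  proof (intro ballI conjI allI impI)
    fix f g assume fg: "f \<in> paths T" "g \<in> paths T"
    note G = \<Phi>[rule_format, OF fg]
    show "\<Phi> f g \<in> paths T" using G by blast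
    show "list_decode r = restrict_to (\<Phi> f g) (length (list_decode r))"
      if "(\<lambda>(t, \<sigma>, \<tau>). stage e (t, prod_encode (list_encode \<sigma>, list_encode \<tau>)))
        (t, restrict_to f k, restrict_to g k) = Suc r" for t k r
    proof -
      have "P (restrict_to f k, restrict_to g k) = Some (list_decode r)"
        using that some stage_iff by auto
      then have "string_graph (list_decode r) \<subseteq> path_graph (\<Phi> f g)" using G by force
      then show ?thesis by (rule string_graph_subset_prefix)
    qed
    show "\<exists>t k r. (\<lambda>(t, \<sigma>, \<tau>). stage e (t, prod_encode (list_encode \<sigma>, list_encode \<tau>)))
        (t, restrict_to f k, restrict_to g k) = Suc r \<and> L < length (list_decode r)" for L
    proof -
      have "(L, \<Phi> f g L) \<in> path_graph (\<Phi> f g)" by (simp add: path_graph_def)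
      then obtain k z where "P (restrict_to f k, restrict_to g k) = Some z" "(L, \<Phi> f g L) \<in> string_graph z"
        using G by auto
      then have z: "P (restrict_to f k, restrict_to g k) = Some (list_decode (list_encode z))" "L < length z"
        by (auto simp: string_graph_def)
      then obtain t where "stage e (t, prod_encode (list_encode (restrict_to f k), list_encode (restrict_to g k))) =
          Suc (list_encode z)"
        using some stage_iff by blast
      with z(2) show ?thesis by (intro exI[of _ t] exI[of _ k] exI[of _ "list_encode z"]) simp
    qed
  qed
qed

lemma approximates_stage1:
  assumes "computable_map_index e T T \<Phi>"
  shows "approximates T (\<lambda>(t, \<sigma>, \<tau>). stage e (t, list_encode \<sigma>)) (\<lambda>f g. \<Phi> f)"
proof -
  obtain P where P: "\<forall>\<sigma>. phi e (list_encode \<sigma>) = map_option list_encode (P \<sigma>)"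
    and \<Phi>: "\<forall>f\<in>paths T. \<Phi> f \<in> paths T \<and> path_graph (\<Phi> f) =
          (\<Union>n \<in> {n. restrict_to f n \<in> dom P}. string_graph (the (P (restrict_to f n))))"
    using assms unfolding computable_map_index_def by blast
  have some: "phi e (list_encode \<sigma>) = Some r \<longleftrightarrow> P \<sigma> = Some (list_decode r)" for \<sigma> r
    by (simp add: P) (metis list_decode_inverse list_encode_inverse)
  show ?thesis
    unfolding approximates_def
  proof (intro ballI conjI allI impI)
    fix f g :: "nat \<Rightarrow> nat" assume f: "f \<in> paths T"
    note G = \<Phi>[rule_format, OF f]
    show "\<Phi> f \<in> paths T" using G by blast
    show "list_decode r = restrict_to (\<Phi> f) (length (list_decode r))"
      if "(\<lambda>(t, \<sigma>, \<tau>). stage e (t, list_encode \<sigma>)) (t, restrict_to f k, restrict_to g k) = Suc r" for t k r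
    proof -
      have "P (restrict_to f k) = Some (list_decode r)"
        using that some stage_iff by auto
      then have "string_graph (list_decode r) \<subseteq> path_graph (\<Phi> f)" using G by force
      then show ?thesis by (rule string_graph_subset_prefix)
    qed
    show "\<exists>t k r. (\<lambda>(t, \<sigma>, \<tau>). stage e (t, list_encode \<sigma>)) (t, restrict_to f k, restrict_to g k) = Suc r \<and>
        L < length (list_decode r)" for L
    proof -
      have "(L, \<Phi> f L) \<in> path_graph (\<Phi> f)" by (simp add: path_graph_def)
      then obtain k z where "P (restrict_to f k) = Some z" "(L, \<Phi> f L) \<in> string_graph z"
        using G by auto
      then have z: "P (restrict_to f k) = Some (list_decode (list_encode z))" "L < length z"
        by (auto simp: string_graph_def)
      then obtain t where "stage e (t, list_encode (restrict_to f k)) = Suc (list_encode z)"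
        using some stage_iff by blast
      with z(2) show ?thesis by (intro exI[of _ t] exI[of _ k] exI[of _ "list_encode z"]) simp
    qed
  qed
qed

text \<open>One program must serve all groups, so the uniform construction is applied to the family
  of all correct triples, with the index as parameter.\<close>

lemma baire_to_haar:
  "\<exists>e. \<forall>(G :: ('a, 'b) monoid_scheme) X p. tdlc_group G X \<and> baire_index p G X \<longrightarrow>
      (\<exists>q. phi e p = Some q \<and> haar_index q G X)"
proof -
  define I where "I = {(G :: ('a, 'b) monoid_scheme, X, p). tdlc_group G X \<and> baire_index p G X}"
  define par :: "('a, 'b) monoid_scheme \<times> 'a topology \<times> nat \<Rightarrow> nat" where "par = (\<lambda>i. snd (snd i))"
  define R where "R i = (if compact_space (fst (snd i)) then {\<sigma> :: nat list. \<sigma> \<noteq> []} else UNIV)"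
    for i :: "('a, 'b) monoid_scheme \<times> 'a topology \<times> nat"
  define Q where "Q i T B H \<longleftrightarrow>
      is_tree T \<and> leafless T \<and> decides (entry 0 (par i)) (list_encode ` T) \<and>
      (\<forall>\<sigma>\<in>R i. phi (entry 1 (par i)) (list_encode \<sigma>) = Some (of_bool (\<sigma> \<in> compact_nodes T))) \<and>
      (\<forall>\<sigma>\<in>R i. \<forall>k. phi (entry 2 (par i)) (prod_encode (list_encode \<sigma>, k)) = Some (H \<sigma> k)) \<and>
      (\<forall>\<sigma>\<in>R i \<inter> compact_nodes T. \<forall>\<rho>\<in>T. prefix \<sigma> \<rho> \<longrightarrow> (\<forall>k<length \<rho>. \<rho> ! k \<le> H \<sigma> k)) \<and>
      topological_group B (path_space T) \<and>
      computable_map2_index (entry 3 (par i)) T T (\<lambda>f g. f \<otimes>\<^bsub>B\<^esub> g) \<and>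
      computable_map_index (entry 4 (par i)) T T (\<lambda>f. inv\<^bsub>B\<^esub> f) \<and>
      topological_group_isomorphic (fst i) (fst (snd i)) B (path_space T)"
    for i :: "('a, 'b) monoid_scheme \<times> 'a topology \<times> nat" and T and B :: "(nat \<Rightarrow> nat) monoid" and H
  have "\<exists>T B H. Q i T B H" if i: "i \<in> I" for i
  proof -
    have "baire_presentation_index (R i) (par i) (fst i) (fst (snd i))"
      using i by (auto simp: I_def par_def R_def baire_index_def)
    then obtain eT eC eH eOp eInv T and B :: "(nat \<Rightarrow> nat) monoid" where p: "par i = list_encode [eT, eC, eH, eOp, eInv]"
      and *: "clc_tree_index (R i) eT eC eH T" "topological_group B (path_space T)"
        "computable_map2_index eOp T T (\<lambda>f g. f \<otimes>\<^bsub>B\<^esub> g)"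
        "computable_map_index eInv T T (\<lambda>f. inv\<^bsub>B\<^esub> f)"
        "topological_group_isomorphic (fst i) (fst (snd i)) B (path_space T)"
      unfolding baire_presentation_index_def by blast
    have e: "entry 0 (par i) = eT" "entry 1 (par i) = eC" "entry 2 (par i) = eH" "entry 3 (par i) = eOp" "entry 4 (par i) = eInv"
      unfolding p by (subst entry_list_encode; simp)+
    obtain H where "\<forall>\<sigma>\<in>R i. \<forall>k. phi eH (prod_encode (list_encode \<sigma>, k)) = Some (H \<sigma> k)"
      "\<forall>\<sigma>\<in>R i \<inter> compact_nodes T. \<forall>\<rho>\<in>T. prefix \<sigma> \<rho> \<longrightarrow> (\<forall>k<length \<rho>. \<rho> ! k \<le> H \<sigma> k)"
      using *(1) unfolding clc_tree_index_def by blast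
    then have "Q i T B H"
      using * unfolding Q_def e clc_tree_index_def by blast
    then show ?thesis by blast
  qed
  \<comment> \<open>These choices are not effective. They only enter correctness proofs, since the
    resulting index is a computable function of \<open>par i\<close>.\<close>
  then obtain T B H where Q: "\<And>i. i \<in> I \<Longrightarrow> Q i (T i) (B i) (H i)" by metis
  interpret uniform I par .
  have R: "\<sigma> \<noteq> [] \<Longrightarrow> \<sigma> \<in> R i" for \<sigma> i by (auto simp: R_def)
  \<comment> \<open>At the root the given bound program need not even be defined, so it is not run
    there; the value \<open>0\<close> only makes the function total.\<close>
  define H' where "H' i \<sigma> k = (if \<sigma> \<noteq> [] then H i \<sigma> k else 0)" for i \<sigma> k
  define P where "P i = (\<lambda>(t, \<sigma>, \<tau>). stage (entry 3 (par i)) (t, prod_encode (list_encode \<sigma>, list_encode \<tau>)))" for i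
  define J where "J i = (\<lambda>(t, \<sigma>, \<tau> :: nat list). stage (entry 4 (par i)) (t, list_encode \<sigma>))" for i
  have idx: "par_computable (\<lambda>i. entry k (par i))" for k
    by (intro par_computable_entry par_intros)
  interpret baire_family I par T H' P J B
  proof (rule baire_family.intro)
    show "uc (\<lambda>i \<sigma>. \<sigma> \<in> T i)"
    proof (rule ucI[OF upc_phi[OF idx[of 0]]])
      fix i and \<sigma> :: "nat list" assume "i \<in> I"
      then have "phi (entry 0 (par i)) (list_encode \<sigma>) = Some (of_bool (list_encode \<sigma> \<in> list_encode ` T i))"
        using Q unfolding Q_def decides_def by blast
      moreover have "list_encode \<sigma> \<in> list_encode ` T i \<longleftrightarrow> \<sigma> \<in> T i"
        by (metis image_iff list_encode_inverse)
      ultimately show "phi (entry 0 (par i)) (enc \<sigma>) = Some (enc (\<sigma> \<in> T i))" by simp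
    qed
    have "uc (\<lambda>i \<sigma>. if \<sigma> \<noteq> [] then \<sigma> \<in> compact_nodes (T i) else False)"
    proof (rule uc_guarded[OF _ upc_phi[OF idx[of 1]]])
      show "phi (entry 1 (par i)) (enc \<sigma>) = Some (enc (\<sigma> \<in> compact_nodes (T i)))"
        if "i \<in> I" "\<sigma> \<noteq> []" for i \<sigma>
        using Q[OF that(1)] R[OF that(2)] unfolding Q_def by simp
    qed (intro uc_intros)+
    then show "uc (\<lambda>i \<sigma>. \<sigma> \<noteq> [] \<and> \<sigma> \<in> compact_nodes (T i))"
      by (rule uc_cong) simp
    show "uc (\<lambda>i z. H' i (fst z) (snd z))"
      unfolding H'_def
    proof (rule uc_guarded[OF _ upc_phi[OF idx[of 2]]])
      show "phi (entry 2 (par i)) (enc z) = Some (enc (H i (fst z) (snd z)))"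
        if "i \<in> I" "fst z \<noteq> []" for i z
        using Q[OF that(1)] R[OF that(2)] unfolding Q_def by (cases z) simp
    qed (intro uc_intros)+
    show "uc P" unfolding P_def case_prod_unfold
      by (intro uc_compose[OF uc_stage[OF idx]] uc_intros)
    show "uc J" unfolding J_def case_prod_unfold
      by (intro uc_compose[OF uc_stage[OF idx]] uc_intros)
    fix i assume i: "i \<in> I"
    note Qi = Q[OF i, unfolded Q_def]
    have "top_group (B i) (path_space (T i))"
      using Qi by (blast intro: top_groupI)
    moreover have "bounded_tree (T i) (H' i)"
    proof
      show "is_tree (T i)" "leafless (T i)" using Qi by blast+
      show "\<rho> ! k \<le> H' i \<sigma> k" if "\<sigma> \<in> compact_nodes (T i)" "\<sigma> \<noteq> []" "\<rho> \<in> T i" "prefix \<sigma> \<rho>" "k < length \<rho>" for \<sigma> \<rho> k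
        using Qi R[OF that(2), of i] that by (simp add: H'_def)
    qed
    moreover have "baire_axioms (B i) (T i) (P i) (J i)"
    proof
      show "approximates (T i) (P i) (\<lambda>x y. x \<otimes>\<^bsub>B i\<^esub> y)"
        unfolding P_def using Qi by (blast intro: approximates_stage2)
      show "approximates (T i) (J i) (\<lambda>x y. inv\<^bsub>B i\<^esub> x)"
        unfolding J_def using Qi by (blast intro: approximates_stage1)
    qed
    ultimately show "baire (B i) (T i) (H' i) (P i) (J i)"
      by (simp add: baire_def)
  qed
  obtain s where s: "par_computable s" "\<And>i. i \<in> I \<Longrightarrow> haar_index (s i) (B i) (path_space (T i))"
    using haar_index_computable by blast
  obtain e where e: "\<forall>i\<in>I. phi e (par i) = Some (s i)"
    using par_computable_index[OF s(1)] by blast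
  have "haar_index (s i) (fst i) (fst (snd i))" if i: "i \<in> I" for i
  proof (rule haar_index_iso[OF s(2)[OF i]])
    show "topological_group_isomorphic (fst i) (fst (snd i)) (B i) (path_space (T i))"
      "topological_group (B i) (path_space (T i))"
      using Q[OF i] unfolding Q_def by blast+
    show "topological_group (fst i) (fst (snd i))"
      using i by (auto simp: I_def tdlc_group_def)
  qed (rule Hausdorff_path_space)
  with e show ?thesis
    by (intro exI[of _ e]) (force simp: I_def par_def)
qed

lemma haar_to_baire:
  "\<exists>e. \<forall>(G :: ('a, 'b) monoid_scheme) X p. tdlc_group G X \<and> haar_index p G X \<longrightarrow>
      (\<exists>q. phi e p = Some q \<and> baire_index q G X)"
proof -
  define I where "I = {(G :: ('a, 'b) monoid_scheme, X, p). tdlc_group G X \<and> haar_index p G X}"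
  define par :: "('a, 'b) monoid_scheme \<times> 'a topology \<times> nat \<Rightarrow> nat" where "par = (\<lambda>i. snd (snd i))"
  define Q where "Q i M \<beta> \<longleftrightarrow>
        meet_groupoid_iso \<beta> M (meet_groupoid_of (fst i) (fst (snd i))) \<and>
        decides (entry 0 (par i)) (mg_dom M) \<and>
        (\<forall>x\<in>mg_dom M. phi (entry 1 (par i)) x = Some (mg_inv M x)) \<and>
        (\<forall>x\<in>mg_dom M. \<forall>y\<in>mg_dom M. phi (entry 2 (par i)) (prod_encode (x, y)) = Some (mg_meet M x y)) \<and>
        (\<forall>x\<in>mg_dom M. \<forall>y\<in>mg_dom M.
           phi (entry 3 (par i)) (prod_encode (x, y)) = Some (of_bool (mg_prod M x y \<noteq> None))) \<and>
        (\<forall>x\<in>mg_dom M. \<forall>y\<in>mg_dom M. phi (entry 4 (par i)) (prod_encode (x, y)) = mg_prod M x y) \<and>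
        (\<forall>u\<in>mg_dom M. \<forall>v\<in>mg_dom M. mg_prod M u u = Some u \<and> mg_prod M v v = Some v \<longrightarrow>
           phi (entry 5 (par i)) (prod_encode (u, v)) = Some (group_index (fst i) (\<beta> u) (\<beta> u \<inter> \<beta> v)))"
    for i :: "('a, 'b) monoid_scheme \<times> 'a topology \<times> nat" and M and \<beta> :: "nat \<Rightarrow> 'a set"
  have "\<exists>M \<beta>. Q i M \<beta>" if i: "i \<in> I" for i
  proof -
    have "haar_index (par i) (fst i) (fst (snd i))"
      using i by (auto simp: I_def par_def)
    then obtain eD eInv eMeet eDef eProd eHaar M \<beta> where
        p: "par i = list_encode [eD, eInv, eMeet, eDef, eProd, eHaar]"
      and *: "meet_groupoid_iso \<beta> M (meet_groupoid_of (fst i) (fst (snd i)))" "decides eD (mg_dom M)"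
        "\<forall>x\<in>mg_dom M. phi eInv x = Some (mg_inv M x)"
        "\<forall>x\<in>mg_dom M. \<forall>y\<in>mg_dom M. phi eMeet (prod_encode (x, y)) = Some (mg_meet M x y)"
        "\<forall>x\<in>mg_dom M. \<forall>y\<in>mg_dom M. phi eDef (prod_encode (x, y)) = Some (of_bool (mg_prod M x y \<noteq> None))"
        "\<forall>x\<in>mg_dom M. \<forall>y\<in>mg_dom M. phi eProd (prod_encode (x, y)) = mg_prod M x y"
        "\<forall>u\<in>mg_dom M. \<forall>v\<in>mg_dom M. mg_prod M u u = Some u \<and> mg_prod M v v = Some v \<longrightarrow>
           phi eHaar (prod_encode (u, v)) = Some (group_index (fst i) (\<beta> u) (\<beta> u \<inter> \<beta> v))"
      unfolding haar_index_def by blast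
    have e: "entry 0 (par i) = eD" "entry 1 (par i) = eInv" "entry 2 (par i) = eMeet" "entry 3 (par i) = eDef"
        "entry 4 (par i) = eProd" "entry 5 (par i) = eHaar"
      unfolding p by (subst entry_list_encode; simp)+
    show ?thesis using * unfolding Q_def e by blast
  qed
  then obtain M \<beta> where Q: "\<And>i. i \<in> I \<Longrightarrow> Q i (M i) (\<beta> i)" by metis
  interpret uniform I par .
  have idx: "par_computable (\<lambda>i. entry k (par i))" for k
    by (intro par_computable_entry par_intros)
  \<comment> \<open>The given index program is specified on codes of subgroups only; elsewhere the
    default \<open>0\<close> replaces it.\<close>
  define ix where "ix i u v = (if g_sub (M i) u \<and> g_sub (M i) v
    then group_index (fst i) (\<beta> i u) (\<beta> i u \<inter> \<beta> i v) else 0)" for i u v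
  have uc_dom: "uc (\<lambda>i x. x \<in> mg_dom (M i))"
  proof (rule ucI[OF upc_phi[OF idx[of 0]]])
    show "phi (entry 0 (par i)) (enc x) = Some (enc (x \<in> mg_dom (M i)))" if "i \<in> I" for i and x :: nat
      using Q[OF that] unfolding Q_def decides_def by simp
  qed
  note uc_dom' = uc_compose[OF uc_dom]
  have uc_inv: "uc (\<lambda>i x. g_inv (M i) x)"
    unfolding g_inv_def
  proof (rule uc_guarded[OF _ upc_phi[OF idx[of 1]]])
    show "phi (entry 1 (par i)) (enc x) = Some (enc (mg_inv (M i) x))" if "i \<in> I" "x \<in> mg_dom (M i)" for i x
      using Q[OF that(1)] that(2) unfolding Q_def by simp
  qed (intro uc_dom uc_intros)+
  have uc_meet: "uc (\<lambda>i z. g_meet (M i) (fst z) (snd z))"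
    unfolding g_meet_def
  proof (rule uc_guarded[OF _ upc_phi[OF idx[of 2]]])
    show "phi (entry 2 (par i)) (enc z) = Some (enc (mg_meet (M i) (fst z) (snd z)))"
      if "i \<in> I" "fst z \<in> mg_dom (M i) \<and> snd z \<in> mg_dom (M i)" for i z
      using Q[OF that(1)] that(2) unfolding Q_def by (cases z) simp
  qed (intro uc_dom' uc_intros)+
  have "uc (\<lambda>i z. if fst z \<in> mg_dom (M i) \<and> snd z \<in> mg_dom (M i)
      then mg_prod (M i) (fst z) (snd z) \<noteq> None else False)"
  proof (rule uc_guarded[OF _ upc_phi[OF idx[of 3]]])
    show "phi (entry 3 (par i)) (enc z) = Some (enc (mg_prod (M i) (fst z) (snd z) \<noteq> None))"
      if "i \<in> I" "fst z \<in> mg_dom (M i) \<and> snd z \<in> mg_dom (M i)" for i z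
      using Q[OF that(1)] that(2) unfolding Q_def by (cases z) simp
  qed (intro uc_dom' uc_intros)+
  then have uc_def: "uc (\<lambda>i z. g_def (M i) (fst z) (snd z))"
    by (rule uc_cong) (auto simp: g_def_def)
  have uc_prod: "uc (\<lambda>i z. g_prod (M i) (fst z) (snd z))"
    unfolding g_prod_def
  proof (rule uc_guarded[OF uc_def upc_phi[OF idx[of 4]]])
    show "phi (entry 4 (par i)) (enc z) = Some (enc (the (mg_prod (M i) (fst z) (snd z))))"
      if "i \<in> I" "g_def (M i) (fst z) (snd z)" for i z
      using Q[OF that(1)] that(2) unfolding Q_def g_def_def by (cases z) auto
  qed (intro uc_intros)
  have "uc (\<lambda>i x. g_sub (M i) (f i x))" if "uc f" for f :: "_ \<Rightarrow> nat \<times> nat \<Rightarrow> nat"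
    unfolding g_sub_def by (intro uc_intros uc_app2[OF uc_def] uc_app2[OF uc_prod] that)
  note uc_sub = this
  have uc_ix: "uc (\<lambda>i z. ix i (fst z) (snd z))"
    unfolding ix_def
  proof (rule uc_guarded[OF _ upc_phi[OF idx[of 5]]])
    show "phi (entry 5 (par i)) (enc z) =
        Some (enc (group_index (fst i) (\<beta> i (fst z)) (\<beta> i (fst z) \<inter> \<beta> i (snd z))))"
      if "i \<in> I" "g_sub (M i) (fst z) \<and> g_sub (M i) (snd z)" for i z
    proof -
      have "w \<in> mg_dom (M i) \<and> mg_prod (M i) w w = Some w" if "g_sub (M i) w" for w
        using that by (auto simp: g_sub_def g_def_def g_prod_def)
      then show ?thesis using Q[OF that(1)] that(2) unfolding Q_def by (cases z) simp
    qed
  qed (intro uc_sub uc_intros)+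
  interpret haar_family I par fst "\<lambda>i. fst (snd i)" M \<beta> ix
  proof (rule haar_family.intro)
    fix i assume i: "i \<in> I"
    have tdlc: "tdlc_group (fst i) (fst (snd i))" using i by (auto simp: I_def)
    then interpret top_group "fst i" "fst (snd i)"
      by (intro top_groupI) (simp add: tdlc_group_def)
    show "haar_copy (fst i) (fst (snd i)) (M i) (\<beta> i) (ix i)"
      by unfold_locales (use Q[OF i] tdlc in \<open>simp_all add: Q_def tdlc_group_def ix_def\<close>)
  qed (fact uc_inv uc_dom uc_meet uc_def uc_prod uc_ix)+
  obtain s where s: "par_computable s" "\<And>i. i \<in> I \<Longrightarrow> baire_index (s i) (fst i) (fst (snd i))"
    using baire_index_computable by blast
  obtain e where e: "\<forall>i\<in>I. phi e (par i) = Some (s i)"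
    using par_computable_index[OF s(1)] by blast
  with s(2) show ?thesis
    by (intro exI[of _ e]) (force simp: I_def par_def)
qed

text \<open>
  If the group is compact, then the missing data at the root amount to a bound on the first
  entries of the paths.
\<close>

lemma baire_presentation_compact:
  assumes "baire_presentation_index {\<sigma>. \<sigma> \<noteq> []} p G X" "compact_space X"
  shows "\<exists>p'. baire_presentation_index UNIV p' G X"
proof -
  obtain eT eC eH eOp eInv T and B :: "(nat \<Rightarrow> nat) monoid" where
    clc: "clc_tree_index {\<sigma>. \<sigma> \<noteq> []} eT eC eH T" and
    B: "carrier B = paths T" "topological_group B (path_space T)"
        "computable_map2_index eOp T T (\<lambda>f g. f \<otimes>\<^bsub>B\<^esub> g)"
        "computable_map_index eInv T T (\<lambda>f. inv\<^bsub>B\<^esub> f)"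
        "topological_group_isomorphic G X B (path_space T)"
    using assms(1) unfolding baire_presentation_index_def by blast
  obtain H where T: "is_tree T" "leafless T" "locally_compact_space (path_space T)" "decides eT (list_encode ` T)"
    and C: "\<And>\<sigma>. \<sigma> \<noteq> [] \<Longrightarrow> phi eC (list_encode \<sigma>) = Some (of_bool (\<sigma> \<in> compact_nodes T))"
    and H: "\<And>\<sigma> i. \<sigma> \<noteq> [] \<Longrightarrow> phi eH (prod_encode (list_encode \<sigma>, i)) = Some (H \<sigma> i)"
    and bound: "\<And>\<sigma> \<rho> i. \<sigma> \<noteq> [] \<Longrightarrow> \<sigma> \<in> compact_nodes T \<Longrightarrow> \<rho> \<in> T \<Longrightarrow> prefix \<sigma> \<rho> \<Longrightarrow> i < length \<rho> \<Longrightarrow> \<rho> ! i \<le> H \<sigma> i"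
    using clc unfolding clc_tree_index_def by auto
  obtain h where "homeomorphic_map X (path_space T) h"
    using B(5) unfolding topological_group_isomorphic_def by blast
  then have "compact_space (path_space T)"
    using assms(2) homeomorphic_compact_space homeomorphic_map_imp_homeomorphic_space by blast
  then have comp: "compactin (path_space T) (paths T)" by (simp add: compact_space_def)
  have node: "\<sigma> \<in> compact_nodes T" if "\<sigma> \<in> T" for \<sigma>
  proof -
    have "paths_through T \<sigma> \<subseteq> paths T" by (auto simp: paths_through_iff)
    then have "compactin (path_space T) (paths_through T \<sigma>)"
      by (rule closed_compactin[OF comp _ closedin_paths_through])
    with that show ?thesis by (simp add: compact_nodes_def)
  qed
  \<comment> \<open>The condition \<open>x 0 < n\<close> forces \<open>n\<close> to be positive, so
    it depends only on the first \<open>n\<close> entries; the second argument is a dummy.\<close>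
  have "\<exists>n. \<forall>x\<in>paths T. \<forall>y\<in>paths T. x 0 < n"
  proof (rule compact_uniform[OF comp comp, of "\<lambda>n x y. x 0 < n"])
    show "x' 0 < n" if "x 0 < n" "restrict_to x n = restrict_to x' n" for n and x x' :: "nat \<Rightarrow> nat"
      using that by (auto simp: restrict_to_eq_iff)
  qed auto
  then obtain h0 where h0: "\<And>x. x \<in> paths T \<Longrightarrow> x 0 < h0" by blast
  define H0 where "H0 \<sigma> i = (if \<sigma> \<noteq> [] then H \<sigma> i else 0)" for \<sigma> i
  \<comment> \<open>A path begins with some \<open>n < h0\<close>, so the sum over these children
    dominates the bound of the child it passes through. The finite number \<open>h0\<close> is built
    into the program.\<close>
  define H' where "H' \<sigma> i = (if \<sigma> \<noteq> [] then H0 \<sigma> i else h0 + sum_list (map (\<lambda>n. H0 [n] i) [0..<h0]))" for \<sigma> i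
  have ucH0: "plain.uc (\<lambda>_ z. H0 (fst z) (snd z))"
    unfolding H0_def
  proof (rule plain.uc_guarded[OF _ plain.upc_phi[OF plain.par_computable_const]])
    show "phi eH (enc z) = Some (enc (H (fst z) (snd z)))" if "fst z \<noteq> []" for z
      using H[OF that] by (cases z) simp
  qed (intro plain.uc_intros)+
  have "plain.uc (\<lambda>_ z. H' (fst z) (snd z))"
    unfolding H'_def by (intro plain.uc_intros plain.uc_app2[OF ucH0])
  then obtain cH where cH: "\<And>z. eval cH (enc z) = Some (H' (fst z) (snd z))"
    using plain_code[of "\<lambda>z. H' (fst z) (snd z)"] by auto
  \<comment> \<open>The answer at the root is built in: the whole path space is compact
    here.\<close>
  have "plain.uc (\<lambda>_ \<sigma>. if \<sigma> \<noteq> [] then \<sigma> \<in> compact_nodes T else True)"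
  proof (rule plain.uc_guarded[OF _ plain.upc_phi[OF plain.par_computable_const]])
    show "phi eC (enc \<sigma>) = Some (enc (\<sigma> \<in> compact_nodes T))" if "\<sigma> \<noteq> []" for \<sigma>
      using C[OF that] by simp
  qed (intro plain.uc_intros)+
  then obtain cC where cC: "\<And>\<sigma>. eval cC (enc \<sigma>) = Some (enc (if \<sigma> \<noteq> [] then \<sigma> \<in> compact_nodes T else True))"
    using plain_code[of "\<lambda>\<sigma>. if \<sigma> \<noteq> [] then \<sigma> \<in> compact_nodes T else True"] by blast
  have "[] \<in> T" using T(1) unfolding is_tree_def by (metis Nil_prefix all_not_in_conv)
  then have "clc_tree_index UNIV eT (code_index cC) (code_index cH) T"
    unfolding clc_tree_index_def
  proof (intro conjI ballI exI[of _ H'] allI impI)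
    show "phi (code_index cC) (list_encode \<sigma>) = Some (of_bool (\<sigma> \<in> compact_nodes T))" for \<sigma>
      using cC[of \<sigma>] node[OF \<open>[] \<in> T\<close>] by (cases "\<sigma> = []") simp_all
    show "phi (code_index cH) (prod_encode (list_encode \<sigma>, i)) = Some (H' \<sigma> i)" for \<sigma> i
      using cH[of "(\<sigma>, i)"] by simp
    show "\<rho> ! i \<le> H' \<sigma> i"
      if h: "\<sigma> \<in> UNIV \<inter> compact_nodes T" "\<rho> \<in> T" "prefix \<sigma> \<rho>" "i < length \<rho>" for \<sigma> \<rho> i
    proof (cases "\<sigma> = []")
      case True
      obtain f where f: "f \<in> paths T" "restrict_to f (length \<rho>) = \<rho>"
        using leafless_extend[OF T(1,2) h(2)] by (metis paths_through_iff)
      have ne: "\<rho> \<noteq> []" using h(4) by auto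
      then have lt: "\<rho> ! 0 < h0" using h0[OF f(1)] f(2) nth_restrict_to[of 0 "length \<rho>" f] by simp
      have pre: "prefix [\<rho> ! 0] \<rho>" using ne by (cases \<rho>) auto
      then have "[\<rho> ! 0] \<in> T" using T(1) h(2) unfolding is_tree_def by blast
      then have "\<rho> ! i \<le> H0 [\<rho> ! 0] i"
        using bound[OF _ node h(2) pre h(4)] by (simp add: H0_def)
      also have "\<dots> \<le> sum_list (map (\<lambda>n. H0 [n] i) [0..<h0])"
        using lt by (intro member_le_sum_list) auto
      finally show ?thesis using True by (simp add: H'_def)
    next
      case False
      then show ?thesis using bound[OF False _ h(2,3,4)] h(1) by (simp add: H'_def H0_def)
    qed
  qed (use T in auto)
  then have "baire_presentation_index UNIV (list_encode [eT, code_index cC, code_index cH, eOp, eInv]) G X"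
    unfolding baire_presentation_index_def using B by blast
  then show ?thesis by blast
qed

theorem theorem7p6:
  shows "(\<forall>(G :: ('a, 'b) monoid_scheme) X. tdlc_group G X \<longrightarrow>
            (computably_tdlc_via_baire G X \<longleftrightarrow> computably_tdlc_via_meet_groupoid G X))
    \<and> (\<exists>e. \<forall>(G :: ('a, 'b) monoid_scheme) X p. tdlc_group G X \<and> baire_index p G X \<longrightarrow>
            (\<exists>q. phi e p = Some q \<and> haar_index q G X))
    \<and> (\<exists>e. \<forall>(G :: ('a, 'b) monoid_scheme) X p. tdlc_group G X \<and> haar_index p G X \<longrightarrow>
            (\<exists>q. phi e p = Some q \<and> baire_index q G X))"
proof (intro conjI allI impI)
  fix G :: "('a, 'b) monoid_scheme" and X assume tdlc: "tdlc_group G X"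
  show "computably_tdlc_via_baire G X \<longleftrightarrow> computably_tdlc_via_meet_groupoid G X"
  proof
    assume "computably_tdlc_via_baire G X"
    then obtain p where "baire_presentation_index UNIV p G X"
      unfolding computably_tdlc_via_baire_def by blast
    then have "baire_index p G X" by (rule baire_index_if_full)
    then show "computably_tdlc_via_meet_groupoid G X"
      using baire_to_haar tdlc unfolding computably_tdlc_via_meet_groupoid_def by blast
  next
    assume "computably_tdlc_via_meet_groupoid G X"
    then obtain q where "baire_index q G X"
      using haar_to_baire tdlc unfolding computably_tdlc_via_meet_groupoid_def by blast
    then show "computably_tdlc_via_baire G X"
      unfolding computably_tdlc_via_baire_def
      by (cases "compact_space X") (auto simp: baire_index_def intro: baire_presentation_compact)
  qed
qed (rule baire_to_haar haar_to_baire)+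

end
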